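(* Let $D\subset\mathbb{C}$ be a bounded domain for which the Cauchy Integral Formula holds (in the sense defined in the context). Let $\Lambda:\mathbb{D}\to D$ be the uniformization map and let $\Gamma$ be the corresponding Fuchsian group on $\mathbb{D}$. Assume that $\Gamma$ is of Widom type, that $\Lambda'$ is an outer Smirnov class function, and that for every $\zeta\in\mathbb{D}$ the function $t\mapsto \dfrac{\Lambda(t)-\Lambda(\zeta)}{g_\zeta(t)}$ is an outer Smirnov class function. Then for every $\zeta\in\mathbb{D}$, every integer $k\ge 0$, and every function $f\in H^1(\mathbb{D})$ that is $\mu_\zeta^k\delta_\zeta$-automorphic, we have $$ \int_{\mathbb{T}}\frac{f(t)}{\Delta_\zeta(t)\,g_\zeta(t)^k}\,\frac{1-|\zeta|^2}{|t-\zeta|^2}\,L(dt) =\frac{1}{k!}\left.\left(\left(\frac{1}{g_\zeta'(t)}\frac{d}{dt}\right)^{k}\left(\frac{f(t)}{\Delta_\zeta(t)}\right)\right)\right|_{t=\zeta}, $$ where $g_\zeta$ is the (complex) Green function of $\Gamma$ with respect to $\zeta$, $\Delta_\zeta$ is the inner part of $g_\zeta'$, $\mu_\zeta$ and $\delta_\zeta$ are the characters of $g_\zeta$ and $\Delta_\zeta$ respectively, and $L(dt)$ is the normalized Lebesgue measure on $\mathbb{T}$.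
   Context: $\mathbb{D}$ is the open unit disk and $\mathbb{T}$ the unit circle. The uniformization map $\Lambda:\mathbb{D}\to D$ is the analytic universal covering map of $D$, and $\Gamma$ is the corresponding Fuchsian group (the group of deck transformations: Möbius automorphisms $\gamma$ of $\mathbb{D}$ with $\Lambda\circ\gamma=\Lambda$). Automorphic functions. For a character $\alpha$ of $\Gamma$ (a homomorphism from $\Gamma$ to $\mathbb{T}$), a function $u$ on $\mathbb{D}$ and/or on $\mathbb{T}$ is called $\alpha$-automorphic if $u\circ\gamma=\alpha(\gamma)u$ for every $\gamma\in\Gamma$. Function classes. An analytic function $u$ on $\mathbb{D}$ is of bounded characteristic if $u=u_1/u_2$ with $u_1,u_2$ bounded analytic functions on $\mathbb{D}$. It is of Smirnov class if the denominator $u_2$ can be taken outer, and it is an outer Smirnov class function if both $u_1$ and $u_2$ can be taken outer. $H^1(\mathbb{D})$ is the usual Hardy space. Functions of bounded characteristic are identified on $\mathbb{T}$ with their nontangential boundary values, defined almost everywhere. Green function. For $\zeta\in\mathbb{D}$, $g_\zeta$ denotes the (complex) Green function of $\Gamma$ with respect to $\zeta$, i.e. the Blaschke product whose zeros are the points of the orbit of $\zeta$ under $\Gamma$. $\Gamma$ is of Widom type if $g_\zeta'$ is of bounded characteristic. In that case, by a theorem of Pommerenke, $g_\zeta'=\Delta_\zeta/\psi_\zeta$, where $\Delta_\zeta$ is an inner function (the inner part of $g_\zeta'$) and $\psi_\zeta$ is a bounded outer function; moreover $g_\zeta$ and $\Delta_\zeta$ are character-automorphic, and $\mu_\zeta$,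 $\delta_\zeta$ denote their characters: $g_\zeta\circ\gamma=\mu_\zeta(\gamma)g_\zeta$ and $\Delta_\zeta\circ\gamma=\delta_\zeta(\gamma)\Delta_\zeta$ for $\gamma\in\Gamma$. The space $H^1(D)$. An analytic function $h$ on $D$ belongs to $H^1(D)$ if $h\circ\Lambda$ is a Smirnov class function on $\mathbb{D}$ and $\int_{\partial D}|h(s)|\,|ds|<\infty$. Cauchy Integral Formula. We say that the Cauchy Integral Formula holds for $D$ if for every $h\in H^1(D)$, $$\frac{1}{2\pi i}\oint_{\partial D}\frac{h(s)}{s-\lambda}\,ds=h(\lambda),\qquad \lambda\in D.$$ Integrals over $\partial D$ are understood through the substitution $s=\Lambda(t)$, $t\in\mathbb{E}$, where $\mathbb{E}\subset\mathbb{T}$ is a fundamental set of $\Gamma$ on $\mathbb{T}$ (a measurable set whose images $\gamma(\mathbb{E})$, $\gamma\in\Gamma$, are pairwise disjoint and cover $\mathbb{T}$ up to a null set): $\oint_{\partial D}F(s)\,ds=\int_{\mathbb{E}}F(\Lambda(t))\Lambda'(t)\,dt$ and $\int_{\partial D}|F(s)|\,|ds|=\int_{\mathbb{E}}|F(\Lambda(t))|\,|\Lambda'(t)|\,|dt|$, where $dt$ is taken along $\mathbb{T}$ counterclockwise, and $h(\Lambda(t))$ denotes the boundary values of $h\circ\Lambda$. The operator $\left(\frac{1}{g_\zeta'(t)}\frac{d}{dt}\right)^{k}$ is the $k$-fold iterate of $u\mapsto u'/g_\zeta'$, acting on functions analytic in a neighborhood of $\zeta$ (note $g_\zeta'(\zeta)\ne0$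 and hence $\Delta_\zeta(\zeta)\neq 0$); for $k=0$ it is the identity. *)

theory Defs
  imports "HOL-Complex_Analysis.Complex_Analysis" "HOL-Library.FuncSet"
begin

section \<open>The unit circle and nontangential boundary values\<close>

text \<open>Normalized Lebesgue measure \<open>L\<close> on the unit circle, completed, as a measure on the whole
  plane that is concentrated on the circle.\<close>

definition circle_lebesgue :: "complex measure" where
  "circle_lebesgue = completion (distr (uniform_measure lborel {0..2 * pi}) borel cis)"

definition has_nt_limit :: "(complex \<Rightarrow> complex) \<Rightarrow> complex \<Rightarrow> complex \<Rightarrow> bool" where
  "has_nt_limit u t l \<longleftrightarrow>
     (\<forall>M>1. (u \<longlongrightarrow> l) (at t within {z \<in> ball 0 1. dist z t < M * (1 - cmod z)}))"

text \<open>Boundary value at a point \<open>t\<close> of the circle; arbitrary where no nontangential limit exists.\<close>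

definition nt_lim :: "(complex \<Rightarrow> complex) \<Rightarrow> complex \<Rightarrow> complex" where
  "nt_lim u t = (THE l. has_nt_limit u t l)"

text \<open>The integral of \<open>F(t) dt\<close> over a subset of the circle, counterclockwise: for
  \<open>t = cis \<theta>\<close> one has \<open>dt = \<i> t d\<theta> = 2 \<pi> \<i> t L(dt)\<close>.\<close>

definition circle_line_integral :: "complex set \<Rightarrow> (complex \<Rightarrow> complex) \<Rightarrow> complex" where
  "circle_line_integral E F =
     (LINT t:E|circle_lebesgue. F t * (2 * complex_of_real pi * \<i> * t))"

section \<open>Function classes on the unit disk\<close>

definition bounded_analytic :: "(complex \<Rightarrow> complex) \<Rightarrow> bool" where
  "bounded_analytic u \<longleftrightarrow> u holomorphic_on ball 0 1 \<and> bounded (u ` ball 0 1)"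

text \<open>Here \<open>w\<close> is the logarithm of the modulus of the boundary values.\<close>

definition outer_function :: "(complex \<Rightarrow> complex) \<Rightarrow> bool" where
  "outer_function u \<longleftrightarrow>
     (\<exists>c. \<exists>w :: complex \<Rightarrow> real. cmod c = 1 \<and> integrable circle_lebesgue w \<and>
        (\<forall>z\<in>ball 0 1. u z = c * exp (LINT t|circle_lebesgue. (t + z) / (t - z) * of_real (w t))))"

definition inner_function :: "(complex \<Rightarrow> complex) \<Rightarrow> bool" where
  "inner_function u \<longleftrightarrow> u holomorphic_on ball 0 1 \<and> (\<forall>z\<in>ball 0 1. cmod (u z) \<le> 1) \<and>
     (AE t in circle_lebesgue. \<exists>l. has_nt_limit u t l \<and> cmod l = 1)"

text \<open>The quotient representation is written multiplicatively because the denominator may have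
  zeros that cancel against zeros of the numerator.\<close>

definition bounded_characteristic :: "(complex \<Rightarrow> complex) \<Rightarrow> bool" where
  "bounded_characteristic u \<longleftrightarrow> u holomorphic_on ball 0 1 \<and>
     (\<exists>u1 u2. bounded_analytic u1 \<and> bounded_analytic u2 \<and> (\<exists>z\<in>ball 0 1. u2 z \<noteq> 0) \<and>
        (\<forall>z\<in>ball 0 1. u z * u2 z = u1 z))"

definition smirnov :: "(complex \<Rightarrow> complex) \<Rightarrow> bool" where
  "smirnov u \<longleftrightarrow> u holomorphic_on ball 0 1 \<and>
     (\<exists>u1 u2. bounded_analytic u1 \<and> bounded_analytic u2 \<and> outer_function u2 \<and>
        (\<forall>z\<in>ball 0 1. u z = u1 z / u2 z))"

definition outer_smirnov :: "(complex \<Rightarrow> complex) \<Rightarrow> bool" where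
  "outer_smirnov u \<longleftrightarrow> u holomorphic_on ball 0 1 \<and>
     (\<exists>u1 u2. bounded_analytic u1 \<and> outer_function u1 \<and> bounded_analytic u2 \<and> outer_function u2 \<and>
        (\<forall>z\<in>ball 0 1. u z = u1 z / u2 z))"

definition hardy_H1 :: "(complex \<Rightarrow> complex) \<Rightarrow> bool" where
  "hardy_H1 f \<longleftrightarrow> f holomorphic_on ball 0 1 \<and>
     bdd_above ((\<lambda>r. LINT t|circle_lebesgue. cmod (f (of_real r * t))) ` {0..<1})"

text \<open>The inner part is determined up to a unimodular constant.\<close>

definition inner_part_of :: "(complex \<Rightarrow> complex) \<Rightarrow> (complex \<Rightarrow> complex) \<Rightarrow> bool" where
  "inner_part_of u \<Delta> \<longleftrightarrow> inner_function \<Delta> \<and>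
     (\<exists>v. outer_smirnov v \<and> (\<forall>z\<in>ball 0 1. u z = \<Delta> z * v z))"

section \<open>Uniformization, characters and the Green function\<close>

definition uniformization :: "(complex \<Rightarrow> complex) \<Rightarrow> complex set \<Rightarrow> bool" where
  "uniformization \<Lambda> D \<longleftrightarrow> \<Lambda> holomorphic_on ball 0 1 \<and> covering_space (ball 0 1) \<Lambda> D"

text \<open>Moebius automorphisms of the disk are represented by their (extensional) restrictions to the
  closed disk, which makes each of them a unique HOL function; the group operation is then
  \<^term>\<open>compose (cball (0 :: complex) 1)\<close>.\<close>

definition moebius_disc_automorphisms :: "(complex \<Rightarrow> complex) set" where
  "moebius_disc_automorphisms =
     {restrict (Moebius_function \<theta> w) (cball 0 1) | \<theta> w. cmod w < 1}"

definition deck_group :: "(complex \<Rightarrow> complex) \<Rightarrow> (complex \<Rightarrow> complex) set" where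
  "deck_group \<Lambda> = {\<gamma> \<in> moebius_disc_automorphisms. \<forall>z\<in>ball 0 1. \<Lambda> (\<gamma> z) = \<Lambda> z}"

definition character :: "(complex \<Rightarrow> complex) set \<Rightarrow> ((complex \<Rightarrow> complex) \<Rightarrow> complex) \<Rightarrow> bool" where
  "character \<Gamma> \<alpha> \<longleftrightarrow> (\<forall>\<gamma>\<in>\<Gamma>. cmod (\<alpha> \<gamma>) = 1) \<and>
     (\<forall>\<gamma>1\<in>\<Gamma>. \<forall>\<gamma>2\<in>\<Gamma>. \<alpha> (compose (cball 0 1) \<gamma>1 \<gamma>2) = \<alpha> \<gamma>1 * \<alpha> \<gamma>2)"

definition automorphic ::
  "(complex \<Rightarrow> complex) set \<Rightarrow> ((complex \<Rightarrow> complex) \<Rightarrow> complex) \<Rightarrow> (complex \<Rightarrow> complex) \<Rightarrow> bool" where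
  "automorphic \<Gamma> \<alpha> u \<longleftrightarrow> (\<forall>\<gamma>\<in>\<Gamma>. \<forall>z\<in>ball 0 1. u (\<gamma> z) = \<alpha> \<gamma> * u z)"

definition character_of ::
  "(complex \<Rightarrow> complex) set \<Rightarrow> (complex \<Rightarrow> complex) \<Rightarrow> ((complex \<Rightarrow> complex) \<Rightarrow> complex) \<Rightarrow> bool" where
  "character_of \<Gamma> u \<alpha> \<longleftrightarrow> character \<Gamma> \<alpha> \<and> automorphic \<Gamma> \<alpha> u"

definition group_orbit :: "(complex \<Rightarrow> complex) set \<Rightarrow> complex \<Rightarrow> complex set" where
  "group_orbit \<Gamma> \<zeta> = (\<lambda>\<gamma>. \<gamma> \<zeta>) ` \<Gamma>"

definition blaschke_factor :: "complex \<Rightarrow> complex \<Rightarrow> complex" where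
  "blaschke_factor a z =
     (if a = 0 then z else of_real (cmod a) / a * ((a - z) / (1 - cnj a * z)))"

text \<open>Unordered Blaschke product with simple zeros at the points of \<open>A\<close>.\<close>

definition blaschke_product :: "complex set \<Rightarrow> complex \<Rightarrow> complex" where
  "blaschke_product A z = Lim (finite_subsets_at_top A) (\<lambda>F. \<Prod>a\<in>F. blaschke_factor a z)"

text \<open>A deck group acts freely on the disk, so all zeros are simple.\<close>

definition green :: "(complex \<Rightarrow> complex) set \<Rightarrow> complex \<Rightarrow> complex \<Rightarrow> complex" where
  "green \<Gamma> \<zeta> = blaschke_product (group_orbit \<Gamma> \<zeta>)"

text \<open>The first conjunct is the Blaschke condition, without which there is no Green function
  (the unordered product would vanish identically).\<close>

definition widom_type :: "(complex \<Rightarrow> complex) set \<Rightarrow> bool" where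
  "widom_type \<Gamma> \<longleftrightarrow>
     (\<forall>\<zeta>\<in>ball 0 1. (\<lambda>a. 1 - cmod a) summable_on group_orbit \<Gamma> \<zeta> \<and>
        bounded_characteristic (deriv (green \<Gamma> \<zeta>)))"

section \<open>The Hardy space of a domain and the Cauchy integral formula\<close>

definition fundamental_set :: "(complex \<Rightarrow> complex) set \<Rightarrow> complex set \<Rightarrow> bool" where
  "fundamental_set \<Gamma> E \<longleftrightarrow> E \<subseteq> sphere 0 1 \<and> E \<in> sets circle_lebesgue \<and>
     disjoint_family_on (\<lambda>\<gamma>. \<gamma> ` E) \<Gamma> \<and>
     (AE t in circle_lebesgue. t \<in> (\<Union>\<gamma>\<in>\<Gamma>. \<gamma> ` E))"

definition H1_domain ::
  "complex set \<Rightarrow> (complex \<Rightarrow> complex) \<Rightarrow> complex set \<Rightarrow> (complex \<Rightarrow> complex) \<Rightarrow> bool" where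
  "H1_domain D \<Lambda> E h \<longleftrightarrow> h holomorphic_on D \<and> smirnov (h \<circ> \<Lambda>) \<and>
     set_integrable circle_lebesgue E (\<lambda>t. cmod (nt_lim (h \<circ> \<Lambda>) t) * cmod (nt_lim (deriv \<Lambda>) t))"

definition cauchy_integral_formula ::
  "complex set \<Rightarrow> (complex \<Rightarrow> complex) \<Rightarrow> complex set \<Rightarrow> bool" where
  "cauchy_integral_formula D \<Lambda> E \<longleftrightarrow>
     (\<forall>h. H1_domain D \<Lambda> E h \<longrightarrow>
        (\<forall>z\<in>D. 1 / (2 * complex_of_real pi * \<i>) *
           circle_line_integral E (\<lambda>t. nt_lim (h \<circ> \<Lambda>) t / (nt_lim \<Lambda> t - z) * nt_lim (deriv \<Lambda>) t)
         = h z))"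

end

theory Submission
  imports Defs "HOL-Computational_Algebra.Fundamental_Theorem_Algebra"
begin

text \<open>Let \<open>g' = \<Delta> v\<close> be the inner-outer factorization of the derivative of the Green function \<open>g\<close> and
  \<open>q = (\<Lambda> - \<Lambda>(\<zeta>)) / g\<close>. The Smirnov function \<open>H = f v q\<^sup>k\<^sup>+\<^sup>1 / \<Lambda>'\<close> is invariant under \<open>\<Gamma>\<close>, so \<open>H = h \<circ> \<Lambda>\<close>
  with \<open>h\<close> in the Hardy space of \<open>D\<close>, and
  \<open>(h \<circ> \<Lambda>) \<Lambda>' / (\<Lambda> - \<Lambda>(\<zeta>))\<^sup>k\<^sup>+\<^sup>1 = f g' / (\<Delta> g\<^sup>k\<^sup>+\<^sup>1)\<close>.
  Since \<open>g\<close> has unimodular boundary values with finite angular derivatives, \<open>t g'(t) / g(t)\<close> is almost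
  everywhere the sum of the Poisson kernels at the points of the orbit of \<open>\<zeta>\<close>. Hence the Poisson integral
  of the \<open>\<Gamma>\<close>-invariant function \<open>f / (\<Delta> g\<^sup>k)\<close> unfolds to the integral of
  \<open>f g' / (\<Delta> g\<^sup>k\<^sup>+\<^sup>1) dt / (2 \<pi> \<i>)\<close> over \<open>E\<close>, which the Cauchy formula for \<open>h\<close>, differentiated \<open>k\<close> times,
  evaluates to \<open>h\<^sup>(\<^sup>k\<^sup>)(\<Lambda>(\<zeta>)) / k!\<close>. This number and the right-hand side are both the residue of
  \<open>f g' / (\<Delta> g\<^sup>k\<^sup>+\<^sup>1)\<close> at \<open>\<zeta>\<close>, computed in the local coordinates \<open>\<Lambda>\<close> and \<open>g\<close>.\<close>

section \<open>Lebesgue measure on the circle and the Poisson kernel\<close>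

text \<open>\<open>nt_lim\<close> is arbitrary where no limit exists, so boundary identities are
  almost-everywhere statements for the completed measure. \<open>circle_borel\<close> is the measure
  before completion: it has the same almost-everywhere statements and nonnegative integrals, and
  substitution and Fubini are carried out there. Limits of Smirnov functions come from quotients of
  bounded functions, limits of \<open>f\<close> from the inclusion of H1 in the Smirnov class,
  limits of \<open>g'\<close> from its factors \<open>\<Delta>\<close> and \<open>v\<close>. The
  Blaschke condition also makes \<open>\<Gamma>\<close> countable, so that exceptional sets can be
  united over the group.

  Membership of \<open>h\<close> in the Hardy space of \<open>D\<close> is obtained backwards:
  unfolding gives integrability over \<open>E\<close> of the density divided by a power of
  \<open>\<Lambda> - c\<close>, where \<open>c\<close> is the value at \<open>\<zeta>\<close>, and
  boundedness of \<open>D\<close> then removes the denominator. Differentiating the Cauchy formula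
  asks that the boundary values of \<open>\<Lambda>\<close> keep a positive distance from
  \<open>c\<close>; this holds because they avoid the open set \<open>D\<close>. Inside the disc the
  zeros of \<open>\<Delta>\<close> and \<open>g\<close> are dealt with by cancelling holomorphic
  factors.\<close>

definition circle_borel :: "complex measure" where
  "circle_borel = distr (uniform_measure lborel {0..2 * pi}) borel cis"

lemma circle_lebesgue_eq: "circle_lebesgue = completion circle_borel"
  by (simp add: circle_lebesgue_def circle_borel_def)

lemma sets_circle_borel [simp, measurable_cong]: "sets circle_borel = sets borel"
  by (simp add: circle_borel_def)

lemma space_circle_borel [simp]: "space circle_borel = UNIV"
  by (simp add: circle_borel_def)

lemma space_circle_lebesgue [simp]: "space circle_lebesgue = UNIV"
  by (simp add: circle_lebesgue_eq)

lemma measurable_cis [measurable]: "cis \<in> borel_measurable borel"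
  by (intro borel_measurable_continuous_onI continuous_intros)

lemma emeasure_circle_borel_UNIV [simp]: "emeasure circle_borel UNIV = 1"
  unfolding circle_borel_def
  by (subst emeasure_distr) (auto intro!: ennreal_divide_self)

interpretation circle: finite_measure circle_borel
  by standard simp

lemma nn_integral_circle_borel:
  assumes [measurable]: "F \<in> borel_measurable borel"
  shows "(\<integral>\<^sup>+t. F t \<partial>circle_borel) =
    (\<integral>\<^sup>+x. F (cis x) * indicator {0..2*pi} x \<partial>lborel) / ennreal (2*pi)"
  unfolding circle_borel_def by (subst nn_integral_distr) (auto simp: nn_integral_uniform_measure)

lemma AE_circle_norm: "AE t in circle_borel. cmod t = 1"
  unfolding circle_borel_def by (subst AE_distr_iff) auto

lemma integral_circle_borel:
  fixes F :: "complex \<Rightarrow> 'b :: euclidean_space"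
  assumes [measurable]: "F \<in> borel_measurable borel"
  shows "(LINT t|circle_borel. F t) = (LINT x:{0..2*pi}|lborel. F (cis x)) /\<^sub>R (2*pi)"
proof -
  have eq: "uniform_measure lborel {0..2*pi} = density lborel (\<lambda>x. ennreal (indicator {0..2*pi} x / (2*pi)))"
    unfolding uniform_measure_def
    by (intro density_cong AE_I2) (auto split: split_indicator simp: divide_ennreal simp flip: ennreal_1)
  have "(LINT t|circle_borel. F t) = (LINT x|lborel. (indicator {0..2*pi} x / (2*pi)) *\<^sub>R F (cis x))"
  proof -
    let ?d = "\<lambda>x. indicator {0..2*pi} x / (2*pi) :: real"
    have "(LINT t|circle_borel. F t) = (LINT x|density lborel (\<lambda>x. ennreal (?d x)). F (cis x))"
      unfolding circle_borel_def eq
    proof (rule integral_distr)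
      show "cis \<in> density lborel (\<lambda>x. ennreal (?d x)) \<rightarrow>\<^sub>M borel" by measurable
    qed fact
    also have "\<dots> = (LINT x|lborel. ?d x *\<^sub>R F (cis x))"
    proof (rule integral_density)
      show "AE x in lborel. 0 \<le> ?d x" by (intro AE_I2) simp
      show "(\<lambda>x. F (cis x)) \<in> borel_measurable lborel" by measurable
      show "?d \<in> borel_measurable lborel" by measurable
    qed
    finally show ?thesis .
  qed
  also have "\<dots> = (LINT x|lborel. (indicator {0..2*pi} x *\<^sub>R F (cis x)) /\<^sub>R (2*pi))"
    by (simp only: divide_inverse scaleR_scaleR mult.commute[of _ "inverse (2*pi)"])
  also have "\<dots> = (LINT x:{0..2*pi}|lborel. F (cis x)) /\<^sub>R (2*pi)"
    by (simp only: integral_scaleR_right set_lebesgue_integral_def)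
  finally show ?thesis .
qed

lemma AE_circle_lebesgue_iff: "(AE t in circle_lebesgue. P t) \<longleftrightarrow> (AE t in circle_borel. P t)"
  unfolding circle_lebesgue_eq by (rule AE_completion_iff)

lemma integral_circle_lebesgue:
  fixes F :: "complex \<Rightarrow> 'b :: {banach, second_countable_topology}"
  assumes "F \<in> borel_measurable borel"
  shows "(LINT t|circle_lebesgue. F t) = (LINT t|circle_borel. F t)"
  unfolding circle_lebesgue_eq by (intro integral_completion) (use assms in simp)

lemma nn_integral_circle_lebesgue: "nn_integral circle_lebesgue F = nn_integral circle_borel F"
  by (simp add: circle_lebesgue_eq nn_integral_completion)

lemma integrable_circle_lebesgue_iff:
  fixes F :: "complex \<Rightarrow> 'b :: {banach, second_countable_topology}"
  assumes "F \<in> borel_measurable borel"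
  shows "integrable circle_lebesgue F \<longleftrightarrow> integrable circle_borel F"
  unfolding circle_lebesgue_eq by (intro integrable_completion) (use assms in simp)

lemma measurable_circle_lebesgue:
  assumes "F \<in> borel_measurable borel"
  shows "F \<in> borel_measurable circle_lebesgue"
  unfolding circle_lebesgue_eq by (intro measurable_completion) (use assms in simp)

text \<open>Completeness enters here: the set where the functions differ lies in a null set, so all
  its subsets are measurable. This is how boundary values, determined only almost everywhere, become
  measurable functions.\<close>

lemma measurable_circle_lebesgue_AE:
  assumes f: "f \<in> borel_measurable circle_lebesgue" and eq: "AE t in circle_borel. f t = g t"
  shows "g \<in> borel_measurable circle_lebesgue"
proof -
  obtain N where N: "N \<in> null_sets circle_borel" "{t. f t \<noteq> g t} \<subseteq> N"
    using eq unfolding eventually_ae_filter by auto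
  show ?thesis
  proof (rule measurableI)
    fix A :: "'a set" assume A: "A \<in> sets borel"
    have fA: "f -` A \<in> sets circle_lebesgue" using measurable_sets[OF f A] by simp
    have NN: "S \<in> sets circle_lebesgue" if "S \<subseteq> N" for S
      using N that unfolding circle_lebesgue_eq by (meson null_sets_completion_subset null_setsD2 null_sets_completionI)
    have "g -` A = (f -` A - {t. f t \<noteq> g t}) \<union> (g -` A \<inter> {t. f t \<noteq> g t})" by auto
    also have "\<dots> \<in> sets circle_lebesgue"
      by (intro sets.Un sets.Diff fA NN) (use N in auto)
    finally show "g -` A \<inter> space circle_lebesgue \<in> sets circle_lebesgue" by simp
  qed auto
qed

lemma circle_Cauchy_integral:
  assumes F: "continuous_on (sphere 0 1) F"
  shows "contour_integral (circlepath 0 1) F =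
     2 * of_real pi * \<i> * (LINT t|circle_borel. indicator (sphere 0 1) t * (F t * t))"
proof -
  let ?G = "\<lambda>t. indicator (sphere 0 1) t * (F t * t)"
  have "?G = (\<lambda>t. if t \<in> sphere 0 1 then F t * t else 0)" by (auto split: split_indicator)
  also have "\<dots> \<in> borel_measurable borel"
    by (rule borel_measurable_continuous_on_if) (auto intro!: continuous_intros F)
  finally have G: "?G \<in> borel_measurable borel" .
  have c: "continuous_on A (\<lambda>x. F (cis x) * cis x)" for A
    by (intro continuous_intros continuous_on_compose2[OF F]) auto
  have "contour_integral (circlepath 0 1) F = integral {0..2*pi} (\<lambda>x. \<i> * (F (cis x) * cis x))"
    unfolding circlepath_def by (subst contour_integral_part_circlepath_eq) (simp_all add: mult_ac)
  also have "\<dots> = \<i> * integral {0..2*pi} (\<lambda>x. F (cis x) * cis x)"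
    by (rule integral_mult_right)
  also have "integral {0..2*pi} (\<lambda>x. F (cis x) * cis x) = (LINT x:{0..2*pi}|lborel. ?G (cis x))"
    using set_borel_integral_eq_integral(2)[OF borel_integrable_atLeastAtMost'[OF c[of "{0..2*pi}"]]]
    by simp
  also have "\<dots> = of_real (2*pi) * (LINT t|circle_borel. ?G t)"
    unfolding integral_circle_borel[OF G] by (simp add: scaleR_conv_of_real)
  finally show ?thesis by (simp add: mult_ac)
qed

definition poisson :: "complex \<Rightarrow> complex \<Rightarrow> real" where
  "poisson z t = (1 - (cmod z)\<^sup>2) / (cmod (t - z))\<^sup>2"

lemma poisson_nonneg: "cmod z < 1 \<Longrightarrow> poisson z t \<ge> 0"
  by (auto simp: poisson_def abs_square_le_1 power_le_one)

lemma measurable_poisson [measurable]: "poisson z \<in> borel_measurable borel"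
  unfolding poisson_def by measurable

lemma continuous_on_poisson [continuous_intros]: "cmod z < 1 \<Longrightarrow> continuous_on (sphere 0 1) (poisson z)"
  unfolding poisson_def by (intro continuous_intros) auto

lemma cnj_mult_norm1: "cmod t = 1 \<Longrightarrow> t * cnj t = 1"
  by (simp flip: complex_norm_square)

text \<open>On the circle \<open>cnj t\<close> is \<open>1 / t\<close>, so the squared distance
  becomes rational in \<open>t\<close>. In this form the kernel can be compared with the Cauchy
  kernel.\<close>

lemma poisson_conv:
  assumes "cmod z < 1" "cmod t = 1"
  shows "of_real (poisson z t) = (1 - z * cnj z) * t / ((t - z) * (1 - cnj z * t))"
proof -
  have "cnj (t - z) * t = 1 - cnj z * t"
    using cnj_mult_norm1[OF assms(2)] by (simp add: algebra_simps)
  moreover have "t \<noteq> 0" "t - z \<noteq> 0" using assms by auto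
  ultimately show ?thesis
    unfolding poisson_def of_real_divide of_real_diff complex_norm_square of_real_1
    by (metis (no_types, lifting) complex_cnj_diff divide_divide_eq_left' mult.commute nonzero_mult_divide_mult_cancel_right)
qed

lemma one_minus_cnj_mult_nz: "cmod z < 1 \<Longrightarrow> cmod t \<le> 1 \<Longrightarrow> 1 - cnj z * t \<noteq> 0"
proof
  assume *: "cmod z < 1" "cmod t \<le> 1" "1 - cnj z * t = 0"
  then have "cmod (cnj z * t) = 1" by simp
  moreover have "cmod (cnj z * t) \<le> cmod z * 1"
    unfolding norm_mult complex_mod_cnj by (intro mult_left_mono *) auto
  ultimately show False using * by simp
qed

lemma borel_measurable_on_circle:
  fixes F :: "complex \<Rightarrow> 'b :: real_normed_vector"
  assumes "continuous_on (sphere 0 1) F"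
  shows "(\<lambda>t. indicator (sphere 0 1) t *\<^sub>R F t) \<in> borel_measurable borel"
  by (rule borel_measurable_continuous_on_indicator) (use assms in auto)

text \<open>Continuous functions are only controlled on the circle itself, so integrals over
  the circle are routed through the indicator of the circle when measurability is needed.\<close>

lemma integral_circle_indicator:
  fixes F :: "complex \<Rightarrow> 'b :: {banach, second_countable_topology}"
  assumes "continuous_on (sphere 0 1) F"
  shows "(LINT t|circle_lebesgue. F t) = (LINT t|circle_borel. indicator (sphere 0 1) t *\<^sub>R F t)"
    and "integrable circle_lebesgue F"
    and "integrable circle_borel (\<lambda>t. indicator (sphere 0 1) t *\<^sub>R F t)"
proof -
  let ?G = "\<lambda>t. indicator (sphere 0 1) t *\<^sub>R F t"
  have m: "?G \<in> borel_measurable borel" by (rule borel_measurable_on_circle[OF assms])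
  have ae: "AE t in circle_borel. ?G t = F t" using AE_circle_norm by eventually_elim auto
  have mF: "F \<in> borel_measurable circle_lebesgue"
    by (rule measurable_circle_lebesgue_AE[OF measurable_circle_lebesgue[OF m] ae])
  have mG: "?G \<in> borel_measurable circle_lebesgue" by (rule measurable_circle_lebesgue[OF m])
  have ae': "AE t in circle_lebesgue. F t = ?G t"
    unfolding AE_circle_lebesgue_iff using ae by eventually_elim simp
  show "(LINT t|circle_lebesgue. F t) = (LINT t|circle_borel. ?G t)"
    unfolding integral_circle_lebesgue[OF m, symmetric]
    by (rule integral_cong_AE[OF mF mG ae'])
  have "bounded (F ` sphere 0 1)" by (intro compact_imp_bounded compact_continuous_image assms) simp
  then obtain B where B: "\<And>t. t \<in> sphere 0 1 \<Longrightarrow> norm (F t) \<le> B"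
    by (metis bounded_iff image_eqI)
  have m': "?G \<in> borel_measurable circle_borel" using m by simp
  show *: "integrable circle_borel ?G"
    by (rule circle.integrable_const_bound[of _ B]) (use AE_circle_norm in \<open>auto elim!: eventually_mono intro!: B m'\<close>)
  show "integrable circle_lebesgue F"
    using * integrable_circle_lebesgue_iff[OF m] integrable_cong_AE[OF mF mG ae'] by blast
qed

text \<open>The Cauchy formula is applied to \<open>G\<close>, that is, to \<open>u\<close> times a
  holomorphic factor equal to 1 at \<open>z\<close>; on the circle this factor turns the Cauchy
  kernel into the Poisson kernel.\<close>

theorem circle_Poisson:
  assumes u: "continuous_on (cball 0 1) u" "u holomorphic_on ball 0 1" and z: "cmod z < 1"
  shows "u z = (LINT t|circle_lebesgue. poisson z t *\<^sub>R u t)"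
proof -
  define G where "G w = u w * (1 - z * cnj z) / (1 - cnj z * w)" for w
  have nz: "1 - cnj z * w \<noteq> 0" if "cmod w \<le> 1" for w using one_minus_cnj_mult_nz z that by blast
  have G: "continuous_on (cball 0 1) G" "G holomorphic_on ball 0 1"
    unfolding G_def using nz by (auto intro!: continuous_intros holomorphic_intros u)
  have "((\<lambda>w. G w / (w - z)) has_contour_integral (2 * of_real pi * \<i> * G z)) (circlepath 0 1)"
    by (rule Cauchy_integral_circlepath[OF G]) (use z in auto)
  then have "2 * of_real pi * \<i> * G z = contour_integral (circlepath 0 1) (\<lambda>w. G w / (w - z))"
    by (metis contour_integral_unique)
  also have "\<dots> = 2 * of_real pi * \<i> * (LINT t|circle_borel. indicator (sphere 0 1) t * (G t / (t - z) * t))"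
    by (rule circle_Cauchy_integral)
       (use z in \<open>auto intro!: continuous_intros continuous_on_subset[OF G(1)]\<close>)
  finally have "G z = (LINT t|circle_borel. indicator (sphere 0 1) t * (G t / (t - z) * t))"
    by simp
  also have "G z = u z" using nz[of z] z by (simp add: G_def mult.commute)
  also have "(\<lambda>t. indicator (sphere 0 1) t * (G t / (t - z) * t)) =
     (\<lambda>t. indicator (sphere 0 1) t *\<^sub>R (poisson z t *\<^sub>R u t))"
    by (auto split: split_indicator simp: scaleR_conv_of_real poisson_conv[OF z] G_def algebra_simps)
  also have "(LINT t|circle_borel. \<dots> t) = (LINT t|circle_lebesgue. poisson z t *\<^sub>R u t)"
    by (subst integral_circle_indicator)
       (auto intro!: continuous_intros z continuous_on_subset[OF u(1)])
  finally show ?thesis .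
qed

lemma integral_poisson: "cmod z < 1 \<Longrightarrow> (LINT t|circle_borel. poisson z t) = 1"
proof -
  assume z: "cmod z < 1"
  have "1 = (LINT t|circle_lebesgue. poisson z t *\<^sub>R (1::complex))"
    by (rule circle_Poisson[of "\<lambda>_. 1", OF _ _ z]) auto
  also have "\<dots> = of_real (LINT t|circle_lebesgue. poisson z t)"
    by (simp add: scaleR_conv_of_real)
  finally have "complex_of_real (LINT t|circle_lebesgue. poisson z t) = of_real 1" by simp
  then have "(LINT t|circle_lebesgue. poisson z t) = 1" by (simp only: of_real_eq_iff)
  moreover have "(LINT t|circle_lebesgue. poisson z t) = (LINT t|circle_borel. poisson z t)"
    by (rule integral_circle_lebesgue, rule measurable_poisson)
  ultimately show ?thesis by (rule trans[OF sym, rotated])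
qed

lemma poisson_zero: "cmod t = 1 \<Longrightarrow> poisson 0 t = 1"
  by (simp add: poisson_def)

text \<open>The Bochner integral of a non-integrable function is 0 by default, so an integral equal
  to 1 already proves integrability.\<close>

lemma integrable_poisson: "cmod z < 1 \<Longrightarrow> integrable circle_borel (poisson z)"
  by (rule ccontr) (use integral_poisson[of z] not_integrable_integral_eq[of circle_borel "poisson z"] in linarith)

subsection \<open>Moebius substitutions\<close>

text \<open>\<open>\<phi>\<close> lifts the boundary map to angles. The argument of
  \<open>Ln\<close> has positive real part, so no branch cut is crossed, and the logarithmic term is
  periodic: over one turn only the summand \<open>x\<close> contributes.\<close>

lemma Moebius_cis:
  fixes \<alpha> x :: real
  assumes w: "cmod w < 1"
  defines "\<phi> \<equiv> \<lambda>x. \<alpha> + x - 2 * Im (Ln (1 - cnj w * cis x))"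
  shows "Moebius_function \<alpha> w (cis x) = cis (\<phi> x)"
    and "(\<phi> has_real_derivative poisson w (cis x)) (at x)"
    and "\<phi> (2*pi) = \<phi> 0 + 2 * pi"
proof -
  have X: "1 - cnj w * cis x \<noteq> 0" "1 - cnj w * cis x \<notin> \<real>\<^sub>\<le>\<^sub>0" for x
  proof -
    have "cmod (cnj w * cis x) < 1" using w by (simp add: norm_mult)
    then have "Re (1 - cnj w * cis x) > 0"
      using complex_Re_le_cmod[of "cnj w * cis x"] by simp
    moreover have "Re z > 0 \<Longrightarrow> z \<noteq> 0 \<and> z \<notin> \<real>\<^sub>\<le>\<^sub>0" for z by (auto simp: complex_nonpos_Reals_iff)
    ultimately show "1 - cnj w * cis x \<noteq> 0" "1 - cnj w * cis x \<notin> \<real>\<^sub>\<le>\<^sub>0" by blast+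
  qed
  let ?L = "Ln (1 - cnj w * cis x)"
  have "cis (-2 * Im ?L) = exp (cnj ?L) / exp ?L"
  proof -
    have "cnj ?L - ?L = \<i> * of_real (-2 * Im ?L)" by (simp add: complex_eq_iff)
    then show ?thesis unfolding cis_conv_exp exp_diff[symmetric] by simp
  qed
  also have "\<dots> = (1 - w * cis (-x)) / (1 - cnj w * cis x)"
    using X by (simp add: cis_cnj flip: exp_cnj)
  finally have 1: "cis (-2 * Im ?L) = (1 - w * cis (-x)) / (1 - cnj w * cis x)" .
  have "cis (\<phi> x) = cis \<alpha> * (cis x * cis (-2 * Im ?L))"
    by (simp add: \<phi>_def cis_mult add_diff_eq)
  also have "\<dots> = Moebius_function \<alpha> w (cis x)"
    unfolding 1 Moebius_function_def by (simp add: cis_conv_exp[symmetric] algebra_simps cis_mult)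
  finally show "Moebius_function \<alpha> w (cis x) = cis (\<phi> x)" ..
  have "((\<lambda>x. Ln (1 - cnj w * cis x)) has_vector_derivative (- (cnj w * (\<i> * cis x)) / (1 - cnj w * cis x))) (at x)"
  proof -
    have "((\<lambda>z. Ln (1 - cnj w * exp (\<i> * z))) has_field_derivative
       (- (cnj w * (\<i> * cis x)) / (1 - cnj w * cis x))) (at (of_real x))"
      using X[of x] by (auto intro!: derivative_eq_intros simp: cis_conv_exp divide_inverse mult_ac)
    from has_vector_derivative_real_field[OF this] show ?thesis by (simp add: cis_conv_exp)
  qed
  then have "((\<lambda>x. Im (Ln (1 - cnj w * cis x))) has_real_derivative
      Im (- (cnj w * (\<i> * cis x)) / (1 - cnj w * cis x))) (at x)"
    by (rule has_field_derivative_Im)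
  from DERIV_diff[OF DERIV_add[OF DERIV_const DERIV_ident] DERIV_cmult[OF this, of 2], of \<alpha>]
  have "(\<phi> has_real_derivative (1 - 2 * Im (- (cnj w * (\<i> * cis x)) / (1 - cnj w * cis x)))) (at x)"
    unfolding \<phi>_def by simp
  also have "1 - 2 * Im (- (cnj w * (\<i> * cis x)) / (1 - cnj w * cis x)) = poisson w (cis x)"
  proof -
    define a where "a = cnj w * cis x"
    have "cmod a = cmod w" by (simp add: a_def norm_mult)
    have "cis x - w = cis x * cnj (1 - a)"
      using cnj_mult_norm1[of "cis x"] by (simp add: a_def algebra_simps)
    then have d: "cmod (cis x - w) = cmod (1 - a)" by (simp only: norm_mult complex_mod_cnj norm_cis mult_1)
    have nz: "(cmod (1 - a))\<^sup>2 \<noteq> 0" using X(1) by (simp add: a_def)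
    have "- (cnj w * (\<i> * cis x)) / (1 - cnj w * cis x) = - \<i> * (a / (1 - a))"
      by (simp add: a_def mult_ac)
    then have "1 - 2 * Im (- (cnj w * (\<i> * cis x)) / (1 - cnj w * cis x)) = 1 + 2 * Re (a / (1 - a))"
      by (simp only:) (simp del: times_divide_eq_right)
    also have "Re (a / (1 - a)) = (Re a * (1 - Re a) - (Im a)\<^sup>2) / (cmod (1 - a))\<^sup>2"
      unfolding Re_divide cmod_power2 by (simp add: power2_eq_square)
    also have "1 + 2 * \<dots> = (1 - (cmod a)\<^sup>2) / (cmod (1 - a))\<^sup>2"
    proof -
      have "1 - (cmod a)\<^sup>2 = (cmod (1 - a))\<^sup>2 + 2 * (Re a * (1 - Re a) - (Im a)\<^sup>2)"
        by (simp only: cmod_power2) (simp add: power2_eq_square algebra_simps)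
      then show ?thesis using nz by (simp add: add_divide_distrib)
    qed
    finally show ?thesis unfolding poisson_def d \<open>cmod a = cmod w\<close> .
  qed
  finally show "(\<phi> has_real_derivative poisson w (cis x)) (at x)" .
  show "\<phi> (2*pi) = \<phi> 0 + 2 * pi" by (simp add: \<phi>_def)
qed

lemma nn_integral_cis_shift:
  assumes [measurable]: "F \<in> borel_measurable borel"
  shows "(\<integral>\<^sup>+x. F (cis x) * indicator {c..c+2*pi} x \<partial>lborel) = (\<integral>\<^sup>+x. F (cis x) * indicator {0..2*pi} x \<partial>lborel)"
proof -
  \<comment> \<open>\<open>d\<close> is \<open>c\<close> reduced to one period. The window from
    \<open>d\<close> to \<open>d + 2*pi\<close> is then cut at \<open>2*pi\<close> and its right
    part moved back by one turn.\<close>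
  define n where "n = \<lfloor>c / (2*pi)\<rfloor>"
  define d where "d = c - 2*pi * of_int n"
  have d: "0 \<le> d" "d \<le> 2*pi"
  proof -
    have "of_int n \<le> c / (2*pi)" "c / (2*pi) < of_int n + 1" unfolding n_def by linarith+
    then show "0 \<le> d" "d \<le> 2*pi" by (simp_all add: d_def field_simps)
  qed
  have per: "cis (2*pi * of_int k + x) = cis x" for k x
    by (simp add: cis_mult[symmetric] cis_multiple_2pi)
  have "(\<integral>\<^sup>+x. F (cis x) * indicator {c..c+2*pi} x \<partial>lborel) =
    (\<integral>\<^sup>+x. F (cis (2*pi * of_int n + x)) * indicator {c..c+2*pi} (2*pi * of_int n + x) \<partial>lborel)"
    by (subst nn_integral_real_affine[where c=1 and t="2*pi * of_int n"]) auto
  also have "\<dots> = (\<integral>\<^sup>+x. F (cis x) * indicator {d..<2*pi} x + F (cis x) * indicator {2*pi..d+2*pi} x \<partial>lborel)"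
    unfolding per by (intro nn_integral_cong) (use d in \<open>auto split: split_indicator simp: d_def\<close>)
  also have "\<dots> = (\<integral>\<^sup>+x. F (cis x) * indicator {d..<2*pi} x \<partial>lborel) +
     (\<integral>\<^sup>+x. F (cis x) * indicator {2*pi..d+2*pi} x \<partial>lborel)"
    by (intro nn_integral_add) auto
  also have "(\<integral>\<^sup>+x. F (cis x) * indicator {2*pi..d+2*pi} x \<partial>lborel) =
     (\<integral>\<^sup>+x. F (cis (2*pi * of_int 1 + x)) * indicator {2*pi..d+2*pi} (2*pi * of_int 1 + x) \<partial>lborel)"
    by (subst nn_integral_real_affine[where c=1 and t="2*pi * of_int 1"]) auto
  also have "\<dots> = (\<integral>\<^sup>+x. F (cis x) * indicator {0..d} x \<partial>lborel)"
    unfolding per by (intro nn_integral_cong) (auto split: split_indicator)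
  also have "(\<integral>\<^sup>+x. F (cis x) * indicator {d..<2*pi} x \<partial>lborel) + \<dots> =
      (\<integral>\<^sup>+x. F (cis x) * indicator {d..<2*pi} x + F (cis x) * indicator {0..d} x \<partial>lborel)"
    by (intro nn_integral_add[symmetric]) auto
  also have "\<dots> = (\<integral>\<^sup>+x. F (cis x) * indicator {0..2*pi} x \<partial>lborel)"
  proof (rule nn_integral_cong_AE)
    show "AE x in lborel. F (cis x) * indicator {d..<2*pi} x + F (cis x) * indicator {0..d} x =
        F (cis x) * indicator {0..2*pi} x"
      using AE_lborel_singleton[of d] AE_lborel_singleton[of "2*pi"]
      by eventually_elim (use d in \<open>auto split: split_indicator\<close>)
  qed
  finally show ?thesis .
qed

lemma measurable_Moebius [measurable]: "Moebius_function \<alpha> w \<in> borel_measurable borel"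
  unfolding Moebius_function_def by measurable

text \<open>The angle lift has derivative \<open>poisson w\<close> and total increment
  \<open>2*pi\<close>, so this is a substitution followed by a shift of the period. In other terms,
  harmonic measure at \<open>w\<close> is carried to normalized length.\<close>

lemma nn_integral_Moebius:
  assumes w: "cmod w < 1" and [measurable]: "F \<in> borel_measurable borel"
  shows "(\<integral>\<^sup>+t. F (Moebius_function \<alpha> w t) * ennreal (poisson w t) \<partial>circle_borel) = (\<integral>\<^sup>+t. F t \<partial>circle_borel)"
proof -
  define \<phi> where "\<phi> = (\<lambda>x. \<alpha> + x - 2 * Im (Ln (1 - cnj w * cis x)))"
  have phi: "Moebius_function \<alpha> w (cis x) = cis (\<phi> x)"
    "(\<phi> has_real_derivative poisson w (cis x)) (at x)" "\<phi> (2*pi) = \<phi> 0 + 2 * pi" for x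
    unfolding \<phi>_def by (rule Moebius_cis[OF w])+
  have "(\<integral>\<^sup>+t. F (Moebius_function \<alpha> w t) * ennreal (poisson w t) \<partial>circle_borel) =
     (\<integral>\<^sup>+x. F (cis (\<phi> x)) * ennreal (poisson w (cis x)) * indicator {0..2*pi} x \<partial>lborel) / ennreal (2*pi)"
    by (subst nn_integral_circle_borel) (auto simp: phi(1))
  also have "(\<integral>\<^sup>+x. F (cis (\<phi> x)) * ennreal (poisson w (cis x)) * indicator {0..2*pi} x \<partial>lborel) =
     (\<integral>\<^sup>+x. F (cis x) * indicator {\<phi> 0..\<phi> (2*pi)} x \<partial>lborel)"
    by (rule nn_integral_substitution_aux[symmetric])
       (auto intro!: phi continuous_on_compose2[OF continuous_on_poisson] continuous_intros w poisson_nonneg)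
  also have "\<dots> = (\<integral>\<^sup>+x. F (cis x) * indicator {0..2*pi} x \<partial>lborel)"
    unfolding phi(3) by (rule nn_integral_cis_shift) simp
  finally show ?thesis by (subst (2) nn_integral_circle_borel) auto
qed

lemma Moebius_norm_eq_1:
  assumes w: "cmod w < 1" and t: "cmod t = 1"
  shows "cmod (Moebius_function \<alpha> w t) = 1"
proof -
  have "t - w = t * cnj (1 - cnj w * t)"
    using cnj_mult_norm1[OF t] by (simp add: algebra_simps)
  then have "cmod (t - w) = cmod (1 - cnj w * t)" using t by (metis complex_mod_cnj mult_1 norm_mult)
  then show ?thesis using one_minus_cnj_mult_nz[OF w, of t] t
    by (simp add: Moebius_function_def norm_mult norm_divide)
qed

lemma Moebius_diff:
  assumes w: "cmod w < 1" and "cmod z \<le> 1" "cmod t \<le> 1"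
  shows "cmod (Moebius_function \<alpha> w t - Moebius_function \<alpha> w z) =
    cmod (t - z) * (1 - (cmod w)\<^sup>2) / (cmod (1 - cnj w * t) * cmod (1 - cnj w * z))"
proof -
  have nz: "1 - cnj w * t \<noteq> 0" "1 - cnj w * z \<noteq> 0"
    using one_minus_cnj_mult_nz assms by auto
  have "(t - w) / (1 - cnj w * t) - (z - w) / (1 - cnj w * z) =
     (t - z) * (1 - w * cnj w) / ((1 - cnj w * t) * (1 - cnj w * z))"
    using nz by (simp add: divide_simps) (simp add: algebra_simps)
  then have "Moebius_function \<alpha> w t - Moebius_function \<alpha> w z =
     exp (\<i> * of_real \<alpha>) * ((t - z) * (1 - w * cnj w) / ((1 - cnj w * t) * (1 - cnj w * z)))"
    by (simp add: Moebius_function_def flip: right_diff_distrib times_divide_eq_right)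
  moreover have "cmod (1 - w * cnj w) = 1 - (cmod w)\<^sup>2"
  proof -
    have "1 - w * cnj w = of_real (1 - (cmod w)\<^sup>2)" by (simp add: complex_norm_square[symmetric])
    moreover have "(cmod w)\<^sup>2 \<le> 1" using w by (simp add: power_le_one)
    ultimately show ?thesis by (metis abs_of_nonneg diff_ge_0_iff_ge norm_of_real)
  qed
  ultimately show ?thesis by (simp add: norm_mult norm_divide)
qed

lemma one_minus_Moebius_norm:
  assumes w: "cmod w < 1" and z: "cmod z \<le> 1"
  shows "1 - (cmod (Moebius_function \<alpha> w z))\<^sup>2 =
    (1 - (cmod z)\<^sup>2) * (1 - (cmod w)\<^sup>2) / (cmod (1 - cnj w * z))\<^sup>2"
proof -
  have nz: "1 - cnj w * z \<noteq> 0" using one_minus_cnj_mult_nz assms by auto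
  have "cmod (Moebius_function \<alpha> w z) = cmod (z - w) / cmod (1 - cnj w * z)"
    by (simp add: Moebius_function_def norm_mult norm_divide)
  then have "1 - (cmod (Moebius_function \<alpha> w z))\<^sup>2 =
    ((cmod (1 - cnj w * z))\<^sup>2 - (cmod (z - w))\<^sup>2) / (cmod (1 - cnj w * z))\<^sup>2"
    using nz by (simp add: power_divide diff_divide_distrib)
  also have "(cmod (1 - cnj w * z))\<^sup>2 - (cmod (z - w))\<^sup>2 = (1 - (cmod z)\<^sup>2) * (1 - (cmod w)\<^sup>2)"
    unfolding cmod_power2 by (simp add: power2_eq_square algebra_simps)
  finally show ?thesis .
qed

text \<open>Conformal invariance of harmonic measure as a pointwise identity: numerator and squared
  distance in the kernel change by explicit factors, and what remains of them cancels against
  \<open>poisson w t\<close>.\<close>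

lemma poisson_Moebius:
  assumes w: "cmod w < 1" and z: "cmod z < 1" and t: "cmod t = 1"
  shows "poisson (Moebius_function \<alpha> w z) (Moebius_function \<alpha> w t) * poisson w t = poisson z t"
proof -
  have "t - w = t * cnj (1 - cnj w * t)"
    using cnj_mult_norm1[OF t] by (simp add: algebra_simps)
  then have tw: "cmod (t - w) = cmod (1 - cnj w * t)" using t by (metis complex_mod_cnj mult_1 norm_mult)
  have nz: "cmod (1 - cnj w * t) \<noteq> 0" "cmod (1 - cnj w * z) \<noteq> 0" "cmod (t - z) \<noteq> 0" "1 - (cmod w)\<^sup>2 \<noteq> 0"
    using one_minus_cnj_mult_nz[OF w, of t] one_minus_cnj_mult_nz[OF w, of z] assms abs_square_less_1[of "cmod w"]
    by auto
  \<comment> \<open>\<open>x\<close> stands for \<open>(cmod z)\<^sup>2\<close>, \<open>b\<close>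
    for \<open>1 - (cmod w)\<^sup>2\<close>, \<open>c\<close> and \<open>e\<close> for the moduli of
    \<open>1 - cnj w * z\<close> and \<open>1 - cnj w * t\<close>, and \<open>d\<close> for
    \<open>cmod (t - z)\<close>.\<close>
  have gen: "(((1-x) * b) / c\<^sup>2) / (d * b / (e * c))\<^sup>2 * (b / e\<^sup>2) = (1-x) / d\<^sup>2"
    if "b \<noteq> 0" "c \<noteq> 0" "d \<noteq> 0" "e \<noteq> 0" for x b c d e :: real
    using that by (simp add: power_mult_distrib power_divide divide_simps) (simp add: power2_eq_square algebra_simps)
  have "cmod (Moebius_function \<alpha> w t - Moebius_function \<alpha> w z) =
    cmod (t - z) * (1 - (cmod w)\<^sup>2) / (cmod (1 - cnj w * t) * cmod (1 - cnj w * z))"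
    "1 - (cmod (Moebius_function \<alpha> w z))\<^sup>2 =
    (1 - (cmod z)\<^sup>2) * (1 - (cmod w)\<^sup>2) / (cmod (1 - cnj w * z))\<^sup>2"
    by (rule Moebius_diff one_minus_Moebius_norm; use assms in simp)+
  then show ?thesis
    unfolding poisson_def tw by (simp only:) (rule gen; use nz in simp)
qed

lemma nn_integral_poisson_Moebius:
  assumes w: "cmod w < 1" and z: "cmod z < 1" and [measurable]: "F \<in> borel_measurable borel"
  shows "(\<integral>\<^sup>+t. F (Moebius_function \<alpha> w t) * ennreal (poisson z t) \<partial>circle_borel) =
    (\<integral>\<^sup>+t. F t * ennreal (poisson (Moebius_function \<alpha> w z) t) \<partial>circle_borel)"
proof -
  have n: "cmod (Moebius_function \<alpha> w z) < 1" by (rule Moebius_function_norm_lt_1[OF w z])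
  have "(\<integral>\<^sup>+t. F t * ennreal (poisson (Moebius_function \<alpha> w z) t) \<partial>circle_borel) =
     (\<integral>\<^sup>+t. F (Moebius_function \<alpha> w t) * ennreal (poisson (Moebius_function \<alpha> w z) (Moebius_function \<alpha> w t))
        * ennreal (poisson w t) \<partial>circle_borel)"
    by (subst nn_integral_Moebius[OF w]) auto
  also have "\<dots> = (\<integral>\<^sup>+t. F (Moebius_function \<alpha> w t) * ennreal (poisson z t) \<partial>circle_borel)"
  proof (rule nn_integral_cong_AE)
    show "AE t in circle_borel. F (Moebius_function \<alpha> w t) *
        ennreal (poisson (Moebius_function \<alpha> w z) (Moebius_function \<alpha> w t)) * ennreal (poisson w t) =
        F (Moebius_function \<alpha> w t) * ennreal (poisson z t)"
      using AE_circle_norm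
    proof eventually_elim
      case (elim t)
      show ?case
        using poisson_Moebius[OF w z elim, of \<alpha>] poisson_nonneg[OF n] poisson_nonneg[OF w]
        by (simp add: mult.assoc flip: ennreal_mult')
    qed
  qed
  finally show ?thesis ..
qed

text \<open>A Poisson kernel serves as test function: for \<open>z\<close> at depth \<open>r\<close>
  below \<open>a\<close> it is at least \<open>1 / (4 * r)\<close> on the part of the circle in the
  ball, and its total mass is 1. For \<open>r\<close> at least 1 the bound exceeds the mass of the
  whole circle.\<close>

lemma measure_circle_cball:
  assumes a: "cmod a = 1" and r: "r > 0"
  shows "measure circle_borel (cball a r) \<le> 4 * r"
proof (cases "r < 1")
  case True
  define z where "z = (1 - r) *\<^sub>R a"
  have z: "cmod z = 1 - r" using a r True by (simp add: z_def)
  have "1 / (4 * r) * indicator (cball a r) t \<le> poisson z t" if t: "cmod t = 1" for t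
  proof (cases "t \<in> cball a r")
    case t2: True
    have "cmod (t - z) \<le> cmod (t - a) + cmod (a - z)" by norm
    also have "a - z = r *\<^sub>R a" by (simp add: z_def algebra_simps)
    finally have "cmod (t - z) \<le> 2 * r" using t2 a r by (simp add: dist_norm norm_minus_commute)
    then have "(cmod (t - z))\<^sup>2 \<le> (2 * r)\<^sup>2" by (intro power_mono) auto
    moreover have "0 < (cmod (t - z))\<^sup>2" using z t r by auto
    moreover have "1 - (1 - r)\<^sup>2 \<ge> r" using True r by (simp add: power2_eq_square algebra_simps)
    ultimately have "r / (2 * r)\<^sup>2 \<le> (1 - (1 - r)\<^sup>2) / (cmod (t - z))\<^sup>2"
      using r by (intro frac_le) auto
    moreover have "r / (2 * r)\<^sup>2 = 1 / (4 * r)" using r by (simp add: power2_eq_square)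
    moreover have "poisson z t = (1 - (1 - r)\<^sup>2) / (cmod (t - z))\<^sup>2" by (simp only: poisson_def z)
    ultimately show ?thesis using t2 by simp
  next
    case False
    then show ?thesis using z r poisson_nonneg[of z t] by simp
  qed
  then have "(LINT t|circle_borel. 1 / (4 * r) * indicator (cball a r) t) \<le> (LINT t|circle_borel. poisson z t)"
  proof (intro integral_mono_AE integrable_poisson)
    show "integrable circle_borel (\<lambda>t. 1 / (4 * r) * indicator (cball a r) t)"
      by (intro integrable_mult_right integrable_real_indicator) (auto simp: less_top[symmetric])
  qed (use AE_circle_norm z r in auto)
  also have "\<dots> = 1" using z r by (intro integral_poisson) simp
  finally show ?thesis using r by (simp add: divide_simps)
next
  case False
  have "measure circle_borel (cball a r) \<le> measure circle_borel (space circle_borel)"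
    by (rule circle.bounded_measure)
  also have "\<dots> = 1" by (simp add: measure_def)
  finally show ?thesis using False by simp
qed

section \<open>Nontangential limits\<close>

text \<open>The Hardy-Littlewood weak-type estimate. Vitali's lemma selects disjoint balls whose
  fivefold enlargements cover the exceptional set, and a ball of radius \<open>5 * R\<close> has
  measure at most \<open>20 * R\<close>, whence the constant. A Borel set containing the exceptional
  set is what Borel-Cantelli later asks for.\<close>

lemma circle_weak_type:
  fixes W :: "complex \<Rightarrow> ennreal" and \<kappa> :: real
  assumes W [measurable]: "W \<in> borel_measurable borel" and \<kappa>: "\<kappa> > 0"
  shows "\<exists>A. A \<in> sets borel \<and>
    {t. cmod t = 1 \<and> (\<exists>r>0. ennreal (\<kappa> * r) < (\<integral>\<^sup>+s\<in>cball t r. W s \<partial>circle_borel))} \<subseteq> A \<and>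
    emeasure circle_borel A \<le> ennreal (20 / \<kappa>) * (\<integral>\<^sup>+s. W s \<partial>circle_borel)"
proof (cases "(\<integral>\<^sup>+s. W s \<partial>circle_borel) = \<infinity>")
  case True
  then show ?thesis using \<kappa> by (intro exI[of _ UNIV]) (auto simp: ennreal_mult_top)
next
  case False
  define S where "S = {t. cmod t = 1 \<and> (\<exists>r>0. ennreal (\<kappa> * r) < (\<integral>\<^sup>+s\<in>cball t r. W s \<partial>circle_borel))}"
  define \<nu> where "\<nu> = density circle_borel W"
  have nu: "emeasure \<nu> B = (\<integral>\<^sup>+s\<in>B. W s \<partial>circle_borel)" if "B \<in> sets borel" for B
    using that unfolding \<nu>_def by (subst emeasure_density) auto
  have nuU: "emeasure \<nu> UNIV = (\<integral>\<^sup>+s. W s \<partial>circle_borel)" using nu[of UNIV] by simp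
  have sets_nu: "sets \<nu> = sets borel" by (simp add: \<nu>_def)
  obtain R where R: "\<And>t. t \<in> S \<Longrightarrow> R t > 0 \<and> ennreal (\<kappa> * R t) < emeasure \<nu> (cball t (R t))"
  proof -
    have "\<forall>t\<in>S. \<exists>r. r > 0 \<and> ennreal (\<kappa> * r) < emeasure \<nu> (cball t r)"
      unfolding S_def by (auto simp: nu)
    then show ?thesis using that by metis
  qed
  \<comment> \<open>Vitali's lemma asks for bounded radii. The total mass of \<open>W\<close> bounds
    them, which is why infinite mass was split off.\<close>
  define B where "B = enn2real (\<integral>\<^sup>+s. W s \<partial>circle_borel) / \<kappa>"
  have RB: "R t \<le> B" if "t \<in> S" for t
  proof -
    have "ennreal (\<kappa> * R t) \<le> emeasure \<nu> (cball t (R t))" using R[OF that] by (blast intro: less_imp_le)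
    also have "\<dots> \<le> (\<integral>\<^sup>+s. W s \<partial>circle_borel)"
      unfolding nuU[symmetric] by (intro emeasure_mono) (auto simp: sets_nu)
    also have "\<dots> = ennreal (enn2real (\<integral>\<^sup>+s. W s \<partial>circle_borel))" using False by (simp add: less_top)
    finally have "\<kappa> * R t \<le> enn2real (\<integral>\<^sup>+s. W s \<partial>circle_borel)" by (simp add: ennreal_le_iff)
    then show ?thesis using \<kappa> by (simp add: B_def field_simps)
  qed
  have SU: "S \<subseteq> (\<Union>i\<in>S. cball i (R i))"
  proof
    fix t assume t: "t \<in> S"
    then have "0 < R t" using R by blast
    then have "t \<in> cball t (R t)" by simp
    then show "t \<in> (\<Union>i\<in>S. cball i (R i))" using t by blast
  qed
  have RB2: "0 < R t \<and> R t \<le> B" if "t \<in> S" for t using R[OF that] RB[OF that] by blast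
  obtain C where C: "countable C" "C \<subseteq> S"
     "pairwise (\<lambda>i j. disjnt (cball i (R i)) (cball j (R j))) C" "S \<subseteq> (\<Union>i\<in>C. cball i (5 * R i))"
    by (rule Vitali_covering_lemma_cballs[where S = S and K = S and a = "\<lambda>x. x" and r = R and B = B, OF SU RB2])
       (assumption, rule that)
  \<comment> \<open>The selected family is indexed by natural numbers so that its unions become
    unions of sequences; each set \<open>{i\<in>C. e i = n}\<close> is empty or a singleton.\<close>
  define e where "e = to_nat_on C"
  have e: "inj_on e C" unfolding e_def by (rule inj_on_to_nat_on[OF C(1)])
  define f where "f n = (\<Union>i\<in>{i\<in>C. e i = n}. cball i (5 * R i))" for n
  define g where "g n = (\<Union>i\<in>{i\<in>C. e i = n}. cball i (R i))" for n
  have one: "{i\<in>C. e i = n} = {} \<or> (\<exists>i\<in>C. {i\<in>C. e i = n} = {i})" for n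
  proof (cases "\<exists>i\<in>C. e i = n")
    case True
    then obtain i where i: "i \<in> C" "e i = n" by blast
    then have "{j\<in>C. e j = n} = {i}" using e by (auto simp: inj_on_def)
    then show ?thesis using i by blast
  qed auto
  have fg: "f n \<in> sets borel \<and> g n \<in> sets borel \<and> emeasure circle_borel (f n) \<le> ennreal (20 / \<kappa>) * emeasure \<nu> (g n)" for n
    using one[of n]
  proof
    assume "\<exists>i\<in>C. {i\<in>C. e i = n} = {i}"
    then obtain i where i: "i \<in> C" "{i\<in>C. e i = n} = {i}" by blast
    have iS: "i \<in> S" using i C by blast
    have Ri: "R i > 0" "ennreal (\<kappa> * R i) < emeasure \<nu> (cball i (R i))" using R[OF iS] by auto
    have "emeasure circle_borel (cball i (5 * R i)) = ennreal (measure circle_borel (cball i (5 * R i)))"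
      by (rule circle.emeasure_eq_measure)
    also have "\<dots> \<le> ennreal (20 * R i)"
      using measure_circle_cball[of i "5 * R i"] Ri iS by (intro ennreal_leI) (auto simp: S_def)
    also have "\<dots> = ennreal (20 / \<kappa>) * ennreal (\<kappa> * R i)"
      using \<kappa> Ri by (simp flip: ennreal_mult)
    also have "\<dots> \<le> ennreal (20 / \<kappa>) * emeasure \<nu> (cball i (R i))"
      using Ri by (intro mult_left_mono) auto
    finally show ?thesis unfolding f_def g_def i(2) by simp
  next
    assume emp: "{i\<in>C. e i = n} = {}"
    show ?thesis unfolding f_def g_def emp by simp
  qed
  have dis: "disjoint_family g"
    using C(3) unfolding disjoint_family_on_def g_def pairwise_def disjnt_def by fastforce
  show ?thesis
  proof (intro exI conjI)
    have "(\<Union>i\<in>C. cball i (5 * R i)) = (\<Union>n. f n)" by (auto simp: f_def)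
    then show "{t. cmod t = 1 \<and> (\<exists>r>0. ennreal (\<kappa> * r) < (\<integral>\<^sup>+s\<in>cball t r. W s \<partial>circle_borel))} \<subseteq> (\<Union>n. f n)"
      using C(4) unfolding S_def by metis
    show "(\<Union>n. f n) \<in> sets borel" using fg by auto
    have "emeasure circle_borel (\<Union>n. f n) \<le> (\<Sum>n. emeasure circle_borel (f n))"
      by (intro emeasure_subadditive_countably) (use fg in auto)
    also have "\<dots> \<le> (\<Sum>n. ennreal (20 / \<kappa>) * emeasure \<nu> (g n))"
      by (intro suminf_le allI) (use fg in auto)
    also have "\<dots> = ennreal (20 / \<kappa>) * (\<Sum>n. emeasure \<nu> (g n))" by (rule ennreal_suminf_cmult)
    also have "(\<Sum>n. emeasure \<nu> (g n)) = emeasure \<nu> (\<Union>n. g n)"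
      by (rule suminf_emeasure) (use fg dis in \<open>auto simp: sets_nu\<close>)
    also have "\<dots> \<le> (\<integral>\<^sup>+s. W s \<partial>circle_borel)"
      unfolding nuU[symmetric] by (intro emeasure_mono) (auto simp: sets_nu)
    finally show "emeasure circle_borel (\<Union>n. f n) \<le> ennreal (20 / \<kappa>) * (\<integral>\<^sup>+s. W s \<partial>circle_borel)"
      by (simp add: mult_left_mono)
  qed
qed

text \<open>The Poisson kernel is dominated by a geometrically weighted sum of indicators of balls
  of radii \<open>2 ^ j * (1 - cmod z)\<close>.\<close>

lemma poisson_maximal_bound:
  fixes W :: "complex \<Rightarrow> ennreal"
  assumes W [measurable]: "W \<in> borel_measurable borel" and t0: "cmod t0 = 1" and \<kappa>: "\<kappa> > 0" and M: "M > 1"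
    and max: "\<And>r. r > 0 \<Longrightarrow> (\<integral>\<^sup>+s\<in>cball t0 r. W s \<partial>circle_borel) \<le> ennreal (\<kappa> * r)"
    and z: "cmod z < 1" "dist z t0 < M * (1 - cmod z)"
  shows "(\<integral>\<^sup>+t. W t * ennreal (poisson z t) \<partial>circle_borel) \<le> ennreal (16 * (1 + M)\<^sup>2 * \<kappa>)"
proof -
  define \<delta> where "\<delta> = 1 - cmod z"
  have \<delta>: "0 < \<delta>" "\<delta> \<le> 1" using z by (auto simp: \<delta>_def)
  obtain J where "2 / \<delta> < 2 ^ J" using real_arch_pow[of 2 "2 / \<delta>"] by auto
  then have J: "2 < 2 ^ J * \<delta>" using \<delta> by (simp add: field_simps)
  \<comment> \<open>If \<open>j\<close> is the first index whose ball contains \<open>t\<close>,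
    then the larger of \<open>\<delta>\<close> and the distance from \<open>t0\<close> to
    \<open>t\<close>, called \<open>m\<close> below, is at least
    \<open>2 ^ j * \<delta> / 2\<close>. Inserting this into the kernel bound
    \<open>2 * \<delta> * (1 + M)\<^sup>2 / m\<^sup>2\<close> gives \<open>c j\<close>. The 16 of
    the conclusion is 8 times the geometric sum.\<close>
  define c where "c j = 8 * (1 + M)\<^sup>2 / (4 ^ j * \<delta>)" for j :: nat
  have c: "c j \<ge> 0" for j using \<delta> by (simp add: c_def)
  have bound: "poisson z t \<le> (\<Sum>j\<le>J. c j * indicator (cball t0 (2 ^ j * \<delta>)) t)" if t: "cmod t = 1" for t
  proof -
    define x where "x = dist t0 t"
    have x2: "x \<le> 2" using norm_triangle_ineq4[of t0 t] t t0 by (simp add: x_def dist_norm)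
    define m where "m = max \<delta> x"
    have tz: "cmod (t - z) \<ge> \<delta>" using norm_triangle_ineq2[of t z] t by (simp add: \<delta>_def)
    have "x \<le> cmod (t - z) + M * \<delta>"
      using dist_triangle[of t t0 z] z by (simp add: x_def \<delta>_def dist_norm norm_minus_commute)
    also have "\<dots> \<le> cmod (t - z) + M * cmod (t - z)" using tz M by simp
    finally have "x \<le> (1 + M) * cmod (t - z)" by (simp add: algebra_simps)
    moreover have "\<delta> \<le> (1 + M) * cmod (t - z)"
      using tz M mult_right_mono[of 1 "1 + M" "cmod (t - z)"] by simp
    ultimately have m: "m \<le> (1 + M) * cmod (t - z)" by (simp add: m_def)
    have m0: "m > 0" using \<delta> by (simp add: m_def)
    have "1 - (cmod z)\<^sup>2 \<le> 2 * \<delta>"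
    proof -
      have "1 - (cmod z)\<^sup>2 = \<delta> * (1 + cmod z)" by (simp add: \<delta>_def algebra_simps power2_eq_square)
      also have "\<dots> \<le> \<delta> * 2" using z \<delta> by (intro mult_left_mono) auto
      finally show ?thesis by simp
    qed
    moreover have "(m / (1 + M))\<^sup>2 \<le> (cmod (t - z))\<^sup>2"
      using m m0 M by (intro power_mono) (auto simp: field_simps)
    moreover have "(m / (1 + M))\<^sup>2 > 0" using m0 M by simp
    ultimately have P: "poisson z t \<le> 2 * \<delta> / (m / (1 + M))\<^sup>2"
      unfolding poisson_def using \<delta> by (intro frac_le) auto
    have "\<exists>j. x \<le> 2 ^ j * \<delta>" using x2 J by (intro exI[of _ J]) simp
    define j where "j = (LEAST j. x \<le> 2 ^ j * \<delta>)"
    have j: "x \<le> 2 ^ j * \<delta>" "j \<le> J"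
      unfolding j_def by (rule LeastI_ex, fact, rule Least_le, use x2 J in simp)
    have "2 ^ j * \<delta> \<le> 2 * m"
    proof (cases j)
      case 0
      then show ?thesis using \<delta> by (simp add: m_def)
    next
      case (Suc i)
      then have "\<not> x \<le> 2 ^ i * \<delta>" unfolding j_def by (metis lessI not_less_Least)
      then show ?thesis using Suc by (simp add: m_def)
    qed
    then have "(2 ^ j * \<delta> / 2)\<^sup>2 \<le> m\<^sup>2" using \<delta> by (intro power_mono) auto
    moreover have "(2 ^ j * \<delta> / 2)\<^sup>2 = 4 ^ j * \<delta>\<^sup>2 / 4"
      by (simp add: power2_eq_square) (simp flip: power_mult_distrib)
    ultimately have m2: "4 ^ j * \<delta>\<^sup>2 / 4 \<le> m\<^sup>2" by simp
    have "2 * \<delta> / (m / (1 + M))\<^sup>2 = 2 * \<delta> * (1 + M)\<^sup>2 / m\<^sup>2" by (simp add: power_divide)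
    also have "\<dots> \<le> 2 * \<delta> * (1 + M)\<^sup>2 / (4 ^ j * \<delta>\<^sup>2 / 4)"
      using m2 \<delta> m0 by (intro divide_left_mono mult_pos_pos) auto
    also have "\<dots> = c j" using \<delta> by (simp add: c_def power2_eq_square)
    also have "c j = (\<Sum>i\<in>{j}. c i * indicator (cball t0 (2 ^ i * \<delta>)) t)" using j by (simp add: x_def)
    also have "\<dots> \<le> (\<Sum>i\<le>J. c i * indicator (cball t0 (2 ^ i * \<delta>)) t)"
      using j c by (intro sum_mono2) auto
    finally show ?thesis using P by linarith
  qed
  have "(\<integral>\<^sup>+t. W t * ennreal (poisson z t) \<partial>circle_borel) \<le>
     (\<integral>\<^sup>+t. (\<Sum>j\<le>J. ennreal (c j) * (W t * indicator (cball t0 (2 ^ j * \<delta>)) t)) \<partial>circle_borel)"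
  proof (rule nn_integral_mono_AE)
    show "AE t in circle_borel. W t * ennreal (poisson z t) \<le>
       (\<Sum>j\<le>J. ennreal (c j) * (W t * indicator (cball t0 (2 ^ j * \<delta>)) t))"
      using AE_circle_norm
    proof eventually_elim
      case (elim t)
      have "W t * ennreal (poisson z t) \<le> W t * ennreal (\<Sum>j\<le>J. c j * indicator (cball t0 (2 ^ j * \<delta>)) t)"
        by (intro mult_left_mono ennreal_leI bound elim) auto
      also have "ennreal (\<Sum>j\<le>J. c j * indicator (cball t0 (2 ^ j * \<delta>)) t) =
         (\<Sum>j\<le>J. ennreal (c j) * indicator (cball t0 (2 ^ j * \<delta>)) t)"
        using c by (subst sum_ennreal[symmetric]) (auto simp: ennreal_mult ennreal_indicator)
      also have "W t * (\<Sum>j\<le>J. ennreal (c j) * indicator (cball t0 (2 ^ j * \<delta>)) t) =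
          (\<Sum>j\<le>J. ennreal (c j) * (W t * indicator (cball t0 (2 ^ j * \<delta>)) t))"
        by (simp only: sum_distrib_left mult.left_commute)
      finally show ?case .
    qed
  qed
  also have "\<dots> = (\<Sum>j\<le>J. ennreal (c j) * (\<integral>\<^sup>+t\<in>cball t0 (2 ^ j * \<delta>). W t \<partial>circle_borel))"
  proof -
    have "(\<integral>\<^sup>+t. (\<Sum>j\<le>J. ennreal (c j) * (W t * indicator (cball t0 (2 ^ j * \<delta>)) t)) \<partial>circle_borel) =
      (\<Sum>j\<le>J. \<integral>\<^sup>+t. ennreal (c j) * (W t * indicator (cball t0 (2 ^ j * \<delta>)) t) \<partial>circle_borel)"
      by (intro nn_integral_sum borel_measurable_times_ennreal borel_measurable_indicator) (use W in auto)
    also have "\<dots> = (\<Sum>j\<le>J. ennreal (c j) * (\<integral>\<^sup>+t\<in>cball t0 (2 ^ j * \<delta>). W t \<partial>circle_borel))"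
      by (intro sum.cong refl nn_integral_cmult borel_measurable_times_ennreal borel_measurable_indicator) (use W in auto)
    finally show ?thesis .
  qed
  also have "\<dots> \<le> (\<Sum>j\<le>J. ennreal (c j) * ennreal (\<kappa> * (2 ^ j * \<delta>)))"
    using \<delta> by (intro sum_mono mult_left_mono max) auto
  also have "\<dots> = ennreal (\<Sum>j\<le>J. 8 * (1 + M)\<^sup>2 * \<kappa> * (1/2) ^ j)"
  proof -
    have "ennreal (c j) * ennreal (\<kappa> * (2 ^ j * \<delta>)) = ennreal (8 * (1 + M)\<^sup>2 * \<kappa> * (1/2) ^ j)" for j
    proof -
      have "c j * (\<kappa> * (2 ^ j * \<delta>)) = 8 * (1 + M)\<^sup>2 * \<kappa> * (2 ^ j / 4 ^ j)" using \<delta> by (simp add: c_def)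
      also have "(2::real) ^ j / 4 ^ j = (1/2) ^ j" unfolding power_divide[symmetric] by simp
      finally show ?thesis using c \<kappa> \<delta> by (simp flip: ennreal_mult)
    qed
    then show ?thesis using \<kappa> by (simp add: sum_ennreal)
  qed
  also have "\<dots> \<le> ennreal (16 * (1 + M)\<^sup>2 * \<kappa>)"
  proof (rule ennreal_leI)
    have "(\<Sum>j\<le>J. (1/2::real) ^ j) = 2 - (1/2) ^ J" by (induction J) auto
    then have "(\<Sum>j\<le>J. (1/2::real) ^ j) \<le> 2" by simp
    then have "8 * (1 + M)\<^sup>2 * \<kappa> * (\<Sum>j\<le>J. (1/2::real) ^ j) \<le> 8 * (1 + M)\<^sup>2 * \<kappa> * 2"
      using \<kappa> by (intro mult_left_mono) auto
    then show "(\<Sum>j\<le>J. 8 * (1 + M)\<^sup>2 * \<kappa> * (1/2) ^ j) \<le> 16 * (1 + M)\<^sup>2 * \<kappa>"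
      by (simp add: sum_distrib_left)
  qed
  finally show ?thesis .
qed

subsection \<open>Square means\<close>

text \<open>Over the complete measure the two functions are measurable together, hence integrable
  together; when neither is integrable, both integrals are the default value 0.\<close>

lemma integral_circle_cong_AE:
  fixes F G :: "complex \<Rightarrow> 'b :: {banach, second_countable_topology}"
  assumes "AE t in circle_borel. F t = G t"
  shows "(LINT t|circle_lebesgue. F t) = (LINT t|circle_lebesgue. G t)"
    and "integrable circle_lebesgue F \<longleftrightarrow> integrable circle_lebesgue G"
proof -
  have ae: "AE t in circle_lebesgue. F t = G t" "AE t in circle_borel. G t = F t"
    using assms unfolding AE_circle_lebesgue_iff by auto
  have m: "F \<in> borel_measurable circle_lebesgue \<longleftrightarrow> G \<in> borel_measurable circle_lebesgue"
    using measurable_circle_lebesgue_AE assms ae(2) by blast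
  show "integrable circle_lebesgue F \<longleftrightarrow> integrable circle_lebesgue G"
    using m integrable_cong_AE[OF _ _ ae(1)] borel_measurable_integrable by blast
  then show "(LINT t|circle_lebesgue. F t) = (LINT t|circle_lebesgue. G t)"
    using m integral_cong_AE[OF _ _ ae(1)] borel_measurable_integrable not_integrable_integral_eq by metis
qed

lemma integral_circle_cong:
  fixes F G :: "complex \<Rightarrow> 'b :: {banach, second_countable_topology}"
  assumes "\<And>t. cmod t = 1 \<Longrightarrow> F t = G t"
  shows "(LINT t|circle_lebesgue. F t) = (LINT t|circle_lebesgue. G t)"
  by (rule integral_circle_cong_AE) (use AE_circle_norm in eventually_elim, rule assms)

lemma circle_mean:
  assumes "continuous_on (cball 0 1) u" "u holomorphic_on ball 0 1"
  shows "(LINT t|circle_lebesgue. u t) = u 0"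
proof -
  have "u 0 = (LINT t|circle_lebesgue. poisson 0 t *\<^sub>R u t)"
    by (rule circle_Poisson[OF assms]) simp
  also have "\<dots> = (LINT t|circle_lebesgue. u t)"
    by (rule integral_circle_cong) (simp add: poisson_zero)
  finally show ?thesis ..
qed

lemma circle_orthogonality:
  "(LINT t|circle_lebesgue. t ^ n * cnj t ^ m) = (if n = m then 1 else 0)"
proof -
  have J: "(LINT t|circle_lebesgue. t ^ k) = (if k = 0 then 1 else 0)" for k :: nat
    by (subst circle_mean) (auto intro!: continuous_intros holomorphic_intros)
  have *: "(LINT t|circle_lebesgue. t ^ n * cnj t ^ m) = (if n = m then 1 else 0)" if "m \<le> n" for n m :: nat
  proof -
    have "(LINT t|circle_lebesgue. t ^ n * cnj t ^ m) = (LINT t|circle_lebesgue. t ^ (n - m))"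
    proof (rule integral_circle_cong)
      fix t :: complex assume "cmod t = 1"
      then have "(t * cnj t) ^ m = 1" by (simp add: cnj_mult_norm1)
      moreover have "t ^ n = t ^ (n - m) * t ^ m" using that by (simp flip: power_add)
      ultimately show "t ^ n * cnj t ^ m = t ^ (n - m)" by (simp add: power_mult_distrib mult.assoc)
    qed
    then show ?thesis using that by (simp add: J)
  qed
  show ?thesis
  proof (cases "m \<le> n")
    case False
    have "(LINT t|circle_lebesgue. t ^ n * cnj t ^ m) = (LINT t|circle_lebesgue. cnj (t ^ m * cnj t ^ n))"
      by (simp add: mult.commute)
    also have "\<dots> = cnj (LINT t|circle_lebesgue. t ^ m * cnj t ^ n)"
      by (rule integral_bounded_linear'[OF bounded_linear_cnj bounded_linear_cnj]) simp
    also have "\<dots> = 0" using *[of n m] False by simp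
    finally show ?thesis using False by simp
  qed (rule *)
qed

lemma circle_Parseval_poly:
  "(LINT t|circle_lebesgue. (cmod (\<Sum>n<N. c n * t ^ n))\<^sup>2) = (\<Sum>n<N. (cmod (c n))\<^sup>2)"
proof -
  have int: "integrable circle_lebesgue (\<lambda>t. c n * cnj (c m) * (t ^ n * cnj t ^ m))" for n m
    by (rule integral_circle_indicator) (intro continuous_intros)
  have "complex_of_real (LINT t|circle_lebesgue. (cmod (\<Sum>n<N. c n * t ^ n))\<^sup>2) =
     (LINT t|circle_lebesgue. complex_of_real ((cmod (\<Sum>n<N. c n * t ^ n))\<^sup>2))"
    by (rule integral_complex_of_real[symmetric])
  also have "\<dots> = (LINT t|circle_lebesgue. (\<Sum>n<N. \<Sum>m<N. c n * cnj (c m) * (t ^ n * cnj t ^ m)))"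
    unfolding complex_norm_square by (simp add: sum_product mult_ac)
  also have "\<dots> = (\<Sum>n<N. \<Sum>m<N. (LINT t|circle_lebesgue. c n * cnj (c m) * (t ^ n * cnj t ^ m)))"
    by (subst Bochner_Integration.integral_sum, intro Bochner_Integration.integrable_sum int)
       (intro sum.cong refl Bochner_Integration.integral_sum int)
  also have "\<dots> = (\<Sum>n<N. \<Sum>m<N. c n * cnj (c m) * (if n = m then 1 else 0))"
    by (simp only: integral_mult_right_zero circle_orthogonality)
  also have "\<dots> = (\<Sum>n<N. complex_of_real ((cmod (c n))\<^sup>2))"
    unfolding complex_norm_square by (intro sum.cong refl) (auto simp: if_distrib[of "\<lambda>x. _ * x"] cong: if_cong)
  also have "\<dots> = complex_of_real (\<Sum>n<N. (cmod (c n))\<^sup>2)" by simp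
  finally show ?thesis by (simp only: of_real_eq_iff)
qed

lemma circle_Parseval:
  assumes c: "summable (\<lambda>n. cmod (c n))" and v: "\<And>t. cmod t = 1 \<Longrightarrow> (\<lambda>n. c n * t ^ n) sums v t"
    and cont: "continuous_on (sphere 0 1) v"
  shows "(\<lambda>n. (cmod (c n))\<^sup>2) sums (LINT t|circle_lebesgue. (cmod (v t))\<^sup>2)"
proof -
  define B where "B = (\<Sum>n. cmod (c n))"
  have m: "(\<lambda>t. (cmod (v t))\<^sup>2) \<in> borel_measurable circle_lebesgue"
    by (rule borel_measurable_integrable, rule integral_circle_indicator) (intro continuous_intros cont)
  have "(\<lambda>N. LINT t|circle_lebesgue. (cmod (\<Sum>n<N. c n * t ^ n))\<^sup>2) \<longlonglongrightarrow> (LINT t|circle_lebesgue. (cmod (v t))\<^sup>2)"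
  proof (rule integral_dominated_convergence[where w = "\<lambda>_. B\<^sup>2"])
    show "(\<lambda>t. (cmod (v t))\<^sup>2) \<in> borel_measurable circle_lebesgue" by (rule m)
    show "(\<lambda>t. (cmod (\<Sum>n<N. c n * t ^ n))\<^sup>2) \<in> borel_measurable circle_lebesgue" for N
      by (rule borel_measurable_integrable, rule integral_circle_indicator) (intro continuous_intros)
    show "integrable circle_lebesgue (\<lambda>_. B\<^sup>2)"
      by (rule integral_circle_indicator) (intro continuous_intros)
    show "AE t in circle_lebesgue. (\<lambda>N. (cmod (\<Sum>n<N. c n * t ^ n))\<^sup>2) \<longlonglongrightarrow> (cmod (v t))\<^sup>2"
      unfolding AE_circle_lebesgue_iff using AE_circle_norm
      by eventually_elim (use v in \<open>auto intro!: tendsto_intros simp: sums_def\<close>)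
    fix N
    show "AE t in circle_lebesgue. norm ((cmod (\<Sum>n<N. c n * t ^ n))\<^sup>2) \<le> B\<^sup>2"
      unfolding AE_circle_lebesgue_iff using AE_circle_norm
    proof eventually_elim
      case (elim t)
      have "cmod (\<Sum>n<N. c n * t ^ n) \<le> (\<Sum>n<N. cmod (c n))"
        using elim by (intro order.trans[OF norm_sum]) (simp add: norm_mult norm_power)
      also have "\<dots> \<le> B" unfolding B_def by (intro sum_le_suminf c) auto
      finally show ?case by (simp add: power_mono)
    qed
  qed
  then show ?thesis unfolding circle_Parseval_poly sums_def .
qed

lemma continuous_on_dilation:
  assumes "u holomorphic_on ball 0 1" "0 \<le> r" "r < 1"
  shows "continuous_on (cball 0 1) (\<lambda>t. u (of_real r * t))" "(\<lambda>t. u (of_real r * t)) holomorphic_on ball 0 1"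
proof -
  have *: "of_real r * t \<in> ball 0 1" if "cmod t \<le> 1" for t
    using that assms mult_left_le[of "cmod t" r] by (auto simp: norm_mult)
  show "continuous_on (cball 0 1) (\<lambda>t. u (of_real r * t))"
    by (rule continuous_on_compose2[OF holomorphic_on_imp_continuous_on[OF assms(1)]])
       (use * in \<open>auto intro!: continuous_intros\<close>)
  show "(\<lambda>t. u (of_real r * t)) holomorphic_on ball 0 1"
    by (rule holomorphic_on_compose_gen[OF _ assms(1), of "\<lambda>t. of_real r * t", unfolded o_def])
       (use * in \<open>auto intro!: holomorphic_intros\<close>)
qed

text \<open>By Parseval the bounded square means make the squared Taylor coefficients summable. The
  difference of two dilations has coefficients \<open>a n * (\<rho> ^ n - \<sigma> ^ n)\<close>: the
  tail is small by summability, the first \<open>N\<close> terms because both radii are close to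
  1.\<close>

lemma H2_Cauchy:
  assumes u: "u holomorphic_on ball 0 1"
    and M: "\<forall>r\<in>{0..<1}. (LINT t|circle_lebesgue. (cmod (u (of_real r * t)))\<^sup>2) \<le> M"
    and \<epsilon>: "\<epsilon> > (0::real)"
  shows "\<exists>\<rho>0. 0 < \<rho>0 \<and> \<rho>0 < 1 \<and> (\<forall>\<rho> \<sigma>. \<rho>0 \<le> \<rho> \<longrightarrow> \<rho> < 1 \<longrightarrow> \<rho>0 \<le> \<sigma> \<longrightarrow> \<sigma> < 1 \<longrightarrow>
    (LINT t|circle_lebesgue. cmod (u (of_real \<rho> * t) - u (of_real \<sigma> * t))) \<le> \<epsilon>)"
proof -
  define a where "a n = (deriv ^^ n) u 0 / fact n" for n
  have a: "(\<lambda>n. a n * z ^ n) sums u z" if "cmod z < 1" for z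
    using holomorphic_power_series[OF u, of z] that by (simp add: a_def)
  have abs: "summable (\<lambda>n. cmod (a n) * r ^ n)" if r: "0 \<le> r" "r < 1" for r
  proof -
    obtain s where s: "r < s" "s < 1" using dense r by blast
    have "summable (\<lambda>n. norm (a n * of_real r ^ n))"
      by (rule powser_insidea[of a "of_real s"]) (use a[of "of_real s"] s r in \<open>auto simp: sums_iff\<close>)
    then show ?thesis using r by (simp add: norm_mult norm_power)
  qed
  define A where "A n = (cmod (a n))\<^sup>2" for n
  have dil: "continuous_on (sphere 0 1) (\<lambda>t. u (of_real r * t))" if "0 \<le> r" "r < 1" for r
    using continuous_on_dilation(1)[OF u that] by (rule continuous_on_subset) auto
  have sumA: "summable A"
  proof (rule bounded_imp_summable)
    fix N
    have "(\<Sum>n<Suc N. A n * (r\<^sup>2) ^ n) \<le> M" if r: "0 \<le> r" "r < 1" for r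
    proof -
      have "(\<lambda>n. (cmod (a n * of_real r ^ n))\<^sup>2) sums (LINT t|circle_lebesgue. (cmod (u (of_real r * t)))\<^sup>2)"
      proof (rule circle_Parseval)
        show "summable (\<lambda>n. cmod (a n * of_real r ^ n))" using abs[OF r] r by (simp add: norm_mult norm_power)
        show "(\<lambda>n. a n * of_real r ^ n * t ^ n) sums u (of_real r * t)" if "cmod t = 1" for t
          using a[of "of_real r * t"] r that by (simp add: norm_mult power_mult_distrib mult.assoc)
      qed (rule dil[OF r])
      then have *: "(\<lambda>n. A n * (r\<^sup>2) ^ n) sums (LINT t|circle_lebesgue. (cmod (u (of_real r * t)))\<^sup>2)"
        using r by (simp add: A_def norm_mult norm_power power_mult_distrib mult.commute flip: power_mult)
      then have "(\<Sum>n<Suc N. A n * (r\<^sup>2) ^ n) \<le> (\<Sum>n. A n * (r\<^sup>2) ^ n)"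
        by (intro sum_le_suminf) (auto simp: sums_iff A_def)
      also have "\<dots> \<le> M" using * bspec[OF M, of r] r by (simp add: sums_iff)
      finally show ?thesis .
    qed
    note bd = this
    \<comment> \<open>A finite section is continuous in \<open>r\<close>, so its bound for radii
      below 1 survives at \<open>r = 1\<close>.\<close>
    have "((\<lambda>r. \<Sum>n<Suc N. A n * (r\<^sup>2) ^ n) \<longlongrightarrow> (\<Sum>n<Suc N. A n * (1\<^sup>2) ^ n)) (at_left (1::real))"
      by (intro tendsto_intros)
    moreover have "\<forall>\<^sub>F r in at_left (1::real). (\<Sum>n<Suc N. A n * (r\<^sup>2) ^ n) \<le> M"
    proof -
      have "\<forall>\<^sub>F r in at_left (1::real). r \<in> {0<..<1}" by (rule eventually_at_left_real) simp
      then show ?thesis by eventually_elim (rule bd, auto)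
    qed
    ultimately have "(\<Sum>n<Suc N. A n * (1\<^sup>2) ^ n) \<le> M"
      by (intro tendsto_upperbound) auto
    then show "(\<Sum>n\<le>N. A n) \<le> M" by (simp only: lessThan_Suc_atMost power_one mult_1_right)
  qed (simp add: A_def)
  obtain N where N: "\<And>n. n \<ge> N \<Longrightarrow> norm (\<Sum>i. A (i + n)) < \<epsilon>\<^sup>2 / 2"
    using suminf_exist_split[OF _ sumA, of "\<epsilon>\<^sup>2 / 2"] \<epsilon> by auto
  define T where "T = (\<Sum>n<N. A n)"
  have "((\<lambda>x::real. T * (1 - x ^ N)\<^sup>2) \<longlongrightarrow> T * (1 - 1 ^ N)\<^sup>2) (at_left 1)"
    by (intro tendsto_intros)
  then have "\<forall>\<^sub>F x in at_left (1::real). T * (1 - x ^ N)\<^sup>2 < \<epsilon>\<^sup>2 / 2"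
    by (rule order_tendstoD) (use \<epsilon> in simp)
  moreover have "\<forall>\<^sub>F r in at_left (1::real). r \<in> {0<..<1}" by (rule eventually_at_left_real) simp
  ultimately have "\<forall>\<^sub>F x in at_left (1::real). T * (1 - x ^ N)\<^sup>2 < \<epsilon>\<^sup>2 / 2 \<and> x \<in> {0<..<1}" by (rule eventually_conj)
  then obtain \<rho>0 where \<rho>0: "T * (1 - \<rho>0 ^ N)\<^sup>2 < \<epsilon>\<^sup>2 / 2" "0 < \<rho>0" "\<rho>0 < 1"
    using eventually_happens'[OF trivial_limit_at_left_real] by auto
  show ?thesis
  proof (intro exI[of _ \<rho>0] conjI allI impI \<rho>0)
    fix \<rho> \<sigma> assume rs: "\<rho>0 \<le> \<rho>" "\<rho> < 1" "\<rho>0 \<le> \<sigma>" "\<sigma> < 1"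
    define d where "d n = \<rho> ^ n - \<sigma> ^ n" for n
    let ?v = "\<lambda>t. u (of_real \<rho> * t) - u (of_real \<sigma> * t)"
    have pos: "0 \<le> \<rho>" "0 \<le> \<sigma>" using rs \<rho>0 by auto
    have cv: "continuous_on (sphere 0 1) ?v" by (intro continuous_intros dil pos rs)
    have sq: "(\<lambda>n. (cmod (a n * of_real (d n)))\<^sup>2) sums (LINT t|circle_lebesgue. (cmod (?v t))\<^sup>2)"
    proof (rule circle_Parseval)
      have "summable (\<lambda>n. cmod (a n) * \<rho> ^ n + cmod (a n) * \<sigma> ^ n)"
        by (intro summable_add abs pos rs)
      then show "summable (\<lambda>n. cmod (a n * of_real (d n)))"
      proof (rule summable_comparison_test'[where N = 0])
        fix n :: nat
        have "\<bar>d n\<bar> \<le> \<rho> ^ n + \<sigma> ^ n" using pos by (simp add: d_def abs_le_iff)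
        then show "norm (cmod (a n * of_real (d n))) \<le> cmod (a n) * \<rho> ^ n + cmod (a n) * \<sigma> ^ n"
          by (simp add: norm_mult mult_left_mono flip: distrib_left)
      qed
      fix t :: complex assume t: "cmod t = 1"
      have "(\<lambda>n. a n * (of_real \<rho> * t) ^ n - a n * (of_real \<sigma> * t) ^ n) sums ?v t"
        by (intro sums_diff a) (use t rs pos in \<open>auto simp: norm_mult\<close>)
      then show "(\<lambda>n. a n * of_real (d n) * t ^ n) sums ?v t"
        by (simp add: d_def algebra_simps power_mult_distrib)
    qed (rule cv)
    then have sq': "(\<lambda>n. A n * (d n)\<^sup>2) sums (LINT t|circle_lebesgue. (cmod (?v t))\<^sup>2)"
      by (simp add: norm_mult A_def power_mult_distrib)
    have p01: "0 \<le> x ^ n \<and> x ^ n \<le> 1" if "0 \<le> x" "x < 1" for x :: real and n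
      using that by (simp add: power_le_one)
    have d1: "(d n)\<^sup>2 \<le> 1" for n
    proof -
      have "\<bar>d n\<bar> \<le> 1"
        using p01[OF pos(1) rs(2), of n] p01[OF pos(2) rs(4), of n] unfolding d_def abs_le_iff by linarith
      then show ?thesis by (simp add: abs_square_le_1)
    qed
    have dN: "(d n)\<^sup>2 \<le> (1 - \<rho>0 ^ N)\<^sup>2" if "n < N" for n
    proof -
      have "\<rho>0 ^ N \<le> x ^ n" if "\<rho>0 \<le> x" for x
      proof -
        have "\<rho>0 ^ N \<le> \<rho>0 ^ n" using \<open>n < N\<close> \<rho>0 by (intro power_decreasing) auto
        also have "\<dots> \<le> x ^ n" using that \<rho>0 by (intro power_mono) auto
        finally show ?thesis .
      qed
      then have "\<bar>d n\<bar> \<le> \<bar>1 - \<rho>0 ^ N\<bar>"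
        using p01[of \<rho> n] p01[of \<sigma> n] rs pos p01[of \<rho>0 N] \<rho>0 unfolding d_def abs_le_iff by fastforce
      then show ?thesis by (simp add: abs_le_square_iff)
    qed
    have "(LINT t|circle_lebesgue. (cmod (?v t))\<^sup>2) = (\<Sum>n. A n * (d n)\<^sup>2)"
      using sq' by (simp add: sums_iff)
    also have "\<dots> = (\<Sum>n. A (n + N) * (d (n + N))\<^sup>2) + (\<Sum>n<N. A n * (d n)\<^sup>2)"
      using sq' by (intro suminf_split_initial_segment) (simp add: sums_iff)
    also have "(\<Sum>n. A (n + N) * (d (n + N))\<^sup>2) \<le> (\<Sum>n. A (n + N))"
    proof (rule suminf_le)
      show "summable (\<lambda>n. A (n + N) * (d (n + N))\<^sup>2)"
        using sq' summable_iff_shift[of "\<lambda>n. A n * (d n)\<^sup>2" N] by (simp add: sums_iff)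
      show "summable (\<lambda>n. A (n + N))" using sumA by (simp add: summable_iff_shift)
      show "A (n + N) * (d (n + N))\<^sup>2 \<le> A (n + N)" for n
        using mult_left_mono[OF d1, of "A (n + N)"] by (simp add: A_def)
    qed
    also have "\<dots> \<le> \<epsilon>\<^sup>2 / 2" using N[of N] by simp
    also have "(\<Sum>n<N. A n * (d n)\<^sup>2) \<le> (\<Sum>n<N. A n * (1 - \<rho>0 ^ N)\<^sup>2)"
      by (intro sum_mono mult_left_mono dN) (auto simp: A_def)
    also have "\<dots> = T * (1 - \<rho>0 ^ N)\<^sup>2" by (simp add: T_def sum_distrib_right)
    also have "\<dots> \<le> \<epsilon>\<^sup>2 / 2" using \<rho>0 by simp
    finally have L2: "(LINT t|circle_lebesgue. (cmod (?v t))\<^sup>2) \<le> \<epsilon>\<^sup>2" by simp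
    \<comment> \<open>From square means to means:
      \<open>x \<le> x\<^sup>2 / (2 * \<epsilon>) + \<epsilon> / 2\<close> holds pointwise, and
      since the square mean is at most \<open>\<epsilon>\<^sup>2\<close>, each of the two terms
      integrates to at most \<open>\<epsilon> / 2\<close>.\<close>
    have "(LINT t|circle_lebesgue. cmod (?v t)) \<le> (LINT t|circle_lebesgue. (cmod (?v t))\<^sup>2 / (2 * \<epsilon>) + \<epsilon> / 2)"
    proof (rule integral_mono)
      show "cmod (?v t) \<le> (cmod (?v t))\<^sup>2 / (2 * \<epsilon>) + \<epsilon> / 2" for t
      proof -
        have "0 \<le> (cmod (?v t) - \<epsilon>)\<^sup>2 / (2 * \<epsilon>)" using \<epsilon> by simp
        also have "\<dots> = (cmod (?v t))\<^sup>2 / (2 * \<epsilon>) + \<epsilon> / 2 - cmod (?v t)"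
          using \<epsilon> by (simp add: power2_eq_square field_simps)
        finally show ?thesis by simp
      qed
      show "integrable circle_lebesgue (\<lambda>t. cmod (?v t))"
        by (rule integral_circle_indicator) (intro continuous_intros cv)
      show "integrable circle_lebesgue (\<lambda>t. (cmod (?v t))\<^sup>2 / (2 * \<epsilon>) + \<epsilon> / 2)"
        by (rule integral_circle_indicator) (use \<epsilon> in \<open>auto intro!: continuous_intros cv\<close>)
    qed
    also have "\<dots> = (LINT t|circle_lebesgue. (cmod (?v t))\<^sup>2) / (2 * \<epsilon>) + (LINT t|circle_lebesgue. \<epsilon> / 2)"
    proof -
      have i1: "integrable circle_lebesgue (\<lambda>t. (cmod (?v t))\<^sup>2 / (2 * \<epsilon>))"
        by (rule integral_circle_indicator) (use \<epsilon> in \<open>auto intro!: continuous_intros cv\<close>)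
      have i2: "integrable circle_lebesgue (\<lambda>t. \<epsilon> / 2)"
        by (rule integral_circle_indicator, rule continuous_on_const)
      show ?thesis unfolding Bochner_Integration.integral_add[OF i1 i2] by simp
    qed
    also have "(LINT t|circle_lebesgue. \<epsilon> / 2) = \<epsilon> / 2"
      by (simp add: measure_def circle_lebesgue_eq)
    also have "(LINT t|circle_lebesgue. (cmod (?v t))\<^sup>2) / (2 * \<epsilon>) \<le> \<epsilon>\<^sup>2 / (2 * \<epsilon>)"
      using L2 \<epsilon> by (intro divide_right_mono) auto
    also have "\<epsilon>\<^sup>2 / (2 * \<epsilon>) + \<epsilon> / 2 = \<epsilon>" using \<epsilon> by (simp add: power2_eq_square)
    finally show "(LINT t|circle_lebesgue. cmod (?v t)) \<le> \<epsilon>" by simp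
  qed
qed

lemma circle_Poisson_norm_le:
  assumes D: "continuous_on (cball 0 1) D" "D holomorphic_on ball 0 1" and z: "cmod z < 1"
  shows "ennreal (cmod (D z)) \<le> (\<integral>\<^sup>+t. ennreal (cmod (D t)) * ennreal (poisson z t) \<partial>circle_borel)"
proof -
  have cD: "continuous_on (sphere 0 1) D" by (rule continuous_on_subset[OF D(1)]) auto
  have "integrable circle_lebesgue (\<lambda>t. poisson z t *\<^sub>R D t)"
    by (rule integral_circle_indicator) (intro continuous_intros cD z)
  then have "ennreal (cmod (LINT t|circle_lebesgue. poisson z t *\<^sub>R D t)) \<le>
      (\<integral>\<^sup>+t. ennreal (norm (poisson z t *\<^sub>R D t)) \<partial>circle_lebesgue)"
    by (rule integral_norm_bound_ennreal)
  then show ?thesis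
    unfolding circle_Poisson[OF D z, symmetric] nn_integral_circle_lebesgue
    using poisson_nonneg[OF z] by (simp add: ennreal_mult' mult.commute)
qed

text \<open>\<open>W n\<close> sums the moduli of the differences of consecutive dilations from
  index \<open>n\<close> on. Telescoping, together with the Poisson formula for dilations, which are
  continuous up to the circle, bounds the distance from \<open>u\<close> to its \<open>n\<close>-th
  dilation by the Poisson integral of \<open>W n\<close>. The factor 2 leaves room above the
  geometric sum \<open>4/3\<close>.\<close>

lemma H2_radial_approx:
  assumes u: "u holomorphic_on ball 0 1"
    and M: "\<forall>r\<in>{0..<1}. (LINT t|circle_lebesgue. (cmod (u (of_real r * t)))\<^sup>2) \<le> M"
  shows "\<exists>(\<rho> :: nat \<Rightarrow> real) (W :: nat \<Rightarrow> complex \<Rightarrow> ennreal).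
    (\<forall>n. 0 < \<rho> n \<and> \<rho> n < 1) \<and> \<rho> \<longlonglongrightarrow> 1 \<and> (\<forall>n. W n \<in> borel_measurable borel) \<and>
    (\<forall>n. (\<integral>\<^sup>+t. W n t \<partial>circle_borel) \<le> ennreal (2 * (1/4) ^ n)) \<and>
    (\<forall>n z. cmod z < 1 \<longrightarrow> ennreal (cmod (u z - u (of_real (\<rho> n) * z))) \<le>
            (\<integral>\<^sup>+t. W n t * ennreal (poisson z t) \<partial>circle_borel))"
proof -
  have "\<forall>n. \<exists>\<rho>0. 0 < \<rho>0 \<and> \<rho>0 < 1 \<and> (\<forall>\<rho> \<sigma>. \<rho>0 \<le> \<rho> \<longrightarrow> \<rho> < 1 \<longrightarrow> \<rho>0 \<le> \<sigma> \<longrightarrow> \<sigma> < 1 \<longrightarrow>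
    (LINT t|circle_lebesgue. cmod (u (of_real \<rho> * t) - u (of_real \<sigma> * t))) \<le> (1/4) ^ n)"
    using H2_Cauchy[OF u M] by simp
  then obtain thr where thr: "\<And>n. 0 < thr n" "\<And>n. thr n < 1" and
    Cau: "\<And>n \<rho> \<sigma>. thr n \<le> \<rho> \<Longrightarrow> \<rho> < 1 \<Longrightarrow> thr n \<le> \<sigma> \<Longrightarrow> \<sigma> < 1 \<Longrightarrow>
    (LINT t|circle_lebesgue. cmod (u (of_real \<rho> * t) - u (of_real \<sigma> * t))) \<le> (1/4) ^ n"
    by metis
  \<comment> \<open>The running maximum keeps \<open>\<rho>\<close> above every earlier threshold,
    so the estimate of stage \<open>n\<close> holds for all later radii; the terms
    \<open>1 - 1 / (real i + 2)\<close> force the limit 1.\<close>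
  define \<rho> where "\<rho> n = Max ((\<lambda>i. max (thr i) (1 - 1 / (real i + 2))) ` {..n})" for n
  have ge: "max (thr n) (1 - 1 / (real n + 2)) \<le> \<rho> m" if "n \<le> m" for n m
    unfolding \<rho>_def using that by (intro Max_ge) auto
  have lt: "\<rho> n < 1" for n
    unfolding \<rho>_def by (subst Max_less_iff) (auto simp: thr)
  have pos: "0 < \<rho> n" for n using ge[of n n] thr(1)[of n] by simp
  have lim: "\<rho> \<longlonglongrightarrow> 1"
  proof (rule tendsto_sandwich[of "\<lambda>n. 1 - 1 / (real n + 2)" _ _ "\<lambda>_. 1"])
    show "(\<lambda>n. 1 - 1 / (real n + 2)) \<longlonglongrightarrow> 1" by real_asymp
    show "\<forall>\<^sub>F n in sequentially. 1 - 1 / (real n + 2) \<le> \<rho> n"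
      using ge by (intro always_eventually allI) (meson le_refl max.cobounded2 order.trans)
    show "\<forall>\<^sub>F n in sequentially. \<rho> n \<le> 1" using lt by (intro always_eventually allI less_imp_le)
  qed auto
  note dil = continuous_on_dilation[OF u less_imp_le[OF pos] lt]
  have dils: "continuous_on (sphere 0 1) (\<lambda>t. u (of_real (\<rho> n) * t))" for n
    using dil(1) by (rule continuous_on_subset) auto
  define d where "d n t = indicator (sphere 0 1) t *\<^sub>R cmod (u (of_real (\<rho> (Suc n)) * t) - u (of_real (\<rho> n) * t))" for n t
  have dc: "continuous_on (sphere 0 1) (\<lambda>t. cmod (u (of_real (\<rho> (Suc n)) * t) - u (of_real (\<rho> n) * t)))" for n
    by (intro continuous_intros dils)
  have dm [measurable]: "d n \<in> borel_measurable borel" for n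
    unfolding d_def by (rule borel_measurable_on_circle[OF dc])
  have d0: "0 \<le> d n t" for n t by (simp add: d_def)
  have dint: "(\<integral>\<^sup>+t. ennreal (d n t) \<partial>circle_borel) \<le> ennreal ((1/4) ^ n)" for n
  proof -
    have "(\<integral>\<^sup>+t. ennreal (d n t) \<partial>circle_borel) = ennreal (LINT t|circle_borel. d n t)"
      by (rule nn_integral_eq_integral) (use integral_circle_indicator(3)[OF dc] d0 in \<open>auto simp: d_def\<close>)
    also have "(LINT t|circle_borel. d n t) = (LINT t|circle_lebesgue. cmod (u (of_real (\<rho> (Suc n)) * t) - u (of_real (\<rho> n) * t)))"
      using integral_circle_indicator(1)[OF dc] by (simp add: d_def)
    also have "\<dots> \<le> (1/4) ^ n"
      using ge[of n n] ge[of n "Suc n"] by (intro Cau lt) auto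
    finally show ?thesis by (simp add: ennreal_leI)
  qed
  define W where "W n t = (\<Sum>m. ennreal (d (n + m) t))" for n t
  have Wm [measurable]: "W n \<in> borel_measurable borel" for n
    unfolding W_def by measurable
  have Wint: "(\<integral>\<^sup>+t. W n t \<partial>circle_borel) \<le> ennreal (2 * (1/4) ^ n)" for n
  proof -
    have "(\<integral>\<^sup>+t. W n t \<partial>circle_borel) = (\<Sum>m. \<integral>\<^sup>+t. ennreal (d (n + m) t) \<partial>circle_borel)"
      unfolding W_def by (rule nn_integral_suminf) measurable
    also have "\<dots> \<le> (\<Sum>m. ennreal ((1/4) ^ (n + m)))" by (intro suminf_le dint) auto
    also have "\<dots> = ennreal ((1/4) ^ n * (1 / (1 - 1/4)))"
      unfolding power_add by (intro suminf_ennreal_eq sums_mult geometric_sums) auto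
    also have "\<dots> \<le> ennreal (2 * (1/4) ^ n)" by (intro ennreal_leI) simp
    finally show ?thesis .
  qed
  have bound: "ennreal (cmod (u (of_real (\<rho> (n + m)) * z) - u (of_real (\<rho> n) * z))) \<le>
      (\<integral>\<^sup>+t. W n t * ennreal (poisson z t) \<partial>circle_borel)" if z: "cmod z < 1" for n m z
  proof -
    have "ennreal (cmod (u (of_real (\<rho> (n + m)) * z) - u (of_real (\<rho> n) * z))) \<le>
       (\<integral>\<^sup>+t. ennreal (cmod (u (of_real (\<rho> (n + m)) * t) - u (of_real (\<rho> n) * t))) * ennreal (poisson z t) \<partial>circle_borel)"
      by (rule circle_Poisson_norm_le[where D = "\<lambda>t. u (of_real (\<rho> (n + m)) * t) - u (of_real (\<rho> n) * t)"])
         (intro continuous_intros holomorphic_intros dil z)+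
    also have "\<dots> \<le> (\<integral>\<^sup>+t. W n t * ennreal (poisson z t) \<partial>circle_borel)"
    proof (rule nn_integral_mono_AE)
      show "AE t in circle_borel. ennreal (cmod (u (of_real (\<rho> (n + m)) * t) - u (of_real (\<rho> n) * t))) * ennreal (poisson z t)
         \<le> W n t * ennreal (poisson z t)"
        using AE_circle_norm
      proof eventually_elim
        case (elim t)
        have "cmod (u (of_real (\<rho> (n + m)) * t) - u (of_real (\<rho> n) * t)) =
           cmod (\<Sum>i<m. u (of_real (\<rho> (n + Suc i)) * t) - u (of_real (\<rho> (n + i)) * t))"
          by (subst sum_lessThan_telescope) simp
        also have "\<dots> \<le> (\<Sum>i<m. d (n + i) t)"
          using elim by (intro order.trans[OF norm_sum]) (simp add: d_def)
        finally have "ennreal (cmod (u (of_real (\<rho> (n + m)) * t) - u (of_real (\<rho> n) * t))) \<le> ennreal (\<Sum>i<m. d (n + i) t)"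
          by (rule ennreal_leI)
        also have "\<dots> = (\<Sum>i<m. ennreal (d (n + i) t))" using d0 by (simp add: sum_ennreal)
        also have "\<dots> \<le> W n t" unfolding W_def by (intro sum_le_suminf) auto
        finally show ?case by (intro mult_right_mono) auto
      qed
    qed
    finally show ?thesis .
  qed
  have final: "ennreal (cmod (u z - u (of_real (\<rho> n) * z))) \<le> (\<integral>\<^sup>+t. W n t * ennreal (poisson z t) \<partial>circle_borel)"
    if z: "cmod z < 1" for n z
  proof -
    have lim2: "(\<lambda>m. \<rho> (n + m)) \<longlonglongrightarrow> 1" using LIMSEQ_ignore_initial_segment[OF lim, of n] by (simp add: add.commute)
    have cont: "isCont u z" using u z holomorphic_on_imp_continuous_on[OF u]
      by (simp add: continuous_on_eq_continuous_at)
    have "(\<lambda>m. of_real (\<rho> (n + m)) * z) \<longlonglongrightarrow> of_real 1 * z" by (intro tendsto_intros lim2)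
    then have "(\<lambda>m. u (of_real (\<rho> (n + m)) * z)) \<longlonglongrightarrow> u z"
      using isCont_tendsto_compose[OF cont] by simp
    then have "(\<lambda>m. ennreal (cmod (u (of_real (\<rho> (n + m)) * z) - u (of_real (\<rho> n) * z)))) \<longlonglongrightarrow>
        ennreal (cmod (u z - u (of_real (\<rho> n) * z)))"
      by (intro tendsto_intros)
    then show ?thesis by (rule LIMSEQ_le_const2) (use bound[OF z] in auto)
  qed
  show ?thesis by (intro exI[of _ \<rho>] exI[of _ W] conjI allI impI pos lt lim Wm Wint final)
qed

subsection \<open>Existence of nontangential limits\<close>

definition stolz :: "real \<Rightarrow> complex \<Rightarrow> complex set" where
  "stolz M t = {z \<in> ball 0 1. dist z t < M * (1 - cmod z)}"

lemma has_nt_limit_stolz: "has_nt_limit u t l \<longleftrightarrow> (\<forall>M>1. (u \<longlongrightarrow> l) (at t within stolz M t))"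
  by (simp add: has_nt_limit_def stolz_def)

text \<open>Boundary values are computed along this one sequence of radii, which exhibits them as
  limits of measurable functions. The shift by 2 keeps every radius strictly between 0 and
  1.\<close>

definition radial :: "nat \<Rightarrow> real" where
  "radial n = 1 - 1 / (real n + 2)"

lemma radial: "0 < radial n" "radial n < 1" "0 \<le> radial n" "radial \<longlonglongrightarrow> 1"
proof -
  show "radial \<longlonglongrightarrow> 1" unfolding radial_def by real_asymp
qed (auto simp: radial_def)

lemma radial_in_stolz:
  assumes "cmod t = 1" "M > 1" "0 \<le> r" "r < 1"
  shows "of_real r * t \<in> stolz M t"
proof -
  have "of_real r * t - t = - of_real (1 - r) * t" by (simp add: algebra_simps)
  then have "dist (of_real r * t) t = 1 - r" using assms by (simp only: dist_norm norm_mult norm_minus_cancel norm_of_real) simp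
  then show ?thesis using assms mult_strict_right_mono[of 1 M "1 - r"] by (simp add: stolz_def norm_mult)
qed

lemma filterlim_radial:
  assumes "cmod t = 1" "M > 1"
  shows "filterlim (\<lambda>n. of_real (radial n) * t) (at t within stolz M t) sequentially"
  unfolding filterlim_at
proof
  have "(\<lambda>n. of_real (radial n) * t) \<longlonglongrightarrow> of_real 1 * t" by (intro tendsto_intros radial)
  then show "(\<lambda>n. of_real (radial n) * t) \<longlonglongrightarrow> t" by simp
  show "\<forall>\<^sub>F n in sequentially. of_real (radial n) * t \<in> stolz M t \<and> of_real (radial n) * t \<noteq> t"
  proof (intro always_eventually allI conjI)
    fix n
    show *: "of_real (radial n) * t \<in> stolz M t"
      using radial(1)[of n] radial(2)[of n] assms by (intro radial_in_stolz) auto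
    show "of_real (radial n) * t \<noteq> t" using * assms by (auto simp: stolz_def)
  qed
qed

lemma stolz_nontrivial: "cmod t = 1 \<Longrightarrow> M > 1 \<Longrightarrow> at t within stolz M t \<noteq> bot"
  using filterlim_radial[of t M] by (auto simp: filterlim_def bot_unique filtermap_bot_iff)

lemma has_nt_limit_radial:
  assumes "has_nt_limit u t l" "cmod t = 1"
  shows "(\<lambda>n. u (of_real (radial n) * t)) \<longlonglongrightarrow> l"
  using assms unfolding has_nt_limit_stolz by (intro filterlim_compose[OF _ filterlim_radial[of t 2]]) auto

text \<open>Uniqueness of the limit is inherited from the radial sequence, which stays in every
  Stolz region of aperture above 1.\<close>

lemma nt_lim_eq:
  assumes "has_nt_limit u t l" "cmod t = 1"
  shows "nt_lim u t = l"
  unfolding nt_lim_def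
  by (rule the_equality) (use assms has_nt_limit_radial LIMSEQ_unique in blast)+

text \<open>Fatou's theorem by way of the maximal function. \<open>W n\<close> has mass of order
  \<open>(1/4) ^ n\<close>; at level \<open>(1/2) ^ n\<close> the weak-type bound leaves an
  exceptional set of measure at most \<open>40 * (1/2) ^ n\<close>, and Borel-Cantelli discards
  these sets. At every other point the dilations converge uniformly on each Stolz region, each
  dilation is continuous up to the point, and the two limits may be interchanged.\<close>

theorem H2_nt_limit_AE:
  assumes u: "u holomorphic_on ball 0 1"
    and B: "\<forall>r\<in>{0..<1}. (LINT t|circle_lebesgue. (cmod (u (of_real r * t)))\<^sup>2) \<le> B"
  shows "AE t in circle_borel. \<exists>l. has_nt_limit u t l"
proof -
  from H2_radial_approx[OF u B] obtain \<rho> :: "nat \<Rightarrow> real" and W where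
    H: "(\<forall>n. 0 < \<rho> n \<and> \<rho> n < 1) \<and> \<rho> \<longlonglongrightarrow> 1 \<and> (\<forall>n. W n \<in> borel_measurable borel) \<and>
    (\<forall>n. (\<integral>\<^sup>+t. W n t \<partial>circle_borel) \<le> ennreal (2 * (1/4) ^ n)) \<and>
    (\<forall>n z. cmod z < 1 \<longrightarrow> ennreal (cmod (u z - u (of_real (\<rho> n) * z))) \<le>
            (\<integral>\<^sup>+t. W n t * ennreal (poisson z t) \<partial>circle_borel))" by (elim exE)
  note H1 = conjunct1[OF H] and H2 = conjunct2[OF conjunct2[OF H]]
  note H3 = conjunct2[OF H2] and H4 = conjunct2[OF conjunct2[OF H2]]
  have \<rho>: "0 < \<rho> n" "\<rho> n < 1" for n using H1 by auto
  have W: "W n \<in> borel_measurable borel" "(\<integral>\<^sup>+t. W n t \<partial>circle_borel) \<le> ennreal (2 * (1/4) ^ n)" for n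
    by (rule spec[OF conjunct1[OF H2]], rule spec[OF conjunct1[OF H3]])
  have uW: "ennreal (cmod (u z - u (of_real (\<rho> n) * z))) \<le>
            (\<integral>\<^sup>+t. W n t * ennreal (poisson z t) \<partial>circle_borel)" if "cmod z < 1" for n z
    by (rule mp[OF spec[OF spec[OF H4]] that])
  define P where "P n A \<longleftrightarrow> A \<in> sets borel \<and>
    {t. cmod t = 1 \<and> (\<exists>r>0. ennreal ((1/2) ^ n * r) < (\<integral>\<^sup>+s\<in>cball t r. W n s \<partial>circle_borel))} \<subseteq> A \<and>
    emeasure circle_borel A \<le> ennreal (20 / (1/2) ^ n) * (\<integral>\<^sup>+s. W n s \<partial>circle_borel)" for n A
  have "\<forall>n. \<exists>A. P n A"
    unfolding P_def by (intro allI circle_weak_type W(1)) simp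
  then obtain A where "\<forall>n. P n (A n)" by (auto dest: choice)
  then have A: "A n \<in> sets borel"
     "{t. cmod t = 1 \<and> (\<exists>r>0. ennreal ((1/2) ^ n * r) < (\<integral>\<^sup>+s\<in>cball t r. W n s \<partial>circle_borel))} \<subseteq> A n"
     "emeasure circle_borel (A n) \<le> ennreal (20 / (1/2) ^ n) * (\<integral>\<^sup>+s. W n s \<partial>circle_borel)" for n
    by (simp_all only: P_def)
  have mA: "measure circle_borel (A n) \<le> 40 * (1/2) ^ n" for n
  proof -
    have "emeasure circle_borel (A n) \<le> ennreal (20 / (1/2) ^ n) * ennreal (2 * (1/4) ^ n)"
      using A(3)[of n] W(2)[of n] by (meson mult_left_mono order.trans zero_le)
    also have "\<dots> = ennreal (20 / (1/2) ^ n * (2 * (1/4) ^ n))" by (rule ennreal_mult[symmetric]) auto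
    also have "20 / (1/2) ^ n * (2 * (1/4) ^ n) = 40 * ((1/4) ^ n / (1/2) ^ n :: real)" by simp
    also have "(1/4) ^ n / (1/2) ^ n = (1/2 :: real) ^ n" unfolding power_divide[symmetric] by simp
    finally show ?thesis unfolding circle.emeasure_eq_measure by (subst (asm) ennreal_le_iff) auto
  qed
  have "AE t in circle_borel. \<forall>\<^sub>F n in sequentially. t \<in> space circle_borel - A n"
  proof (rule borel_cantelli_AE1)
    show "summable (\<lambda>n. measure circle_borel (A n))"
    proof (rule summable_comparison_test'[where N = 0])
      show "summable (\<lambda>n. 40 * (1/2 :: real) ^ n)" by (intro summable_mult summable_geometric) simp
    qed (use mA in auto)
  qed (use A in \<open>auto simp: less_top[symmetric]\<close>)
  then show ?thesis
    using AE_circle_norm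
  proof eventually_elim
    case (elim t)
    obtain N where "\<forall>n\<ge>N. t \<in> space circle_borel - A n"
      using elim(1) unfolding eventually_sequentially by (elim exE)
    then have N: "t \<notin> A n" if "n \<ge> N" for n using that by blast
    have bd: "cmod (u z - u (of_real (\<rho> n) * z)) \<le> 16 * (1 + M)\<^sup>2 * (1/2) ^ n"
      if n: "n \<ge> N" and M: "M > 1" and z: "z \<in> stolz M t" for n M z
    proof -
      have "(\<integral>\<^sup>+s\<in>cball t r. W n s \<partial>circle_borel) \<le> ennreal ((1/2) ^ n * r)" if "r > 0" for r
      proof (rule ccontr)
        assume "\<not> ?thesis"
        then have "ennreal ((1/2) ^ n * r) < (\<integral>\<^sup>+s\<in>cball t r. W n s \<partial>circle_borel)" by (simp only: not_le)
        then have "t \<in> A n" by (intro subsetD[OF A(2)] CollectI conjI exI[of _ r] elim(2) that)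
        then show False using N[OF n] by blast
      qed
      then have "(\<integral>\<^sup>+s. W n s * ennreal (poisson z s) \<partial>circle_borel) \<le> ennreal (16 * (1 + M)\<^sup>2 * (1/2) ^ n)"
        using z by (intro poisson_maximal_bound[OF W(1) elim(2) _ M]) (auto simp: stolz_def)
      then have "ennreal (cmod (u z - u (of_real (\<rho> n) * z))) \<le> ennreal (16 * (1 + M)\<^sup>2 * (1/2) ^ n)"
        using z by (intro order.trans[OF uW]) (auto simp: stolz_def)
      then show ?thesis by (subst (asm) ennreal_le_iff) auto
    qed
    have geo: "(\<lambda>n. 16 * (1 + M)\<^sup>2 * (1/2 :: real) ^ n) \<longlonglongrightarrow> 0" for M :: real
      by (intro tendsto_mult_right_zero LIMSEQ_power_zero) simp
    have unif: "uniform_limit (stolz M t) (\<lambda>n z. u (of_real (\<rho> n) * z)) u sequentially" if M: "M > 1" for M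
      unfolding uniform_limit_iff
    proof (intro allI impI)
      fix e :: real assume "e > 0"
      have "\<forall>\<^sub>F n in sequentially. 16 * (1 + M)\<^sup>2 * (1/2 :: real) ^ n < e"
        using geo[of M] \<open>e > 0\<close> by (rule order_tendstoD)
      moreover have "\<forall>\<^sub>F n in sequentially. n \<ge> N" by (rule eventually_ge_at_top)
      ultimately show "\<forall>\<^sub>F n in sequentially. \<forall>z\<in>stolz M t. dist (u (of_real (\<rho> n) * z)) (u z) < e"
      proof eventually_elim
        case (elim n)
        show ?case
        proof
          fix z assume "z \<in> stolz M t"
          then have "cmod (u z - u (of_real (\<rho> n) * z)) < e" using bd[OF elim(2) M, of z] elim(1) by linarith
          then show "dist (u (of_real (\<rho> n) * z)) (u z) < e" by (simp add: dist_norm norm_minus_commute)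
        qed
      qed
    qed
    have lim: "((\<lambda>z. u (of_real (\<rho> n) * z)) \<longlongrightarrow> u (of_real (\<rho> n) * t)) (at t within stolz M t)" for n M
    proof -
      have "continuous_on (cball 0 1) (\<lambda>z. u (of_real (\<rho> n) * z))"
        by (rule continuous_on_dilation[OF u less_imp_le[OF \<rho>(1)] \<rho>(2)])
      then have "((\<lambda>z. u (of_real (\<rho> n) * z)) \<longlongrightarrow> u (of_real (\<rho> n) * t)) (at t within cball 0 1)"
        using elim(2) by (simp add: continuous_on_def)
      then show ?thesis by (rule tendsto_within_subset) (auto simp: stolz_def)
    qed
    \<comment> \<open>The values of two dilations at \<open>t\<close> are compared through points
      \<open>z\<close> of a Stolz region, where both are close to \<open>u z\<close>; then
      \<open>z\<close> tends to \<open>t\<close>.\<close>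
    have "Cauchy (\<lambda>n. u (of_real (\<rho> n) * t))"
    proof (rule metric_CauchyI)
      fix e :: real assume e: "e > 0"
      have "\<forall>\<^sub>F n in sequentially. 16 * (1 + 2)\<^sup>2 * (1/2 :: real) ^ n < e / 2"
        using geo[of 2] by (rule order_tendstoD) (use e in simp)
      then obtain N' where N': "\<forall>n\<ge>N'. 16 * (1 + 2)\<^sup>2 * (1/2 :: real) ^ n < e / 2"
        unfolding eventually_sequentially by (elim exE)
      define K where "K = 16 * (1 + 2)\<^sup>2 * (1/2 :: real) ^ max N N'"
      have K: "2 * K < e" using N'[rule_format, of "max N N'"] by (simp add: K_def)
      have le: "cmod (u z - u (of_real (\<rho> n) * z)) \<le> K" if "n \<ge> max N N'" "z \<in> stolz 2 t" for n z
      proof -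
        have "cmod (u z - u (of_real (\<rho> n) * z)) \<le> 16 * (1 + 2)\<^sup>2 * (1/2) ^ n" using bd[of n 2 z] that by simp
        also have "\<dots> \<le> K" unfolding K_def using that by (intro mult_left_mono power_decreasing) auto
        finally show ?thesis .
      qed
      have "dist (u (of_real (\<rho> n) * t)) (u (of_real (\<rho> m) * t)) \<le> 2 * K" if "n \<ge> max N N'" "m \<ge> max N N'" for n m
      proof (rule tendsto_upperbound)
        show "((\<lambda>z. dist (u (of_real (\<rho> n) * z)) (u (of_real (\<rho> m) * z))) \<longlongrightarrow>
            dist (u (of_real (\<rho> n) * t)) (u (of_real (\<rho> m) * t))) (at t within stolz 2 t)"
          by (intro tendsto_intros lim)
        show "\<forall>\<^sub>F z in at t within stolz 2 t. dist (u (of_real (\<rho> n) * z)) (u (of_real (\<rho> m) * z)) \<le> 2 * K"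
          unfolding eventually_at_filter
        proof (intro always_eventually allI impI)
          fix z assume "z \<in> stolz 2 t"
          then show "dist (u (of_real (\<rho> n) * z)) (u (of_real (\<rho> m) * z)) \<le> 2 * K"
            using le[OF that(1), of z] le[OF that(2), of z]
              dist_triangle3[of "u (of_real (\<rho> n) * z)" "u (of_real (\<rho> m) * z)" "u z"]
            by (simp add: dist_norm)
        qed
      qed (use stolz_nontrivial[OF elim(2)] in auto)
      then show "\<exists>M. \<forall>m\<ge>M. \<forall>n\<ge>M. dist (u (of_real (\<rho> m) * t)) (u (of_real (\<rho> n) * t)) < e"
        using K by (intro exI[of _ "max N N'"] allI impI) (rule le_less_trans)
    qed
    then have "convergent (\<lambda>n. u (of_real (\<rho> n) * t))" by (rule Cauchy_convergent)
    then obtain l where l: "(\<lambda>n. u (of_real (\<rho> n) * t)) \<longlonglongrightarrow> l" unfolding convergent_def by (elim exE)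
    have "has_nt_limit u t l"
      unfolding has_nt_limit_stolz
    proof (intro allI impI)
      fix M :: real assume M: "M > 1"
      show "(u \<longlongrightarrow> l) (at t within stolz M t)"
        by (rule swap_uniform_limit[OF _ l unif[OF M]]) (use lim in auto)
    qed
    then show ?case ..
  qed
qed

subsection \<open>Boundary values of bounded functions and quotients\<close>

lemma tendsto_stolz_cong:
  assumes "\<And>z. cmod z < 1 \<Longrightarrow> u z = v z"
  shows "(u \<longlongrightarrow> l) (at t within stolz M t) \<longleftrightarrow> (v \<longlongrightarrow> l) (at t within stolz M t)"
  by (intro tendsto_cong) (auto simp: eventually_at_filter stolz_def assms)

lemma has_nt_limit_cong:
  assumes "\<And>z. cmod z < 1 \<Longrightarrow> u z = v z"
  shows "has_nt_limit u t l \<longleftrightarrow> has_nt_limit v t l"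
  unfolding has_nt_limit_stolz using tendsto_stolz_cong[OF assms] by simp

lemma has_nt_limit_mult:
  "has_nt_limit u t a \<Longrightarrow> has_nt_limit v t b \<Longrightarrow> has_nt_limit (\<lambda>z. u z * v z) t (a * b)"
  unfolding has_nt_limit_stolz by (auto intro!: tendsto_intros)

lemma has_nt_limit_divide:
  "has_nt_limit u t a \<Longrightarrow> has_nt_limit v t b \<Longrightarrow> b \<noteq> 0 \<Longrightarrow> has_nt_limit (\<lambda>z. u z / v z) t (a / b)"
  unfolding has_nt_limit_stolz by (auto intro!: tendsto_intros)

lemma has_nt_limit_power:
  "has_nt_limit u t a \<Longrightarrow> has_nt_limit (\<lambda>z. u z ^ k) t (a ^ k)"
  unfolding has_nt_limit_stolz by (auto intro!: tendsto_intros)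

lemma has_nt_limit_diff_const:
  "has_nt_limit u t a \<Longrightarrow> has_nt_limit (\<lambda>z. u z - c) t (a - c)"
  unfolding has_nt_limit_stolz by (auto intro!: tendsto_intros)

lemma has_nt_limit_nt_lim:
  assumes "\<exists>l. has_nt_limit u t l" "cmod t = 1"
  shows "has_nt_limit u t (nt_lim u t)"
  using assms nt_lim_eq by metis

lemma measure_circle_UNIV [simp]: "measure circle_lebesgue UNIV = 1" "measure circle_borel UNIV = 1"
  by (simp_all add: measure_def circle_lebesgue_eq)

lemma measurable_radial_dilation:
  assumes "u holomorphic_on ball 0 1"
  shows "(\<lambda>t. indicator (sphere 0 1) t *\<^sub>R u (of_real (radial n) * t)) \<in> borel_measurable borel"
  by (intro borel_measurable_on_circle continuous_on_subset[OF continuous_on_dilation(1)[OF assms radial(3,2)]]) auto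

lemma measurable_nt_lim:
  assumes u: "u holomorphic_on ball 0 1" and ae: "AE t in circle_borel. \<exists>l. has_nt_limit u t l"
  shows "nt_lim u \<in> borel_measurable circle_lebesgue"
proof (rule measurable_circle_lebesgue_AE)
  let ?h = "\<lambda>n t. indicator (sphere 0 1) t *\<^sub>R u (of_real (radial n) * t)"
  show "(\<lambda>t. lim (\<lambda>n. ?h n t)) \<in> borel_measurable circle_lebesgue"
    by (intro measurable_circle_lebesgue borel_measurable_lim_metric measurable_radial_dilation u)
  show "AE t in circle_borel. lim (\<lambda>n. ?h n t) = nt_lim u t"
    using ae AE_circle_norm
  proof eventually_elim
    case (elim t)
    then have "(\<lambda>n. u (of_real (radial n) * t)) \<longlonglongrightarrow> nt_lim u t"
      by (intro has_nt_limit_radial has_nt_limit_nt_lim)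
    then show ?case using elim by (simp add: limI)
  qed
qed

lemma bounded_analyticE:
  assumes "bounded_analytic u"
  obtains C where "u holomorphic_on ball 0 1" "C > 0" "\<And>z. cmod z < 1 \<Longrightarrow> cmod (u z) \<le> C"
proof -
  obtain C where "\<And>z. cmod z < 1 \<Longrightarrow> cmod (u z) \<le> C"
    using assms unfolding bounded_analytic_def bounded_iff by fastforce
  then show ?thesis using assms that[of "max C 1"] unfolding bounded_analytic_def by (simp add: le_max_iff_disj)
qed

lemma bounded_analyticI:
  assumes "u holomorphic_on ball 0 1" "\<And>z. cmod z < 1 \<Longrightarrow> cmod (u z) \<le> C"
  shows "bounded_analytic u"
  using assms unfolding bounded_analytic_def bounded_iff by (auto intro!: exI[of _ C])

lemma bounded_analytic_nt_limit_AE: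
  assumes "bounded_analytic u"
  shows "AE t in circle_borel. \<exists>l. has_nt_limit u t l"
proof -
  obtain C where C: "u holomorphic_on ball 0 1" "C > 0" "\<And>z. cmod z < 1 \<Longrightarrow> cmod (u z) \<le> C"
    using bounded_analyticE[OF assms] by blast
  show ?thesis
  proof (rule H2_nt_limit_AE[OF C(1)], rule ballI)
    fix r :: real assume r: "r \<in> {0..<1}"
    have cont: "continuous_on (sphere 0 1) (\<lambda>t. u (of_real r * t))"
      by (rule continuous_on_subset[OF continuous_on_dilation(1)[OF C(1)]]) (use r in auto)
    have "(LINT t|circle_lebesgue. (cmod (u (of_real r * t)))\<^sup>2) \<le> (LINT t|circle_lebesgue. C\<^sup>2)"
    proof (rule integral_mono_AE)
      show "AE t in circle_lebesgue. (cmod (u (of_real r * t)))\<^sup>2 \<le> C\<^sup>2"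
        unfolding AE_circle_lebesgue_iff using AE_circle_norm
        by eventually_elim (use r in \<open>auto intro!: power_mono C simp: norm_mult\<close>)
    qed (rule integral_circle_indicator, intro continuous_intros cont)+
    then show "(LINT t|circle_lebesgue. (cmod (u (of_real r * t)))\<^sup>2) \<le> C\<^sup>2" by simp
  qed
qed

text \<open>\<open>ln C - ln (cmod (u z))\<close> is nonnegative and, as \<open>u\<close> has a
  holomorphic logarithm, harmonic, so its means over all circles equal its value at 0. By Fatou's
  lemma its lower limit along almost every radius is finite, while a boundary value 0 would drive it
  to infinity.\<close>

lemma bounded_zero_free_nt_lim_nonzero:
  assumes u: "bounded_analytic u" and nz: "\<And>z. cmod z < 1 \<Longrightarrow> u z \<noteq> 0"
  shows "AE t in circle_borel. nt_lim u t \<noteq> 0"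
proof -
  obtain C where C: "u holomorphic_on ball 0 1" "C > 0" "\<And>z. cmod z < 1 \<Longrightarrow> cmod (u z) \<le> C"
    using bounded_analyticE[OF u] by blast
  obtain L where L: "L holomorphic_on ball 0 1" "\<And>z. z \<in> ball 0 1 \<Longrightarrow> u z = exp (L z)"
    by (rule contractible_imp_holomorphic_log[OF C(1)]) (use nz in \<open>auto intro: convex_imp_contractible\<close>)
  let ?c = "\<lambda>n t. ln C - Re (L (of_real (radial n) * t))"
  define F where "F n t = indicator (sphere 0 1) t *\<^sub>R ?c n t" for n t
  have cont: "continuous_on (sphere 0 1) (?c n)" for n
    by (intro continuous_intros continuous_on_subset[OF continuous_on_dilation(1)[OF L(1) radial(3,2)]]) auto
  have Fm [measurable]: "F n \<in> borel_measurable borel" for n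
    unfolding F_def by (rule borel_measurable_on_circle[OF cont])
  have rad: "cmod (of_real (radial n) * t) < 1" if "cmod t = 1" for n t
    using that radial(1)[of n] radial(2)[of n] by (simp add: norm_mult)
  have lnu: "ln (cmod (u z)) = Re (L z)" if "cmod z < 1" for z using L(2)[of z] that by simp
  have F0: "0 \<le> F n t" for n t
  proof (cases "cmod t = 1")
    case True
    have "Re (L (of_real (radial n) * t)) \<le> ln C"
      unfolding lnu[OF rad[OF True], symmetric]
      using nz[OF rad[OF True]] C(3)[OF rad[OF True]] C(2) by (intro ln_mono) auto
    then show ?thesis by (simp add: F_def)
  qed (simp add: F_def)
  have int: "(\<integral>\<^sup>+t. ennreal (F n t) \<partial>circle_borel) = ennreal (ln C - Re (L 0))" for n
  proof -
    have "(\<integral>\<^sup>+t. ennreal (F n t) \<partial>circle_borel) = ennreal (LINT t|circle_borel. F n t)"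
      by (rule nn_integral_eq_integral) (use integral_circle_indicator(3)[OF cont] F0 in \<open>auto simp: F_def\<close>)
    also have "(LINT t|circle_borel. F n t) = (LINT t|circle_lebesgue. ?c n t)"
      using integral_circle_indicator(1)[OF cont] by (simp add: F_def)
    also have "\<dots> = Re (LINT t|circle_lebesgue. of_real (ln C) - L (of_real (radial n) * t))"
    proof -
      have "integrable circle_lebesgue (\<lambda>t. of_real (ln C) - L (of_real (radial n) * t))"
        by (rule integral_circle_indicator(2),
            intro continuous_intros continuous_on_subset[OF continuous_on_dilation(1)[OF L(1) radial(3,2)]]) auto
      from integral_Re[OF this] show ?thesis by simp
    qed
    also have "(LINT t|circle_lebesgue. of_real (ln C) - L (of_real (radial n) * t)) = of_real (ln C) - L (of_real (radial n) * 0)"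
      by (rule circle_mean) (intro continuous_intros holomorphic_intros continuous_on_dilation[OF L(1) radial(3,2)])+
    finally show ?thesis by simp
  qed
  have "(\<integral>\<^sup>+t. liminf (\<lambda>n. ennreal (F n t)) \<partial>circle_borel) \<le> liminf (\<lambda>n. \<integral>\<^sup>+t. ennreal (F n t) \<partial>circle_borel)"
    by (rule nn_integral_liminf) measurable
  also have "\<dots> < \<infinity>" unfolding int by (simp add: Liminf_const)
  finally have "AE t in circle_borel. liminf (\<lambda>n. ennreal (F n t)) \<noteq> \<infinity>"
    by (intro nn_integral_PInf_AE) auto
  then show ?thesis
    using AE_circle_norm bounded_analytic_nt_limit_AE[OF u]
  proof eventually_elim
    case (elim t)
    show ?case
    proof
      assume "nt_lim u t = 0"
      then have "(\<lambda>n. u (of_real (radial n) * t)) \<longlonglongrightarrow> 0"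
        using has_nt_limit_radial[OF has_nt_limit_nt_lim[OF elim(3,2)] elim(2)] by simp
      then have "(\<lambda>n. cmod (u (of_real (radial n) * t))) \<longlonglongrightarrow> 0" by (rule tendsto_norm_zero)
      then have "filterlim (\<lambda>n. cmod (u (of_real (radial n) * t))) (at_right 0) sequentially"
        using nz[OF rad[OF elim(2)]] by (auto simp: filterlim_at)
      then have "filterlim (\<lambda>n. ln (cmod (u (of_real (radial n) * t)))) at_bot sequentially"
        by (rule filterlim_compose[OF ln_at_0])
      then have "filterlim (\<lambda>n. Re (L (of_real (radial n) * t))) at_bot sequentially"
        by (simp only: lnu[OF rad[OF elim(2)]])
      then have "filterlim (\<lambda>n. ln C + - Re (L (of_real (radial n) * t))) at_top sequentially"
        by (intro filterlim_tendsto_add_at_top[OF tendsto_const]) (simp add: filterlim_uminus_at_bot)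
      then have "filterlim (\<lambda>n. F n t) at_top sequentially" using elim(2) by (simp add: F_def)
      then have "(\<lambda>n. ennreal (F n t)) \<longlonglongrightarrow> top" by (simp only: ennreal_tendsto_top_eq_at_top)
      then have "liminf (\<lambda>n. ennreal (F n t)) = top" by (intro lim_imp_Liminf) auto
      then show False using elim(1) by simp
    qed
  qed
qed

section \<open>Outer functions and the Smirnov class\<close>

lemma outer_function_nonzero: "outer_function u \<Longrightarrow> cmod z < 1 \<Longrightarrow> u z \<noteq> 0"
  by (fastforce simp: outer_function_def)

lemma integrable_Herglotz:
  assumes w: "integrable circle_lebesgue w" and z: "cmod z < 1"
  shows "integrable circle_lebesgue (\<lambda>t. (t + z) / (t - z) * complex_of_real (w t))"
proof (rule Bochner_Integration.integrable_bound)
  show "integrable circle_lebesgue (\<lambda>t. 2 / (1 - cmod z) * w t)" using w by simp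
  have "(\<lambda>t. (t + z) / (t - z)) \<in> borel_measurable circle_lebesgue"
    by (intro measurable_circle_lebesgue) measurable
  moreover have "(\<lambda>t. complex_of_real (w t)) \<in> borel_measurable circle_lebesgue"
    using borel_measurable_integrable[OF w] by measurable
  ultimately show "(\<lambda>t. (t + z) / (t - z) * complex_of_real (w t)) \<in> borel_measurable circle_lebesgue"
    by (rule borel_measurable_times)
  show "AE t in circle_lebesgue. norm ((t + z) / (t - z) * complex_of_real (w t)) \<le> norm (2 / (1 - cmod z) * w t)"
    unfolding AE_circle_lebesgue_iff using AE_circle_norm
  proof eventually_elim
    case (elim t)
    have "cmod (t + z) \<le> 2" using norm_triangle_ineq[of t z] elim z by simp
    moreover have "1 - cmod z \<le> cmod (t - z)" using norm_triangle_ineq2[of t z] elim by simp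
    ultimately have "cmod (t + z) / cmod (t - z) \<le> 2 / (1 - cmod z)" using z by (intro frac_le) auto
    then have "cmod (t + z) / cmod (t - z) * \<bar>w t\<bar> \<le> 2 / (1 - cmod z) * \<bar>w t\<bar>" by (rule mult_right_mono) simp
    then show ?case using z by (simp add: norm_mult norm_divide abs_mult)
  qed
qed

lemma outer_function_mult:
  assumes "outer_function u" "outer_function v"
  shows "outer_function (\<lambda>z. u z * v z)"
proof -
  obtain c w where u: "cmod c = 1" "integrable circle_lebesgue w"
    "\<And>z. z \<in> ball 0 1 \<Longrightarrow> u z = c * exp (LINT t|circle_lebesgue. (t + z) / (t - z) * of_real (w t))"
    using assms(1) unfolding outer_function_def by blast
  obtain d x where v: "cmod d = 1" "integrable circle_lebesgue x"
    "\<And>z. z \<in> ball 0 1 \<Longrightarrow> v z = d * exp (LINT t|circle_lebesgue. (t + z) / (t - z) * of_real (x t))"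
    using assms(2) unfolding outer_function_def by blast
  show ?thesis
    unfolding outer_function_def
  proof (intro exI[of _ "c * d"] exI[of _ "\<lambda>t. w t + x t"] conjI ballI)
    show "cmod (c * d) = 1" using u v by (simp add: norm_mult)
    show "integrable circle_lebesgue (\<lambda>t. w t + x t)" using u v by simp
    fix z :: complex assume z: "z \<in> ball 0 1"
    then have "(LINT t|circle_lebesgue. (t + z) / (t - z) * of_real (w t) + (t + z) / (t - z) * of_real (x t)) =
       (LINT t|circle_lebesgue. (t + z) / (t - z) * of_real (w t)) + (LINT t|circle_lebesgue. (t + z) / (t - z) * of_real (x t))"
      by (intro Bochner_Integration.integral_add integrable_Herglotz u v) auto
    then show "u z * v z = c * d * exp (LINT t|circle_lebesgue. (t + z) / (t - z) * of_real (w t + x t))"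
      unfolding u(3)[OF z] v(3)[OF z] of_real_add distrib_left by (simp only: exp_add mult_ac)
  qed
qed

lemma bounded_analytic_mult:
  assumes "bounded_analytic u" "bounded_analytic v"
  shows "bounded_analytic (\<lambda>z. u z * v z)"
proof -
  obtain B where B: "u holomorphic_on ball 0 1" "B > 0" "\<And>z. cmod z < 1 \<Longrightarrow> cmod (u z) \<le> B"
    using bounded_analyticE[OF assms(1)] by blast
  obtain C where C: "v holomorphic_on ball 0 1" "C > 0" "\<And>z. cmod z < 1 \<Longrightarrow> cmod (v z) \<le> C"
    using bounded_analyticE[OF assms(2)] by blast
  show ?thesis
    by (rule bounded_analyticI[of _ "B * C"])
       (use B C in \<open>auto intro!: holomorphic_intros mult_mono simp: norm_mult less_imp_le\<close>)
qed

lemma smirnov_mult: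
  assumes "smirnov u" "smirnov v"
  shows "smirnov (\<lambda>z. u z * v z)"
proof -
  obtain a b where u: "u holomorphic_on ball 0 1" "bounded_analytic a" "bounded_analytic b" "outer_function b"
     "\<And>z. z \<in> ball 0 1 \<Longrightarrow> u z = a z / b z" using assms(1) unfolding smirnov_def by blast
  obtain c d where v: "v holomorphic_on ball 0 1" "bounded_analytic c" "bounded_analytic d" "outer_function d"
     "\<And>z. z \<in> ball 0 1 \<Longrightarrow> v z = c z / d z" using assms(2) unfolding smirnov_def by blast
  show ?thesis
    unfolding smirnov_def
    by (intro conjI holomorphic_intros exI[of _ "\<lambda>z. a z * c z"] exI[of _ "\<lambda>z. b z * d z"]
        bounded_analytic_mult outer_function_mult u(1-4) v(1-4)) (simp add: u(5) v(5))
qed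

lemma smirnov_const: "smirnov (\<lambda>z. c)"
proof -
  have "bounded_analytic (\<lambda>z. c)" for c by (rule bounded_analyticI[of _ "cmod c"]) auto
  moreover have "outer_function (\<lambda>z. 1)"
    unfolding outer_function_def by (intro exI[of _ 1] exI[of _ "\<lambda>_. 0"]) simp
  ultimately show ?thesis unfolding smirnov_def by (intro conjI exI[of _ "\<lambda>_. c"] exI[of _ "\<lambda>_. 1"]) auto
qed

lemma smirnov_power: "smirnov u \<Longrightarrow> smirnov (\<lambda>z. u z ^ k)"
  by (induction k) (auto intro: smirnov_const smirnov_mult)

lemma smirnov_cong:
  assumes "smirnov u" "\<And>z. cmod z < 1 \<Longrightarrow> u z = v z"
  shows "smirnov v"
proof -
  have "v holomorphic_on ball 0 1"
    by (rule holomorphic_transform[of u]) (use assms in \<open>auto simp: smirnov_def\<close>)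
  then show ?thesis using assms unfolding smirnov_def by auto
qed

lemma outer_smirnov_imp_smirnov: "outer_smirnov u \<Longrightarrow> smirnov u"
  unfolding outer_smirnov_def smirnov_def by blast

lemma outer_smirnov_nonzero: "outer_smirnov u \<Longrightarrow> cmod z < 1 \<Longrightarrow> u z \<noteq> 0"
  unfolding outer_smirnov_def using outer_function_nonzero by fastforce

lemma outer_smirnov_inverse_smirnov:
  assumes "outer_smirnov u"
  shows "smirnov (\<lambda>z. 1 / u z)"
proof -
  obtain a b where u: "u holomorphic_on ball 0 1" "bounded_analytic a" "outer_function a"
     "bounded_analytic b" "outer_function b" "\<And>z. z \<in> ball 0 1 \<Longrightarrow> u z = a z / b z"
    using assms unfolding outer_smirnov_def by blast
  show ?thesis
    unfolding smirnov_def
    by (intro conjI holomorphic_intros exI[of _ b] exI[of _ a] u(1-5)) (use u outer_smirnov_nonzero[OF assms] in auto)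
qed

text \<open>The outer denominator is bounded and zero-free, so its boundary values vanish only on a
  null set, and elsewhere the quotient of the limits is the limit of the quotient.\<close>

lemma smirnov_nt_limit_AE:
  assumes "smirnov u"
  shows "AE t in circle_borel. \<exists>l. has_nt_limit u t l"
proof -
  obtain a b where u: "bounded_analytic a" "bounded_analytic b" "outer_function b"
     "\<And>z. z \<in> ball 0 1 \<Longrightarrow> u z = a z / b z" using assms unfolding smirnov_def by blast
  have "AE t in circle_borel. nt_lim b t \<noteq> 0"
    by (rule bounded_zero_free_nt_lim_nonzero[OF u(2)]) (rule outer_function_nonzero[OF u(3)])
  then show ?thesis
    using AE_circle_norm bounded_analytic_nt_limit_AE[OF u(1)] bounded_analytic_nt_limit_AE[OF u(2)]
  proof eventually_elim
    case (elim t)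
    have "has_nt_limit (\<lambda>z. a z / b z) t (nt_lim a t / nt_lim b t)"
      by (intro has_nt_limit_divide has_nt_limit_nt_lim elim)
    then show ?case using has_nt_limit_cong[of u "\<lambda>z. a z / b z"] u(4) by auto
  qed
qed

section \<open>Blaschke products\<close>

lemma blaschke_factor_norm:
  "cmod (blaschke_factor a z) = cmod (Moebius_function 0 a z)"
  by (cases "a = 0")
     (auto simp: blaschke_factor_def Moebius_function_simple norm_mult norm_divide norm_minus_commute)

lemma blaschke_factor_norm_le:
  assumes "cmod a < 1" "cmod z < 1"
  shows "cmod (blaschke_factor a z) \<le> 1"
  unfolding blaschke_factor_norm using Moebius_function_norm_lt_1[OF assms] by (rule less_imp_le)

lemma blaschke_factor_norm_circle:
  assumes "cmod a < 1" "cmod t = 1"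
  shows "cmod (blaschke_factor a t) = 1"
  unfolding blaschke_factor_norm by (rule Moebius_norm_eq_1[OF assms])

lemma blaschke_factor_holomorphic:
  assumes "cmod a < 1"
  shows "blaschke_factor a holomorphic_on ball 0 1" "continuous_on (cball 0 1) (blaschke_factor a)"
proof -
  have nz: "1 - cnj a * z \<noteq> 0" if "cmod z \<le> 1" for z by (rule one_minus_cnj_mult_nz[OF assms that])
  show "blaschke_factor a holomorphic_on ball 0 1"
    unfolding blaschke_factor_def by (cases "a = 0") (use nz in \<open>auto intro!: holomorphic_intros\<close>)
  show "continuous_on (cball 0 1) (blaschke_factor a)"
    unfolding blaschke_factor_def by (cases "a = 0") (use nz in \<open>auto intro!: continuous_intros\<close>)
qed

lemma blaschke_factor_self [simp]: "blaschke_factor a a = 0"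
  by (simp add: blaschke_factor_def)

text \<open>A bound linear in \<open>1 - cmod a\<close>, with a constant depending only on
  \<open>cmod z\<close>, is what turns the Blaschke condition into locally uniform convergence. The
  point \<open>a = 0\<close> is separate because its factor is normalized differently.\<close>

lemma one_minus_blaschke_factor_le:
  assumes a: "cmod a < 1" and z: "cmod z < 1"
  shows "cmod (1 - blaschke_factor a z) \<le> (1 + cmod z) / (1 - cmod z) * (1 - cmod a)"
proof (cases "a = 0")
  case True
  have "cmod (1 - z) \<le> 1 + cmod z" using norm_triangle_ineq4[of 1 z] by simp
  also have "\<dots> \<le> (1 + cmod z) / (1 - cmod z)" using z by (simp add: divide_simps mult_left_le)
  finally show ?thesis using True by (simp add: blaschke_factor_def)
next
  case False
  have nz: "1 - cnj a * z \<noteq> 0" by (rule one_minus_cnj_mult_nz) (use a z in auto)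
  have aa: "a * cnj a = of_real (cmod a) * of_real (cmod a)" using complex_norm_square[of a] by (simp add: power2_eq_square)
  have "1 - blaschke_factor a z = (a * (1 - cnj a * z) - of_real (cmod a) * (a - z)) / (a * (1 - cnj a * z))"
  proof -
    have e: "blaschke_factor a z = (of_real (cmod a) * (a - z)) / (a * (1 - cnj a * z))"
      using False by (simp add: blaschke_factor_def)
    show ?thesis unfolding e diff_divide_distrib[of "a * (1 - cnj a * z)"] using nz False by simp
  qed
  also have "a * (1 - cnj a * z) - of_real (cmod a) * (a - z) = a - a * cnj a * z - of_real (cmod a) * a + of_real (cmod a) * z"
    by (simp add: algebra_simps)
  also have "\<dots> = of_real (1 - cmod a) * (a + of_real (cmod a) * z)"
    unfolding aa by (simp add: algebra_simps)
  finally have "cmod (1 - blaschke_factor a z) = (1 - cmod a) * cmod (a + of_real (cmod a) * z) / (cmod a * cmod (1 - cnj a * z))"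
    using a by (simp add: norm_mult norm_divide flip: of_real_diff)
  also have "\<dots> \<le> (1 - cmod a) * (cmod a * (1 + cmod z)) / (cmod a * (1 - cmod z))"
  proof (intro frac_le mult_left_mono)
    show "cmod (a + of_real (cmod a) * z) \<le> cmod a * (1 + cmod z)"
      using norm_triangle_ineq[of a "of_real (cmod a) * z"] by (simp add: norm_mult distrib_left)
    have "cmod (cnj a * z) \<le> 1 * cmod z" unfolding norm_mult using a by (intro mult_right_mono) auto
    then show "1 - cmod z \<le> cmod (1 - cnj a * z)" using norm_triangle_ineq2[of 1 "cnj a * z"] by simp
  qed (use a z False in auto)
  also have "\<dots> = (1 + cmod z) / (1 - cmod z) * (1 - cmod a)" using False by simp
  finally show ?thesis .
qed

lemma one_minus_blaschke_factor_sq: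
  assumes "cmod a < 1" "cmod z < 1"
  shows "1 - (cmod (blaschke_factor a z))\<^sup>2 = (1 - (cmod z)\<^sup>2) * (1 - (cmod a)\<^sup>2) / (cmod (1 - cnj a * z))\<^sup>2"
  unfolding blaschke_factor_norm by (rule one_minus_Moebius_norm) (use assms in auto)

lemma mult_less_of_less_divide: "0 < c \<Longrightarrow> x < e / c \<Longrightarrow> c * x < (e :: real)"
  by (simp add: pos_less_divide_eq mult.commute)

lemma one_minus_prod_le_sum:
  fixes y :: "'a \<Rightarrow> real"
  assumes "\<And>i. i \<in> F \<Longrightarrow> 0 \<le> y i \<and> y i \<le> 1"
  shows "1 - (\<Prod>i\<in>F. y i) \<le> (\<Sum>i\<in>F. 1 - y i)"
proof -
  have "norm ((\<Prod>i\<in>F. 1) - (\<Prod>i\<in>F. y i)) \<le> (\<Sum>i\<in>F. norm (1 - y i))"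
    by (rule norm_prod_diff) (use assms in auto)
  also have "(\<Sum>i\<in>F. norm (1 - y i)) = (\<Sum>i\<in>F. 1 - y i)" by (intro sum.cong) (use assms in auto)
  finally show ?thesis by simp
qed

context
  fixes A :: "complex set"
  assumes A: "A \<subseteq> ball 0 1" and summ: "(\<lambda>a. 1 - cmod a) summable_on A"
begin

lemma blaschke_tail_nonneg: "0 \<le> (\<Sum>\<^sub>\<infinity>a\<in>A - F. 1 - cmod a)"
  by (rule infsum_nonneg) (use A in auto)

text \<open>The factors common to both products have modulus at most 1, so only the additional ones
  count.\<close>

lemma blaschke_partial_diff:
  assumes F: "finite F" "F \<subseteq> A" "finite G" "F \<subseteq> G" "G \<subseteq> A" and z: "cmod z < 1"
  shows "cmod ((\<Prod>a\<in>G. blaschke_factor a z) - (\<Prod>a\<in>F. blaschke_factor a z)) \<le>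
    (1 + cmod z) / (1 - cmod z) * (\<Sum>\<^sub>\<infinity>a\<in>A - F. 1 - cmod a)"
proof -
  have le1: "cmod (blaschke_factor a z) \<le> 1" if "a \<in> A" for a
    using blaschke_factor_norm_le[of a z] A that z by auto
  have "(\<Prod>a\<in>G. blaschke_factor a z) = (\<Prod>a\<in>G - F. blaschke_factor a z) * (\<Prod>a\<in>F. blaschke_factor a z)"
    using prod.subset_diff[OF F(4,3)] .
  then have "cmod ((\<Prod>a\<in>G. blaschke_factor a z) - (\<Prod>a\<in>F. blaschke_factor a z)) =
     cmod ((\<Prod>a\<in>G - F. blaschke_factor a z) - 1) * cmod (\<Prod>a\<in>F. blaschke_factor a z)"
    by (simp add: norm_mult[symmetric] algebra_simps)
  also have "\<dots> \<le> cmod ((\<Prod>a\<in>G - F. blaschke_factor a z) - 1) * 1"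
    using le1 F by (intro mult_left_mono) (auto simp: prod_norm[symmetric] intro!: prod_le_1)
  also have "\<dots> \<le> (\<Sum>a\<in>G - F. cmod (blaschke_factor a z - 1))"
    using norm_prod_diff[of "G - F" "\<lambda>a. blaschke_factor a z" "\<lambda>_. 1"] le1 F by auto
  also have "\<dots> \<le> (\<Sum>a\<in>G - F. (1 + cmod z) / (1 - cmod z) * (1 - cmod a))"
    using one_minus_blaschke_factor_le[OF _ z] A F z by (intro sum_mono) (auto simp: norm_minus_commute)
  also have "\<dots> = (1 + cmod z) / (1 - cmod z) * (\<Sum>a\<in>G - F. 1 - cmod a)" by (rule sum_distrib_left[symmetric])
  also have "\<dots> \<le> (1 + cmod z) / (1 - cmod z) * (\<Sum>\<^sub>\<infinity>a\<in>A - F. 1 - cmod a)"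
    using F A z by (intro mult_left_mono finite_sum_le_infsum summable_on_subset_banach[OF summ]) auto
  finally show ?thesis .
qed

lemma blaschke_tail_small:
  assumes "e > 0"
  shows "\<exists>F. finite F \<and> F \<subseteq> A \<and> (\<Sum>\<^sub>\<infinity>a\<in>A - F. 1 - cmod a) < e"
proof -
  have "((\<lambda>F. sum (\<lambda>a. 1 - cmod a) F) \<longlongrightarrow> infsum (\<lambda>a. 1 - cmod a) A) (finite_subsets_at_top A)"
    by (rule infsum_tendsto[OF summ])
  then have "\<forall>\<^sub>F F in finite_subsets_at_top A. infsum (\<lambda>a. 1 - cmod a) A - e < sum (\<lambda>a. 1 - cmod a) F"
    by (rule order_tendstoD) (use assms in simp)
  then obtain F where F: "finite F" "F \<subseteq> A" "infsum (\<lambda>a. 1 - cmod a) A - e < sum (\<lambda>a. 1 - cmod a) F"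
    unfolding eventually_finite_subsets_at_top by blast
  have "infsum (\<lambda>a. 1 - cmod a) A = sum (\<lambda>a. 1 - cmod a) F + (\<Sum>\<^sub>\<infinity>a\<in>A - F. 1 - cmod a)"
    using infsum_Un_disjoint[of "\<lambda>a. 1 - cmod a" F "A - F"] F summable_on_subset_banach[OF summ, of "A - F"]
    by (simp add: Un_absorb1)
  then show ?thesis using F by (intro exI[of _ F]) auto
qed

text \<open>\<open>blaschke_product\<close> is a \<open>Lim\<close>, whose value means something
  only once convergence along the finite subsets is known. Small tails make the partial products a
  Cauchy filter.\<close>

lemma blaschke_product_tendsto:
  assumes z: "cmod z < 1"
  shows "((\<lambda>F. \<Prod>a\<in>F. blaschke_factor a z) \<longlongrightarrow> blaschke_product A z) (finite_subsets_at_top A)"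
proof -
  let ?C = "(1 + cmod z) / (1 - cmod z)"
  let ?p = "\<lambda>F. \<Prod>a\<in>F. blaschke_factor a z"
  have C: "?C > 0" using z by (intro divide_pos_pos) (auto simp: add_pos_nonneg)
  have "cauchy_filter (filtermap ?p (finite_subsets_at_top A))"
    unfolding cauchy_filter_metric_filtermap
  proof (intro allI impI)
    fix e :: real assume e: "e > 0"
    have "e / (2 * ?C) > 0" by (intro divide_pos_pos mult_pos_pos e C) simp
    then obtain F where F: "finite F" "F \<subseteq> A" "(\<Sum>\<^sub>\<infinity>a\<in>A - F. 1 - cmod a) < e / (2 * ?C)"
      using blaschke_tail_small by blast
    then have lt: "?C * (\<Sum>\<^sub>\<infinity>a\<in>A - F. 1 - cmod a) < e / 2"
      using mult_less_of_less_divide[OF _ F(3)] C by linarith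
    show "\<exists>P. eventually P (finite_subsets_at_top A) \<and> (\<forall>x y. P x \<and> P y \<longrightarrow> dist (?p x) (?p y) < e)"
    proof (intro exI[of _ "\<lambda>G. finite G \<and> F \<subseteq> G \<and> G \<subseteq> A"] conjI allI impI)
      show "\<forall>\<^sub>F G in finite_subsets_at_top A. finite G \<and> F \<subseteq> G \<and> G \<subseteq> A"
        unfolding eventually_finite_subsets_at_top using F by (intro exI[of _ F]) auto
      fix x y assume xy: "(finite x \<and> F \<subseteq> x \<and> x \<subseteq> A) \<and> (finite y \<and> F \<subseteq> y \<and> y \<subseteq> A)"
      have "dist (?p x) (?p F) < e / 2" if "finite x \<and> F \<subseteq> x \<and> x \<subseteq> A" for x
        unfolding dist_norm by (rule le_less_trans[OF blaschke_partial_diff lt]) (use that F z in blast)+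
      then have "dist (?p x) (?p F) < e / 2" "dist (?p y) (?p F) < e / 2" using xy by blast+
      then show "dist (?p x) (?p y) < e" by (rule dist_triangle_half_l)
    qed
  qed
  moreover have "complete (UNIV :: complex set)" by (rule complete_UNIV)
  ultimately obtain l where "(?p \<longlongrightarrow> l) (finite_subsets_at_top A)"
    using complete_uniform[where S = "UNIV :: complex set"] by (force simp add: filterlim_def)
  then show ?thesis unfolding blaschke_product_def by (subst tendsto_Lim) auto
qed

lemma blaschke_product_diff:
  assumes F: "finite F" "F \<subseteq> A" and z: "cmod z < 1"
  shows "cmod (blaschke_product A z - (\<Prod>a\<in>F. blaschke_factor a z)) \<le>
    (1 + cmod z) / (1 - cmod z) * (\<Sum>\<^sub>\<infinity>a\<in>A - F. 1 - cmod a)"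
proof (rule tendsto_upperbound)
  show "((\<lambda>G. cmod ((\<Prod>a\<in>G. blaschke_factor a z) - (\<Prod>a\<in>F. blaschke_factor a z))) \<longlongrightarrow>
     cmod (blaschke_product A z - (\<Prod>a\<in>F. blaschke_factor a z))) (finite_subsets_at_top A)"
    by (intro tendsto_intros blaschke_product_tendsto z)
  show "\<forall>\<^sub>F G in finite_subsets_at_top A. cmod ((\<Prod>a\<in>G. blaschke_factor a z) - (\<Prod>a\<in>F. blaschke_factor a z)) \<le>
    (1 + cmod z) / (1 - cmod z) * (\<Sum>\<^sub>\<infinity>a\<in>A - F. 1 - cmod a)"
    unfolding eventually_finite_subsets_at_top
  proof (intro exI[of _ F] conjI allI impI F)
    fix G assume "finite G \<and> F \<subseteq> G \<and> G \<subseteq> A"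
    then show "cmod ((\<Prod>a\<in>G. blaschke_factor a z) - (\<Prod>a\<in>F. blaschke_factor a z)) \<le>
      (1 + cmod z) / (1 - cmod z) * (\<Sum>\<^sub>\<infinity>a\<in>A - F. 1 - cmod a)"
      by (intro blaschke_partial_diff F z) blast+
  qed
qed auto

text \<open>Further factors can only decrease the modulus. This locates zeros of the product, and
  later bounds the finite Poisson sums by the boundary derivative.\<close>

lemma blaschke_product_norm_le_partial:
  assumes F: "finite F" "F \<subseteq> A" and z: "cmod z < 1"
  shows "cmod (blaschke_product A z) \<le> cmod (\<Prod>a\<in>F. blaschke_factor a z)"
proof (rule tendsto_upperbound)
  show "((\<lambda>G. cmod (\<Prod>a\<in>G. blaschke_factor a z)) \<longlongrightarrow> cmod (blaschke_product A z)) (finite_subsets_at_top A)"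
    by (intro tendsto_intros blaschke_product_tendsto z)
  have "cmod (\<Prod>a\<in>G. blaschke_factor a z) \<le> cmod (\<Prod>a\<in>F. blaschke_factor a z)"
    if G: "finite G" "F \<subseteq> G" "G \<subseteq> A" for G
  proof -
    have "cmod (\<Prod>a\<in>G. blaschke_factor a z) = cmod (\<Prod>a\<in>G - F. blaschke_factor a z) * cmod (\<Prod>a\<in>F. blaschke_factor a z)"
      by (simp only: prod.subset_diff[OF G(2,1)] norm_mult)
    also have "\<dots> \<le> 1 * cmod (\<Prod>a\<in>F. blaschke_factor a z)"
      using G A z by (intro mult_right_mono) (auto simp: prod_norm[symmetric] intro!: prod_le_1 prod_nonneg blaschke_factor_norm_le)
    finally show ?thesis by simp
  qed
  then show "\<forall>\<^sub>F G in finite_subsets_at_top A. cmod (\<Prod>a\<in>G. blaschke_factor a z) \<le> cmod (\<Prod>a\<in>F. blaschke_factor a z)"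
    unfolding eventually_finite_subsets_at_top using F by (intro exI[of _ F]) auto
qed auto

lemma blaschke_product_norm_le: "cmod z < 1 \<Longrightarrow> cmod (blaschke_product A z) \<le> 1"
  using blaschke_product_norm_le_partial[of "{}" z] by simp

lemma blaschke_product_zero: "a \<in> A \<Longrightarrow> blaschke_product A a = 0"
  using blaschke_product_norm_le_partial[of "{a}" a] A by auto

lemma blaschke_product_holomorphic: "blaschke_product A holomorphic_on ball 0 1"
proof -
  have "blaschke_product A holomorphic_on ball 0 r" if r: "0 < r" "r < 1" for r
  proof (rule holomorphic_uniform_limit[where F = "finite_subsets_at_top A" and z = 0 and r = r
      and f = "\<lambda>F z. \<Prod>a\<in>F. blaschke_factor a z" and g = "blaschke_product A"])
    have "(\<lambda>z. \<Prod>a\<in>F. blaschke_factor a z) holomorphic_on ball 0 1" if "finite F" "F \<subseteq> A" for F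
      using that A by (intro holomorphic_intros blaschke_factor_holomorphic) auto
    note hol = this
    show "\<forall>\<^sub>F F in finite_subsets_at_top A. continuous_on (cball 0 r) (\<lambda>z. \<Prod>a\<in>F. blaschke_factor a z) \<and>
       (\<lambda>z. \<Prod>a\<in>F. blaschke_factor a z) holomorphic_on ball 0 r"
    proof (rule eventually_finite_subsets_at_top_weakI)
      fix F assume "finite F" "F \<subseteq> A"
      from hol[OF this] have *: "(\<lambda>z. \<Prod>a\<in>F. blaschke_factor a z) holomorphic_on cball 0 r"
        by (rule holomorphic_on_subset) (use r in auto)
      then show "continuous_on (cball 0 r) (\<lambda>z. \<Prod>a\<in>F. blaschke_factor a z) \<and>
         (\<lambda>z. \<Prod>a\<in>F. blaschke_factor a z) holomorphic_on ball 0 r"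
        using holomorphic_on_imp_continuous_on[OF *] holomorphic_on_subset[OF *, of "ball 0 r"] by auto
    qed
    show "uniform_limit (cball 0 r) (\<lambda>F z. \<Prod>a\<in>F. blaschke_factor a z) (blaschke_product A) (finite_subsets_at_top A)"
      unfolding uniform_limit_iff
    proof (intro allI impI)
      fix e :: real assume e: "e > 0"
      let ?C = "(1 + r) / (1 - r)"
      have C: "?C > 0" using r by auto
      have "e / ?C > 0" by (intro divide_pos_pos e C)
      then obtain F where F: "finite F" "F \<subseteq> A" "(\<Sum>\<^sub>\<infinity>a\<in>A - F. 1 - cmod a) < e / ?C"
        using blaschke_tail_small by blast
      have "dist (\<Prod>a\<in>G. blaschke_factor a z) (blaschke_product A z) < e"
        if G: "finite G" "F \<subseteq> G" "G \<subseteq> A" and z: "z \<in> cball 0 r" for G z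
      proof -
        have "dist (\<Prod>a\<in>G. blaschke_factor a z) (blaschke_product A z) \<le>
            (1 + cmod z) / (1 - cmod z) * (\<Sum>\<^sub>\<infinity>a\<in>A - G. 1 - cmod a)"
          unfolding dist_norm norm_minus_commute[of "\<Prod>a\<in>G. blaschke_factor a z"]
          using G z r by (intro blaschke_product_diff) auto
        also have "\<dots> \<le> ?C * (\<Sum>\<^sub>\<infinity>a\<in>A - F. 1 - cmod a)"
          using z r A G by (intro mult_mono frac_le blaschke_tail_nonneg infsum_mono2 summable_on_subset_banach[OF summ]) auto
        also have "\<dots> < e" by (rule mult_less_of_less_divide[OF C F(3)])
        finally show ?thesis .
      qed
      then show "\<forall>\<^sub>F G in finite_subsets_at_top A. \<forall>z\<in>cball 0 r. dist (\<Prod>a\<in>G. blaschke_factor a z) (blaschke_product A z) < e"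
        unfolding eventually_finite_subsets_at_top using F by (intro exI[of _ F]) auto
    qed
  qed auto
  then have "blaschke_product A holomorphic_on (\<Union>r\<in>{0<..<1}. ball 0 r)"
    by (intro holomorphic_on_UN_open) auto
  moreover have "(\<Union>r\<in>{0<..<1}. ball (0::complex) r) = ball 0 1"
  proof (intro equalityI subsetI)
    fix z :: complex assume "z \<in> ball 0 1"
    then obtain r where "cmod z < r" "r < 1" using dense by auto
    then show "z \<in> (\<Union>r\<in>{0<..<1}. ball 0 r)" using le_less_trans[OF norm_ge_zero] by (intro UN_I[of r]) auto
  qed auto
  ultimately show ?thesis by simp
qed

lemma blaschke_product_bounded_analytic: "bounded_analytic (blaschke_product A)"
  by (rule bounded_analyticI[OF blaschke_product_holomorphic blaschke_product_norm_le])

end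

lemma blaschke_product_insert:
  assumes A: "insert a A \<subseteq> ball 0 1" "a \<notin> A" and summ: "(\<lambda>a. 1 - cmod a) summable_on insert a A" and z: "cmod z < 1"
  shows "blaschke_product (insert a A) z = blaschke_factor a z * blaschke_product A z"
proof -
  have sA: "(\<lambda>a. 1 - cmod a) summable_on A" by (rule summable_on_subset_banach[OF summ]) auto
  have 1: "((\<lambda>F. \<Prod>b\<in>F. blaschke_factor b z) \<longlongrightarrow> blaschke_product (insert a A) z) (finite_subsets_at_top (insert a A))"
    by (rule blaschke_product_tendsto[OF A(1) summ z])
  have "filterlim (insert a) (finite_subsets_at_top (insert a A)) (finite_subsets_at_top A)"
    unfolding filterlim_finite_subsets_at_top
  proof (intro allI impI)
    fix X assume X: "finite X \<and> X \<subseteq> insert a A"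
    show "\<forall>\<^sub>F Y in finite_subsets_at_top A. finite (insert a Y) \<and> X \<subseteq> insert a Y \<and> insert a Y \<subseteq> insert a A"
      unfolding eventually_finite_subsets_at_top using X by (intro exI[of _ "X - {a}"]) auto
  qed
  from filterlim_compose[OF 1 this]
  have 2: "((\<lambda>F. \<Prod>b\<in>insert a F. blaschke_factor b z) \<longlongrightarrow> blaschke_product (insert a A) z) (finite_subsets_at_top A)" .
  have "\<forall>\<^sub>F F in finite_subsets_at_top A. (\<Prod>b\<in>insert a F. blaschke_factor b z) = blaschke_factor a z * (\<Prod>b\<in>F. blaschke_factor b z)"
    using A by (intro eventually_finite_subsets_at_top_weakI prod.insert) auto
  with 2 have "((\<lambda>F. blaschke_factor a z * (\<Prod>b\<in>F. blaschke_factor b z)) \<longlongrightarrow> blaschke_product (insert a A) z) (finite_subsets_at_top A)"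
    by (rule Lim_transform_eventually)
  moreover have "((\<lambda>F. blaschke_factor a z * (\<Prod>b\<in>F. blaschke_factor b z)) \<longlongrightarrow> blaschke_factor a z * blaschke_product A z) (finite_subsets_at_top A)"
    by (intro tendsto_intros blaschke_product_tendsto sA z) (use A in auto)
  ultimately show ?thesis by (rule tendsto_unique[rotated]) auto
qed

lemma blaschke_product_split:
  assumes "finite F" "F \<subseteq> A" "A \<subseteq> ball 0 1" "(\<lambda>a. 1 - cmod a) summable_on A" "cmod z < 1"
  shows "blaschke_product A z = (\<Prod>a\<in>F. blaschke_factor a z) * blaschke_product (A - F) z"
  using assms
proof (induction F rule: finite_induct)
  case (insert a F)
  have "insert a (A - insert a F) = A - F" using insert by auto
  then have "blaschke_product (A - F) z = blaschke_factor a z * blaschke_product (A - insert a F) z"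
    using blaschke_product_insert[of a "A - insert a F" z] insert summable_on_subset_banach[OF insert(6), of "A - F"]
    by auto
  then show ?case using insert by (simp add: mult_ac)
qed auto

text \<open>The mean value inequality on the circles of radius \<open>radial n\<close> passes to the
  boundary by dominated convergence.\<close>

lemma bounded_analytic_mean_nt_lim:
  assumes u: "u holomorphic_on ball 0 1" and le: "\<forall>z. cmod z < 1 \<longrightarrow> cmod (u z) \<le> 1"
  shows "cmod (u 0) \<le> (LINT t|circle_lebesgue. cmod (nt_lim u t))" "integrable circle_lebesgue (\<lambda>t. cmod (nt_lim u t))"
    "AE t in circle_borel. cmod (nt_lim u t) \<le> 1"
proof -
  have b: "bounded_analytic u" by (rule bounded_analyticI[OF u(1), of 1]) (use le in blast)
  note ae = bounded_analytic_nt_limit_AE[OF b]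
  have m: "(\<lambda>t. cmod (nt_lim u t)) \<in> borel_measurable circle_lebesgue"
    using measurable_nt_lim[OF u(1) ae] by measurable
  have rad: "cmod (of_real (radial n) * t) < 1" if "cmod t = 1" for n t
    using that radial(1)[of n] radial(2)[of n] by (simp add: norm_mult)
  have cf: "continuous_on (sphere 0 1) (\<lambda>t. u (of_real (radial n) * t))" for n
    by (rule continuous_on_subset[OF continuous_on_dilation(1)[OF u(1) radial(3,2)]]) auto
  show le1: "AE t in circle_borel. cmod (nt_lim u t) \<le> 1"
    using ae AE_circle_norm
  proof eventually_elim
    case (elim t)
    have "(\<lambda>n. cmod (u (of_real (radial n) * t))) \<longlonglongrightarrow> cmod (nt_lim u t)"
      by (intro tendsto_intros has_nt_limit_radial has_nt_limit_nt_lim elim)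
    then show ?case by (rule LIMSEQ_le_const2) (intro exI allI impI le[rule_format] rad elim)
  qed
  show "integrable circle_lebesgue (\<lambda>t. cmod (nt_lim u t))"
  proof (rule Bochner_Integration.integrable_bound)
    show "integrable circle_lebesgue (\<lambda>_. 1 :: real)" by (rule integral_circle_indicator, rule continuous_on_const)
  qed (use m le1 in \<open>auto simp: AE_circle_lebesgue_iff\<close>)
  have "(\<lambda>n. LINT t|circle_lebesgue. cmod (u (of_real (radial n) * t))) \<longlonglongrightarrow> (LINT t|circle_lebesgue. cmod (nt_lim u t))"
  proof (rule integral_dominated_convergence[where w = "\<lambda>_. 1"])
    show "(\<lambda>t. cmod (u (of_real (radial n) * t))) \<in> borel_measurable circle_lebesgue" for n
      by (rule borel_measurable_integrable, rule integral_circle_indicator) (intro continuous_intros cf)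
    show "integrable circle_lebesgue (\<lambda>_. 1 :: real)" by (rule integral_circle_indicator, rule continuous_on_const)
    show "AE t in circle_lebesgue. (\<lambda>n. cmod (u (of_real (radial n) * t))) \<longlonglongrightarrow> cmod (nt_lim u t)"
      unfolding AE_circle_lebesgue_iff using ae AE_circle_norm
    proof eventually_elim
      case (elim t)
      show ?case by (intro tendsto_intros has_nt_limit_radial has_nt_limit_nt_lim elim)
    qed
    show "AE t in circle_lebesgue. norm (cmod (u (of_real (radial n) * t))) \<le> 1" for n
      unfolding AE_circle_lebesgue_iff using AE_circle_norm
      by eventually_elim (simp add: le rad)
  qed (rule m)
  moreover have "cmod (u 0) \<le> (LINT t|circle_lebesgue. cmod (u (of_real (radial n) * t)))" for n
  proof -
    have "u 0 = (LINT t|circle_lebesgue. u (of_real (radial n) * t))"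
      by (subst circle_mean[OF continuous_on_dilation[OF u(1) radial(3,2)]]) simp
    then show ?thesis using integral_norm_bound by metis
  qed
  ultimately show "cmod (u 0) \<le> (LINT t|circle_lebesgue. cmod (nt_lim u t))"
    by (intro LIMSEQ_le_const) auto
qed

text \<open>A finite Blaschke product is unimodular on the circle, so the full product and each of
  its tails have boundary values of equal modulus. A small tail has a value close to 1 at the
  origin, which pushes the mean of that modulus up to 1; a function bounded by 1 with mean 1 equals
  1 almost everywhere.\<close>

theorem blaschke_product_unimodular:
  assumes A: "A \<subseteq> ball 0 1" and summ: "(\<lambda>a. 1 - cmod a) summable_on A"
  shows "AE t in circle_borel. cmod (nt_lim (blaschke_product A) t) = 1"
proof -
  let ?g = "blaschke_product A"
  have g: "?g holomorphic_on ball 0 1" "\<forall>z. cmod z < 1 \<longrightarrow> cmod (?g z) \<le> 1"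
    using blaschke_product_holomorphic[OF A summ] blaschke_product_norm_le[OF A summ] by blast+
  note gm = bounded_analytic_mean_nt_lim[OF g]
  have lb: "1 - e < (LINT t|circle_lebesgue. cmod (nt_lim ?g t))" if e: "e > 0" for e
  proof -
    obtain F where F: "finite F" "F \<subseteq> A" "(\<Sum>\<^sub>\<infinity>a\<in>A - F. 1 - cmod a) < e"
      using blaschke_tail_small[OF A summ e] by blast
    have A': "A - F \<subseteq> ball 0 1" and s': "(\<lambda>a. 1 - cmod a) summable_on (A - F)"
      using A by (auto intro: summable_on_subset_banach[OF summ])
    let ?h = "blaschke_product (A - F)"
    have h: "?h holomorphic_on ball 0 1" "\<forall>z. cmod z < 1 \<longrightarrow> cmod (?h z) \<le> 1"
      using blaschke_product_holomorphic[OF A' s'] blaschke_product_norm_le[OF A' s'] by blast+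
    have "cmod (?h 0 - 1) \<le> (\<Sum>\<^sub>\<infinity>a\<in>A - F. 1 - cmod a)"
      using blaschke_product_diff[OF A' s', of "{}" 0] by simp
    then have "1 - e < cmod (?h 0)" using F(3) norm_triangle_ineq2[of 1 "?h 0"] by (simp add: norm_minus_commute)
    also have "\<dots> \<le> (LINT t|circle_lebesgue. cmod (nt_lim ?h t))" by (rule bounded_analytic_mean_nt_lim[OF h])
    also have "\<dots> = (LINT t|circle_lebesgue. cmod (nt_lim ?g t))"
    proof (rule integral_circle_cong_AE)
      show "AE t in circle_borel. cmod (nt_lim ?h t) = cmod (nt_lim ?g t)"
        using AE_circle_norm bounded_analytic_nt_limit_AE[OF blaschke_product_bounded_analytic[OF A' s']]
      proof eventually_elim
        case (elim t)
        have "has_nt_limit (\<lambda>z. \<Prod>a\<in>F. blaschke_factor a z) t (\<Prod>a\<in>F. blaschke_factor a t)"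
          unfolding has_nt_limit_stolz
        proof (intro allI impI)
          fix M :: real
          have "continuous_on (cball 0 1) (\<lambda>z. \<Prod>a\<in>F. blaschke_factor a z)"
            using F A by (intro continuous_intros blaschke_factor_holomorphic) auto
          then have "((\<lambda>z. \<Prod>a\<in>F. blaschke_factor a z) \<longlongrightarrow> (\<Prod>a\<in>F. blaschke_factor a t)) (at t within cball 0 1)"
            using elim(1) by (simp add: continuous_on_def)
          then show "((\<lambda>z. \<Prod>a\<in>F. blaschke_factor a z) \<longlongrightarrow> (\<Prod>a\<in>F. blaschke_factor a t)) (at t within stolz M t)"
            by (rule tendsto_within_subset) (auto simp: stolz_def)
        qed
        from has_nt_limit_mult[OF this has_nt_limit_nt_lim[OF elim(2,1)]]
        have "has_nt_limit ?g t ((\<Prod>a\<in>F. blaschke_factor a t) * nt_lim ?h t)"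
          by (subst has_nt_limit_cong[OF blaschke_product_split[OF F(1,2) A summ]])
        then have "nt_lim ?g t = (\<Prod>a\<in>F. blaschke_factor a t) * nt_lim ?h t" by (rule nt_lim_eq[OF _ elim(1)])
        moreover have "cmod (\<Prod>a\<in>F. blaschke_factor a t) = 1"
          unfolding prod_norm[symmetric] using F A elim(1) by (intro prod.neutral ballI blaschke_factor_norm_circle) auto
        ultimately show ?case by (simp add: norm_mult)
      qed
    qed
    finally show ?thesis .
  qed
  have ge: "1 \<le> (LINT t|circle_lebesgue. cmod (nt_lim ?g t))"
  proof (rule field_le_epsilon)
    fix e :: real assume "e > 0"
    from lb[OF this] show "1 \<le> (LINT t|circle_lebesgue. cmod (nt_lim ?g t)) + e" by linarith
  qed
  have one: "integrable circle_lebesgue (\<lambda>_. 1 :: real)" by (rule integral_circle_indicator, rule continuous_on_const)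
  have i: "integrable circle_lebesgue (\<lambda>t. 1 - cmod (nt_lim ?g t))" using gm(2) one by simp
  have nn: "AE t in circle_lebesgue. 0 \<le> 1 - cmod (nt_lim ?g t)"
    unfolding AE_circle_lebesgue_iff using gm(3) by eventually_elim simp
  have "(LINT t|circle_lebesgue. 1 - cmod (nt_lim ?g t)) = (LINT t|circle_lebesgue. 1) - (LINT t|circle_lebesgue. cmod (nt_lim ?g t))"
    by (rule Bochner_Integration.integral_diff[OF one gm(2)])
  then have "(LINT t|circle_lebesgue. 1 - cmod (nt_lim ?g t)) \<le> 0" using ge by simp
  then have "(LINT t|circle_lebesgue. 1 - cmod (nt_lim ?g t)) = 0" using integral_nonneg_AE[OF nn] by simp
  then have "AE t in circle_lebesgue. 1 - cmod (nt_lim ?g t) = 0"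
    using integral_nonneg_eq_0_iff_AE[OF i nn] by simp
  then show ?thesis unfolding AE_circle_lebesgue_iff by eventually_elim simp
qed

subsection \<open>Angular derivatives\<close>

context
  fixes g :: "complex \<Rightarrow> complex" and t l c :: complex
  assumes g: "g holomorphic_on ball 0 1" and t: "cmod t = 1"
    and l: "has_nt_limit g t l" and c: "has_nt_limit (deriv g) t c"
begin

lemma ray_in_stolz:
  assumes d: "Re d > 0" and \<epsilon>: "0 < \<epsilon>" "\<epsilon> < Re d / (cmod d)\<^sup>2"
  shows "t - of_real \<epsilon> * t * d \<in> stolz (2 * cmod d / Re d + 1) t"
proof -
  let ?z = "t - of_real \<epsilon> * t * d"
  have d0: "cmod d > 0" using d by auto
  have "?z = t * (1 - of_real \<epsilon> * d)" by (simp add: algebra_simps)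
  then have "(cmod ?z)\<^sup>2 = (cmod (1 - of_real \<epsilon> * d))\<^sup>2" using t by (simp add: norm_mult)
  also have "\<dots> = 1 - 2 * \<epsilon> * Re d + \<epsilon> * (\<epsilon> * (cmod d)\<^sup>2)"
    unfolding cmod_power2 by (simp add: power2_eq_square algebra_simps)
  also have "\<epsilon> * (cmod d)\<^sup>2 \<le> Re d" using \<epsilon> d0 by (simp add: pos_less_divide_eq)
  then have "\<epsilon> * (\<epsilon> * (cmod d)\<^sup>2) \<le> \<epsilon> * Re d" using \<epsilon> by (intro mult_left_mono) auto
  then have "1 - 2 * \<epsilon> * Re d + \<epsilon> * (\<epsilon> * (cmod d)\<^sup>2) \<le> 1 - \<epsilon> * Re d" by simp
  finally have sq: "(cmod ?z)\<^sup>2 \<le> 1 - \<epsilon> * Re d" .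
  have pos: "0 < \<epsilon> * Re d" using \<epsilon> d by simp
  have "(cmod ?z)\<^sup>2 < 1\<^sup>2" using sq pos unfolding one_power2 by linarith
  then have z1: "cmod ?z < 1" by (rule power_less_imp_less_base) simp
  have "\<epsilon> * Re d \<le> (1 - cmod ?z) * (1 + cmod ?z)" using sq by (simp add: algebra_simps power2_eq_square)
  also have "\<dots> \<le> (1 - cmod ?z) * 2" using z1 by (intro mult_left_mono) auto
  finally have m: "\<epsilon> * Re d / 2 \<le> 1 - cmod ?z" by simp
  have "dist ?z t = \<epsilon> * cmod d" using \<epsilon> t by (simp add: dist_norm norm_mult)
  also have "\<epsilon> * cmod d < (2 * cmod d / Re d + 1) * (\<epsilon> * Re d / 2)"
    using d pos by (simp add: distrib_right)
  also have "\<dots> \<le> (2 * cmod d / Re d + 1) * (1 - cmod ?z)" using d by (intro mult_left_mono m) auto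
  finally show ?thesis using z1 by (simp add: stolz_def)
qed

lemma ray_tendsto: "((\<lambda>\<epsilon>::real. t - of_real \<epsilon> * t * d) \<longlongrightarrow> t) (at_right 0)"
proof -
  have "((\<lambda>\<epsilon>::real. t - of_real \<epsilon> * t * d) \<longlongrightarrow> t - of_real 0 * t * d) (at_right 0)" by (intro tendsto_intros)
  then show ?thesis by simp
qed

lemma eventually_ray:
  assumes d: "Re d > 0"
  shows "\<forall>\<^sub>F \<epsilon> in at_right 0. 0 < \<epsilon> \<and> \<epsilon> < Re d / (cmod d)\<^sup>2"
proof -
  have "Re d / (cmod d)\<^sup>2 > 0" using d by (intro divide_pos_pos) auto
  then show ?thesis by (rule eventually_mono[OF eventually_at_right_real]) auto
qed

lemma filterlim_ray:
  assumes d: "Re d > 0"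
  shows "filterlim (\<lambda>\<epsilon>::real. t - of_real \<epsilon> * t * d) (at t within stolz (2 * cmod d / Re d + 1) t) (at_right 0)"
  unfolding filterlim_at
proof (intro conjI ray_tendsto)
  show "\<forall>\<^sub>F \<epsilon> in at_right 0. t - of_real \<epsilon> * t * d \<in> stolz (2 * cmod d / Re d + 1) t \<and> t - of_real \<epsilon> * t * d \<noteq> t"
    using eventually_ray[OF d]
    by eventually_elim (use d t in \<open>auto intro: ray_in_stolz[OF d]\<close>)
qed

lemma ray_aperture: "Re d > 0 \<Longrightarrow> 2 * cmod d / Re d + 1 > 1"
  by (auto intro!: divide_pos_pos)

lemma ray_limit:
  assumes d: "Re d > 0"
  shows "((\<lambda>\<epsilon>::real. g (t - of_real \<epsilon> * t * d)) \<longlongrightarrow> l) (at_right 0)"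
  using l ray_aperture[OF d] unfolding has_nt_limit_stolz
  by (intro filterlim_compose[OF _ filterlim_ray[OF d]]) auto

text \<open>The mean value inequality is applied to \<open>g w - c * w\<close> on a segment of the
  ray between two interior points, where the derivative is within \<open>\<eta>\<close> of
  \<open>c\<close>; then the nearer point is sent to \<open>t\<close>, where only the limit
  \<open>l\<close> of \<open>g\<close> is known.\<close>

lemma angular_derivative:
  assumes d: "Re d > 0"
  shows "((\<lambda>\<epsilon>::real. (g (t - of_real \<epsilon> * t * d) - l) / of_real \<epsilon>) \<longlongrightarrow> - (c * t * d)) (at_right 0)"
proof (rule tendstoI)
  fix e :: real assume e: "e > 0"
  have d0: "cmod d > 0" using d by auto
  let ?M = "2 * cmod d / Re d + 1"
  let ?z = "\<lambda>\<epsilon>::real. t - of_real \<epsilon> * t * d"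
  define \<eta> where "\<eta> = e / (2 * cmod d)"
  have \<eta>: "\<eta> > 0" using e d0 by (simp add: \<eta>_def)
  have "(deriv g \<longlongrightarrow> c) (at t within stolz ?M t)"
    using c ray_aperture[OF d] unfolding has_nt_limit_stolz by blast
  then have "\<forall>\<^sub>F w in at t within stolz ?M t. dist (deriv g w) c < \<eta>" using \<eta> by (rule tendstoD)
  then obtain \<delta> where \<delta>: "\<delta> > 0" "\<And>w. w \<in> stolz ?M t \<Longrightarrow> w \<noteq> t \<Longrightarrow> dist w t < \<delta> \<Longrightarrow> dist (deriv g w) c < \<eta>"
    unfolding eventually_at by blast
  have "\<delta> / cmod d > 0" using \<delta> d0 by simp
  then have "\<forall>\<^sub>F \<epsilon> in at_right 0. 0 < \<epsilon> \<and> \<epsilon> < \<delta> / cmod d"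
    by (rule eventually_mono[OF eventually_at_right_real]) auto
  then show "\<forall>\<^sub>F \<epsilon>::real in at_right 0. dist ((g (?z \<epsilon>) - l) / of_real \<epsilon>) (- (c * t * d)) < e"
    using eventually_ray[OF d]
  proof eventually_elim
    case (elim \<epsilon>)
    have main: "cmod ((g (?z \<epsilon>) - c * ?z \<epsilon>) - (l - c * t)) \<le> \<eta> * (\<epsilon> * cmod d)"
    proof (rule tendsto_upperbound)
      show "((\<lambda>x::real. cmod ((g (?z \<epsilon>) - c * ?z \<epsilon>) - (g (?z x) - c * ?z x))) \<longlongrightarrow> cmod ((g (?z \<epsilon>) - c * ?z \<epsilon>) - (l - c * t))) (at_right 0)"
        by (intro tendsto_intros ray_limit d ray_tendsto)
      have "\<forall>\<^sub>F x in at_right 0. 0 < x \<and> x < \<epsilon>"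
        by (rule eventually_mono[OF eventually_at_right_real[of 0 \<epsilon>]]) (use elim in auto)
      then show "\<forall>\<^sub>F x in at_right 0. cmod ((g (?z \<epsilon>) - c * ?z \<epsilon>) - (g (?z x) - c * ?z x)) \<le> \<eta> * (\<epsilon> * cmod d)"
      proof eventually_elim
        case x: (elim x)
        have seg: "w \<in> stolz ?M t \<and> w \<noteq> t \<and> dist w t < \<delta>" if w_in: "w \<in> closed_segment (?z x) (?z \<epsilon>)" for w
        proof -
          obtain u where u: "0 \<le> u" "u \<le> 1" "w = (1 - u) *\<^sub>R ?z x + u *\<^sub>R ?z \<epsilon>" using w_in unfolding in_segment by blast
          define s where "s = (1 - u) * x + u * \<epsilon>"
          have w: "w = ?z s" unfolding u s_def by (simp add: scaleR_conv_of_real algebra_simps)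
          have "(1 - u) * x + u * x \<le> s" unfolding s_def using u x by (intro add_left_mono mult_left_mono) auto
          then have s1: "0 < s" using x by (simp add: algebra_simps)
          have "s \<le> (1 - u) * \<epsilon> + u * \<epsilon>" unfolding s_def using u x by (intro add_right_mono mult_left_mono) auto
          then have s2: "s \<le> \<epsilon>" by (simp add: algebra_simps)
          have "w \<in> stolz ?M t" unfolding w by (rule ray_in_stolz[OF d s1]) (use s2 elim in simp)
          moreover have "dist w t = s * cmod d" unfolding w dist_norm using s1 t by (simp add: norm_mult)
          moreover have "s * cmod d < \<delta>" using s2 elim d0 by (simp add: pos_less_divide_eq le_less_trans[OF mult_right_mono])
          ultimately show ?thesis using s1 d0 by auto
        qed
        have "cmod ((g (?z \<epsilon>) - c * ?z \<epsilon>) - (g (?z x) - c * ?z x)) \<le> \<eta> * cmod (?z \<epsilon> - ?z x)"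
        proof (rule field_differentiable_bound[where S = "closed_segment (?z x) (?z \<epsilon>)" and f' = "\<lambda>w. deriv g w - c"])
          fix w assume w: "w \<in> closed_segment (?z x) (?z \<epsilon>)"
          have "w \<in> ball 0 1" using seg[OF w] by (simp add: stolz_def)
          then have "(g has_field_derivative deriv g w) (at w)" by (rule holomorphic_derivI[OF g open_ball])
          then have "((\<lambda>w. g w - c * w) has_field_derivative deriv g w - c * 1) (at w)"
            by (rule DERIV_diff[OF _ DERIV_cmult[OF DERIV_ident]])
          then show "((\<lambda>w. g w - c * w) has_field_derivative deriv g w - c) (at w within closed_segment (?z x) (?z \<epsilon>))"
            unfolding mult_1_right by (rule has_field_derivative_at_within)
          show "cmod (deriv g w - c) \<le> \<eta>" using \<delta>(2)[of w] seg[OF w] by (simp add: dist_norm less_imp_le)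
        qed auto
        also have "\<dots> \<le> \<eta> * (\<epsilon> * cmod d)"
        proof (intro mult_left_mono)
          have "?z \<epsilon> - ?z x = - of_real (\<epsilon> - x) * t * d" by (simp add: algebra_simps)
          then have "cmod (?z \<epsilon> - ?z x) = (\<epsilon> - x) * cmod d"
            using x t by (simp only: norm_mult norm_minus_cancel norm_of_real) simp
          then show "cmod (?z \<epsilon> - ?z x) \<le> \<epsilon> * cmod d" using x by (simp add: mult_right_mono)
        qed (use \<eta> in simp)
        finally show ?case .
      qed
    qed auto
    have "(g (?z \<epsilon>) - l) / of_real \<epsilon> - (- (c * t * d)) = ((g (?z \<epsilon>) - c * ?z \<epsilon>) - (l - c * t)) / of_real \<epsilon>"
      using elim by (simp add: field_simps)
    then have "dist ((g (?z \<epsilon>) - l) / of_real \<epsilon>) (- (c * t * d)) = cmod ((g (?z \<epsilon>) - c * ?z \<epsilon>) - (l - c * t)) / \<epsilon>"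
      using elim by (simp only: dist_norm norm_divide norm_of_real) simp
    also have "\<dots> \<le> \<eta> * (\<epsilon> * cmod d) / \<epsilon>" using main elim by (intro divide_right_mono) auto
    also have "\<dots> = e / 2" using elim d0 by (simp add: \<eta>_def)
    also have "\<dots> < e" using e by simp
    finally show ?case .
  qed
qed

text \<open>With \<open>g = l + \<epsilon> * \<phi>\<close> the first-order term of the squared
  modulus is \<open>2 * Re (cnj l * \<phi>)\<close>, and \<open>cnj l = 1 / l\<close> for unimodular
  \<open>l\<close>.\<close>

lemma ray_modulus_derivative:
  assumes d: "Re d > 0" and l1: "cmod l = 1"
  shows "((\<lambda>\<epsilon>::real. (1 - (cmod (g (t - of_real \<epsilon> * t * d)))\<^sup>2) / \<epsilon>) \<longlongrightarrow> 2 * Re (c * t / l * d)) (at_right 0)"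
proof -
  define \<phi> where "\<phi> \<epsilon> = (g (t - of_real \<epsilon> * t * d) - l) / of_real \<epsilon>" for \<epsilon> :: real
  have lim: "(\<phi> \<longlongrightarrow> - (c * t * d)) (at_right 0)" unfolding \<phi>_def by (rule angular_derivative[OF d])
  have "((\<lambda>\<epsilon>. - (2 * Re (cnj l * \<phi> \<epsilon>) + \<epsilon> * (cmod (\<phi> \<epsilon>))\<^sup>2)) \<longlongrightarrow>
     - (2 * Re (cnj l * - (c * t * d)) + 0 * (cmod (- (c * t * d)))\<^sup>2)) (at_right 0)"
    by (intro tendsto_intros lim)
  also have "- (2 * Re (cnj l * - (c * t * d)) + 0 * (cmod (- (c * t * d)))\<^sup>2) = 2 * Re (c * t / l * d)"
  proof -
    have "cnj l = 1 / l" using cnj_mult_norm1[OF l1] l1 by (auto simp: eq_divide_eq mult.commute)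
    then show ?thesis by (simp add: mult_ac)
  qed
  finally show ?thesis
  proof (rule Lim_transform_eventually)
    have "\<forall>\<^sub>F \<epsilon>::real in at_right 0. 0 < \<epsilon>" by (simp add: eventually_at_right_less)
    then show "\<forall>\<^sub>F \<epsilon> in at_right 0. - (2 * Re (cnj l * \<phi> \<epsilon>) + \<epsilon> * (cmod (\<phi> \<epsilon>))\<^sup>2) = (1 - (cmod (g (t - of_real \<epsilon> * t * d)))\<^sup>2) / \<epsilon>"
    proof eventually_elim
      case (elim \<epsilon>)
      have "g (t - of_real \<epsilon> * t * d) = l + of_real \<epsilon> * \<phi> \<epsilon>" using elim by (simp add: \<phi>_def)
      then have "(cmod (g (t - of_real \<epsilon> * t * d)))\<^sup>2 = (cmod l)\<^sup>2 + \<epsilon> * (2 * Re (cnj l * \<phi> \<epsilon>) + \<epsilon> * (cmod (\<phi> \<epsilon>))\<^sup>2)"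
        by (simp only: cmod_power2) (simp add: power2_eq_square algebra_simps)
      then show ?case using elim l1 by simp
    qed
  qed
qed

text \<open>Since \<open>cmod (g z)\<close> stays below \<open>cmod l = 1\<close>, the number
  \<open>\<kappa> = c * t / l\<close> satisfies \<open>Re (\<kappa> * d) \<ge> 0\<close> for every
  \<open>d\<close> in the right half plane. Letting \<open>d\<close> tend to both ends
  \<open>\<i>\<close> and \<open>-\<i>\<close> of the imaginary directions bounds
  \<open>Im \<kappa>\<close> by 0 from both sides.\<close>

lemma angular_derivative_real:
  assumes l1: "cmod l = 1" and b: "\<And>z. cmod z < 1 \<Longrightarrow> cmod (g z) \<le> 1"
  shows "Im (c * t / l) = 0"
proof -
  define \<kappa> where "\<kappa> = c * t / l"
  have pos: "0 \<le> Re (\<kappa> * d)" if d: "Re d > 0" for d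
  proof -
    have "0 \<le> 2 * Re (c * t / l * d)"
    proof (rule tendsto_lowerbound[OF ray_modulus_derivative[OF d l1]])
      show "\<forall>\<^sub>F \<epsilon> in at_right 0. 0 \<le> (1 - (cmod (g (t - of_real \<epsilon> * t * d)))\<^sup>2) / \<epsilon>"
        using eventually_ray[OF d]
      proof eventually_elim
        case (elim \<epsilon>)
        have "cmod (t - of_real \<epsilon> * t * d) < 1" using ray_in_stolz[OF d, of \<epsilon>] elim by (simp add: stolz_def)
        then have "(cmod (g (t - of_real \<epsilon> * t * d)))\<^sup>2 \<le> 1" using b by (simp add: power_le_one)
        then show ?case using elim by simp
      qed
    qed simp
    then show ?thesis by (simp add: \<kappa>_def)
  qed
  have lim: "((\<lambda>\<delta>::real. Re (\<kappa> * Complex \<delta> s)) \<longlongrightarrow> Re \<kappa> * 0 - Im \<kappa> * s) (at_right 0)" for s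
  proof -
    have "((\<lambda>\<delta>::real. Re \<kappa> * \<delta> - Im \<kappa> * s) \<longlongrightarrow> Re \<kappa> * 0 - Im \<kappa> * s) (at_right 0)" by (intro tendsto_intros)
    then show ?thesis by simp
  qed
  have "0 \<le> Re \<kappa> * 0 - Im \<kappa> * s" for s
  proof (rule tendsto_lowerbound[OF lim])
    have "\<forall>\<^sub>F \<delta>::real in at_right 0. 0 < \<delta>" by (simp add: eventually_at_right_less)
    then show "\<forall>\<^sub>F \<delta> in at_right 0. 0 \<le> Re (\<kappa> * Complex \<delta> s)"
      by eventually_elim (rule pos, simp)
  qed simp
  from this[of 1] this[of "-1"] show ?thesis by (simp add: \<kappa>_def)
qed

end

text \<open>The second bound controls the tail of a product uniformly in \<open>\<epsilon>\<close>.
  Its 8 is 2, from \<open>2 - \<epsilon>\<close>, times 4, because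
  \<open>cmod (1 - cnj a * z)\<close> is at least half of \<open>cmod (t - a)\<close> along the
  radius.\<close>

lemma blaschke_ray_factor:
  assumes a: "cmod a < 1" and t: "cmod t = 1" and \<epsilon>: "0 < \<epsilon>" "\<epsilon> < 1"
  shows "(1 - (cmod (blaschke_factor a (t - of_real \<epsilon> * t)))\<^sup>2) / \<epsilon> =
      (2 - \<epsilon>) * (1 - (cmod a)\<^sup>2) / (cmod (1 - cnj a * (t - of_real \<epsilon> * t)))\<^sup>2"
    and "(1 - (cmod (blaschke_factor a (t - of_real \<epsilon> * t)))\<^sup>2) / \<epsilon> \<le> 8 * poisson a t"
proof -
  let ?z = "t - of_real \<epsilon> * t"
  have "?z = of_real (1 - \<epsilon>) * t" by (simp add: algebra_simps)
  then have nz: "cmod ?z = 1 - \<epsilon>" using \<epsilon> t by (simp only: norm_mult norm_of_real) simp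
  have "1 - (cmod ?z)\<^sup>2 = \<epsilon> * (2 - \<epsilon>)" unfolding nz by (simp add: power2_eq_square algebra_simps)
  then show eq: "(1 - (cmod (blaschke_factor a ?z))\<^sup>2) / \<epsilon> = (2 - \<epsilon>) * (1 - (cmod a)\<^sup>2) / (cmod (1 - cnj a * ?z))\<^sup>2"
    using one_minus_blaschke_factor_sq[OF a, of ?z] nz \<epsilon> by simp
  have ta: "cmod (t - a) = cmod (1 - cnj a * t)"
    using Moebius_norm_eq_1[OF a t, of 0] one_minus_cnj_mult_nz[OF a, of t] t by (simp add: Moebius_function_simple norm_divide)
  have a2: "0 \<le> 1 - (cmod a)\<^sup>2" using a by (simp add: power_le_one)
  have "cmod (cnj a * ?z) \<le> 1 * (1 - \<epsilon>)" unfolding norm_mult nz using a \<epsilon> by (intro mult_right_mono) auto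
  then have lo: "\<epsilon> \<le> cmod (1 - cnj a * ?z)" using norm_triangle_ineq2[of 1 "cnj a * ?z"] by simp
  have eq2: "1 - cnj a * t = (1 - cnj a * ?z) - cnj a * of_real \<epsilon> * t" by (simp add: algebra_simps)
  have "cmod (1 - cnj a * t) \<le> cmod (1 - cnj a * ?z) + cmod (cnj a * of_real \<epsilon> * t)"
    by (subst eq2) (rule norm_triangle_ineq4)
  also have "cmod (cnj a * of_real \<epsilon> * t) = cmod a * \<epsilon>" using \<epsilon> t by (simp add: norm_mult)
  also have "cmod (1 - cnj a * ?z) + cmod a * \<epsilon> \<le> cmod (1 - cnj a * ?z) + 1 * cmod (1 - cnj a * ?z)" using a lo \<epsilon> by (intro add_left_mono mult_mono) auto
  finally have le: "cmod (t - a) / 2 \<le> cmod (1 - cnj a * ?z)" unfolding ta by simp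
  have ta0: "cmod (t - a) > 0" using a t by auto
  have "(2 - \<epsilon>) * (1 - (cmod a)\<^sup>2) / (cmod (1 - cnj a * ?z))\<^sup>2 \<le> 2 * (1 - (cmod a)\<^sup>2) / (cmod (t - a) / 2)\<^sup>2"
    using \<epsilon> a2 ta0 le by (intro frac_le mult_right_mono power_mono mult_nonneg_nonneg) auto
  also have "\<dots> = 8 * poisson a t" by (simp add: poisson_def power_divide)
  finally show "(1 - (cmod (blaschke_factor a ?z))\<^sup>2) / \<epsilon> \<le> 8 * poisson a t" unfolding eq .
qed

lemma eventually_unit_right: "\<forall>\<^sub>F \<epsilon>::real in at_right 0. 0 < \<epsilon> \<and> \<epsilon> < 1"
  by (rule eventually_mono[OF eventually_at_right_real[of 0 1]]) auto

lemma blaschke_ray_factor_tendsto: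
  assumes a: "cmod a < 1" and t: "cmod t = 1"
  shows "((\<lambda>\<epsilon>::real. (1 - (cmod (blaschke_factor a (t - of_real \<epsilon> * t)))\<^sup>2) / \<epsilon>) \<longlongrightarrow> 2 * poisson a t) (at_right 0)"
proof (rule Lim_transform_eventually)
  have nz: "1 - cnj a * t \<noteq> 0" by (rule one_minus_cnj_mult_nz) (use a t in auto)
  have ta: "cmod (t - a) = cmod (1 - cnj a * t)"
    using Moebius_norm_eq_1[OF a t, of 0] nz t by (simp add: Moebius_function_simple norm_divide)
  have "((\<lambda>\<epsilon>::real. (2 - \<epsilon>) * (1 - (cmod a)\<^sup>2) / (cmod (1 - cnj a * (t - of_real \<epsilon> * t)))\<^sup>2) \<longlongrightarrow>
     (2 - 0) * (1 - (cmod a)\<^sup>2) / (cmod (1 - cnj a * (t - of_real 0 * t)))\<^sup>2) (at_right 0)"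
    by (intro tendsto_intros) (use nz in simp)
  then show "((\<lambda>\<epsilon>::real. (2 - \<epsilon>) * (1 - (cmod a)\<^sup>2) / (cmod (1 - cnj a * (t - of_real \<epsilon> * t)))\<^sup>2) \<longlongrightarrow> 2 * poisson a t) (at_right 0)"
    by (simp add: poisson_def ta)
  show "\<forall>\<^sub>F \<epsilon> in at_right 0. (2 - \<epsilon>) * (1 - (cmod a)\<^sup>2) / (cmod (1 - cnj a * (t - of_real \<epsilon> * t)))\<^sup>2 =
      (1 - (cmod (blaschke_factor a (t - of_real \<epsilon> * t)))\<^sup>2) / \<epsilon>"
    using eventually_unit_right by eventually_elim (simp add: blaschke_ray_factor(1)[OF a t])
qed

text \<open>A product rule for the radial derivative, resting on
  \<open>1 - x * y = (1 - x) + x * (1 - y)\<close>.\<close>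

lemma blaschke_ray_prod_tendsto:
  assumes F: "finite F" "F \<subseteq> ball 0 1" and t: "cmod t = 1"
  shows "((\<lambda>\<epsilon>::real. (1 - (\<Prod>a\<in>F. (cmod (blaschke_factor a (t - of_real \<epsilon> * t)))\<^sup>2)) / \<epsilon>) \<longlongrightarrow> 2 * (\<Sum>a\<in>F. poisson a t)) (at_right 0)"
  using F
proof (induction F rule: finite_induct)
  case (insert a F)
  let ?b = "\<lambda>a \<epsilon>. (cmod (blaschke_factor a (t - of_real \<epsilon> * t)))\<^sup>2"
  have a: "cmod a < 1" using insert by auto
  note fa = blaschke_ray_factor_tendsto[OF a t]
  have "((\<lambda>\<epsilon>::real. 1 - \<epsilon> * ((1 - ?b a \<epsilon>) / \<epsilon>)) \<longlongrightarrow> 1 - 0 * (2 * poisson a t)) (at_right 0)"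
    by (intro tendsto_intros fa)
  then have "((\<lambda>\<epsilon>::real. 1 - \<epsilon> * ((1 - ?b a \<epsilon>) / \<epsilon>)) \<longlongrightarrow> 1) (at_right 0)" by simp
  then have b1: "((\<lambda>\<epsilon>::real. ?b a \<epsilon>) \<longlongrightarrow> 1) (at_right 0)"
    by (rule Lim_transform_eventually) (use eventually_unit_right in \<open>eventually_elim, simp\<close>)
  have "((\<lambda>\<epsilon>::real. (1 - ?b a \<epsilon>) / \<epsilon> + ?b a \<epsilon> * ((1 - (\<Prod>a\<in>F. ?b a \<epsilon>)) / \<epsilon>)) \<longlongrightarrow>
      2 * poisson a t + 1 * (2 * (\<Sum>a\<in>F. poisson a t))) (at_right 0)"
    by (intro tendsto_intros fa b1 insert.IH) (use insert in auto)
  also have "(\<lambda>\<epsilon>::real. (1 - ?b a \<epsilon>) / \<epsilon> + ?b a \<epsilon> * ((1 - (\<Prod>a\<in>F. ?b a \<epsilon>)) / \<epsilon>)) =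
     (\<lambda>\<epsilon>. (1 - (\<Prod>a\<in>insert a F. ?b a \<epsilon>)) / \<epsilon>)"
    using insert by (intro ext) (simp add: right_diff_distrib flip: add_divide_distrib)
  finally show ?case using insert by (simp add: distrib_left)
qed simp

text \<open>The derivative of the squared modulus along the radius is computed twice: from the
  angular derivative, where it is twice the real number \<open>c * t / l\<close>, and from the
  product. Finite subproducts dominate the modulus of the whole product, which bounds the finite
  kernel sums from above; the reverse inequality needs control of infinitely many factors at
  once.\<close>

theorem blaschke_product_log_derivative:
  assumes A: "A \<subseteq> ball 0 1" and summ: "(\<lambda>a. 1 - cmod a) summable_on A" and t: "cmod t = 1"
    and l: "has_nt_limit (blaschke_product A) t l" and l1: "cmod l = 1"
    and c: "has_nt_limit (deriv (blaschke_product A)) t c"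
  shows "(\<lambda>a. poisson a t) summable_on A" "c * t / l = of_real (\<Sum>\<^sub>\<infinity>a\<in>A. poisson a t)"
proof -
  let ?g = "blaschke_product A"
  note g = blaschke_product_holomorphic[OF A summ]
  define \<kappa> where "\<kappa> = Re (c * t / l)"
  have real: "c * t / l = of_real \<kappa>"
    unfolding \<kappa>_def by (rule complex_eqI)
      (simp, simp add: angular_derivative_real[OF g t l c l1 blaschke_product_norm_le[OF A summ]])
  have lim: "((\<lambda>\<epsilon>::real. (1 - (cmod (?g (t - of_real \<epsilon> * t)))\<^sup>2) / \<epsilon>) \<longlongrightarrow> 2 * \<kappa>) (at_right 0)"
    using ray_modulus_derivative[OF g t l c, of 1] l1 by (simp add: \<kappa>_def)
  have zb: "cmod (t - of_real \<epsilon> * t) < 1" if "0 < \<epsilon>" "\<epsilon> < 1" for \<epsilon> :: real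
  proof -
    have "t - of_real \<epsilon> * t = of_real (1 - \<epsilon>) * t" by (simp add: algebra_simps)
    then show ?thesis using that t by (simp only: norm_mult norm_of_real) simp
  qed
  have P0: "0 \<le> poisson a t" if "a \<in> A" for a using that A by (intro poisson_nonneg) auto
  have upper: "(\<Sum>a\<in>F. poisson a t) \<le> \<kappa>" if F: "finite F" "F \<subseteq> A" for F
  proof -
    have "2 * (\<Sum>a\<in>F. poisson a t) \<le> 2 * \<kappa>"
    proof (rule tendsto_le[OF _ lim blaschke_ray_prod_tendsto[OF F(1) _ t]])
      show "\<forall>\<^sub>F \<epsilon> in at_right 0. (1 - (\<Prod>a\<in>F. (cmod (blaschke_factor a (t - of_real \<epsilon> * t)))\<^sup>2)) / \<epsilon> \<le> (1 - (cmod (?g (t - of_real \<epsilon> * t)))\<^sup>2) / \<epsilon>"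
        using eventually_unit_right
      proof eventually_elim
        case (elim \<epsilon>)
        have "(cmod (?g (t - of_real \<epsilon> * t)))\<^sup>2 \<le> (cmod (\<Prod>a\<in>F. blaschke_factor a (t - of_real \<epsilon> * t)))\<^sup>2"
          using zb[of \<epsilon>] elim by (intro power_mono blaschke_product_norm_le_partial[OF A summ F]) auto
        also have "\<dots> = (\<Prod>a\<in>F. (cmod (blaschke_factor a (t - of_real \<epsilon> * t)))\<^sup>2)"
          by (simp add: prod_norm[symmetric] prod_power_distrib)
        finally show ?case using elim by (intro divide_right_mono) auto
      qed
    qed (use F A in auto)
    then show ?thesis by simp
  qed
  show sP: "(\<lambda>a. poisson a t) summable_on A"
    by (rule nonneg_bdd_above_summable_on) (use P0 upper in \<open>auto simp: bdd_above_def\<close>)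
  have "infsum (\<lambda>a. poisson a t) A \<le> \<kappa>"
    by (rule infsum_le_finite_sums[OF sP]) (rule upper)
  moreover have "\<kappa> \<le> infsum (\<lambda>a. poisson a t) A"
  proof -
    let ?S = "infsum (\<lambda>a. poisson a t) A"
    \<comment> \<open>The factors outside \<open>F\<close> are estimated uniformly in
      \<open>\<epsilon>\<close>, by 8 times their kernels, before \<open>\<epsilon>\<close> tends to
      0. This error is a tail of a convergent sum and disappears when \<open>F\<close>
      grows.\<close>
    have bound: "2 * \<kappa> \<le> 2 * (\<Sum>a\<in>F. poisson a t) + 8 * (?S - (\<Sum>a\<in>F. poisson a t))" if F: "finite F" "F \<subseteq> A" for F
    proof (rule tendsto_le[OF _ _ lim])
      show "((\<lambda>\<epsilon>::real. (\<Sum>a\<in>F. (1 - (cmod (blaschke_factor a (t - of_real \<epsilon> * t)))\<^sup>2) / \<epsilon>) + 8 * (?S - (\<Sum>a\<in>F. poisson a t))) \<longlongrightarrow>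
          2 * (\<Sum>a\<in>F. poisson a t) + 8 * (?S - (\<Sum>a\<in>F. poisson a t))) (at_right 0)"
        unfolding sum_distrib_left[of 2]
        by (intro tendsto_intros blaschke_ray_factor_tendsto t) (use F A in auto)
      show "\<forall>\<^sub>F \<epsilon> in at_right 0. (1 - (cmod (?g (t - of_real \<epsilon> * t)))\<^sup>2) / \<epsilon> \<le>
         (\<Sum>a\<in>F. (1 - (cmod (blaschke_factor a (t - of_real \<epsilon> * t)))\<^sup>2) / \<epsilon>) + 8 * (?S - (\<Sum>a\<in>F. poisson a t))"
        using eventually_unit_right
      proof eventually_elim
        case (elim \<epsilon>)
        let ?z = "t - of_real \<epsilon> * t"
        let ?x = "\<lambda>a. (1 - (cmod (blaschke_factor a ?z))\<^sup>2) / \<epsilon>"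
        have z: "cmod ?z < 1" using zb elim by simp
        have part: "(1 - (cmod (\<Prod>a\<in>G. blaschke_factor a ?z))\<^sup>2) / \<epsilon> \<le> (\<Sum>a\<in>F. ?x a) + 8 * (?S - (\<Sum>a\<in>F. poisson a t))"
          if G: "finite G" "F \<subseteq> G" "G \<subseteq> A" for G
        proof -
          have "1 - (\<Prod>a\<in>G. (cmod (blaschke_factor a ?z))\<^sup>2) \<le> (\<Sum>a\<in>G. 1 - (cmod (blaschke_factor a ?z))\<^sup>2)"
            by (rule one_minus_prod_le_sum) (use blaschke_factor_norm_le[OF _ z] G A in \<open>auto simp: power_le_one\<close>)
          then have "(1 - (cmod (\<Prod>a\<in>G. blaschke_factor a ?z))\<^sup>2) / \<epsilon> \<le> (\<Sum>a\<in>G. 1 - (cmod (blaschke_factor a ?z))\<^sup>2) / \<epsilon>"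
            using elim by (intro divide_right_mono) (auto simp: prod_norm[symmetric] prod_power_distrib)
          also have "\<dots> = (\<Sum>a\<in>G. ?x a)" by (rule sum_divide_distrib)
          also have "\<dots> = (\<Sum>a\<in>G - F. ?x a) + (\<Sum>a\<in>F. ?x a)" by (rule sum.subset_diff[OF G(2,1)])
          also have "(\<Sum>a\<in>G - F. ?x a) \<le> (\<Sum>a\<in>G - F. 8 * poisson a t)"
            using G A elim by (intro sum_mono blaschke_ray_factor(2) t) auto
          also have "\<dots> = 8 * ((\<Sum>a\<in>G. poisson a t) - (\<Sum>a\<in>F. poisson a t))"
            unfolding sum_distrib_left[symmetric] using sum.subset_diff[OF G(2,1), of "\<lambda>a. poisson a t"] by simp
          also have "(\<Sum>a\<in>G. poisson a t) \<le> ?S" by (rule finite_sum_le_infsum[OF sP G(1,3)]) (use P0 in auto)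
          finally show ?thesis by simp
        qed
        show ?case
        proof (rule tendsto_upperbound)
          show "((\<lambda>G. (1 - (cmod (\<Prod>a\<in>G. blaschke_factor a ?z))\<^sup>2) / \<epsilon>) \<longlongrightarrow> (1 - (cmod (?g ?z))\<^sup>2) / \<epsilon>) (finite_subsets_at_top A)"
            by (intro tendsto_intros blaschke_product_tendsto[OF A summ z]) (use elim in simp)
          show "\<forall>\<^sub>F G in finite_subsets_at_top A. (1 - (cmod (\<Prod>a\<in>G. blaschke_factor a ?z))\<^sup>2) / \<epsilon> \<le> (\<Sum>a\<in>F. ?x a) + 8 * (?S - (\<Sum>a\<in>F. poisson a t))"
            unfolding eventually_finite_subsets_at_top
          proof (intro exI[of _ F] conjI allI impI F)
            fix G assume "finite G \<and> F \<subseteq> G \<and> G \<subseteq> A"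
            then show "(1 - (cmod (\<Prod>a\<in>G. blaschke_factor a ?z))\<^sup>2) / \<epsilon> \<le> (\<Sum>a\<in>F. ?x a) + 8 * (?S - (\<Sum>a\<in>F. poisson a t))"
              by (intro part) blast+
          qed
        qed simp
      qed
    qed simp
    have "2 * \<kappa> \<le> 2 * ?S + 8 * (?S - ?S)"
    proof (rule tendsto_lowerbound)
      show "((\<lambda>F. 2 * (\<Sum>a\<in>F. poisson a t) + 8 * (?S - (\<Sum>a\<in>F. poisson a t))) \<longlongrightarrow> 2 * ?S + 8 * (?S - ?S)) (finite_subsets_at_top A)"
        by (intro tendsto_intros infsum_tendsto sP)
      show "\<forall>\<^sub>F F in finite_subsets_at_top A. 2 * \<kappa> \<le> 2 * (\<Sum>a\<in>F. poisson a t) + 8 * (?S - (\<Sum>a\<in>F. poisson a t))"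
        by (rule eventually_finite_subsets_at_top_weakI) (rule bound)
    qed simp
    then show ?thesis by simp
  qed
  ultimately show "c * t / l = of_real (\<Sum>\<^sub>\<infinity>a\<in>A. poisson a t)" using real by simp
qed

subsection \<open>The Hardy class\<close>

lemma nn_integral_poisson: "cmod z < 1 \<Longrightarrow> (\<integral>\<^sup>+t. ennreal (poisson z t) \<partial>circle_borel) = 1"
  by (subst nn_integral_eq_integral) (auto simp: integrable_poisson integral_poisson poisson_nonneg)

lemma poisson_le:
  assumes "cmod z < 1" "cmod t = 1"
  shows "poisson z t \<le> 2 / (1 - cmod z)"
proof -
  have d: "1 - cmod z \<le> cmod (t - z)" using norm_triangle_ineq2[of t z] assms by simp
  have "poisson z t \<le> (1 - (cmod z)\<^sup>2) / (1 - cmod z)\<^sup>2"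
    unfolding poisson_def
    by (intro divide_left_mono power_mono mult_pos_pos d) (use assms d in \<open>auto simp: abs_square_le_1 power_le_one\<close>)
  also have "\<dots> = ((1 - cmod z) * (1 + cmod z)) / ((1 - cmod z) * (1 - cmod z))"
    by (simp add: power2_eq_square algebra_simps)
  also have "\<dots> = (1 + cmod z) / (1 - cmod z)" using assms by simp
  also have "\<dots> \<le> 2 / (1 - cmod z)" using assms by (intro divide_right_mono) auto
  finally show ?thesis .
qed

text \<open>Zeros in the disc are reflected: \<open>t - a\<close> becomes
  \<open>1 - cnj a * t\<close>, which has the same modulus on the circle, a larger one inside, and
  no zero there. This divides out a finite Blaschke product while staying among polynomials, and the
  zero-free result admits a square root.\<close>

lemma poly_flip:
  fixes p :: "complex poly"
  assumes "p \<noteq> 0"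
  shows "\<exists>q. (\<forall>t. cmod t = 1 \<longrightarrow> cmod (poly q t) = cmod (poly p t)) \<and>
    (\<forall>z. cmod z < 1 \<longrightarrow> cmod (poly p z) \<le> cmod (poly q z) \<and> poly q z \<noteq> 0)"
  using assms
proof (induction "degree p" arbitrary: p)
  case 0
  then obtain c where "p = [:c:]" by (metis degree_eq_zeroE)
  then show ?case using 0 by (intro exI[of _ p]) auto
next
  case (Suc n)
  then have "\<not> constant (poly p)" by (simp add: constant_degree)
  then obtain a where "poly p a = 0" using fundamental_theorem_of_algebra by blast
  then obtain p' where p': "p = [:-a, 1:] * p'" by (metis dvdE poly_eq_0_iff_dvd)
  have nz: "p' \<noteq> 0" using Suc p' by auto
  have "degree p = Suc (degree p')" unfolding p' using nz by (subst degree_mult_eq) auto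
  then have "n = degree p'" using Suc by simp
  from Suc(1)[OF this nz] obtain q' where q': "\<And>t. cmod t = 1 \<Longrightarrow> cmod (poly q' t) = cmod (poly p' t)"
    "\<And>z. cmod z < 1 \<Longrightarrow> cmod (poly p' z) \<le> cmod (poly q' z) \<and> poly q' z \<noteq> 0" by blast
  show ?case
  proof (cases "cmod a < 1")
    case True
    have 1: "cmod (1 - cnj a * t) = cmod (t - a)" if "cmod t = 1" for t
      using Moebius_norm_eq_1[OF True that, of 0] one_minus_cnj_mult_nz[OF True, of t] that
      by (simp add: Moebius_function_simple norm_divide)
    have 2: "cmod (z - a) \<le> cmod (1 - cnj a * z)" if "cmod z < 1" for z
      using Moebius_function_norm_lt_1[OF True that, of 0] one_minus_cnj_mult_nz[OF True, of z] that
      by (simp add: Moebius_function_simple norm_divide)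
    have e1: "poly ([:1, - cnj a:] * q') t = (1 - cnj a * t) * poly q' t" for t by (simp add: algebra_simps)
    have e2: "poly p t = (t - a) * poly p' t" for t by (simp add: p' algebra_simps)
    show ?thesis
    proof (intro exI[of _ "[:1, - cnj a:] * q'"] conjI allI impI)
      fix t :: complex assume "cmod t = 1"
      then show "cmod (poly ([:1, - cnj a:] * q') t) = cmod (poly p t)"
        by (simp only: e1 e2 norm_mult 1 q'(1))
    next
      fix z :: complex assume z: "cmod z < 1"
      show "cmod (poly p z) \<le> cmod (poly ([:1, - cnj a:] * q') z)"
        unfolding e1 e2 norm_mult using q'(2)[OF z] by (intro mult_mono 2[OF z]) auto
      show "poly ([:1, - cnj a:] * q') z \<noteq> 0"
        unfolding e1 using q'(2)[OF z] one_minus_cnj_mult_nz[OF True, of z] z by simp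
    qed
  next
    \<comment> \<open>A zero on or outside the circle is kept, since its factor does not vanish in
      the open disc.\<close>
    case False
    have e1: "poly ([:-a, 1:] * q') t = (t - a) * poly q' t" for t by (simp add: algebra_simps)
    have e2: "poly p t = (t - a) * poly p' t" for t by (simp add: p' algebra_simps)
    show ?thesis
    proof (intro exI[of _ "[:-a, 1:] * q'"] conjI allI impI)
      fix t :: complex assume "cmod t = 1"
      then show "cmod (poly ([:-a, 1:] * q') t) = cmod (poly p t)"
        by (simp only: e1 e2 norm_mult q'(1))
    next
      fix z :: complex assume z: "cmod z < 1"
      show "cmod (poly p z) \<le> cmod (poly ([:-a, 1:] * q') z)"
        unfolding e1 e2 norm_mult using q'(2)[OF z] by (intro mult_left_mono) auto
      show "poly ([:-a, 1:] * q') z \<noteq> 0"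
        unfolding e1 using q'(2)[OF z] z False by auto
    qed
  qed
qed

text \<open>The Poisson formula bounds the modulus at \<open>r * t\<close> by an integral over the
  circle. The kernel is symmetric in the two boundary points,
  \<open>poisson (r * t) s = poisson (r * s) t\<close>, so after Fubini the integral over
  \<open>t\<close> is 1.\<close>

lemma circle_mean_poly_le:
  fixes q :: "complex poly"
  assumes r: "0 \<le> r" "r < 1"
  shows "(LINT t|circle_lebesgue. cmod (poly q (of_real r * t))) \<le> (LINT t|circle_lebesgue. cmod (poly q t))"
proof -
  interpret P: pair_sigma_finite circle_borel circle_borel ..
  have [measurable]: "poly q \<in> borel_measurable borel" by (intro borel_measurable_continuous_onI continuous_intros)
  have eq: "(\<integral>\<^sup>+t. ennreal (cmod (poly q (f t))) \<partial>circle_borel) = ennreal (LINT t|circle_lebesgue. cmod (poly q (f t)))"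
    if f: "continuous_on UNIV f" for f
  proof -
    have c: "continuous_on (sphere 0 1) (\<lambda>t. cmod (poly q (f t)))"
      by (intro continuous_intros continuous_on_subset[OF f]) auto
    show ?thesis
      unfolding nn_integral_circle_lebesgue[symmetric]
      by (intro nn_integral_eq_integral integral_circle_indicator c AE_I2) auto
  qed
  have rb: "cmod (of_real r * t) < 1" if "cmod t = 1" for t using that r by (simp add: norm_mult)
  have "(\<integral>\<^sup>+t. ennreal (cmod (poly q (of_real r * t))) \<partial>circle_borel) \<le>
     (\<integral>\<^sup>+t. \<integral>\<^sup>+s. ennreal (cmod (poly q s)) * ennreal (poisson (of_real r * t) s) \<partial>circle_borel \<partial>circle_borel)"
  proof (rule nn_integral_mono_AE)
    show "AE t in circle_borel. ennreal (cmod (poly q (of_real r * t))) \<le>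
        (\<integral>\<^sup>+s. ennreal (cmod (poly q s)) * ennreal (poisson (of_real r * t) s) \<partial>circle_borel)"
      using AE_circle_norm
      by eventually_elim (intro circle_Poisson_norm_le continuous_intros holomorphic_intros rb)
  qed
  also have "\<dots> = (\<integral>\<^sup>+s. \<integral>\<^sup>+t. ennreal (cmod (poly q s)) * ennreal (poisson (of_real r * t) s) \<partial>circle_borel \<partial>circle_borel)"
    unfolding poisson_def by (rule P.Fubini'; measurable)
  also have "\<dots> = (\<integral>\<^sup>+s. ennreal (cmod (poly q s)) \<partial>circle_borel)"
  proof (rule nn_integral_cong_AE)
    show "AE s in circle_borel. (\<integral>\<^sup>+t. ennreal (cmod (poly q s)) * ennreal (poisson (of_real r * t) s) \<partial>circle_borel) = ennreal (cmod (poly q s))"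
      using AE_circle_norm
    proof eventually_elim
      case (elim s)
      have "(\<integral>\<^sup>+t. ennreal (cmod (poly q s)) * ennreal (poisson (of_real r * t) s) \<partial>circle_borel) =
        (\<integral>\<^sup>+t. ennreal (cmod (poly q s)) * ennreal (poisson (of_real r * s) t) \<partial>circle_borel)"
      proof (rule nn_integral_cong_AE)
        show "AE t in circle_borel. ennreal (cmod (poly q s)) * ennreal (poisson (of_real r * t) s) =
           ennreal (cmod (poly q s)) * ennreal (poisson (of_real r * s) t)"
          using AE_circle_norm
        proof eventually_elim
          case t: (elim t)
          have "s - of_real r * t = (s * t) * cnj (t - of_real r * s)"
            using cnj_mult_norm1[OF t] cnj_mult_norm1[OF elim] by (simp add: algebra_simps)
          then have "cmod (s - of_real r * t) = cmod (t - of_real r * s)"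
            using t elim by (simp only: norm_mult complex_mod_cnj mult_1)
          then show ?case unfolding poisson_def using t elim by (simp add: norm_mult)
        qed
      qed
      also have "\<dots> = ennreal (cmod (poly q s)) * (\<integral>\<^sup>+t. ennreal (poisson (of_real r * s) t) \<partial>circle_borel)"
        by (rule nn_integral_cmult; measurable)
      finally show ?case by (simp only: nn_integral_poisson[OF rb[OF elim]] mult_1_right)
    qed
  qed
  finally have "ennreal (LINT t|circle_lebesgue. cmod (poly q (of_real r * t))) \<le> ennreal (LINT t|circle_lebesgue. cmod (poly q t))"
    using eq[of "\<lambda>t. of_real r * t"] eq[of "\<lambda>t. t"] by (simp add: continuous_intros)
  then show ?thesis by (subst (asm) ennreal_le_iff) auto
qed

text \<open>\<open>s\<close> is a holomorphic square root of the reflected polynomial, so its square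
  means are controlled by the mean of \<open>cmod (poly p t)\<close> over the circle. The last
  bound, from the size of the Poisson kernel, is the local bound for a normal family
  argument.\<close>

lemma poly_majorant:
  assumes "p \<noteq> 0" and K: "(LINT t|circle_lebesgue. cmod (poly p t)) \<le> K"
  shows "\<exists>s. s holomorphic_on ball 0 1 \<and> (\<forall>z. cmod z < 1 \<longrightarrow> cmod (poly p z) \<le> (cmod (s z))\<^sup>2) \<and>
    (\<forall>r\<in>{0..<1}. (LINT t|circle_lebesgue. (cmod (s (of_real r * t)))\<^sup>2) \<le> K) \<and>
    (\<forall>z. cmod z < 1 \<longrightarrow> (cmod (s z))\<^sup>2 \<le> K * (2 / (1 - cmod z)))"
proof -
  obtain q where q: "\<And>t. cmod t = 1 \<Longrightarrow> cmod (poly q t) = cmod (poly p t)"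
    "\<And>z. cmod z < 1 \<Longrightarrow> cmod (poly p z) \<le> cmod (poly q z)" "\<And>z. cmod z < 1 \<Longrightarrow> poly q z \<noteq> 0"
    using poly_flip[OF assms(1)] by blast
  have h: "poly q holomorphic_on ball 0 1" by (intro holomorphic_intros)
  obtain s where s: "s holomorphic_on ball 0 1" "\<And>z. z \<in> ball 0 1 \<Longrightarrow> poly q z = s z ^ 2"
    by (rule contractible_imp_holomorphic_sqrt[OF h]) (use q in \<open>auto intro: convex_imp_contractible\<close>)
  have sq: "(cmod (s z))\<^sup>2 = cmod (poly q z)" if "cmod z < 1" for z using s(2)[of z] that by (simp add: norm_power)
  have qp: "(LINT t|circle_lebesgue. cmod (poly q t)) = (LINT t|circle_lebesgue. cmod (poly p t))"
    by (rule integral_circle_cong) (rule q)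
  have cq: "continuous_on (sphere 0 1) (\<lambda>t. cmod (poly q t))" by (intro continuous_intros)
  show ?thesis
  proof (intro exI[of _ s] conjI allI impI ballI s(1))
    fix z :: complex assume z: "cmod z < 1"
    show "cmod (poly p z) \<le> (cmod (s z))\<^sup>2" using q(2)[OF z] sq[OF z] by simp
    have "ennreal (cmod (poly q z)) \<le> (\<integral>\<^sup>+t. ennreal (cmod (poly q t)) * ennreal (poisson z t) \<partial>circle_borel)"
      by (intro circle_Poisson_norm_le continuous_intros holomorphic_intros z)
    also have "\<dots> \<le> (\<integral>\<^sup>+t. ennreal (cmod (poly q t) * (2 / (1 - cmod z))) \<partial>circle_borel)"
    proof (rule nn_integral_mono_AE)
      show "AE t in circle_borel. ennreal (cmod (poly q t)) * ennreal (poisson z t) \<le> ennreal (cmod (poly q t) * (2 / (1 - cmod z)))"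
        using AE_circle_norm
      proof eventually_elim
        case (elim t)
        show ?case using poisson_le[OF z elim] poisson_nonneg[OF z, of t]
          by (subst ennreal_mult[symmetric]) (auto simp del: times_divide_eq_right intro!: ennreal_leI mult_left_mono)
      qed
    qed
    also have "\<dots> = ennreal (LINT t|circle_lebesgue. cmod (poly q t) * (2 / (1 - cmod z)))"
      unfolding nn_integral_circle_lebesgue[symmetric]
    proof (intro nn_integral_eq_integral AE_I2)
      show "integrable circle_lebesgue (\<lambda>t. cmod (poly q t) * (2 / (1 - cmod z)))"
        using integral_circle_indicator(2)[OF cq] by (rule integrable_mult_left)
    qed (use z in simp)
    also have "(LINT t|circle_lebesgue. cmod (poly q t) * (2 / (1 - cmod z))) = (LINT t|circle_lebesgue. cmod (poly p t)) * (2 / (1 - cmod z))"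
      unfolding qp[symmetric] by (rule integral_mult_left_zero)
    also have "ennreal \<dots> \<le> ennreal (K * (2 / (1 - cmod z)))"
      using z by (intro ennreal_leI mult_right_mono K) auto
    finally have "ennreal (cmod (poly q z)) \<le> ennreal (K * (2 / (1 - cmod z)))" .
    moreover have "0 \<le> (LINT t|circle_lebesgue. cmod (poly p t))" by (rule Bochner_Integration.integral_nonneg) simp
    then have "0 \<le> K" using K by linarith
    ultimately show "(cmod (s z))\<^sup>2 \<le> K * (2 / (1 - cmod z))"
      using z unfolding sq[OF z] by (subst (asm) ennreal_le_iff) auto
  next
    fix r :: real assume r: "r \<in> {0..<1}"
    have "(LINT t|circle_lebesgue. (cmod (s (of_real r * t)))\<^sup>2) = (LINT t|circle_lebesgue. cmod (poly q (of_real r * t)))"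
      by (rule integral_circle_cong) (use r in \<open>simp add: sq norm_mult\<close>)
    also have "\<dots> \<le> K" using circle_mean_poly_le[of r q] r K qp by simp
    finally show "(LINT t|circle_lebesgue. (cmod (s (of_real r * t)))\<^sup>2) \<le> K" .
  qed
qed

lemma holomorphic_poly_approx:
  assumes f: "f holomorphic_on ball 0 1" and r: "0 \<le> r" "r < 1" and \<epsilon>: "\<epsilon> > (0::real)"
  shows "\<exists>p :: complex poly. p \<noteq> 0 \<and> (\<forall>t. cmod t \<le> 1 \<longrightarrow> cmod (poly p t - f (of_real r * t)) \<le> \<epsilon>)"
proof -
  define a where "a n = (deriv ^^ n) f 0 / fact n" for n
  have a: "(\<lambda>n. a n * z ^ n) sums f z" if "cmod z < 1" for z
    using holomorphic_power_series[OF f, of z] that by (simp add: a_def)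
  obtain s where s: "r < s" "s < 1" using dense r by blast
  have abs: "summable (\<lambda>n. norm (a n * of_real r ^ n))"
    by (rule powser_insidea[of a "of_real s"]) (use a[of "of_real s"] s r in \<open>auto simp: sums_iff\<close>)
  obtain N where N: "\<And>n. n \<ge> N \<Longrightarrow> norm (\<Sum>i. norm (a (i + n) * of_real r ^ (i + n))) < \<epsilon> / 2"
    using suminf_exist_split[OF _ abs, of "\<epsilon> / 2"] \<epsilon> by auto
  define p0 where "p0 = (\<Sum>n<N. monom (a n * of_real r ^ n) n)"
  have p0: "cmod (poly p0 t - f (of_real r * t)) \<le> \<epsilon> / 2" if t: "cmod t \<le> 1" for t
  proof -
    have "cmod (of_real r * t) \<le> r * 1" unfolding norm_mult using r t by (intro mult_mono) auto
    then have "(\<lambda>n. a n * (of_real r * t) ^ n) sums f (of_real r * t)" using r by (intro a) auto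
    then have sm: "(\<lambda>n. a n * of_real r ^ n * t ^ n) sums f (of_real r * t)"
      by (simp add: power_mult_distrib mult.assoc)
    have "f (of_real r * t) = (\<Sum>n. a (n + N) * of_real r ^ (n + N) * t ^ (n + N)) + (\<Sum>n<N. a n * of_real r ^ n * t ^ n)"
      using suminf_split_initial_segment[OF sums_summable[OF sm], of N] sums_unique[OF sm] by simp
    then have "cmod (poly p0 t - f (of_real r * t)) = cmod (\<Sum>n. a (n + N) * of_real r ^ (n + N) * t ^ (n + N))"
      by (simp add: p0_def poly_sum poly_monom)
    also have "\<dots> \<le> (\<Sum>n. norm (a (n + N) * of_real r ^ (n + N)))"
    proof (rule norm_suminf_le)
      show "summable (\<lambda>n. norm (a (n + N) * of_real r ^ (n + N)))"
        using abs summable_iff_shift[of "\<lambda>n. norm (a n * of_real r ^ n)" N] by simp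
      show "norm (a (n + N) * of_real r ^ (n + N) * t ^ (n + N)) \<le> norm (a (n + N) * of_real r ^ (n + N))" for n
        using t unfolding norm_mult[of _ "t ^ (n + N)"] norm_power
        by (intro mult_left_le power_le_one) auto
    qed
    also have "\<dots> \<le> \<epsilon> / 2" using N[of N] by simp
    finally show ?thesis .
  qed
  show ?thesis
  proof (cases "p0 = 0")
    case False
    have "cmod (poly p0 t - f (of_real r * t)) \<le> \<epsilon>" if "cmod t \<le> 1" for t
      using p0[OF that] \<epsilon> by linarith
    with False show ?thesis by blast
  next
    \<comment> \<open>Reflecting zeros asks for a nonzero polynomial. A vanishing Taylor section is
      replaced by a small constant, which is why the section was taken with error
      \<open>\<epsilon> / 2\<close>.\<close>
    case True
    have "cmod (poly [:of_real (\<epsilon> / 2):] t - f (of_real r * t)) \<le> \<epsilon>" if "cmod t \<le> 1" for t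
    proof -
      have "cmod (f (of_real r * t)) \<le> \<epsilon> / 2" using p0[OF that] True by simp
      then show ?thesis using norm_triangle_ineq4[of "of_real (\<epsilon> / 2)" "f (of_real r * t)"] \<epsilon> by simp
    qed
    moreover have "[:complex_of_real (\<epsilon> / 2):] \<noteq> 0" using \<epsilon> by simp
    ultimately show ?thesis by blast
  qed
qed

text \<open>This inequality plays the role of the factorization of an H1 function into a Blaschke
  product and a square. Dilations of \<open>f\<close> are approximated by polynomials, these are
  reflected and replaced by square roots, and Montel's theorem extracts a limit, along which both
  the pointwise and the integral bound persist.\<close>

lemma H1_square_majorant:
  assumes "hardy_H1 f"
  shows "\<exists>g K. g holomorphic_on ball 0 1 \<and> (\<forall>z. cmod z < 1 \<longrightarrow> cmod (f z) \<le> (cmod (g z))\<^sup>2) \<and>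
    (\<forall>r\<in>{0..<1}. (LINT t|circle_lebesgue. (cmod (g (of_real r * t)))\<^sup>2) \<le> K)"
proof -
  have f: "f holomorphic_on ball 0 1" using assms by (simp add: hardy_H1_def)
  obtain K0 where "\<forall>r\<in>{0..<1}. (LINT t|circle_lebesgue. cmod (f (of_real r * t))) \<le> K0"
    using assms unfolding hardy_H1_def bdd_above_def by blast
  then have K0: "(LINT t|circle_lebesgue. cmod (f (of_real r * t))) \<le> K0" if "r \<in> {0..<1}" for r
    using that by (rule bspec)
  \<comment> \<open>The added 1 accounts for the distance between the approximating polynomials and
    the dilations of \<open>f\<close> on the circle.\<close>
  define K where "K = K0 + 1"
  have "\<exists>p :: complex poly. p \<noteq> 0 \<and> (\<forall>t. cmod t \<le> 1 \<longrightarrow> cmod (poly p t - f (of_real (radial n) * t)) \<le> 1 / (real n + 1))" for n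
    by (intro holomorphic_poly_approx f radial) simp
  then have "\<forall>n. \<exists>p :: complex poly. p \<noteq> 0 \<and> (\<forall>t. cmod t \<le> 1 \<longrightarrow> cmod (poly p t - f (of_real (radial n) * t)) \<le> 1 / (real n + 1))" by blast
  from choice[OF this] obtain p :: "nat \<Rightarrow> complex poly" where
    p: "\<And>n. p n \<noteq> 0" "\<And>n t. cmod t \<le> 1 \<Longrightarrow> cmod (poly (p n) t - f (of_real (radial n) * t)) \<le> 1 / (real n + 1)"
    by blast
  have pK: "(LINT t|circle_lebesgue. cmod (poly (p n) t)) \<le> K" for n
  proof -
    have cf: "continuous_on (sphere 0 1) (\<lambda>t. f (of_real (radial n) * t))"
      by (rule continuous_on_subset[OF continuous_on_dilation(1)[OF f radial(3,2)]]) auto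
    have i1: "integrable circle_lebesgue (\<lambda>t. cmod (f (of_real (radial n) * t)))"
      by (rule integral_circle_indicator) (intro continuous_intros cf)
    have "(LINT t|circle_lebesgue. cmod (poly (p n) t)) \<le> (LINT t|circle_lebesgue. cmod (f (of_real (radial n) * t)) + 1)"
    proof (rule integral_mono_AE)
      show "integrable circle_lebesgue (\<lambda>t. cmod (poly (p n) t))"
        by (rule integral_circle_indicator) (intro continuous_intros)
      show "integrable circle_lebesgue (\<lambda>t. cmod (f (of_real (radial n) * t)) + 1)"
        by (rule integral_circle_indicator) (intro continuous_intros cf)
      show "AE t in circle_lebesgue. cmod (poly (p n) t) \<le> cmod (f (of_real (radial n) * t)) + 1"
        unfolding AE_circle_lebesgue_iff using AE_circle_norm
      proof eventually_elim
        case (elim t)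
        have "1 / (real n + 1) \<le> 1" by simp
        then show ?case
          using p(2)[of t n] elim norm_triangle_ineq2[of "poly (p n) t" "f (of_real (radial n) * t)"] by linarith
      qed
    qed
    also have "\<dots> = (LINT t|circle_lebesgue. cmod (f (of_real (radial n) * t))) + (LINT t|circle_lebesgue. 1)"
      by (rule Bochner_Integration.integral_add[OF i1], rule integral_circle_indicator, rule continuous_on_const)
    also have "\<dots> \<le> K" using K0[of "radial n"] radial(2,3)[of n] by (simp add: K_def)
    finally show ?thesis .
  qed
  have "\<forall>n. \<exists>s. s holomorphic_on ball 0 1 \<and> (\<forall>z. cmod z < 1 \<longrightarrow> cmod (poly (p n) z) \<le> (cmod (s z))\<^sup>2) \<and>
    (\<forall>r\<in>{0..<1}. (LINT t|circle_lebesgue. (cmod (s (of_real r * t)))\<^sup>2) \<le> K) \<and>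
    (\<forall>z. cmod z < 1 \<longrightarrow> (cmod (s z))\<^sup>2 \<le> K * (2 / (1 - cmod z)))"
    by (intro allI poly_majorant p pK)
  from choice[OF this] obtain s :: "nat \<Rightarrow> complex \<Rightarrow> complex" where
    S: "\<forall>n. s n holomorphic_on ball 0 1 \<and> (\<forall>z. cmod z < 1 \<longrightarrow> cmod (poly (p n) z) \<le> (cmod (s n z))\<^sup>2) \<and>
    (\<forall>r\<in>{0..<1}. (LINT t|circle_lebesgue. (cmod (s n (of_real r * t)))\<^sup>2) \<le> K) \<and>
    (\<forall>z. cmod z < 1 \<longrightarrow> (cmod (s n z))\<^sup>2 \<le> K * (2 / (1 - cmod z)))" by (elim exE)
  have s: "s n holomorphic_on ball 0 1" "cmod z < 1 \<Longrightarrow> cmod (poly (p n) z) \<le> (cmod (s n z))\<^sup>2"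
    "r \<in> {0..<1} \<Longrightarrow> (LINT t|circle_lebesgue. (cmod (s n (of_real r * t)))\<^sup>2) \<le> K"
    "cmod z < 1 \<Longrightarrow> (cmod (s n z))\<^sup>2 \<le> K * (2 / (1 - cmod z))" for n z r
    using S[rule_format, of n] by simp_all
  \<comment> \<open>Only the pointwise bound is put into the family: on a compact subset of the disc
    \<open>cmod z\<close> has a maximum below 1, which gives the uniform bound for Montel's
    theorem.\<close>
  define H where "H = {h. h holomorphic_on ball 0 1 \<and> (\<forall>z. cmod z < 1 \<longrightarrow> (cmod (h z))\<^sup>2 \<le> K * (2 / (1 - cmod z)))}"
  have K00: "0 \<le> K"
    using order.trans[OF zero_le_power2 s(4)[of 0 0]] by simp
  obtain g k where g: "g holomorphic_on ball 0 1" "strict_mono (k :: nat \<Rightarrow> nat)"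
    "\<And>x. x \<in> ball 0 1 \<Longrightarrow> ((\<lambda>n. s (k n) x) \<longlongrightarrow> g x) sequentially"
  proof (rule Montel[of "ball 0 1" H s])
    show "range s \<subseteq> H" using s by (auto simp: H_def)
    fix C :: "complex set" assume C: "compact C" "C \<subseteq> ball 0 1"
    show "\<exists>B. \<forall>h\<in>H. \<forall>z\<in>C. norm (h z) \<le> B"
    proof (cases "C = {}")
      case False
      obtain x where x: "x \<in> C" "\<And>y. y \<in> C \<Longrightarrow> cmod y \<le> cmod x"
        using continuous_attains_sup[OF C(1) False, of cmod] by (auto intro: continuous_intros)
      have "norm (h z) \<le> 1 + K * (2 / (1 - cmod x))" if "h \<in> H" "z \<in> C" for h z
      proof -
        have zx: "cmod z \<le> cmod x" "cmod x < 1" using x C that by auto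
        have "norm (h z) \<le> 1 + (cmod (h z))\<^sup>2"
        proof (cases "cmod (h z) \<le> 1")
          case False
          then have "cmod (h z) * 1 \<le> cmod (h z) * cmod (h z)" by (intro mult_left_mono) auto
          then show ?thesis by (simp add: power2_eq_square)
        qed (simp add: add_increasing2)
        also have "(cmod (h z))\<^sup>2 \<le> K * (2 / (1 - cmod z))" using that C zx by (auto simp: H_def)
        also have "\<dots> \<le> K * (2 / (1 - cmod x))" using zx K00 by (intro mult_left_mono divide_left_mono) auto
        finally show ?thesis by simp
      qed
      then show ?thesis by blast
    qed auto
  qed (auto simp: H_def)
  show ?thesis
  proof (intro exI[of _ g] exI[of _ K] conjI g(1) allI impI ballI)
    fix z :: complex assume z: "cmod z < 1"
    have "(\<lambda>n. poly (p n) z - f (of_real (radial n) * z)) \<longlonglongrightarrow> 0"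
    proof (rule Lim_null_comparison)
      show "\<forall>\<^sub>F n in sequentially. norm (poly (p n) z - f (of_real (radial n) * z)) \<le> 1 / (real n + 1)"
        using p(2) z by (intro always_eventually allI) simp
      show "(\<lambda>n. 1 / (real n + 1)) \<longlonglongrightarrow> 0" by real_asymp
    qed
    moreover have "(\<lambda>n. f (of_real (radial n) * z)) \<longlonglongrightarrow> f z"
    proof -
      have "isCont f z" using f z holomorphic_on_imp_continuous_on[OF f] by (simp add: continuous_on_eq_continuous_at)
      moreover have "(\<lambda>n. of_real (radial n) * z) \<longlonglongrightarrow> of_real 1 * z" by (intro tendsto_intros radial)
      ultimately show ?thesis using isCont_tendsto_compose by fastforce
    qed
    ultimately have "(\<lambda>n. (poly (p n) z - f (of_real (radial n) * z)) + f (of_real (radial n) * z)) \<longlonglongrightarrow> 0 + f z"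
      by (rule tendsto_add)
    then have "(\<lambda>n. poly (p n) z) \<longlonglongrightarrow> f z" by simp
    then have pf: "(\<lambda>n. poly (p (k n)) z) \<longlonglongrightarrow> f z"
      using LIMSEQ_subseq_LIMSEQ[OF _ g(2)] unfolding o_def by blast
    have sg: "(\<lambda>n. s (k n) z) \<longlonglongrightarrow> g z" using g(3) z by simp
    show "cmod (f z) \<le> (cmod (g z))\<^sup>2"
    proof (rule tendsto_le[OF sequentially_bot])
      show "(\<lambda>n. cmod (poly (p (k n)) z)) \<longlonglongrightarrow> cmod (f z)" by (intro tendsto_intros pf)
      show "(\<lambda>n. (cmod (s (k n) z))\<^sup>2) \<longlonglongrightarrow> (cmod (g z))\<^sup>2" by (intro tendsto_intros sg)
      show "\<forall>\<^sub>F n in sequentially. cmod (poly (p (k n)) z) \<le> (cmod (s (k n) z))\<^sup>2"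
        by (intro always_eventually allI s z)
    qed
  next
    fix r :: real assume r: "r \<in> {0..<1}"
    have rb: "cmod (of_real r * t) = r" if "cmod t = 1" for t using that r by (simp add: norm_mult)
    have cs: "continuous_on (sphere 0 1) (\<lambda>t. h (of_real r * t))" if "h holomorphic_on ball 0 1" for h
      by (rule continuous_on_subset[OF continuous_on_dilation(1)[OF that]]) (use r in auto)
    have "(\<lambda>n. LINT t|circle_lebesgue. (cmod (s (k n) (of_real r * t)))\<^sup>2) \<longlonglongrightarrow>
        (LINT t|circle_lebesgue. (cmod (g (of_real r * t)))\<^sup>2)"
    proof (rule integral_dominated_convergence[where w = "\<lambda>_. K * (2 / (1 - r))"])
      show "(\<lambda>t. (cmod (g (of_real r * t)))\<^sup>2) \<in> borel_measurable circle_lebesgue"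
        by (rule borel_measurable_integrable, rule integral_circle_indicator) (intro continuous_intros cs g)
      show "(\<lambda>t. (cmod (s (k n) (of_real r * t)))\<^sup>2) \<in> borel_measurable circle_lebesgue" for n
        by (rule borel_measurable_integrable, rule integral_circle_indicator) (intro continuous_intros cs s)
      show "integrable circle_lebesgue (\<lambda>_. K * (2 / (1 - r)))"
        by (rule integral_circle_indicator, rule continuous_on_const)
      show "AE t in circle_lebesgue. (\<lambda>n. (cmod (s (k n) (of_real r * t)))\<^sup>2) \<longlonglongrightarrow> (cmod (g (of_real r * t)))\<^sup>2"
        unfolding AE_circle_lebesgue_iff using AE_circle_norm
      proof eventually_elim
        case (elim t)
        show ?case using rb[OF elim] r by (intro tendsto_intros g) simp
      qed
      show "AE t in circle_lebesgue. norm ((cmod (s (k n) (of_real r * t)))\<^sup>2) \<le> K * (2 / (1 - r))" for n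
        unfolding AE_circle_lebesgue_iff using AE_circle_norm
      proof eventually_elim
        case (elim t)
        show ?case using rb[OF elim] r s(4)[of "of_real r * t" "k n"] by simp
      qed
    qed
    then show "(LINT t|circle_lebesgue. (cmod (g (of_real r * t)))\<^sup>2) \<le> K"
      by (rule LIMSEQ_le_const2) (intro exI allI impI s(3) r)
  qed
qed

text \<open>On the circle the kernel is 1 plus twice the sum of \<open>(cnj t * z) ^ n\<close> over
  positive \<open>n\<close>, hence the special factor at \<open>n = 0\<close> in \<open>e\<close>.
  Termwise integration yields a power series in \<open>z\<close>.\<close>

lemma Herglotz_holomorphic:
  assumes w: "integrable circle_lebesgue w"
  shows "(\<lambda>z. LINT t|circle_lebesgue. (t + z) / (t - z) * complex_of_real (w t)) holomorphic_on ball 0 1"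
proof -
  define e where "e n t = (if n = 0 then 1 else 2) * (cnj t ^ n * complex_of_real (w t))" for n :: nat and t
  define c where "c n = (LINT t|circle_lebesgue. e n t)" for n
  have wm: "w \<in> borel_measurable circle_lebesgue" using w by auto
  have em: "e n \<in> borel_measurable circle_lebesgue" for n
  proof -
    have "(\<lambda>t. cnj t ^ n) \<in> borel_measurable circle_lebesgue"
      by (intro measurable_circle_lebesgue borel_measurable_continuous_onI continuous_intros)
    then show ?thesis using wm unfolding e_def by measurable
  qed
  have ebd: "AE t in circle_lebesgue. norm (e n t) \<le> 2 * \<bar>w t\<bar>" for n
    unfolding AE_circle_lebesgue_iff using AE_circle_norm
    by eventually_elim (auto simp: e_def norm_mult norm_power)
  have ei: "integrable circle_lebesgue (e n)" for n
    by (rule Bochner_Integration.integrable_bound[of _ "\<lambda>t. 2 * \<bar>w t\<bar>"]) (use w em ebd in auto)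
  have "(\<lambda>n. c n * (z - 0) ^ n) sums (LINT t|circle_lebesgue. (t + z) / (t - z) * complex_of_real (w t))"
    if z: "z \<in> ball 0 1" for z
  proof -
    have geo: "(\<lambda>n. e n t * z ^ n) sums ((t + z) / (t - z) * complex_of_real (w t))" if t: "cmod t = 1" for t
    proof -
      define x where "x = cnj t * z"
      have x: "cmod x < 1" using z t by (simp add: x_def norm_mult)
      have "(\<lambda>n. 2 * x ^ n - (if n = 0 then 1 else 0)) sums (2 * (1 / (1 - x)) - 1)"
        by (intro sums_diff sums_mult geometric_sums x sums_single)
      also have "2 * (1 / (1 - x)) - 1 = (1 + x) / (1 - x)"
      proof -
        have "1 - x \<noteq> 0" using x by auto
        then show ?thesis by (simp add: divide_simps)
      qed
      also have "(1 + x) / (1 - x) = (t * (1 + x)) / (t * (1 - x))" using t by auto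
      also have "t * (1 + x) = t + z" using cnj_mult_norm1[OF t] by (simp add: x_def algebra_simps)
      also have "t * (1 - x) = t - z" using cnj_mult_norm1[OF t] by (simp add: x_def algebra_simps)
      finally have "(\<lambda>n. (2 * x ^ n - (if n = 0 then 1 else 0)) * of_real (w t)) sums ((t + z) / (t - z) * complex_of_real (w t))"
        by (rule sums_mult2)
      also have "(\<lambda>n. (2 * x ^ n - (if n = 0 then 1 else 0)) * of_real (w t)) = (\<lambda>n. e n t * z ^ n)"
        by (auto simp: e_def x_def power_mult_distrib)
      finally show ?thesis .
    qed
    have "(\<lambda>n. LINT t|circle_lebesgue. e n t * z ^ n) sums (LINT t|circle_lebesgue. (\<Sum>n. e n t * z ^ n))"
    proof (rule sums_integral)
      show "integrable circle_lebesgue (\<lambda>t. e n t * z ^ n)" for n using ei by (rule integrable_mult_left)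
      show "AE t in circle_lebesgue. summable (\<lambda>n. norm (e n t * z ^ n))"
        unfolding AE_circle_lebesgue_iff using AE_circle_norm
      proof eventually_elim
        case (elim t)
        have "summable (\<lambda>n. 2 * \<bar>w t\<bar> * cmod z ^ n)" using z by (intro summable_mult summable_geometric) simp
        then show ?case
          by (rule summable_comparison_test'[where N = 0])
             (use elim in \<open>auto simp: e_def norm_mult norm_power intro!: mult_right_mono\<close>)
      qed
      have "summable (\<lambda>n. (LINT t|circle_lebesgue. 2 * \<bar>w t\<bar>) * cmod z ^ n)"
        using z by (intro summable_mult summable_geometric) simp
      then show "summable (\<lambda>n. LINT t|circle_lebesgue. norm (e n t * z ^ n))"
      proof (rule summable_comparison_test'[where N = 0])
        fix n
        have "(LINT t|circle_lebesgue. norm (e n t)) \<le> (LINT t|circle_lebesgue. 2 * \<bar>w t\<bar>)"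
          by (intro integral_mono_AE integrable_norm ei ebd) (use w in auto)
        then show "norm (LINT t|circle_lebesgue. norm (e n t * z ^ n)) \<le> (LINT t|circle_lebesgue. 2 * \<bar>w t\<bar>) * cmod z ^ n"
          by (simp add: norm_mult norm_power mult_right_mono)
      qed
    qed
    also have "(LINT t|circle_lebesgue. (\<Sum>n. e n t * z ^ n)) = (LINT t|circle_lebesgue. (t + z) / (t - z) * complex_of_real (w t))"
      by (rule integral_circle_cong) (use geo in \<open>simp add: sums_iff\<close>)
    finally show ?thesis by (simp add: c_def)
  qed
  then show ?thesis by (rule power_series_holomorphic)
qed

lemma Re_Herglotz:
  assumes w: "integrable circle_lebesgue w" and z: "cmod z < 1"
  shows "Re (LINT t|circle_lebesgue. (t + z) / (t - z) * complex_of_real (w t)) = (LINT t|circle_lebesgue. poisson z t * w t)"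
proof -
  have "Re (LINT t|circle_lebesgue. (t + z) / (t - z) * complex_of_real (w t)) =
     (LINT t|circle_lebesgue. Re ((t + z) / (t - z) * complex_of_real (w t)))"
    by (rule integral_Re[symmetric], rule integrable_Herglotz[OF w z])
  also have "\<dots> = (LINT t|circle_lebesgue. poisson z t * w t)"
  proof (rule integral_circle_cong)
    fix t :: complex assume t: "cmod t = 1"
    have "Re ((t + z) / (t - z)) = ((Re t + Re z) * (Re t - Re z) + (Im t + Im z) * (Im t - Im z)) / (cmod (t - z))\<^sup>2"
      by (simp add: Re_divide cmod_power2)
    also have "(Re t + Re z) * (Re t - Re z) + (Im t + Im z) * (Im t - Im z) = (cmod t)\<^sup>2 - (cmod z)\<^sup>2"
      unfolding cmod_power2 by (simp add: power2_eq_square algebra_simps)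
    finally have "Re ((t + z) / (t - z)) = poisson z t" using t by (simp add: poisson_def)
    then show "Re ((t + z) / (t - z) * complex_of_real (w t)) = poisson z t * w t"
      by (simp del: times_divide_eq_left)
  qed
  finally show ?thesis .
qed

text \<open>A square majorant \<open>g\<close> is itself dominated by the Poisson integral of an
  integrable \<open>w\<close>. The outer function with boundary log-modulus \<open>- 2 * w\<close>
  is therefore at most \<open>exp (- 2 * cmod (g z))\<close>, which decays fast enough to make its
  product with \<open>f\<close> bounded; it serves as the denominator.\<close>

theorem H1_smirnov:
  assumes "hardy_H1 f"
  shows "smirnov f"
proof -
  have f: "f holomorphic_on ball 0 1" using assms by (simp add: hardy_H1_def)
  from H1_square_majorant[OF assms] obtain g K where G: "g holomorphic_on ball 0 1 \<and> (\<forall>z. cmod z < 1 \<longrightarrow> cmod (f z) \<le> (cmod (g z))\<^sup>2) \<and>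
    (\<forall>r\<in>{0..<1}. (LINT t|circle_lebesgue. (cmod (g (of_real r * t)))\<^sup>2) \<le> K)" by (elim exE)
  note g = conjunct1[OF G] and fg = conjunct1[OF conjunct2[OF G]] and gK = conjunct2[OF conjunct2[OF G]]
  from H2_radial_approx[OF g gK] obtain \<rho> :: "nat \<Rightarrow> real" and W where
    H: "(\<forall>n. 0 < \<rho> n \<and> \<rho> n < 1) \<and> \<rho> \<longlonglongrightarrow> 1 \<and> (\<forall>n. W n \<in> borel_measurable borel) \<and>
    (\<forall>n. (\<integral>\<^sup>+t. W n t \<partial>circle_borel) \<le> ennreal (2 * (1/4) ^ n)) \<and>
    (\<forall>n z. cmod z < 1 \<longrightarrow> ennreal (cmod (g z - g (of_real (\<rho> n) * z))) \<le>
            (\<integral>\<^sup>+t. W n t * ennreal (poisson z t) \<partial>circle_borel))" by (elim exE)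
  note H1 = conjunct1[OF H] and H2 = conjunct2[OF conjunct2[OF H]]
  note H3 = conjunct2[OF H2] and H4 = conjunct2[OF conjunct2[OF H2]]
  have \<rho>: "0 \<le> \<rho> 0" "\<rho> 0 < 1" using H1 by (auto intro: less_imp_le)
  have Wm [measurable]: "W 0 \<in> borel_measurable borel" by (rule spec[OF conjunct1[OF H2]])
  have Wi: "(\<integral>\<^sup>+t. W 0 t \<partial>circle_borel) < \<infinity>"
    by (rule le_less_trans[OF spec[OF conjunct1[OF H3]]]) simp
  have gW: "ennreal (cmod (g z - g (of_real (\<rho> 0) * z))) \<le>
            (\<integral>\<^sup>+t. W 0 t * ennreal (poisson z t) \<partial>circle_borel)" if "cmod z < 1" for z
    by (rule mp[OF spec[OF spec[OF H4]] that])
  have "compact ((\<lambda>t. g (of_real (\<rho> 0) * t)) ` cball 0 1)"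
    by (intro compact_continuous_image continuous_on_dilation[OF g \<rho>]) simp
  then have "bounded ((\<lambda>t. g (of_real (\<rho> 0) * t)) ` cball 0 1)" by (rule compact_imp_bounded)
  then obtain C0 where C0b: "\<forall>x\<in>(\<lambda>t. g (of_real (\<rho> 0) * t)) ` cball 0 1. cmod x \<le> C0"
    unfolding bounded_iff by (elim exE)
  have C0: "cmod (g (of_real (\<rho> 0) * z)) \<le> C0" if "cmod z \<le> 1" for z
    by (rule bspec[OF C0b], rule imageI) (use that in simp)
  have C00: "0 \<le> C0" using order.trans[OF norm_ge_zero C0[of 0]] by simp
  \<comment> \<open>\<open>C0\<close> majorizes one dilation of \<open>g\<close> and the Poisson
    integral of \<open>W 0\<close> the distance of \<open>g\<close> from it, so the Poisson integral
    of \<open>w\<close> majorizes \<open>cmod (g z)\<close>.\<close>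
  define w where "w t = C0 + enn2real (W 0 t)" for t
  have Wae: "AE t in circle_borel. W 0 t \<noteq> \<infinity>" by (rule nn_integral_PInf_AE) (use Wi in auto)
  have wi': "integrable circle_borel (\<lambda>t. enn2real (W 0 t))"
  proof (rule integrableI_nonneg)
    have "(\<integral>\<^sup>+t. ennreal (enn2real (W 0 t)) \<partial>circle_borel) = (\<integral>\<^sup>+t. W 0 t \<partial>circle_borel)"
      by (rule nn_integral_cong_AE) (use Wae in \<open>eventually_elim, simp add: less_top\<close>)
    then show "(\<integral>\<^sup>+t. ennreal (enn2real (W 0 t)) \<partial>circle_borel) < \<infinity>" using Wi by simp
  qed auto
  have wm [measurable]: "w \<in> borel_measurable borel" unfolding w_def by measurable
  have wi: "integrable circle_borel w" unfolding w_def using wi' by simp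
  have wL: "integrable circle_lebesgue w" using wi integrable_circle_lebesgue_iff[OF wm] by simp
  have w0: "0 \<le> w t" for t using C00 by (simp add: w_def)
  have gw: "cmod (g z) \<le> (LINT t|circle_lebesgue. poisson z t * w t)" if z: "cmod z < 1" for z
  proof -
    have ipw: "integrable circle_borel (\<lambda>t. poisson z t * w t)"
    proof (rule Bochner_Integration.integrable_bound)
      show "integrable circle_borel (\<lambda>t. 2 / (1 - cmod z) * w t)" using wi by simp
      show "AE t in circle_borel. norm (poisson z t * w t) \<le> norm (2 / (1 - cmod z) * w t)"
        using AE_circle_norm
      proof eventually_elim
        case (elim t)
        then show ?case using mult_right_mono[OF poisson_le[OF z elim] w0[of t]] poisson_nonneg[OF z, of t] w0[of t] z
          by (simp add: abs_mult)
      qed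
    qed measurable
    have "ennreal (cmod (g z)) \<le> ennreal (C0 + cmod (g z - g (of_real (\<rho> 0) * z)))"
      using C0[of z] z norm_triangle_ineq2[of "g z" "g (of_real (\<rho> 0) * z)"] by (intro ennreal_leI) linarith
    also have "\<dots> = ennreal C0 + ennreal (cmod (g z - g (of_real (\<rho> 0) * z)))" using C00 by simp
    also have "\<dots> \<le> (\<integral>\<^sup>+t. ennreal C0 * ennreal (poisson z t) \<partial>circle_borel) + (\<integral>\<^sup>+t. W 0 t * ennreal (poisson z t) \<partial>circle_borel)"
      by (intro add_mono gW z) (simp add: nn_integral_cmult nn_integral_poisson[OF z])
    also have "\<dots> = (\<integral>\<^sup>+t. ennreal C0 * ennreal (poisson z t) + W 0 t * ennreal (poisson z t) \<partial>circle_borel)"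
      by (rule nn_integral_add[symmetric]) measurable
    also have "\<dots> = (\<integral>\<^sup>+t. ennreal (poisson z t * w t) \<partial>circle_borel)"
    proof (rule nn_integral_cong_AE)
      show "AE t in circle_borel. ennreal C0 * ennreal (poisson z t) + W 0 t * ennreal (poisson z t) = ennreal (poisson z t * w t)"
        using Wae
      proof eventually_elim
        case (elim t)
        then have "W 0 t = ennreal (enn2real (W 0 t))" by (simp add: less_top)
        then have "ennreal C0 + W 0 t = ennreal (w t)" unfolding w_def using C00 by (metis ennreal_plus enn2real_nonneg)
        then show ?case using poisson_nonneg[OF z, of t] w0[of t]
          unfolding distrib_right[symmetric] by (simp add: ennreal_mult mult.commute)
      qed
    qed
    also have "\<dots> = ennreal (LINT t|circle_borel. poisson z t * w t)"
      by (rule nn_integral_eq_integral[OF ipw]) (use w0 poisson_nonneg[OF z] in auto)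
    also have "(LINT t|circle_borel. poisson z t * w t) = (LINT t|circle_lebesgue. poisson z t * w t)"
      by (rule integral_circle_lebesgue[symmetric]) measurable
    finally have "ennreal (cmod (g z)) \<le> ennreal (LINT t|circle_lebesgue. poisson z t * w t)" .
    moreover have "0 \<le> (LINT t|circle_lebesgue. poisson z t * w t)"
      by (rule Bochner_Integration.integral_nonneg) (use w0 poisson_nonneg[OF z] in auto)
    ultimately show ?thesis by (subst (asm) ennreal_le_iff) auto
  qed
  \<comment> \<open>The factor 2 matches the square in the majorant:
    \<open>x\<^sup>2 * exp (- 2 * x)\<close> is at most 1 for nonnegative \<open>x\<close>.\<close>
  define w2 where "w2 t = - 2 * w t" for t
  have w2: "integrable circle_lebesgue w2" unfolding w2_def using wL by simp
  define u2 where "u2 z = exp (LINT t|circle_lebesgue. (t + z) / (t - z) * complex_of_real (w2 t))" for z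
  have out: "outer_function u2"
    unfolding outer_function_def by (intro exI[of _ 1] exI[of _ w2] conjI w2) (auto simp: u2_def)
  have hol: "u2 holomorphic_on ball 0 1"
    unfolding u2_def by (intro holomorphic_intros Herglotz_holomorphic w2)
  have nu2: "cmod (u2 z) = exp (- 2 * (LINT t|circle_lebesgue. poisson z t * w t))" if z: "cmod z < 1" for z
  proof -
    have "(LINT t|circle_lebesgue. poisson z t * w2 t) = (LINT t|circle_lebesgue. - 2 * (poisson z t * w t))"
      by (rule integral_circle_cong) (simp add: w2_def)
    also have "\<dots> = - 2 * (LINT t|circle_lebesgue. poisson z t * w t)" by (rule integral_mult_right_zero)
    finally show ?thesis unfolding u2_def norm_exp_eq_Re Re_Herglotz[OF w2 z] by simp
  qed
  have b2: "cmod (u2 z) \<le> exp (- 2 * cmod (g z))" if "cmod z < 1" for z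
    unfolding nu2[OF that] using gw[OF that] by simp
  have bu2: "bounded_analytic u2"
    by (rule bounded_analyticI[OF hol, of 1]) (use b2 in \<open>force intro: order.trans\<close>)
  have bu1: "bounded_analytic (\<lambda>z. f z * u2 z)"
  proof (rule bounded_analyticI[of _ 1])
    show "(\<lambda>z. f z * u2 z) holomorphic_on ball 0 1" by (intro holomorphic_intros f hol)
    fix z :: complex assume z: "cmod z < 1"
    have "cmod (f z * u2 z) \<le> (cmod (g z))\<^sup>2 * exp (- 2 * cmod (g z))"
      unfolding norm_mult using fg z b2[OF z] by (intro mult_mono) auto
    also have "\<dots> \<le> (exp (cmod (g z)))\<^sup>2 * exp (- 2 * cmod (g z))"
    proof -
      have "cmod (g z) \<le> exp (cmod (g z))" using exp_ge_add_one_self[of "cmod (g z)"] by linarith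
      then show ?thesis by (intro mult_right_mono power_mono) auto
    qed
    also have "\<dots> = 1" by (simp add: power2_eq_square flip: exp_add)
    finally show "cmod (f z * u2 z) \<le> 1" .
  qed
  show ?thesis
    unfolding smirnov_def
    by (intro conjI f exI[of _ "\<lambda>z. f z * u2 z"] exI[of _ u2] bu1 bu2 out) (simp add: u2_def)
qed

text \<open>Fatou's lemma for the moduli along the radii; that the limits exist almost everywhere
  comes from the Smirnov class.\<close>

lemma H1_nt_lim_integrable:
  assumes "hardy_H1 f"
  shows "integrable circle_lebesgue (nt_lim f)"
proof (rule integrableI_bounded)
  have f: "f holomorphic_on ball 0 1" using assms by (simp add: hardy_H1_def)
  have ae: "AE t in circle_borel. \<exists>l. has_nt_limit f t l" by (rule smirnov_nt_limit_AE[OF H1_smirnov[OF assms]])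
  show "nt_lim f \<in> borel_measurable circle_lebesgue" by (rule measurable_nt_lim[OF f ae])
  obtain K0 where "\<forall>r\<in>{0..<1}. (LINT t|circle_lebesgue. cmod (f (of_real r * t))) \<le> K0"
    using assms unfolding hardy_H1_def bdd_above_def by blast
  then have K0: "(LINT t|circle_lebesgue. cmod (f (of_real r * t))) \<le> K0" if "r \<in> {0..<1}" for r
    using that by (rule bspec)
  let ?h = "\<lambda>n t. indicator (sphere 0 1) t *\<^sub>R f (of_real (radial n) * t)"
  have hm: "?h n \<in> borel_measurable borel" for n by (rule measurable_radial_dilation[OF f])
  have hm': "(\<lambda>t. ennreal (cmod (?h n t))) \<in> borel_measurable circle_borel" for n
  proof -
    note [measurable] = hm[of n]
    show ?thesis by measurable
  qed
  have "(\<integral>\<^sup>+t. ennreal (cmod (nt_lim f t)) \<partial>circle_lebesgue) = (\<integral>\<^sup>+t. ennreal (cmod (nt_lim f t)) \<partial>circle_borel)"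
    by (rule nn_integral_circle_lebesgue)
  also have "\<dots> = (\<integral>\<^sup>+t. liminf (\<lambda>n. ennreal (cmod (?h n t))) \<partial>circle_borel)"
  proof (rule nn_integral_cong_AE)
    show "AE t in circle_borel. ennreal (cmod (nt_lim f t)) = liminf (\<lambda>n. ennreal (cmod (?h n t)))"
      using ae AE_circle_norm
    proof eventually_elim
      case (elim t)
      have "(\<lambda>n. f (of_real (radial n) * t)) \<longlonglongrightarrow> nt_lim f t"
        by (intro has_nt_limit_radial has_nt_limit_nt_lim elim)
      then have "(\<lambda>n. ennreal (cmod (f (of_real (radial n) * t)))) \<longlonglongrightarrow> ennreal (cmod (nt_lim f t))"
        by (intro tendsto_intros)
      then have "liminf (\<lambda>n. ennreal (cmod (f (of_real (radial n) * t)))) = ennreal (cmod (nt_lim f t))"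
        by (intro lim_imp_Liminf) auto
      then show ?case using elim(2) by simp
    qed
  qed
  also have "\<dots> \<le> liminf (\<lambda>n. \<integral>\<^sup>+t. ennreal (cmod (?h n t)) \<partial>circle_borel)"
    by (rule nn_integral_liminf) (rule hm')
  also have "\<dots> \<le> ennreal K0"
  proof -
    have "(\<integral>\<^sup>+t. ennreal (cmod (?h n t)) \<partial>circle_borel) \<le> ennreal K0" for n
    proof -
      have cf: "continuous_on (sphere 0 1) (\<lambda>t. cmod (f (of_real (radial n) * t)))"
        by (intro continuous_intros continuous_on_subset[OF continuous_on_dilation(1)[OF f radial(3,2)]]) auto
      have "(\<integral>\<^sup>+t. ennreal (cmod (?h n t)) \<partial>circle_borel) = (\<integral>\<^sup>+t. ennreal (cmod (f (of_real (radial n) * t))) \<partial>circle_lebesgue)"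
        unfolding nn_integral_circle_lebesgue
        by (rule nn_integral_cong_AE) (use AE_circle_norm in \<open>eventually_elim, simp\<close>)
      also have "\<dots> = ennreal (LINT t|circle_lebesgue. cmod (f (of_real (radial n) * t)))"
        by (rule nn_integral_eq_integral[OF integral_circle_indicator(2)[OF cf]]) auto
      also have "\<dots> \<le> ennreal K0" using K0[of "radial n"] radial(2,3)[of n] by (intro ennreal_leI) auto
      finally show ?thesis .
    qed
    then have "liminf (\<lambda>n. \<integral>\<^sup>+t. ennreal (cmod (?h n t)) \<partial>circle_borel) \<le> liminf (\<lambda>n. ennreal K0)"
      by (intro Liminf_mono always_eventually allI)
    then show ?thesis by (simp add: Liminf_const)
  qed
  finally show "(\<integral>\<^sup>+t. ennreal (cmod (nt_lim f t)) \<partial>circle_lebesgue) < \<infinity>" by (rule le_less_trans) simp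
qed

section \<open>The deck group\<close>

lemma Moebius_norm_le_1:
  assumes "cmod w < 1" "cmod z \<le> 1"
  shows "cmod (Moebius_function \<alpha> w z) \<le> 1"
  using Moebius_function_norm_lt_1[OF assms(1), of z] Moebius_norm_eq_1[OF assms(1), of z] assms(2)
  by (cases "cmod z = 1") (auto intro: less_imp_le)

lemma Moebius_inverse:
  assumes w: "cmod w < 1" and z: "cmod z \<le> 1"
  shows "Moebius_function (- \<alpha>) (- (exp (\<i> * of_real \<alpha>) * w)) (Moebius_function \<alpha> w z) = z"
proof -
  define u where "u = exp (\<i> * of_real \<alpha>)"
  have u: "cmod u = 1" by (simp add: u_def)
  have uc: "exp (\<i> * of_real (- \<alpha>)) = cnj u" by (simp add: u_def exp_cnj)
  have nz: "1 - cnj w * z \<noteq> 0" by (rule one_minus_cnj_mult_nz[OF w z])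
  have w2: "1 - cnj w * w \<noteq> 0" by (rule one_minus_cnj_mult_nz[OF w]) (use w in simp)
  define q where "q = (z - w) / (1 - cnj w * z)"
  have uu: "cnj u * u = 1" using cnj_mult_norm1[OF u] by (simp add: mult.commute)
  have M: "Moebius_function \<alpha> w z = u * q" by (simp add: Moebius_function_def u_def q_def)
  have "Moebius_function (- \<alpha>) (- (u * w)) (u * q) = (cnj u * u) * (q + w) / (1 + (cnj u * u) * cnj w * q)"
    unfolding Moebius_function_def uc by (simp add: algebra_simps)
  also have "\<dots> = (q + w) / (1 + cnj w * q)" by (simp add: uu)
  also have "q + w = z * (1 - cnj w * w) / (1 - cnj w * z)"
    unfolding q_def using nz by (simp add: field_simps)
  also have "1 + cnj w * q = (1 - cnj w * w) / (1 - cnj w * z)"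
    unfolding q_def using nz by (simp add: field_simps)
  also have "z * (1 - cnj w * w) / (1 - cnj w * z) / ((1 - cnj w * w) / (1 - cnj w * z)) = z" using nz w2 by simp
  finally show ?thesis unfolding M u_def .
qed

text \<open>After normalization at 0 the Schwarz lemma applies to the map and to its inverse. The
  two inequalities at the single point \<open>1/2\<close> combine to an equality, which already
  forces a rotation.\<close>

lemma disc_automorphism_Moebius:
  assumes F: "F holomorphic_on ball 0 1" "\<And>z. cmod z < 1 \<Longrightarrow> cmod (F z) < 1"
    and G: "G holomorphic_on ball 0 1" "\<And>z. cmod z < 1 \<Longrightarrow> cmod (G z) < 1"
    and FG: "\<And>z. cmod z < 1 \<Longrightarrow> F (G z) = z" and GF: "\<And>z. cmod z < 1 \<Longrightarrow> G (F z) = z"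
  shows "\<exists>\<theta> a. cmod a < 1 \<and> (\<forall>z. cmod z < 1 \<longrightarrow> F z = Moebius_function \<theta> a z)"
proof -
  define a where "a = G 0"
  have a: "cmod a < 1" unfolding a_def by (rule G) simp
  have a': "cmod (- a) < 1" using a by simp
  let ?M = "Moebius_function 0 a" and ?N = "Moebius_function 0 (- a)"
  define \<Phi> where "\<Phi> z = F (?N z)" for z
  define \<Psi> where "\<Psi> z = ?M (G z)" for z
  have h\<Phi>: "\<Phi> holomorphic_on ball 0 1"
    unfolding \<Phi>_def by (rule holomorphic_on_compose_gen[OF Moebius_function_holomorphic[OF a'] F(1), unfolded o_def])
      (use Moebius_function_norm_lt_1[OF a'] in auto)
  have h\<Psi>: "\<Psi> holomorphic_on ball 0 1"
    unfolding \<Psi>_def by (rule holomorphic_on_compose_gen[OF G(1) Moebius_function_holomorphic[OF a], unfolded o_def]) (use G in auto)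
  have b\<Phi>: "cmod (\<Phi> z) < 1" if "cmod z < 1" for z
    unfolding \<Phi>_def by (intro F Moebius_function_norm_lt_1 a' that)
  have b\<Psi>: "cmod (\<Psi> z) < 1" if "cmod z < 1" for z
    unfolding \<Psi>_def by (intro G Moebius_function_norm_lt_1 a that)
  have \<Phi>0: "\<Phi> 0 = 0" using FG[of 0] by (simp add: \<Phi>_def Moebius_function_of_zero a_def)
  have \<Psi>0: "\<Psi> 0 = 0" by (simp add: \<Psi>_def a_def Moebius_function_eq_zero)
  have inv: "\<Psi> (\<Phi> z) = z" if z: "cmod z < 1" for z
    unfolding \<Psi>_def \<Phi>_def GF[OF Moebius_function_norm_lt_1[OF a' z]]
    using Moebius_function_compose[of a "- a" z] a z by simp
  have "cmod (\<Phi> (1/2)) = cmod (1/2 :: complex)"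
  proof (rule antisym)
    show "cmod (\<Phi> (1/2)) \<le> cmod (1/2 :: complex)" by (rule Schwarz_Lemma(1)[OF h\<Phi> \<Phi>0 b\<Phi>]) auto
    have "cmod (\<Psi> (\<Phi> (1/2))) \<le> cmod (\<Phi> (1/2))"
      by (rule Schwarz_Lemma(1)[OF h\<Psi> \<Psi>0 b\<Psi>]) (auto intro: b\<Phi>)
    then show "cmod (1/2 :: complex) \<le> cmod (\<Phi> (1/2))" using inv[of "1/2"] by simp
  qed
  then have "\<exists>z. norm z < 1 \<and> z \<noteq> 0 \<and> norm (\<Phi> z) = norm z" by (intro exI[of _ "1/2"]) simp
  then have "\<exists>\<alpha>. (\<forall>z. norm z < 1 \<longrightarrow> \<Phi> z = \<alpha> * z) \<and> norm \<alpha> = 1"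
    using Schwarz_Lemma(3)[OF h\<Phi> \<Phi>0 b\<Phi>, of 0] by simp
  then obtain \<alpha> where \<alpha>: "\<forall>z. norm z < 1 \<longrightarrow> \<Phi> z = \<alpha> * z" "norm \<alpha> = 1" by blast
  have "F z = Moebius_function (Arg \<alpha>) a z" if z: "cmod z < 1" for z
  proof -
    have "F z = \<Phi> (?M z)"
      unfolding \<Phi>_def using Moebius_function_compose[of "- a" a z] a z by simp
    also have "\<dots> = \<alpha> * ?M z" using \<alpha>(1) Moebius_function_norm_lt_1[OF a z] by blast
    also have "\<alpha> = exp (\<i> * of_real (Arg \<alpha>))"
    proof -
      have "\<alpha> \<noteq> 0" using \<alpha>(2) by auto
      then have "\<alpha> = of_real (cmod \<alpha>) * exp (\<i> * of_real (Arg \<alpha>))" by (rule Arg_eq)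
      then show ?thesis by (simp only: \<alpha>(2) of_real_1 mult_1)
    qed
    finally show ?thesis by (simp add: Moebius_function_def)
  qed
  then show ?thesis using a by blast
qed

lemma deck_groupE:
  assumes "\<gamma> \<in> deck_group \<Lambda>"
  obtains \<theta> w where "cmod w < 1" "\<gamma> = restrict (Moebius_function \<theta> w) (cball 0 1)"
    "\<And>z. cmod z < 1 \<Longrightarrow> \<Lambda> (\<gamma> z) = \<Lambda> z"
  using assms unfolding deck_group_def moebius_disc_automorphisms_def by auto

lemma deck_group_ball: "\<gamma> \<in> deck_group \<Lambda> \<Longrightarrow> cmod z < 1 \<Longrightarrow> cmod (\<gamma> z) < 1"
  by (elim deck_groupE) (simp add: Moebius_function_norm_lt_1)

lemma deck_group_invariant: "\<gamma> \<in> deck_group \<Lambda> \<Longrightarrow> cmod z < 1 \<Longrightarrow> \<Lambda> (\<gamma> z) = \<Lambda> z"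
  by (elim deck_groupE) simp

lemma deck_group_inverse:
  assumes "\<gamma> \<in> deck_group \<Lambda>"
  shows "\<exists>\<gamma>'\<in>deck_group \<Lambda>. \<forall>z. cmod z \<le> 1 \<longrightarrow> \<gamma>' (\<gamma> z) = z \<and> \<gamma> (\<gamma>' z) = z"
proof -
  obtain \<theta> w where w: "cmod w < 1" "\<gamma> = restrict (Moebius_function \<theta> w) (cball 0 1)"
    "\<And>z. cmod z < 1 \<Longrightarrow> \<Lambda> (\<gamma> z) = \<Lambda> z" using deck_groupE[OF assms] by blast
  define v where "v = - (exp (\<i> * of_real \<theta>) * w)"
  have v: "cmod v < 1" using w by (simp add: v_def norm_mult)
  have wv: "- (exp (\<i> * of_real (- \<theta>)) * v) = w" by (simp add: v_def flip: exp_add mult.assoc)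
  define \<gamma>' where "\<gamma>' = restrict (Moebius_function (- \<theta>) v) (cball 0 1)"
  have inv1: "\<gamma>' (\<gamma> z) = z" if "cmod z \<le> 1" for z
    using Moebius_inverse[OF w(1) that, of \<theta>] Moebius_norm_le_1[OF w(1) that] that by (simp add: w(2) \<gamma>'_def v_def)
  have inv2: "\<gamma> (\<gamma>' z) = z" if "cmod z \<le> 1" for z
    using Moebius_inverse[OF v that, of "- \<theta>"] Moebius_norm_le_1[OF v that] that wv by (simp add: w(2) \<gamma>'_def)
  have "\<gamma>' \<in> deck_group \<Lambda>"
    unfolding deck_group_def moebius_disc_automorphisms_def
  proof (intro CollectI conjI ballI)
    show "\<exists>\<theta> w. \<gamma>' = restrict (Moebius_function \<theta> w) (cball 0 1) \<and> cmod w < 1" using v \<gamma>'_def by blast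
    fix z :: complex assume "z \<in> ball 0 1"
    then have z: "cmod z < 1" by simp
    then have "cmod (\<gamma>' z) < 1" unfolding \<gamma>'_def using Moebius_function_norm_lt_1[OF v z] by simp
    from w(3)[OF this] show "\<Lambda> (\<gamma>' z) = \<Lambda> z" using inv2[of z] z by simp
  qed
  then show ?thesis using inv1 inv2 by blast
qed

section \<open>Deck transformations as lifts of the covering map\<close>

context
  fixes \<Lambda> D assumes unif: "uniformization \<Lambda> D"
begin

lemma unif_cov: "covering_space (ball 0 1) \<Lambda> D" and unif_hol: "\<Lambda> holomorphic_on ball 0 1"
  using unif by (simp_all add: uniformization_def)

lemma unif_image: "\<Lambda> ` ball 0 1 = D"
  by (rule covering_space_imp_surjective[OF unif_cov])

lemma unif_cont: "continuous_on (ball 0 1) \<Lambda>" by (rule holomorphic_on_imp_continuous_on[OF unif_hol])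

lemma deck_lift:
  assumes "cmod z < 1" "cmod w < 1" "\<Lambda> z = \<Lambda> w"
  shows "\<exists>F. F holomorphic_on ball 0 1 \<and> F \<in> ball 0 1 \<rightarrow> ball 0 1 \<and> F z = w \<and> (\<forall>y\<in>ball 0 1. \<Lambda> (F y) = \<Lambda> y)"
proof -
  have L: "\<Lambda> \<in> ball 0 1 \<rightarrow> D" using unif_image by auto
  have w: "w \<in> ball 0 1" and z: "z \<in> ball 0 1" using assms by auto
  have sc: "simply_connected (ball (0::complex) 1)" by (intro convex_imp_simply_connected convex_ball)
  have lp: "locally path_connected (ball (0::complex) 1)" by (intro convex_imp_locally_path_connected convex_ball)
  obtain F where F: "continuous_on (ball 0 1) F" "F \<in> ball 0 1 \<rightarrow> ball 0 1" "F z = w" "\<And>y. y \<in> ball 0 1 \<Longrightarrow> \<Lambda> (F y) = \<Lambda> y"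
    using covering_space_lift_strong[OF unif_cov w z sc lp unif_cont L assms(3)] by blast
  have "F holomorphic_on ball 0 1"
    by (rule covering_space_lift_is_holomorphic[OF unif_cov open_ball unif_hol unif_hol L F(2) F(1) F(4)])
  then show ?thesis using F by blast
qed

lemma deck_unique:
  assumes "F holomorphic_on ball 0 1" "F \<in> ball 0 1 \<rightarrow> ball 0 1" "\<And>y. y \<in> ball 0 1 \<Longrightarrow> \<Lambda> (F y) = \<Lambda> y"
    and "cmod a < 1" "F a = a" "cmod x < 1"
  shows "F x = x"
proof -
  have "F x = (\<lambda>x. x) x"
    by (rule covering_space_lift_unique[OF unif_cov, where ?g1.0 = F and ?g2.0 = "\<lambda>x. x" and a = a and T = "ball 0 1" and f = \<Lambda>])
       (use assms unif_image unif_cont in \<open>auto intro: holomorphic_on_imp_continuous_on\<close>)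
  then show ?thesis .
qed

text \<open>As the disc is simply connected, \<open>\<Lambda>\<close> lifts through itself with
  \<open>z\<close> sent to \<open>w\<close>, and also with \<open>w\<close> sent to
  \<open>z\<close>. Each composition of the two lifts fixes a point, so uniqueness of lifts makes it
  the identity, and a biholomorphic self-map of the disc is a Moebius map.\<close>

lemma deck_group_transitive:
  assumes z: "cmod z < 1" and w: "cmod w < 1" and eq: "\<Lambda> z = \<Lambda> w"
  shows "\<exists>\<gamma>\<in>deck_group \<Lambda>. \<gamma> z = w"
proof -
  from deck_lift[OF z w eq] obtain F where F: "F holomorphic_on ball 0 1" "F \<in> ball 0 1 \<rightarrow> ball 0 1" "F z = w"
    "\<forall>y\<in>ball 0 1. \<Lambda> (F y) = \<Lambda> y" by blast
  from deck_lift[OF w z eq[symmetric]] obtain G where G: "G holomorphic_on ball 0 1" "G \<in> ball 0 1 \<rightarrow> ball 0 1" "G w = z"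
    "\<forall>y\<in>ball 0 1. \<Lambda> (G y) = \<Lambda> y" by blast
  have FG: "F (G x) = x" if "cmod x < 1" for x
    by (rule deck_unique[of "\<lambda>x. F (G x)", OF _ _ _ w _ that])
       (use F G in \<open>auto intro!: holomorphic_on_compose_gen[of G _ F, unfolded o_def] simp: Pi_iff\<close>)
  have GF: "G (F x) = x" if "cmod x < 1" for x
    by (rule deck_unique[of "\<lambda>x. G (F x)", OF _ _ _ z _ that])
       (use F G in \<open>auto intro!: holomorphic_on_compose_gen[of F _ G, unfolded o_def] simp: Pi_iff\<close>)
  obtain \<theta> a where a: "cmod a < 1" "\<And>z. cmod z < 1 \<Longrightarrow> F z = Moebius_function \<theta> a z"
    using disc_automorphism_Moebius[OF F(1) _ G(1) _ FG GF] F(2) G(2) by (auto simp: Pi_iff)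
  have "restrict (Moebius_function \<theta> a) (cball 0 1) \<in> deck_group \<Lambda>"
    unfolding deck_group_def moebius_disc_automorphisms_def
    using a F(4) by (auto simp flip: a(2))
  moreover have "restrict (Moebius_function \<theta> a) (cball 0 1) z = w" using a(2)[OF z] F(3) z by simp
  ultimately show ?thesis by blast
qed

text \<open>Group elements are functions restricted to the closed disc, so agreement inside has to
  be carried to the circle by continuity; outside, both restrictions are
  \<open>undefined\<close>.\<close>

lemma deck_group_eq_on_ball:
  assumes g1: "\<gamma>1 \<in> deck_group \<Lambda>" and g2: "\<gamma>2 \<in> deck_group \<Lambda>" and eq: "\<And>z. cmod z < 1 \<Longrightarrow> \<gamma>1 z = \<gamma>2 z"
  shows "\<gamma>1 = \<gamma>2"
proof -
  obtain \<theta> w where 1: "cmod w < 1" "\<gamma>1 = restrict (Moebius_function \<theta> w) (cball 0 1)" using deck_groupE[OF g1] by blast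
  obtain \<eta> v where 2: "cmod v < 1" "\<gamma>2 = restrict (Moebius_function \<eta> v) (cball 0 1)" using deck_groupE[OF g2] by blast
  have c: "continuous_on (cball 0 1) (Moebius_function \<theta> w)" if "cmod w < 1" for \<theta> w
    unfolding Moebius_function_def using one_minus_cnj_mult_nz[OF that] by (intro continuous_intros) auto
  have "Moebius_function \<theta> w z = Moebius_function \<eta> v z" if z: "cmod z \<le> 1" for z
  proof -
    have "Moebius_function \<theta> w z - Moebius_function \<eta> v z = 0"
    proof (rule continuous_constant_on_closure[of "ball 0 1" "\<lambda>z. Moebius_function \<theta> w z - Moebius_function \<eta> v z"])
      show "continuous_on (closure (ball 0 1)) (\<lambda>z. Moebius_function \<theta> w z - Moebius_function \<eta> v z)"
        using c[OF 1(1)] c[OF 2(1)] by (auto intro!: continuous_intros)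
      show "Moebius_function \<theta> w x - Moebius_function \<eta> v x = 0" if "x \<in> ball 0 1" for x
        using eq[of x] that by (simp add: 1(2) 2(2))
    qed (use z in simp)
    then show ?thesis by simp
  qed
  then show ?thesis unfolding 1(2) 2(2) by (intro restrict_ext) simp
qed

text \<open>Both elements are lifts of \<open>\<Lambda>\<close> through itself, and lifts that agree
  at one point agree on the connected disc. Hence the orbit map is injective, so orbit sums and
  group sums coincide.\<close>

lemma deck_group_free:
  assumes g1: "\<gamma>1 \<in> deck_group \<Lambda>" and g2: "\<gamma>2 \<in> deck_group \<Lambda>" and a: "cmod a < 1" and eq: "\<gamma>1 a = \<gamma>2 a"
  shows "\<gamma>1 = \<gamma>2"
proof (rule deck_group_eq_on_ball[OF g1 g2])
  fix x :: complex assume x: "cmod x < 1"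
  have hol: "\<gamma> holomorphic_on ball 0 1" if g_in: "\<gamma> \<in> deck_group \<Lambda>" for \<gamma>
  proof -
    obtain \<theta> w where w: "cmod w < 1" "\<gamma> = restrict (Moebius_function \<theta> w) (cball 0 1)" using deck_groupE[OF g_in] by blast
    show ?thesis by (rule holomorphic_transform[OF Moebius_function_holomorphic[OF w(1)]]) (simp add: w(2))
  qed
  show "\<gamma>1 x = \<gamma>2 x"
  proof (rule covering_space_lift_unique[OF unif_cov, where a = a and T = "ball 0 1" and f = \<Lambda> and ?g1.0 = \<gamma>1 and ?g2.0 = \<gamma>2])
    show "\<gamma>1 a = \<gamma>2 a" by (rule eq)
    show "continuous_on (ball 0 1) \<Lambda>" by (rule unif_cont)
    show "\<Lambda> \<in> ball 0 1 \<rightarrow> D" using unif_image by auto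
    show "continuous_on (ball 0 1) \<gamma>1" by (intro holomorphic_on_imp_continuous_on hol g1)
    show "continuous_on (ball 0 1) \<gamma>2" by (intro holomorphic_on_imp_continuous_on hol g2)
    show "\<gamma>1 \<in> ball 0 1 \<rightarrow> ball 0 1" using deck_group_ball[OF g1] by simp
    show "\<gamma>2 \<in> ball 0 1 \<rightarrow> ball 0 1" using deck_group_ball[OF g2] by simp
    show "\<Lambda> y = \<Lambda> (\<gamma>1 y)" if "y \<in> ball 0 1" for y using deck_group_invariant[OF g1, of y] that by simp
    show "\<Lambda> y = \<Lambda> (\<gamma>2 y)" if "y \<in> ball 0 1" for y using deck_group_invariant[OF g2, of y] that by simp
  qed (use a x in simp_all)
qed

lemma deck_group_id: "restrict (\<lambda>z. z) (cball 0 1) \<in> deck_group \<Lambda>"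
proof -
  have "restrict (\<lambda>z. z) (cball 0 1) = restrict (Moebius_function 0 0) (cball 0 1)"
    by (intro restrict_ext) (simp add: Moebius_function_simple)
  then show ?thesis
    unfolding deck_group_def moebius_disc_automorphisms_def by (auto intro!: exI[of _ 0] simp: Moebius_function_simple)
qed

text \<open>A boundary value in \<open>D\<close> would let the radius be lifted to a path with endpoint in the open disc.\<close>

lemma unif_boundary_value:
  assumes t: "cmod t = 1" and s: "has_nt_limit \<Lambda> t s"
  shows "s \<notin> D"
proof
  assume sD: "s \<in> D"
  have in_ball: "of_real x * t \<in> ball 0 1" if "0 \<le> x" "x < 1" for x using that t by (simp add: norm_mult)
  have lim: "((\<lambda>x::real. \<Lambda> (of_real x * t)) \<longlongrightarrow> s) (at_left 1)"
  proof -
    have "filterlim (\<lambda>x::real. of_real x * t) (at t within stolz 2 t) (at_left 1)"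
      unfolding filterlim_at
    proof
      have "((\<lambda>x::real. of_real x * t) \<longlongrightarrow> of_real 1 * t) (at_left 1)" by (intro tendsto_intros)
      then show "((\<lambda>x::real. of_real x * t) \<longlongrightarrow> t) (at_left 1)" by simp
      have "\<forall>\<^sub>F x in at_left (1::real). x \<in> {0<..<1}" by (rule eventually_at_left_real) simp
      then show "\<forall>\<^sub>F x in at_left (1::real). of_real x * t \<in> stolz 2 t \<and> of_real x * t \<noteq> t"
      proof eventually_elim
        case (elim x)
        have "of_real x * t \<in> stolz 2 t" by (rule radial_in_stolz[OF t]) (use elim in auto)
        then show ?case using t by (auto simp: stolz_def)
      qed
    qed
    moreover have "(\<Lambda> \<longlongrightarrow> s) (at t within stolz 2 t)" using s unfolding has_nt_limit_stolz by simp
    ultimately show ?thesis by (rule filterlim_compose[rotated])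
  qed
  define p where "p x = (if x < 1 then \<Lambda> (of_real x * t) else s)" for x :: real
  have "continuous_on {0..1} p"
    unfolding continuous_on_def
  proof
    fix x :: real assume x: "x \<in> {0..1}"
    show "(p \<longlongrightarrow> p x) (at x within {0..1})"
    proof (cases "x < 1")
      case True
      have "isCont \<Lambda> (of_real x * t)"
        using unif_cont in_ball[of x] x True by (simp add: continuous_on_eq_continuous_at)
      then have "((\<lambda>x::real. \<Lambda> (of_real x * t)) \<longlongrightarrow> \<Lambda> (of_real x * t)) (at x within {0..1})"
        by (rule isCont_tendsto_compose) (intro tendsto_intros)
      moreover have "\<forall>\<^sub>F y in at x within {0..1}. \<Lambda> (of_real y * t) = p y"
      proof -
        have "\<forall>\<^sub>F y in nhds x. y \<in> {..<1}" using True by (intro eventually_nhds_in_open) auto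
        then show ?thesis unfolding eventually_at_filter by eventually_elim (simp add: p_def)
      qed
      ultimately have "(p \<longlongrightarrow> \<Lambda> (of_real x * t)) (at x within {0..1})" by (rule Lim_transform_eventually)
      then show ?thesis using True by (simp add: p_def)
    next
      case False
      then have x1: "x = 1" using x by simp
      have "at (1::real) within {0..1} = at_left 1" by (rule at_within_Icc_at_left) simp
      moreover have "(p \<longlongrightarrow> s) (at_left 1)"
      proof (rule Lim_transform_eventually[OF lim])
        have "\<forall>\<^sub>F x in at_left (1::real). x \<in> {0<..<1}" by (rule eventually_at_left_real) simp
        then show "\<forall>\<^sub>F x in at_left 1. \<Lambda> (of_real x * t) = p x" by eventually_elim (simp add: p_def)
      qed
      ultimately show ?thesis by (simp add: x1 p_def)
    qed
  qed
  then have path: "path p" by (simp add: path_def)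
  have im: "path_image p \<subseteq> D"
    unfolding path_image_def p_def using sD in_ball unif_image by auto
  have st: "pathstart p = \<Lambda> 0" by (simp add: pathstart_def p_def)
  obtain h where h: "path h" "path_image h \<subseteq> ball 0 1" "pathstart h = 0" "\<And>x. x \<in> {0..1} \<Longrightarrow> \<Lambda> (h x) = p x"
    using covering_space_lift_path_strong[OF unif_cov, of 0 p] path im st by auto
  have hc: "continuous_on {0..1} h" using h(1) by (simp add: path_def)
  have eq: "h x = of_real x * t" if "x \<in> {0..<1}" for x
  proof (rule covering_space_lift_unique[OF unif_cov, where a = 0 and T = "{0..<1::real}" and f = p and ?g1.0 = h and ?g2.0 = "\<lambda>x. of_real x * t"])
    show "h 0 = of_real 0 * t" using h(3) by (simp add: pathstart_def)
    show "continuous_on {0..<1} p" by (rule continuous_on_subset[OF \<open>continuous_on {0..1} p\<close>]) auto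
    show "continuous_on {0..<1} h" by (rule continuous_on_subset[OF hc]) auto
    show "p \<in> {0..<1} \<rightarrow> D" using im by (auto simp: path_image_def)
    show "h \<in> {0..<1} \<rightarrow> ball 0 1" using h(2) by (auto simp: path_image_def)
    show "p y = \<Lambda> (h y)" if "y \<in> {0..<1}" for y using h(4)[of y] that by simp
    show "continuous_on {0..<1} (\<lambda>x. of_real x * t)" by (intro continuous_intros)
    show "(\<lambda>x. of_real x * t) \<in> {0..<1} \<rightarrow> ball 0 1" using in_ball by auto
    show "p y = \<Lambda> (of_real y * t)" if "y \<in> {0..<1}" for y using that by (simp add: p_def)
  qed (use that in auto)
  have "(h \<longlongrightarrow> h 1) (at 1 within {0..1})" using hc by (simp add: continuous_on_def)
  then have h1: "(h \<longlongrightarrow> h 1) (at_left 1)" by (simp add: at_within_Icc_at_left)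
  have "((\<lambda>x::real. of_real x * t) \<longlongrightarrow> h 1) (at_left 1)"
  proof (rule Lim_transform_eventually[OF h1])
    have "\<forall>\<^sub>F x in at_left (1::real). x \<in> {0<..<1}" by (rule eventually_at_left_real) simp
    then show "\<forall>\<^sub>F x in at_left 1. h x = of_real x * t" by eventually_elim (use eq in simp)
  qed
  moreover have "((\<lambda>x::real. of_real x * t) \<longlongrightarrow> of_real 1 * t) (at_left 1)" by (intro tendsto_intros)
  ultimately have "h 1 = t" using tendsto_unique[OF trivial_limit_at_left_real] by fastforce
  moreover have "h 1 \<in> ball 0 1" by (rule subsetD[OF h(2)]) (simp add: path_image_def)
  ultimately show False using t by simp
qed

end

subsection \<open>Boundary action\<close>

text \<open>A Moebius map carries each Stolz region at \<open>t\<close> into a Stolz region of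
  larger aperture at the image point, so the approach stays nontangential.\<close>

lemma has_nt_limit_Moebius:
  assumes w: "cmod w < 1" and t: "cmod t = 1" and l: "has_nt_limit u (Moebius_function \<alpha> w t) l"
  shows "has_nt_limit (\<lambda>z. u (Moebius_function \<alpha> w z)) t l"
  unfolding has_nt_limit_stolz
proof (intro allI impI)
  fix K :: real assume K: "K > 1"
  let ?M = "Moebius_function \<alpha> w"
  \<comment> \<open>With \<open>A\<close> and \<open>B\<close> as introduced below, the 4 collects
    \<open>A \<le> 2\<close> and \<open>1 + cmod (?M z) \<le> 2\<close>, and
    \<open>1 - cmod w\<close> is a lower bound for \<open>B\<close>. The added 1 makes the final
    inequality strict and \<open>K'\<close> larger than 1.\<close>
  define K' where "K' = 4 * K / (1 - cmod w) + 1"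
  have K': "K' > 1" using K w by (auto simp: K'_def)
  have "filterlim ?M (at (?M t) within stolz K' (?M t)) (at t within stolz K t)"
    unfolding filterlim_at
  proof
    have "continuous_on (cball 0 1) ?M"
      unfolding Moebius_function_def using one_minus_cnj_mult_nz[OF w] by (intro continuous_intros) auto
    then have "(?M \<longlongrightarrow> ?M t) (at t within cball 0 1)" using t by (simp add: continuous_on_def)
    then show "(?M \<longlongrightarrow> ?M t) (at t within stolz K t)" by (rule tendsto_within_subset) (auto simp: stolz_def)
    have "?M z \<in> stolz K' (?M t) \<and> ?M z \<noteq> ?M t" if z: "z \<in> stolz K t" for z
    proof -
      have z1: "cmod z < 1" "cmod (z - t) < K * (1 - cmod z)" using z by (auto simp: stolz_def dist_norm)
      define A B where "A = cmod (1 - cnj w * z)" and "B = cmod (1 - cnj w * t)"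
      define q where "q = 1 - (cmod w)\<^sup>2"
      have AB: "A > 0" "B > 0" using one_minus_cnj_mult_nz[OF w] z1 t by (auto simp: A_def B_def)
      have q: "q > 0" using w by (simp add: q_def abs_square_less_1)
      have M1: "cmod (?M z) < 1" by (rule Moebius_function_norm_lt_1[OF w z1(1)])
      have "cmod (cnj w * t) \<le> cmod w" using t by (simp add: norm_mult)
      then have Bl: "1 - cmod w \<le> B" unfolding B_def using norm_triangle_ineq2[of 1 "cnj w * t"] by simp
      have "cmod (cnj w * z) \<le> 1 * 1" unfolding norm_mult using w z1 by (intro mult_mono) auto
      then have Au: "A \<le> 2" unfolding A_def using norm_triangle_ineq4[of 1 "cnj w * z"] by simp
      have e1: "dist (?M z) (?M t) = cmod (z - t) * q / (A * B)"
        unfolding dist_norm A_def B_def q_def by (rule Moebius_diff[OF w]) (use t z1 in auto)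
      have "(1 - (cmod z)\<^sup>2) * q / A\<^sup>2 = 1 - (cmod (?M z))\<^sup>2"
        unfolding q_def A_def by (rule one_minus_Moebius_norm[symmetric, OF w]) (use z1 in simp)
      also have "\<dots> = (1 - cmod (?M z)) * (1 + cmod (?M z))" by (simp add: power2_eq_square algebra_simps)
      also have "\<dots> \<le> (1 - cmod (?M z)) * 2" using M1 by (intro mult_left_mono) auto
      finally have e2: "(1 - (cmod z)\<^sup>2) * q / A\<^sup>2 \<le> 2 * (1 - cmod (?M z))" by simp
      have "(1 - cmod z) * 1 \<le> (1 - cmod z) * (1 + cmod z)" using z1 by (intro mult_left_mono) auto
      then have "1 - cmod z \<le> 1 - (cmod z)\<^sup>2" by (simp add: power2_eq_square algebra_simps)
      then have "(1 - cmod z) * q / A\<^sup>2 \<le> (1 - (cmod z)\<^sup>2) * q / A\<^sup>2" using q by (intro divide_right_mono mult_right_mono) auto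
      with e2 have e3: "(1 - cmod z) * q / A\<^sup>2 \<le> 2 * (1 - cmod (?M z))" by linarith
      have "cmod (z - t) * q / (A * B) \<le> K * (1 - cmod z) * q / (A * B)"
        using z1 q AB by (intro divide_right_mono mult_right_mono) auto
      also have "\<dots> = K * A / B * ((1 - cmod z) * q / A\<^sup>2)" using AB by (simp add: power2_eq_square mult_ac)
      also have "\<dots> \<le> K * A / B * (2 * (1 - cmod (?M z)))" using K AB by (intro mult_left_mono e3) auto
      also have "\<dots> \<le> K * 2 / (1 - cmod w) * (2 * (1 - cmod (?M z)))"
        using K AB Bl Au M1 w by (intro mult_right_mono frac_le mult_left_mono) auto
      also have "\<dots> = 4 * K / (1 - cmod w) * (1 - cmod (?M z))" by simp
      also have "\<dots> < K' * (1 - cmod (?M z))" using M1 by (intro mult_strict_right_mono) (auto simp: K'_def)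
      finally have "dist (?M z) (?M t) < K' * (1 - cmod (?M z))" unfolding e1 .
      moreover have "?M z \<noteq> ?M t" using M1 Moebius_norm_eq_1[OF w t, of \<alpha>] by auto
      ultimately show ?thesis using M1 by (simp add: stolz_def)
    qed
    then show "\<forall>\<^sub>F z in at t within stolz K t. ?M z \<in> stolz K' (?M t) \<and> ?M z \<noteq> ?M t"
      by (simp add: eventually_at_filter)
  qed
  moreover have "(u \<longlongrightarrow> l) (at (?M t) within stolz K' (?M t))" using l K' unfolding has_nt_limit_stolz by blast
  ultimately show "((\<lambda>z. u (?M z)) \<longlongrightarrow> l) (at t within stolz K t)" by (rule filterlim_compose[rotated])
qed

text \<open>The substitution density \<open>poisson w\<close> is strictly positive on the circle, so
  the preimage of a null set is null.\<close>

lemma AE_Moebius: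
  assumes w: "cmod w < 1" and ae: "AE t in circle_borel. P t"
  shows "AE t in circle_borel. P (Moebius_function \<alpha> w t)"
proof -
  obtain N where N: "N \<in> null_sets circle_borel" "{t. \<not> P t} \<subseteq> N"
    using ae unfolding eventually_ae_filter by auto
  have [measurable]: "N \<in> sets borel" using N(1) by auto
  let ?F = "\<lambda>t. indicator N (Moebius_function \<alpha> w t) * ennreal (poisson w t)"
  have "(\<integral>\<^sup>+t. ?F t \<partial>circle_borel) = (\<integral>\<^sup>+t. indicator N t \<partial>circle_borel)"
    by (rule nn_integral_Moebius[OF w]) measurable
  also have "\<dots> = 0" using N(1) by (simp add: null_setsD1)
  finally have "AE t in circle_borel. ?F t = 0" by (subst (asm) nn_integral_0_iff_AE) auto
  then show ?thesis
    using AE_circle_norm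
  proof eventually_elim
    case (elim t)
    have "poisson w t > 0"
      unfolding poisson_def using w elim(2) by (intro divide_pos_pos) (auto simp: abs_square_less_1)
    then have "Moebius_function \<alpha> w t \<notin> N" using elim(1) by (auto split: split_indicator_asm)
    then show ?case using N(2) by auto
  qed
qed

lemma AE_deck_group:
  assumes "countable \<Gamma>" "\<Gamma> \<subseteq> deck_group \<Lambda>" "AE t in circle_borel. P t"
  shows "AE t in circle_borel. \<forall>\<gamma>\<in>\<Gamma>. P (\<gamma> t)"
proof -
  have "AE t in circle_borel. P (\<gamma> t)" if g_in: "\<gamma> \<in> \<Gamma>" for \<gamma>
  proof -
    obtain \<theta> w where w: "cmod w < 1" "\<gamma> = restrict (Moebius_function \<theta> w) (cball 0 1)"
      using deck_groupE[OF subsetD[OF assms(2) g_in]] by blast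
    show ?thesis using AE_Moebius[OF w(1) assms(3), of \<theta>] AE_circle_norm by eventually_elim (simp add: w(2))
  qed
  then show ?thesis by (subst AE_ball_countable[OF assms(1)]) blast
qed

lemma nt_lim_automorphic:
  assumes \<gamma>: "\<gamma> \<in> deck_group \<Lambda>" and t: "cmod t = 1"
    and l: "\<exists>l. has_nt_limit u t l" "\<exists>l. has_nt_limit u (\<gamma> t) l"
    and eq: "\<And>z. cmod z < 1 \<Longrightarrow> u (\<gamma> z) = \<alpha> * u z"
  shows "nt_lim u (\<gamma> t) = \<alpha> * nt_lim u t"
proof -
  obtain \<theta> w where w: "cmod w < 1" "\<gamma> = restrict (Moebius_function \<theta> w) (cball 0 1)" using deck_groupE[OF \<gamma>] by blast
  have gt: "\<gamma> t = Moebius_function \<theta> w t" using t by (simp add: w(2))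
  have gt1: "cmod (\<gamma> t) = 1" unfolding gt by (rule Moebius_norm_eq_1[OF w(1) t])
  have "has_nt_limit u (\<gamma> t) (nt_lim u (\<gamma> t))" by (rule has_nt_limit_nt_lim[OF l(2) gt1])
  then have "has_nt_limit (\<lambda>z. u (Moebius_function \<theta> w z)) t (nt_lim u (\<gamma> t))"
    unfolding gt by (rule has_nt_limit_Moebius[OF w(1) t])
  then have "has_nt_limit (\<lambda>z. \<alpha> * u z) t (nt_lim u (\<gamma> t))"
    by (subst has_nt_limit_cong[of _ "\<lambda>z. u (Moebius_function \<theta> w z)"]) (use eq in \<open>auto simp: w(2)\<close>)
  moreover have "has_nt_limit (\<lambda>z. \<alpha> * u z) t (\<alpha> * nt_lim u t)"
    using has_nt_limit_nt_lim[OF l(1) t] unfolding has_nt_limit_stolz by (auto intro!: tendsto_intros)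
  ultimately show ?thesis using nt_lim_eq[OF _ t] by metis
qed

text \<open>The definition speaks of images of \<open>E\<close>; inverses turn it into a statement
  about the elements that send \<open>t\<close> into \<open>E\<close>. If two elements do so, the
  images of \<open>E\<close> under their inverses overlap, hence the inverses coincide, and with
  them the elements.\<close>

lemma fundamental_set_AE_ex1:
  assumes E: "fundamental_set (deck_group \<Lambda>) E"
  shows "AE t in circle_borel. \<exists>!\<gamma>. \<gamma> \<in> deck_group \<Lambda> \<and> \<gamma> t \<in> E"
proof -
  let ?\<Gamma> = "deck_group \<Lambda>"
  have sub: "E \<subseteq> sphere 0 1" and dis: "disjoint_family_on (\<lambda>\<gamma>. \<gamma> ` E) ?\<Gamma>"
    and ae: "AE t in circle_lebesgue. t \<in> (\<Union>\<gamma>\<in>?\<Gamma>. \<gamma> ` E)" using E by (auto simp: fundamental_set_def)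
  have ext: "\<gamma> z = undefined" if "\<gamma> \<in> ?\<Gamma>" "\<not> cmod z \<le> 1" for \<gamma> z
    using that by (elim deck_groupE) simp
  have ae': "AE t in circle_borel. t \<in> (\<Union>\<gamma>\<in>?\<Gamma>. \<gamma> ` E)" using ae by (simp only: AE_circle_lebesgue_iff)
  show ?thesis
    using ae' AE_circle_norm
  proof eventually_elim
    case (elim t)
    then obtain \<gamma> e where g: "\<gamma> \<in> ?\<Gamma>" "e \<in> E" "t = \<gamma> e" by blast
    obtain \<gamma>' where g': "\<gamma>' \<in> ?\<Gamma>" "\<forall>z. cmod z \<le> 1 \<longrightarrow> \<gamma>' (\<gamma> z) = z \<and> \<gamma> (\<gamma>' z) = z"
      using deck_group_inverse[OF g(1)] by blast
    have "\<gamma>' t \<in> E" using g g' sub by auto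
    moreover have "\<gamma>1 = \<gamma>2" if h: "\<gamma>1 \<in> ?\<Gamma>" "\<gamma>1 t \<in> E" "\<gamma>2 \<in> ?\<Gamma>" "\<gamma>2 t \<in> E" for \<gamma>1 \<gamma>2
    proof -
      obtain \<delta>1 where d1: "\<delta>1 \<in> ?\<Gamma>" "\<forall>z. cmod z \<le> 1 \<longrightarrow> \<delta>1 (\<gamma>1 z) = z \<and> \<gamma>1 (\<delta>1 z) = z"
        using deck_group_inverse[OF h(1)] by blast
      obtain \<delta>2 where d2: "\<delta>2 \<in> ?\<Gamma>" "\<forall>z. cmod z \<le> 1 \<longrightarrow> \<delta>2 (\<gamma>2 z) = z \<and> \<gamma>2 (\<delta>2 z) = z"
        using deck_group_inverse[OF h(3)] by blast
      have "t = \<delta>1 (\<gamma>1 t)" "t = \<delta>2 (\<gamma>2 t)" using d1 d2 elim(2) by auto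
      then have "t \<in> \<delta>1 ` E \<inter> \<delta>2 ` E" using h by blast
      then have "\<delta>1 = \<delta>2" using dis d1(1) d2(1) unfolding disjoint_family_on_def by blast
      show ?thesis
      proof
        fix z
        show "\<gamma>1 z = \<gamma>2 z"
        proof (cases "cmod z \<le> 1")
          case True
          have b: "cmod (\<gamma>2 z) \<le> 1" using h(3) True by (elim deck_groupE) (simp add: Moebius_norm_le_1)
          have "\<gamma>1 z = \<gamma>1 (\<delta>2 (\<gamma>2 z))" using d2(2) True by simp
          also have "\<dots> = \<gamma>2 z" using d1(2) b \<open>\<delta>1 = \<delta>2\<close> by simp
          finally show ?thesis .
        qed (simp add: ext[OF h(1)] ext[OF h(3)])
      qed
    qed
    ultimately show ?case using g'(1) by blast
  qed
qed

subsection \<open>Unfolding the Poisson integral over a fundamental set\<close>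

text \<open>For almost every \<open>t\<close> exactly one element sends \<open>t\<close> into
  \<open>E\<close>, so 1 can be written as a sum of indicators over \<open>\<Gamma>\<close>. After
  exchanging sum and integral, the substitution by \<open>\<gamma>\<close> moves the pole of the
  kernel from \<open>\<zeta>\<close> to \<open>\<gamma> \<zeta>\<close>. The sum is an integral over
  a count space, so that Fubini applies; \<open>E\<close> and \<open>\<Phi>\<close> are replaced by
  Borel versions, and countability keeps the exceptional sets null for all elements at once.\<close>

lemma unfold_nn_integral:
  fixes \<Phi> :: "complex \<Rightarrow> ennreal"
  assumes \<Gamma>: "countable \<Gamma>" "\<Gamma> \<subseteq> deck_group \<Lambda>" and E: "E \<in> sets circle_lebesgue"
    and ex1: "AE t in circle_borel. \<exists>!\<gamma>. \<gamma> \<in> \<Gamma> \<and> \<gamma> t \<in> E"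
    and \<Phi>: "\<Phi> \<in> borel_measurable circle_lebesgue" and inv: "AE t in circle_borel. \<forall>\<gamma>\<in>\<Gamma>. \<Phi> (\<gamma> t) = \<Phi> t"
    and \<zeta>: "cmod \<zeta> < 1"
  shows "(\<integral>\<^sup>+t. \<Phi> t * ennreal (poisson \<zeta> t) \<partial>circle_borel) =
    (\<integral>\<^sup>+t. \<Phi> t * indicator E t * (\<integral>\<^sup>+\<gamma>. ennreal (poisson (\<gamma> \<zeta>) t) \<partial>count_space \<Gamma>) \<partial>circle_borel)"
proof -
  interpret P: pair_sigma_finite "count_space \<Gamma>" circle_borel
    by (intro pair_sigma_finite.intro sigma_finite_measure_count_space_countable \<Gamma>) unfold_locales
  obtain S N N' where S: "E = S \<union> N" "N \<subseteq> N'" "N' \<in> null_sets circle_borel" "S \<in> sets circle_borel"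
    using sets_completionE[OF E[unfolded circle_lebesgue_eq]] by blast
  have [measurable]: "S \<in> sets borel" using S(4) by simp
  have ES: "AE t in circle_borel. t \<in> E \<longleftrightarrow> t \<in> S"
    using AE_not_in[OF S(3)] by eventually_elim (use S in auto)
  obtain \<Psi> where \<Psi>: "\<Psi> \<in> borel_measurable circle_borel" and \<Phi>\<Psi>: "AE t in circle_borel. \<Phi> t = \<Psi> t"
    using completion_ex_borel_measurable[OF \<Phi>[unfolded circle_lebesgue_eq]] by blast
  have [measurable]: "\<Psi> \<in> borel_measurable borel" using \<Psi> by simp
  have "\<forall>\<gamma>\<in>\<Gamma>. \<exists>p. cmod (snd p) < 1 \<and> \<gamma> = restrict (Moebius_function (fst p) (snd p)) (cball 0 1)"
  proof
    fix \<gamma> assume "\<gamma> \<in> \<Gamma>"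
    then obtain \<theta> w where "cmod w < 1" "\<gamma> = restrict (Moebius_function \<theta> w) (cball 0 1)"
      using deck_groupE[OF subsetD[OF \<Gamma>(2)]] by blast
    then show "\<exists>p. cmod (snd p) < 1 \<and> \<gamma> = restrict (Moebius_function (fst p) (snd p)) (cball 0 1)"
      by (intro exI[of _ "(\<theta>, w)"]) simp
  qed
  from bchoice[OF this] obtain p where p: "\<And>\<gamma>. \<gamma> \<in> \<Gamma> \<Longrightarrow> cmod (snd (p \<gamma>)) < 1"
    "\<And>\<gamma>. \<gamma> \<in> \<Gamma> \<Longrightarrow> \<gamma> = restrict (Moebius_function (fst (p \<gamma>)) (snd (p \<gamma>))) (cball 0 1)" by blast
  \<comment> \<open>\<open>M \<gamma>\<close> is the unrestricted Moebius map, to which the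
    substitution rule applies; it agrees with \<open>\<gamma>\<close> on the closed disc.\<close>
  define M where "M \<gamma> = Moebius_function (fst (p \<gamma>)) (snd (p \<gamma>))" for \<gamma>
  have Mm [measurable]: "M \<gamma> \<in> borel_measurable borel" for \<gamma> unfolding M_def by measurable
  have \<gamma>M: "\<gamma> z = M \<gamma> z" if "\<gamma> \<in> \<Gamma>" "cmod z \<le> 1" for \<gamma> z
    using fun_cong[OF p(2)[OF that(1)], of z] that(2) by (simp add: M_def)
  let ?f = "\<lambda>\<gamma> t. \<Psi> (M \<gamma> t) * indicator S (M \<gamma> t) * ennreal (poisson \<zeta> t)"
  let ?h = "\<lambda>\<gamma> t. \<Psi> t * indicator S t * ennreal (poisson (\<gamma> \<zeta>) t)"
  have fm: "(\<lambda>(\<gamma>, t). ?f \<gamma> t) \<in> borel_measurable (count_space \<Gamma> \<Otimes>\<^sub>M circle_borel)"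
    by (rule measurable_pair_measure_countable1[OF \<Gamma>(1)]) (simp only: prod.case, measurable)
  have hm: "(\<lambda>(\<gamma>, t). ?h \<gamma> t) \<in> borel_measurable (count_space \<Gamma> \<Otimes>\<^sub>M circle_borel)"
    by (rule measurable_pair_measure_countable1[OF \<Gamma>(1)]) (simp only: prod.case, measurable)
  have "(\<integral>\<^sup>+t. \<Phi> t * ennreal (poisson \<zeta> t) \<partial>circle_borel) = (\<integral>\<^sup>+t. \<integral>\<^sup>+\<gamma>. ?f \<gamma> t \<partial>count_space \<Gamma> \<partial>circle_borel)"
  proof (rule nn_integral_cong_AE)
    show "AE t in circle_borel. \<Phi> t * ennreal (poisson \<zeta> t) = (\<integral>\<^sup>+\<gamma>. ?f \<gamma> t \<partial>count_space \<Gamma>)"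
      using ex1 inv AE_deck_group[OF \<Gamma> ES] AE_deck_group[OF \<Gamma> \<Phi>\<Psi>] AE_circle_norm
    proof eventually_elim
      case (elim t)
      from elim(1) obtain \<gamma>0 where g0: "\<gamma>0 \<in> \<Gamma>" "\<gamma>0 t \<in> E" "\<And>\<gamma>. \<gamma> \<in> \<Gamma> \<Longrightarrow> \<gamma> t \<in> E \<Longrightarrow> \<gamma> = \<gamma>0" by blast
      have "(\<integral>\<^sup>+\<gamma>. ?f \<gamma> t \<partial>count_space \<Gamma>) = (\<integral>\<^sup>+\<gamma>. (\<Phi> t * ennreal (poisson \<zeta> t)) * indicator {\<gamma>0} \<gamma> \<partial>count_space \<Gamma>)"
      proof (rule nn_integral_cong)
        fix \<gamma> assume "\<gamma> \<in> space (count_space \<Gamma>)"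
        then have g: "\<gamma> \<in> \<Gamma>" by simp
        have e1: "M \<gamma> t = \<gamma> t" using \<gamma>M[OF g, of t] elim(5) by simp
        have e2: "\<Psi> (\<gamma> t) = \<Phi> t" using bspec[OF elim(2) g] bspec[OF elim(4) g] by simp
        have e3: "\<gamma> t \<in> S \<longleftrightarrow> \<gamma> = \<gamma>0" using bspec[OF elim(3) g] g0(2) g0(3)[OF g] by auto
        have e4: "indicator S (\<gamma> t) = (indicator {\<gamma>0} \<gamma> :: ennreal)" using e3 by (simp add: indicator_def)
        show "?f \<gamma> t = (\<Phi> t * ennreal (poisson \<zeta> t)) * indicator {\<gamma>0} \<gamma>"
          unfolding e1 e2 e4 by (simp add: mult_ac)
      qed
      also have "\<dots> = (\<Phi> t * ennreal (poisson \<zeta> t)) * emeasure (count_space \<Gamma>) {\<gamma>0}"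
        by (rule nn_integral_cmult_indicator) (use g0(1) in simp)
      also have "\<dots> = \<Phi> t * ennreal (poisson \<zeta> t)" using g0(1) by simp
      finally show ?case ..
    qed
  qed
  also have "\<dots> = (\<integral>\<^sup>+\<gamma>. \<integral>\<^sup>+t. ?f \<gamma> t \<partial>circle_borel \<partial>count_space \<Gamma>)" by (rule P.Fubini'[OF fm])
  also have "\<dots> = (\<integral>\<^sup>+\<gamma>. \<integral>\<^sup>+t. ?h \<gamma> t \<partial>circle_borel \<partial>count_space \<Gamma>)"
  proof (rule nn_integral_cong)
    fix \<gamma> assume "\<gamma> \<in> space (count_space \<Gamma>)"
    then have g: "\<gamma> \<in> \<Gamma>" by simp
    have "(\<integral>\<^sup>+t. ?f \<gamma> t \<partial>circle_borel) = (\<integral>\<^sup>+t. \<Psi> t * indicator S t * ennreal (poisson (M \<gamma> \<zeta>) t) \<partial>circle_borel)"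
      unfolding M_def by (rule nn_integral_poisson_Moebius[OF p(1)[OF g] \<zeta>, of "\<lambda>t. \<Psi> t * indicator S t"]) measurable
    then show "(\<integral>\<^sup>+t. ?f \<gamma> t \<partial>circle_borel) = (\<integral>\<^sup>+t. ?h \<gamma> t \<partial>circle_borel)" using \<gamma>M[OF g, of \<zeta>] \<zeta> by simp
  qed
  also have "\<dots> = (\<integral>\<^sup>+t. \<integral>\<^sup>+\<gamma>. ?h \<gamma> t \<partial>count_space \<Gamma> \<partial>circle_borel)" by (rule P.Fubini'[OF hm, symmetric])
  also have "\<dots> = (\<integral>\<^sup>+t. \<Phi> t * indicator E t * (\<integral>\<^sup>+\<gamma>. ennreal (poisson (\<gamma> \<zeta>) t) \<partial>count_space \<Gamma>) \<partial>circle_borel)"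
  proof (rule nn_integral_cong_AE)
    show "AE t in circle_borel. (\<integral>\<^sup>+\<gamma>. ?h \<gamma> t \<partial>count_space \<Gamma>) = \<Phi> t * indicator E t * (\<integral>\<^sup>+\<gamma>. ennreal (poisson (\<gamma> \<zeta>) t) \<partial>count_space \<Gamma>)"
      using \<Phi>\<Psi> ES
    proof eventually_elim
      case (elim t)
      have e: "\<Phi> t * indicator E t = \<Psi> t * indicator S t" using elim by (simp split: split_indicator)
      show ?case unfolding e by (rule nn_integral_cmult) simp
    qed
  qed
  finally show ?thesis .
qed

text \<open>\<open>ennreal\<close> sends negative reals to 0, so the nonnegative identity applied to
  \<open>\<phi>\<close> and to \<open>- \<phi>\<close> treats positive and negative parts; real and
  imaginary parts of \<open>F\<close> then give the complex case. Integrability is transported in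
  the same way, from the circle to \<open>E\<close>.\<close>

lemma unfold_integral:
  fixes F :: "complex \<Rightarrow> complex" and S :: "complex \<Rightarrow> real"
  assumes \<Gamma>: "countable \<Gamma>" "\<Gamma> \<subseteq> deck_group \<Lambda>" and E: "E \<in> sets circle_lebesgue"
    and ex1: "AE t in circle_borel. \<exists>!\<gamma>. \<gamma> \<in> \<Gamma> \<and> \<gamma> t \<in> E"
    and F: "F \<in> borel_measurable circle_lebesgue" and inv: "AE t in circle_borel. \<forall>\<gamma>\<in>\<Gamma>. F (\<gamma> t) = F t"
    and \<zeta>: "cmod \<zeta> < 1" and int: "integrable circle_lebesgue (\<lambda>t. F t * of_real (poisson \<zeta> t))"
    and Sm: "S \<in> borel_measurable circle_lebesgue"
    and S: "AE t in circle_borel. 0 \<le> S t \<and> (\<integral>\<^sup>+\<gamma>. ennreal (poisson (\<gamma> \<zeta>) t) \<partial>count_space \<Gamma>) = ennreal (S t)"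
  shows "integrable circle_lebesgue (\<lambda>t. indicator E t *\<^sub>R (F t * of_real (S t)))"
    and "(LINT t|circle_lebesgue. F t * of_real (poisson \<zeta> t)) = (LINT t|circle_lebesgue. indicator E t *\<^sub>R (F t * of_real (S t)))"
proof -
  have P0: "0 \<le> poisson \<zeta> t" for t by (rule poisson_nonneg[OF \<zeta>])
  have nn: "(\<integral>\<^sup>+t. ennreal (\<phi> t * poisson \<zeta> t) \<partial>circle_lebesgue) = (\<integral>\<^sup>+t. ennreal (indicator E t * (\<phi> t * S t)) \<partial>circle_lebesgue)"
    if \<phi>: "\<phi> \<in> borel_measurable circle_lebesgue" and \<phi>i: "AE t in circle_borel. \<forall>\<gamma>\<in>\<Gamma>. \<phi> (\<gamma> t) = \<phi> t" for \<phi> :: "complex \<Rightarrow> real"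
  proof -
    have "(\<integral>\<^sup>+t. ennreal (\<phi> t * poisson \<zeta> t) \<partial>circle_lebesgue) = (\<integral>\<^sup>+t. ennreal (\<phi> t) * ennreal (poisson \<zeta> t) \<partial>circle_borel)"
      unfolding nn_integral_circle_lebesgue by (intro nn_integral_cong ennreal_mult'' P0)
    also have "\<dots> = (\<integral>\<^sup>+t. ennreal (\<phi> t) * indicator E t * (\<integral>\<^sup>+\<gamma>. ennreal (poisson (\<gamma> \<zeta>) t) \<partial>count_space \<Gamma>) \<partial>circle_borel)"
    proof (rule unfold_nn_integral[OF \<Gamma> E ex1 _ _ \<zeta>])
      show "(\<lambda>t. ennreal (\<phi> t)) \<in> borel_measurable circle_lebesgue" using \<phi> by measurable
      show "AE t in circle_borel. \<forall>\<gamma>\<in>\<Gamma>. ennreal (\<phi> (\<gamma> t)) = ennreal (\<phi> t)" using \<phi>i by eventually_elim simp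
    qed
    also have "\<dots> = (\<integral>\<^sup>+t. ennreal (indicator E t * (\<phi> t * S t)) \<partial>circle_lebesgue)"
      unfolding nn_integral_circle_lebesgue
    proof (rule nn_integral_cong_AE)
      show "AE t in circle_borel. ennreal (\<phi> t) * indicator E t * (\<integral>\<^sup>+\<gamma>. ennreal (poisson (\<gamma> \<zeta>) t) \<partial>count_space \<Gamma>) =
          ennreal (indicator E t * (\<phi> t * S t))"
        using S
      proof eventually_elim
        case (elim t)
        then show ?case by (cases "t \<in> E") (simp_all add: ennreal_mult'')
      qed
    qed
    finally show ?thesis .
  qed
  have real: "integrable circle_lebesgue (\<lambda>t. indicator E t * (\<phi> t * S t)) \<and>
     (LINT t|circle_lebesgue. \<phi> t * poisson \<zeta> t) = (LINT t|circle_lebesgue. indicator E t * (\<phi> t * S t))"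
    if \<phi>: "\<phi> \<in> borel_measurable circle_lebesgue" and \<phi>i: "AE t in circle_borel. \<forall>\<gamma>\<in>\<Gamma>. \<phi> (\<gamma> t) = \<phi> t"
      and i: "integrable circle_lebesgue (\<lambda>t. \<phi> t * poisson \<zeta> t)" for \<phi> :: "complex \<Rightarrow> real"
  proof -
    have \<phi>i': "AE t in circle_borel. \<forall>\<gamma>\<in>\<Gamma>. - \<phi> (\<gamma> t) = - \<phi> t" using \<phi>i by eventually_elim simp
    have \<phi>m': "(\<lambda>t. - \<phi> t) \<in> borel_measurable circle_lebesgue" using \<phi> by measurable
    have n1: "(\<integral>\<^sup>+t. ennreal (indicator E t * (\<phi> t * S t)) \<partial>circle_lebesgue) = (\<integral>\<^sup>+t. ennreal (\<phi> t * poisson \<zeta> t) \<partial>circle_lebesgue)"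
      by (rule nn[OF \<phi> \<phi>i, symmetric])
    have n2: "(\<integral>\<^sup>+t. ennreal (- (indicator E t * (\<phi> t * S t))) \<partial>circle_lebesgue) = (\<integral>\<^sup>+t. ennreal (- (\<phi> t * poisson \<zeta> t)) \<partial>circle_lebesgue)"
      using nn[OF \<phi>m' \<phi>i'] by simp
    have m: "(\<lambda>t. indicator E t * (\<phi> t * S t)) \<in> borel_measurable circle_lebesgue"
      using E \<phi> Sm by measurable
    have ii: "integrable circle_lebesgue (\<lambda>t. indicator E t * (\<phi> t * S t))"
      using i m unfolding real_integrable_def n1 n2 by blast
    show ?thesis
      unfolding real_lebesgue_integral_def[OF i] real_lebesgue_integral_def[OF ii] n1 n2 using ii by blast
  qed
  let ?a = "\<lambda>t. Re (F t)" and ?b = "\<lambda>t. Im (F t)"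
  have am: "?a \<in> borel_measurable circle_lebesgue" "?b \<in> borel_measurable circle_lebesgue" using F by measurable
  have ai: "integrable circle_lebesgue (\<lambda>t. ?a t * poisson \<zeta> t)" "integrable circle_lebesgue (\<lambda>t. ?b t * poisson \<zeta> t)"
    using integrable_Re[OF int] integrable_Im[OF int] by simp_all
  have av: "AE t in circle_borel. \<forall>\<gamma>\<in>\<Gamma>. ?a (\<gamma> t) = ?a t" "AE t in circle_borel. \<forall>\<gamma>\<in>\<Gamma>. ?b (\<gamma> t) = ?b t"
    using inv by (eventually_elim, simp)+
  note ra = real[OF am(1) av(1) ai(1)] and rb = real[OF am(2) av(2) ai(2)]
  have eq1: "F t * of_real (poisson \<zeta> t) = of_real (?a t * poisson \<zeta> t) + \<i> * of_real (?b t * poisson \<zeta> t)" for t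
    by (simp add: complex_eq_iff)
  have eq2: "indicator E t *\<^sub>R (F t * of_real (S t)) = of_real (indicator E t * (?a t * S t)) + \<i> * of_real (indicator E t * (?b t * S t))" for t
    by (simp add: complex_eq_iff)
  have j: "integrable circle_lebesgue (\<lambda>t. complex_of_real (indicator E t * (?a t * S t)))"
     "integrable circle_lebesgue (\<lambda>t. \<i> * complex_of_real (indicator E t * (?b t * S t)))"
    using ra rb by (auto intro!: integrable_mult_right integrable_of_real simp del: of_real_mult)
  have k: "integrable circle_lebesgue (\<lambda>t. complex_of_real (?a t * poisson \<zeta> t))"
     "integrable circle_lebesgue (\<lambda>t. \<i> * complex_of_real (?b t * poisson \<zeta> t))"
    using ai by (auto intro!: integrable_mult_right integrable_of_real simp del: of_real_mult)
  show "integrable circle_lebesgue (\<lambda>t. indicator E t *\<^sub>R (F t * of_real (S t)))"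
    unfolding eq2 by (rule Bochner_Integration.integrable_add[OF j])
  show "(LINT t|circle_lebesgue. F t * of_real (poisson \<zeta> t)) = (LINT t|circle_lebesgue. indicator E t *\<^sub>R (F t * of_real (S t)))"
    unfolding eq1 eq2 Bochner_Integration.integral_add[OF j] Bochner_Integration.integral_add[OF k]
      integral_mult_right_zero integral_complex_of_real using ra rb by simp
qed

lemma nn_integral_count_space_infsum:
  assumes "\<And>x. x \<in> A \<Longrightarrow> 0 \<le> f x" "f summable_on A"
  shows "(\<integral>\<^sup>+x. ennreal (f x) \<partial>count_space A) = ennreal (infsum f A)"
proof -
  have "Infinite_Sum.abs_summable_on f A"
    using assms summable_on_iff_abs_summable_on_real by blast
  then have *: "Infinite_Set_Sum.abs_summable_on f A" by (simp only: abs_summable_equivalent)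
  have "(\<integral>\<^sup>+x. ennreal (f x) \<partial>count_space A) = ennreal (infsetsum f A)"
    by (rule nn_integral_conv_infsetsum[OF *]) (rule assms(1))
  then show ?thesis using infsetsum_infsum[OF *] by simp
qed

subsection \<open>Derivatives of Cauchy integrals\<close>

text \<open>The kernel is expanded geometrically in \<open>(z - c) / (s t - c)\<close>, which
  converges because \<open>s t\<close> stays at distance at least \<open>d\<close> from
  \<open>c\<close>. Termwise integration gives a power series for \<open>h\<close> on the ball, and
  its coefficients must be the Taylor coefficients.\<close>

lemma cauchy_kernel_higher_deriv:
  fixes X s :: "complex \<Rightarrow> complex"
  assumes X: "integrable circle_lebesgue X" and s: "s \<in> borel_measurable circle_lebesgue"
    and d: "d > 0" "AE t in circle_borel. d \<le> cmod (s t - c)"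
    and h: "h holomorphic_on ball c d" "\<And>z. z \<in> ball c d \<Longrightarrow> (LINT t|circle_lebesgue. X t / (s t - z)) = h z"
  shows "(LINT t|circle_lebesgue. X t / (s t - c) ^ Suc k) = (deriv ^^ k) h c / fact k"
proof -
  define a where "a n = (LINT t|circle_lebesgue. X t / (s t - c) ^ Suc n)" for n
  define b where "b n = (deriv ^^ n) h c / fact n" for n
  have Xm: "X \<in> borel_measurable circle_lebesgue" using X by auto
  have km: "(\<lambda>t. X t / (s t - c) ^ Suc n) \<in> borel_measurable circle_lebesgue" for n
    using Xm s by measurable
  have kb: "AE t in circle_lebesgue. cmod (X t / (s t - c) ^ Suc n) \<le> cmod (X t) / d ^ Suc n" for n
    unfolding AE_circle_lebesgue_iff using d(2)
  proof eventually_elim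
    case (elim t)
    have "d ^ Suc n \<le> cmod (s t - c) ^ Suc n" using elim d(1) by (intro power_mono) auto
    then have "cmod (X t) / cmod (s t - c) ^ Suc n \<le> cmod (X t) / d ^ Suc n" using d(1) by (intro frac_le) auto
    then show ?case by (simp only: norm_divide norm_power)
  qed
  have ki: "integrable circle_lebesgue (\<lambda>t. X t / (s t - c) ^ Suc n)" for n
  proof (rule Bochner_Integration.integrable_bound[OF _ km])
    show "integrable circle_lebesgue (\<lambda>t. cmod (X t) / d ^ Suc n)" using X by simp
    show "AE t in circle_lebesgue. norm (X t / (s t - c) ^ Suc n) \<le> norm (cmod (X t) / d ^ Suc n)"
      using kb[of n] by eventually_elim (use d(1) in simp)
  qed
  have sums: "(\<lambda>n. a n * (z - c) ^ n) sums h z" if z: "z \<in> ball c d" for z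
  proof -
    have zd: "cmod (z - c) < d" using z by (simp add: dist_norm norm_minus_commute)
    define r where "r = cmod (z - c) / d"
    have r: "0 \<le> r" "r < 1" using zd d(1) by (auto simp: r_def)
    let ?f = "\<lambda>n t. X t / (s t - c) ^ Suc n * (z - c) ^ n"
    have fb: "norm (x / y ^ Suc n * (z - c) ^ n) \<le> cmod x / d * r ^ n" if "d \<le> cmod y" for x y :: complex and n
    proof -
      have "d ^ Suc n \<le> cmod y ^ Suc n" using that d(1) by (intro power_mono) auto
      then have "cmod x / cmod y ^ Suc n \<le> cmod x / d ^ Suc n" using d(1) by (intro frac_le) auto
      then have "cmod x / cmod y ^ Suc n * cmod (z - c) ^ n \<le> cmod x / d ^ Suc n * cmod (z - c) ^ n" by (rule mult_right_mono) simp
      also have "\<dots> = cmod x / d * r ^ n" by (simp add: r_def power_divide)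
      finally show ?thesis by (simp only: norm_mult norm_divide norm_power)
    qed
    have "(\<lambda>n. LINT t|circle_lebesgue. ?f n t) sums (LINT t|circle_lebesgue. (\<Sum>n. ?f n t))"
    proof (rule sums_integral)
      show "integrable circle_lebesgue (?f n)" for n using ki by (rule integrable_mult_left)
      show "AE t in circle_lebesgue. summable (\<lambda>n. norm (?f n t))"
        unfolding AE_circle_lebesgue_iff using d(2)
      proof eventually_elim
        case (elim t)
        have "summable (\<lambda>n. cmod (X t) / d * r ^ n)" using r by (intro summable_mult summable_geometric) simp
        then show ?case by (rule summable_comparison_test'[where N = 0]) (use fb[OF elim] in simp)
      qed
      have "summable (\<lambda>n. (LINT t|circle_lebesgue. cmod (X t) / d) * r ^ n)" using r by (intro summable_mult summable_geometric) simp
      then show "summable (\<lambda>n. LINT t|circle_lebesgue. norm (?f n t))"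
      proof (rule summable_comparison_test'[where N = 0])
        fix n
        have "(LINT t|circle_lebesgue. norm (?f n t)) \<le> (LINT t|circle_lebesgue. cmod (X t) / d * r ^ n)"
        proof (rule integral_mono_AE)
          show "integrable circle_lebesgue (\<lambda>t. norm (?f n t))" by (intro integrable_norm integrable_mult_left ki)
          show "integrable circle_lebesgue (\<lambda>t. cmod (X t) / d * r ^ n)" using X by simp
          show "AE t in circle_lebesgue. norm (?f n t) \<le> cmod (X t) / d * r ^ n"
            unfolding AE_circle_lebesgue_iff using d(2) by eventually_elim (rule fb)
        qed
        also have "\<dots> = (LINT t|circle_lebesgue. cmod (X t) / d) * r ^ n" by (rule integral_mult_left_zero)
        finally show "norm (LINT t|circle_lebesgue. norm (?f n t)) \<le> (LINT t|circle_lebesgue. cmod (X t) / d) * r ^ n"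
          using Bochner_Integration.integral_nonneg[of circle_lebesgue "\<lambda>t. norm (?f n t)"] by simp
      qed
    qed
    also have "(LINT t|circle_lebesgue. (\<Sum>n. ?f n t)) = (LINT t|circle_lebesgue. X t / (s t - z))"
    proof (rule integral_circle_cong_AE(1))
      show "AE t in circle_borel. (\<Sum>n. ?f n t) = X t / (s t - z)"
        using d(2)
      proof eventually_elim
        case (elim t)
        define y where "y = s t - c"
        have y: "y \<noteq> 0" "cmod ((z - c) / y) < 1" using elim d(1) zd by (auto simp: y_def norm_divide divide_less_eq)
        have "(\<lambda>n. X t / y * ((z - c) / y) ^ n) sums (X t / y * (1 / (1 - (z - c) / y)))"
          by (intro sums_mult geometric_sums y)
        also have "(\<lambda>n. X t / y * ((z - c) / y) ^ n) = (\<lambda>n. ?f n t)" by (simp add: y_def power_divide)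
        also have "X t / y * (1 / (1 - (z - c) / y)) = X t / (y * (1 - (z - c) / y))" by simp
        also have "y * (1 - (z - c) / y) = y - (z - c)"
          using nonzero_mult_div_cancel_left[OF y(1), of "z - c"] by (simp only: right_diff_distrib[of y 1] mult_1_right times_divide_eq_right)
        finally show ?case by (simp add: sums_iff y_def)
      qed
    qed
    also have "\<dots> = h z" by (rule h(2)[OF z])
    finally show ?thesis unfolding a_def integral_mult_left_zero .
  qed
  have sumsb: "(\<lambda>n. b n * (z - c) ^ n) sums h z" if "z \<in> ball c d" for z
    using holomorphic_power_series[OF h(1) that] by (simp add: b_def)
  \<comment> \<open>The two series are compared through their values near 0, which asks for positive
    radii of convergence; summability at the point \<open>w\<close>, halfway to the boundary,
    provides them.\<close>
  define w where "w = complex_of_real (d / 2)"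
  have cr: "fps_conv_radius (Abs_fps f) > 0" if "\<And>z. z \<in> ball c d \<Longrightarrow> (\<lambda>n. f n * (z - c) ^ n) sums h z" for f
  proof -
    have "c + w \<in> ball c d" using d(1) by (simp add: w_def dist_norm)
    from that[OF this] have "summable (\<lambda>n. f n * w ^ n)" by (simp add: sums_iff)
    from conv_radius_geI[OF this] have "ereal (d / 2) \<le> conv_radius f" using d(1) by (simp add: w_def)
    then show ?thesis unfolding fps_conv_radius_def using d(1) by (simp add: less_le_trans[of 0 "ereal (d / 2)"])
  qed
  have "Abs_fps a = Abs_fps b"
  proof (rule eval_fps_eqD[OF cr[OF sums] cr[OF sumsb]])
    have "\<forall>\<^sub>F z in nhds 0. z \<in> ball (0::complex) d" using d(1) by (intro eventually_nhds_in_open) auto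
    then show "\<forall>\<^sub>F z in nhds 0. eval_fps (Abs_fps a) z = eval_fps (Abs_fps b) z"
    proof eventually_elim
      case (elim z)
      then have "c + z \<in> ball c d" by (simp add: dist_norm)
      from sums[OF this] sumsb[OF this] show ?case by (simp add: eval_fps_def sums_iff)
    qed
  qed
  then have "a k = b k" by (metis fps_nth_Abs_fps)
  then show ?thesis by (simp add: a_def b_def)
qed

subsection \<open>Residues in a local coordinate\<close>

text \<open>On the punctured neighbourhood the function has a primitive, so its integral over a
  closed circle vanishes.\<close>

lemma residue_deriv:
  assumes S: "open S" "z \<in> S" and f: "f holomorphic_on S - {z}"
  shows "residue (deriv f) z = 0"
proof -
  obtain r where r: "r > 0" "cball z r \<subseteq> S" using S open_contains_cball by blast
  have o: "open (S - {z})" using S by (intro open_delete)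
  have "(deriv f has_contour_integral 2 * pi * \<i> * residue (deriv f) z) (circlepath z r)"
    by (rule base_residue[OF S r(1) holomorphic_deriv[OF f o] r(2)])
  moreover have "(deriv f has_contour_integral (f (pathfinish (circlepath z r)) - f (pathstart (circlepath z r)))) (circlepath z r)"
  proof (rule contour_integral_primitive)
    show "(f has_field_derivative deriv f x) (at x within S - {z})" if "x \<in> S - {z}" for x
      using holomorphic_derivI[OF f o that] by (rule has_field_derivative_at_within)
    show "path_image (circlepath z r) \<subseteq> S - {z}" using r by (auto simp: sphere_def)
  qed auto
  ultimately have "2 * pi * \<i> * residue (deriv f) z = f (pathfinish (circlepath z r)) - f (pathstart (circlepath z r))"
    by (rule contour_integral_unique[THEN trans[OF sym], OF _ contour_integral_unique])
  then show ?thesis by simp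
qed

text \<open>Induction on \<open>k\<close>: integrating by parts lowers the order of the pole.\<close>

lemma residue_local_coordinate:
  assumes r: "r > 0" and \<phi>: "\<phi> holomorphic_on ball \<zeta> r" "\<phi> \<zeta> = 0" "\<And>z. z \<in> ball \<zeta> r \<Longrightarrow> deriv \<phi> z \<noteq> 0"
      "\<And>z. z \<in> ball \<zeta> r - {\<zeta>} \<Longrightarrow> \<phi> z \<noteq> 0"
    and u: "u holomorphic_on ball \<zeta> r"
  shows "residue (\<lambda>t. u t * deriv \<phi> t / \<phi> t ^ Suc k) \<zeta> = 1 / fact k * (((\<lambda>u t. deriv u t / deriv \<phi> t) ^^ k) u) \<zeta>"
  using u
proof (induction k arbitrary: u)
  case 0
  \<comment> \<open>Dividing the zero out of \<open>\<phi>\<close> exhibits a simple pole in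
    \<open>t - \<zeta>\<close>. The value of \<open>\<psi>\<close> at \<open>\<zeta>\<close> is
    \<open>deriv \<phi> \<zeta>\<close>, which then cancels in the residue.\<close>
  define \<psi> where "\<psi> z = (if z = \<zeta> then deriv \<phi> \<zeta> else \<phi> z / (z - \<zeta>))" for z
  have d\<phi>: "deriv \<phi> holomorphic_on ball \<zeta> r" by (intro holomorphic_deriv \<phi> open_ball)
  have \<psi>h: "\<psi> holomorphic_on ball \<zeta> r"
    using pole_theorem_open[OF \<phi>(1) open_ball, of \<zeta>]
    unfolding \<psi>_def by (rule holomorphic_transform) (auto simp: \<phi>(2))
  have \<psi>0: "\<psi> z \<noteq> 0" if "z \<in> ball \<zeta> r" for z using \<phi>(3)[OF that] \<phi>(4)[of z] that by (auto simp: \<psi>_def)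
  have "residue (\<lambda>t. u t * deriv \<phi> t / \<phi> t ^ Suc 0) \<zeta> = residue (\<lambda>t. (u t * deriv \<phi> t / \<psi> t) / (t - \<zeta>)) \<zeta>"
  proof (rule residue_cong)
    show "\<forall>\<^sub>F t in at \<zeta>. u t * deriv \<phi> t / \<phi> t ^ Suc 0 = u t * deriv \<phi> t / \<psi> t / (t - \<zeta>)"
      by (auto simp: eventually_at_filter \<psi>_def)
  qed simp
  also have "\<dots> = u \<zeta> * deriv \<phi> \<zeta> / \<psi> \<zeta>"
    by (rule residue_simple[OF open_ball]) (use r \<psi>0 in \<open>auto intro!: holomorphic_intros 0 \<phi>(1) d\<phi> \<psi>h\<close>)
  also have "\<dots> = u \<zeta>" using \<phi>(3)[of \<zeta>] r by (simp add: \<psi>_def)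
  finally show ?case by simp
next
  case (Suc k)
  let ?B = "ball \<zeta> r"
  define v where "v t = deriv u t / deriv \<phi> t" for t
  have d\<phi>: "deriv \<phi> holomorphic_on ?B" by (intro holomorphic_deriv \<phi> open_ball)
  have du: "deriv u holomorphic_on ?B" by (intro holomorphic_deriv Suc.prems open_ball)
  have vh: "v holomorphic_on ?B" unfolding v_def using \<phi>(3) by (intro holomorphic_intros du d\<phi>) auto
  have sub: "f holomorphic_on ?B - {\<zeta>}" if "f holomorphic_on ?B" for f
    by (rule holomorphic_on_subset[OF that]) auto
  define W where "W t = u t / \<phi> t ^ Suc k" for t
  have Wh: "W holomorphic_on ?B - {\<zeta>}"
    unfolding W_def using \<phi>(4) by (intro holomorphic_intros sub Suc.prems \<phi>(1)) auto
  have o: "open (?B - {\<zeta>})" by (intro open_delete open_ball)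
  have dW: "deriv W t = v t * deriv \<phi> t / \<phi> t ^ Suc k - of_nat (Suc k) * (u t * deriv \<phi> t / \<phi> t ^ Suc (Suc k))"
    if t: "t \<in> ?B - {\<zeta>}" for t
  proof -
    have tB: "t \<in> ?B" using t by simp
    have ph: "\<phi> t \<noteq> 0" "deriv \<phi> t \<noteq> 0" using \<phi>(3)[OF tB] \<phi>(4)[OF t] by auto
    have 1: "(u has_field_derivative deriv u t) (at t)" by (rule holomorphic_derivI[OF Suc.prems open_ball tB])
    have 2: "(\<phi> has_field_derivative deriv \<phi> t) (at t)" by (rule holomorphic_derivI[OF \<phi>(1) open_ball tB])
    have "(W has_field_derivative (deriv u t * \<phi> t ^ Suc k - u t * (of_nat (Suc k) * (deriv \<phi> t * \<phi> t ^ k))) / (\<phi> t ^ Suc k * \<phi> t ^ Suc k)) (at t)"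
      unfolding W_def by (rule DERIV_divide[OF 1 DERIV_power_Suc[OF 2, of k, simplified]] DERIV_cong[OF DERIV_divide[OF 1 DERIV_power[OF 2, of "Suc k"]]])
         (use ph in simp_all)
    then have "deriv W t = (deriv u t * \<phi> t ^ Suc k - u t * (of_nat (Suc k) * (deriv \<phi> t * \<phi> t ^ k))) / (\<phi> t ^ Suc k * \<phi> t ^ Suc k)"
      by (rule DERIV_imp_deriv)
    also have "\<dots> = deriv u t / \<phi> t ^ Suc k - of_nat (Suc k) * (u t * deriv \<phi> t / \<phi> t ^ Suc (Suc k))"
      using ph by (simp add: diff_divide_distrib)
    also have "deriv u t = v t * deriv \<phi> t" using ph by (simp add: v_def)
    finally show ?thesis .
  qed
  have h1: "(\<lambda>t. v t * deriv \<phi> t / \<phi> t ^ Suc k) holomorphic_on ?B - {\<zeta>}"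
    using \<phi>(4) by (intro holomorphic_intros sub vh d\<phi> \<phi>(1)) auto
  have h2: "(\<lambda>t. u t * deriv \<phi> t / \<phi> t ^ Suc (Suc k)) holomorphic_on ?B - {\<zeta>}"
    using \<phi>(4) by (intro holomorphic_intros sub Suc.prems d\<phi> \<phi>(1)) auto
  have zB: "\<zeta> \<in> ?B" using r by simp
  have "0 = residue (deriv W) \<zeta>" by (rule residue_deriv[OF open_ball zB Wh, symmetric])
  also have "\<dots> = residue (\<lambda>t. v t * deriv \<phi> t / \<phi> t ^ Suc k - of_nat (Suc k) * (u t * deriv \<phi> t / \<phi> t ^ Suc (Suc k))) \<zeta>"
  proof (rule residue_cong)
    have "\<forall>\<^sub>F t in at \<zeta>. t \<in> ?B - {\<zeta>}" using r by (intro eventually_at_in_open) auto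
    then show "\<forall>\<^sub>F t in at \<zeta>. deriv W t = v t * deriv \<phi> t / \<phi> t ^ Suc k - of_nat (Suc k) * (u t * deriv \<phi> t / \<phi> t ^ Suc (Suc k))"
      by eventually_elim (rule dW)
  qed simp
  also have "\<dots> = residue (\<lambda>t. v t * deriv \<phi> t / \<phi> t ^ Suc k) \<zeta> - residue (\<lambda>t. of_nat (Suc k) * (u t * deriv \<phi> t / \<phi> t ^ Suc (Suc k))) \<zeta>"
    by (rule residue_diff[OF open_ball zB h1]) (intro holomorphic_intros h2)
  also have "residue (\<lambda>t. of_nat (Suc k) * (u t * deriv \<phi> t / \<phi> t ^ Suc (Suc k))) \<zeta> = of_nat (Suc k) * residue (\<lambda>t. u t * deriv \<phi> t / \<phi> t ^ Suc (Suc k)) \<zeta>"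
    by (rule residue_lmul[OF open_ball zB h2])
  also have "residue (\<lambda>t. v t * deriv \<phi> t / \<phi> t ^ Suc k) \<zeta> = 1 / fact k * (((\<lambda>u t. deriv u t / deriv \<phi> t) ^^ k) v) \<zeta>"
    by (rule Suc.IH[OF vh])
  also have "((\<lambda>u t. deriv u t / deriv \<phi> t) ^^ k) v = ((\<lambda>u t. deriv u t / deriv \<phi> t) ^^ Suc k) u"
    unfolding funpow_Suc_right o_def v_def ..
  finally have "of_nat (Suc k) * residue (\<lambda>t. u t * deriv \<phi> t / \<phi> t ^ Suc (Suc k)) \<zeta> =
      1 / fact k * (((\<lambda>u t. deriv u t / deriv \<phi> t) ^^ Suc k) u) \<zeta>" by simp
  moreover have "x = 1 / fact (Suc k) * y" if "of_nat (Suc k) * x = 1 / fact k * y" for x y :: complex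
  proof -
    have "x = (of_nat (Suc k) * x) / of_nat (Suc k)" by (simp del: of_nat_Suc)
    then show ?thesis unfolding that by (simp add: fact_Suc mult.commute del: of_nat_Suc)
  qed
  ultimately show ?case by blast
qed

subsection \<open>Transfer between the disk and the domain\<close>

text \<open>Zeros of \<open>c\<close> are isolated, so the cancelled identity holds on a punctured
  neighbourhood of each of them and extends by continuity. This carries identities across the zeros
  of \<open>\<Delta>\<close> and \<open>g\<close>.\<close>

lemma holomorphic_cancel:
  assumes S: "open S" "connected S" and c: "c holomorphic_on S" "z0 \<in> S" "c z0 \<noteq> 0"
    and ab: "continuous_on S a" "continuous_on S b" and eq: "\<And>z. z \<in> S \<Longrightarrow> c z * a z = c z * (b z :: complex)"
    and z: "z \<in> S"
  shows "a z = b z"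
proof (cases "c z = 0")
  case True
  obtain r where r: "0 < r" "ball z r \<subseteq> S" "\<And>w. w \<in> ball z r - {z} \<Longrightarrow> c w \<noteq> 0"
    using isolated_zeros[OF c(1) S z True c(2,3)] by blast
  have "\<forall>\<^sub>F w in at z. w \<in> ball z r - {z}" using r(1) by (intro eventually_at_in_open) auto
  then have "\<forall>\<^sub>F w in at z. a w = b w"
    by eventually_elim (use r(2,3) eq in \<open>meson Diff_iff in_mono mult_left_cancel\<close>)
  moreover have "a \<midarrow>z\<rightarrow> a z" "b \<midarrow>z\<rightarrow> b z"
    using ab z S(1) by (simp_all add: continuous_on_eq_continuous_at isContD)
  ultimately show ?thesis by (intro tendsto_unique[of "at z" b "a z" "b z"]) (auto intro: Lim_transform_eventually)
qed (use eq[OF z] in simp)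

text \<open>Where \<open>g\<close> vanishes the plain quotient is 0 by convention, so the identity
  is first obtained off the zeros and then extended by cancelling \<open>g\<close>. If
  \<open>g\<close> vanished identically, the repaired quotient would be 0 at the origin, against the
  zero-freeness of outer functions.\<close>

lemma remove_sings_quotient_mult:
  assumes u: "u holomorphic_on ball 0 1" and g: "g holomorphic_on ball 0 1"
    and q: "outer_smirnov (remove_sings (\<lambda>t. u t / g t))" and z: "cmod z < 1"
  shows "remove_sings (\<lambda>t. u t / g t) z * g z = u z"
proof -
  let ?q = "remove_sings (\<lambda>t. u t / g t)"
  have qh: "?q holomorphic_on ball 0 1" using q by (simp add: outer_smirnov_def)
  have "\<exists>z0\<in>ball 0 1. g z0 \<noteq> 0"
  proof (rule ccontr)
    assume *: "\<not> ?thesis"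
    have "\<forall>\<^sub>F t in at 0. t \<in> ball (0::complex) 1 - {0}" by (intro eventually_at_in_open) auto
    then have "\<forall>\<^sub>F t in at 0. 0 = u t / g t" by eventually_elim (use * in auto)
    then have "(\<lambda>t. u t / g t) \<midarrow>0\<rightarrow> 0" by (rule Lim_transform_eventually[OF tendsto_const])
    then have "?q 0 = 0" by (rule remove_sings_eqI)
    then show False using outer_smirnov_nonzero[OF q, of 0] by simp
  qed
  then obtain z0 where z0: "z0 \<in> ball 0 1" "g z0 \<noteq> 0" by blast
  show ?thesis
  proof (rule holomorphic_cancel[OF open_ball connected_ball g z0, where a = "\<lambda>z. ?q z * g z" and b = u])
    show "continuous_on (ball 0 1) (\<lambda>z. ?q z * g z)" "continuous_on (ball 0 1) u"
      by (intro continuous_on_mult holomorphic_on_imp_continuous_on qh g u)+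
    show "g w * (?q w * g w) = g w * u w" if w: "w \<in> ball 0 1" for w
    proof (cases "g w = 0")
      case False
      have "isCont u w" "isCont g w"
        using w holomorphic_on_imp_continuous_on[OF u] holomorphic_on_imp_continuous_on[OF g]
        by (auto simp: continuous_on_eq_continuous_at)
      then have "(\<lambda>t. u t / g t) \<midarrow>w\<rightarrow> u w / g w" using False by (intro tendsto_divide isContD)
      then have "?q w = u w / g w" by (rule remove_sings_eqI)
      then show ?thesis using False by simp
    qed simp
  qed (use z in simp)
qed

lemma deck_group_holomorphic:
  assumes "\<gamma> \<in> deck_group \<Lambda>"
  shows "\<gamma> holomorphic_on ball 0 1"
proof -
  obtain \<theta> w where w: "cmod w < 1" "\<gamma> = restrict (Moebius_function \<theta> w) (cball 0 1)" using assms by (rule deck_groupE)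
  show ?thesis by (rule holomorphic_transform[OF Moebius_function_holomorphic[OF w(1)]]) (simp add: w(2))
qed

lemma deriv_automorphic:
  assumes \<gamma>: "\<gamma> \<in> deck_group \<Lambda>" and u: "u holomorphic_on ball 0 1"
    and eq: "\<And>z. cmod z < 1 \<Longrightarrow> u (\<gamma> z) = m * u z" and z: "cmod z < 1"
  shows "deriv u (\<gamma> z) * deriv \<gamma> z = m * deriv u z"
proof -
  have z': "z \<in> ball 0 1" "\<gamma> z \<in> ball 0 1" using z deck_group_ball[OF \<gamma> z] by auto
  have "((\<lambda>z. u (\<gamma> z)) has_field_derivative deriv u (\<gamma> z) * deriv \<gamma> z) (at z)"
    by (rule DERIV_chain2[OF holomorphic_derivI[OF u open_ball z'(2)]
        holomorphic_derivI[OF deck_group_holomorphic[OF \<gamma>] open_ball z'(1)]])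
  then have "((\<lambda>z. m * u z) has_field_derivative deriv u (\<gamma> z) * deriv \<gamma> z) (at z)"
    by (rule has_field_derivative_transform_within_open[OF _ open_ball z'(1)]) (simp add: eq)
  moreover have "((\<lambda>z. m * u z) has_field_derivative m * deriv u z) (at z)"
    by (rule DERIV_cmult[OF holomorphic_derivI[OF u open_ball z'(1)]])
  ultimately show ?thesis by (rule DERIV_unique)
qed

text \<open>The group acts transitively on the fibres, so an invariant function does not depend on
  the chosen preimage. Holomorphy is local: where \<open>deriv \<Lambda>\<close> is nonzero,
  \<open>\<Lambda>\<close> has a holomorphic local inverse.\<close>

lemma deck_group_descend:
  assumes unif: "uniformization \<Lambda> D" and d: "\<And>z. cmod z < 1 \<Longrightarrow> deriv \<Lambda> z \<noteq> 0"
    and H: "H holomorphic_on ball 0 1"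
    and inv: "\<And>\<gamma> z. \<gamma> \<in> deck_group \<Lambda> \<Longrightarrow> cmod z < 1 \<Longrightarrow> H (\<gamma> z) = H z"
  shows "\<exists>h. h holomorphic_on D \<and> (\<forall>z. cmod z < 1 \<longrightarrow> h (\<Lambda> z) = H z)"
proof -
  define h where "h s = H (SOME z. cmod z < 1 \<and> \<Lambda> z = s)" for s
  have h: "h (\<Lambda> z) = H z" if z: "cmod z < 1" for z
  proof -
    define w where "w = (SOME w. cmod w < 1 \<and> \<Lambda> w = \<Lambda> z)"
    have w: "cmod w < 1 \<and> \<Lambda> w = \<Lambda> z" unfolding w_def by (rule someI[of _ z]) (use z in simp)
    obtain \<gamma> where \<gamma>: "\<gamma> \<in> deck_group \<Lambda>" "\<gamma> z = w"
      using deck_group_transitive[OF unif z conjunct1[OF w]] w by force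
    have "h (\<Lambda> z) = H w" by (simp add: h_def w_def)
    also have "\<dots> = H z" using inv[OF \<gamma>(1) z] by (simp add: \<gamma>(2))
    finally show ?thesis .
  qed
  have "h field_differentiable at s" if s: "s \<in> D" for s
  proof -
    obtain z where z: "z \<in> ball 0 1" "s = \<Lambda> z" using s unif_image[OF unif] by blast
    obtain r where r: "r > 0" "ball z r \<subseteq> ball 0 1" "inj_on \<Lambda> (ball z r)"
      using has_complex_derivative_locally_injective[OF unif_hol[OF unif] z(1) open_ball] d[of z] z(1) by auto
    have L: "\<Lambda> holomorphic_on ball z r" by (rule holomorphic_on_subset[OF unif_hol[OF unif] r(2)])
    obtain g where g: "g holomorphic_on \<Lambda> ` ball z r" "\<And>w. w \<in> ball z r \<Longrightarrow> g (\<Lambda> w) = w"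
      using holomorphic_has_inverse[OF L open_ball r(3)] by metis
    have o: "open (\<Lambda> ` ball z r)" by (rule open_mapping_thm3[OF L open_ball r(3)])
    have "(H \<circ> g) holomorphic_on \<Lambda> ` ball z r"
      by (rule holomorphic_on_compose_gen[OF g(1) H]) (use g(2) r(2) in auto)
    then have "h holomorphic_on \<Lambda> ` ball z r"
    proof (rule holomorphic_transform)
      fix s assume "s \<in> \<Lambda> ` ball z r"
      then obtain w where w: "w \<in> ball z r" "s = \<Lambda> w" by blast
      have "cmod w < 1" using subsetD[OF r(2) w(1)] by simp
      then show "(H \<circ> g) s = h s" using g(2)[OF w(1)] h[of w] by (simp add: w(2))
    qed
    then show ?thesis by (rule holomorphic_on_imp_differentiable_at[OF _ o]) (use z r(1) in auto)
  qed
  then have "h holomorphic_on D" by (auto simp: holomorphic_on_def intro: field_differentiable_at_within)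
  with h show ?thesis by blast
qed

text \<open>By the chain rule, division by \<open>deriv \<Lambda>\<close> turns the derivative in
  \<open>t\<close> into the derivative in the coordinate \<open>\<Lambda>\<close>. The denominator
  is phrased through \<open>\<phi>\<close>, later \<open>\<Lambda> - c\<close>, because the residue
  is computed in a coordinate that vanishes at \<open>\<zeta>\<close>.\<close>

lemma funpow_deriv_quotient_comp:
  assumes D: "open D" and L: "\<Lambda> holomorphic_on ball 0 1" "\<Lambda> ` ball 0 1 \<subseteq> D" and d: "\<And>z. cmod z < 1 \<Longrightarrow> deriv \<Lambda> z \<noteq> 0"
    and h: "h holomorphic_on D" and \<phi>: "\<And>z. cmod z < 1 \<Longrightarrow> deriv \<phi> z = deriv \<Lambda> z" and z: "cmod z < 1"
  shows "((\<lambda>u t. deriv u t / deriv \<phi> t) ^^ k) (\<lambda>t. h (\<Lambda> t)) z = (deriv ^^ k) h (\<Lambda> z)"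
  using z
proof (induction k arbitrary: z)
  case (Suc k)
  let ?U = "((\<lambda>u t. deriv u t / deriv \<phi> t) ^^ k) (\<lambda>t. h (\<Lambda> t))" and ?h = "(deriv ^^ k) h"
  have z: "z \<in> ball 0 1" "\<Lambda> z \<in> D" using Suc.prems L(2) by auto
  have "(?h has_field_derivative deriv ?h (\<Lambda> z)) (at (\<Lambda> z))"
    by (rule holomorphic_derivI[OF holomorphic_higher_deriv[OF h D] D z(2)])
  from DERIV_chain2[OF this holomorphic_derivI[OF L(1) open_ball z(1)]]
  have "((\<lambda>z. ?h (\<Lambda> z)) has_field_derivative deriv ?h (\<Lambda> z) * deriv \<Lambda> z) (at z)" .
  then have "(?U has_field_derivative deriv ?h (\<Lambda> z) * deriv \<Lambda> z) (at z)"
    by (rule has_field_derivative_transform_within_open[OF _ open_ball z(1)]) (simp add: Suc.IH)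
  then have "deriv ?U z = deriv ?h (\<Lambda> z) * deriv \<Lambda> z" by (rule DERIV_imp_deriv)
  then show ?case using d[OF Suc.prems] \<phi>[OF Suc.prems] by simp
qed simp

lemma nt_lim_norm_le:
  assumes "has_nt_limit u t l" "cmod t = 1" "\<And>z. cmod z < 1 \<Longrightarrow> cmod (u z) \<le> C"
  shows "cmod l \<le> C"
proof -
  have "(\<lambda>n. cmod (u (of_real (radial n) * t))) \<longlonglongrightarrow> cmod l"
    by (intro tendsto_intros has_nt_limit_radial assms(1,2))
  moreover have "cmod (u (of_real (radial n) * t)) \<le> C" for n
    using radial(1)[of n] radial(2)[of n] assms(2) by (intro assms(3)) (simp add: norm_mult)
  ultimately show ?thesis by (intro LIMSEQ_le_const2) auto
qed

text \<open>Differentiating \<open>u \<circ> \<gamma> = m u\<close> for \<open>u = g\<close> and \<open>\<Lambda> \<circ> \<gamma> = \<Lambda>\<close> produces the same factor \<open>\<gamma>'\<close>, which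
  cancels in the quotient of \<open>f g'\<close> and \<open>\<Delta> \<Lambda>'\<close>.\<close>

lemma automorphic_density_invariant:
  fixes k :: nat
  assumes unif: "uniformization \<Lambda> D" and d: "\<And>z. cmod z < 1 \<Longrightarrow> deriv \<Lambda> z \<noteq> 0" and \<gamma>: "\<gamma> \<in> deck_group \<Lambda>"
    and hol: "f holomorphic_on ball 0 1" "g holomorphic_on ball 0 1" "\<Delta> holomorphic_on ball 0 1"
      "v holomorphic_on ball 0 1" "q holomorphic_on ball 0 1"
    and dg: "\<And>z. cmod z < 1 \<Longrightarrow> deriv g z = \<Delta> z * v z" and qg: "\<And>z. cmod z < 1 \<Longrightarrow> q z * g z = \<Lambda> z - c"
    and nz: "cmod z0 < 1" "\<Delta> z0 * g z0 ^ Suc k \<noteq> 0" and m: "m \<noteq> 0" "n \<noteq> 0"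
    and aut: "\<And>z. cmod z < 1 \<Longrightarrow> g (\<gamma> z) = m * g z" "\<And>z. cmod z < 1 \<Longrightarrow> \<Delta> (\<gamma> z) = n * \<Delta> z"
      "\<And>z. cmod z < 1 \<Longrightarrow> f (\<gamma> z) = m ^ k * n * f z"
    and z: "cmod z < 1"
  defines "H \<equiv> \<lambda>z. f z * v z * q z ^ Suc k / deriv \<Lambda> z"
  shows "H (\<gamma> z) = H z"
proof -
  note L = unif_hol[OF unif]
  have \<gamma>b: "cmod (\<gamma> w) < 1" if "cmod w < 1" for w by (rule deck_group_ball[OF \<gamma> that])
  have Hh: "H holomorphic_on ball 0 1" unfolding H_def
    using d by (intro holomorphic_intros hol holomorphic_deriv[OF L]) auto
  have id: "H w * deriv \<Lambda> w * \<Delta> w * g w ^ Suc k = f w * deriv g w * (\<Lambda> w - c) ^ Suc k" if w: "cmod w < 1" for w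
  proof -
    have "H w * deriv \<Lambda> w = f w * v w * q w ^ Suc k" using d[OF w] by (simp add: H_def)
    then have "H w * deriv \<Lambda> w * \<Delta> w * g w ^ Suc k = f w * (\<Delta> w * v w) * (q w ^ Suc k * g w ^ Suc k)"
      by (simp only: mult_ac)
    also have "\<dots> = f w * deriv g w * (\<Lambda> w - c) ^ Suc k"
      unfolding dg[OF w] qg[OF w, symmetric] power_mult_distrib ..
    finally show ?thesis .
  qed
  show ?thesis
  proof (rule holomorphic_cancel[OF open_ball connected_ball, where c = "\<lambda>w. \<Delta> w * g w ^ Suc k" and ?z0.0 = z0
        and a = "\<lambda>w. H (\<gamma> w)" and b = H])
    show "z0 \<in> ball 0 1" "z \<in> ball 0 1" using nz(1) z by simp_all
    show "\<Delta> z0 * g z0 ^ Suc k \<noteq> 0" by (rule nz(2))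
    show "(\<lambda>w. \<Delta> w * g w ^ Suc k) holomorphic_on ball 0 1" by (intro holomorphic_intros hol)
    show "continuous_on (ball 0 1) (\<lambda>w. H (\<gamma> w))"
      by (rule continuous_on_compose2[OF holomorphic_on_imp_continuous_on[OF Hh]
            holomorphic_on_imp_continuous_on[OF deck_group_holomorphic[OF \<gamma>]]]) (use \<gamma>b in auto)
    show "continuous_on (ball 0 1) H" by (rule holomorphic_on_imp_continuous_on[OF Hh])
    fix w :: complex assume "w \<in> ball 0 1"
    then have w: "cmod w < 1" by simp
    have e1: "deriv g (\<gamma> w) * deriv \<gamma> w = m * deriv g w" by (rule deriv_automorphic[OF \<gamma> hol(2) aut(1) w])
    have e2: "deriv \<Lambda> (\<gamma> w) * deriv \<gamma> w = deriv \<Lambda> w"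
      using deriv_automorphic[OF \<gamma> L, of 1 w] deck_group_invariant[OF \<gamma>] w by simp
    have "(m ^ Suc k * n * deriv \<Lambda> w) * (\<Delta> w * g w ^ Suc k * H (\<gamma> w)) =
        (H (\<gamma> w) * deriv \<Lambda> (\<gamma> w) * \<Delta> (\<gamma> w) * g (\<gamma> w) ^ Suc k) * deriv \<gamma> w"
      unfolding aut(1,2)[OF w] e2[symmetric] power_mult_distrib by (simp only: mult_ac)
    also have "\<dots> = f (\<gamma> w) * (deriv g (\<gamma> w) * deriv \<gamma> w) * (\<Lambda> w - c) ^ Suc k"
      unfolding id[OF \<gamma>b[OF w]] deck_group_invariant[OF \<gamma> w] by (simp only: mult_ac)
    also have "\<dots> = m ^ Suc k * n * (H w * deriv \<Lambda> w * \<Delta> w * g w ^ Suc k)"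
      unfolding id[OF w] e1 aut(3)[OF w] by (simp add: mult_ac)
    also have "\<dots> = (m ^ Suc k * n * deriv \<Lambda> w) * (\<Delta> w * g w ^ Suc k * H w)" by (simp only: mult_ac)
    finally have eq: "(m ^ Suc k * n * deriv \<Lambda> w) * (\<Delta> w * g w ^ Suc k * H (\<gamma> w)) =
        (m ^ Suc k * n * deriv \<Lambda> w) * (\<Delta> w * g w ^ Suc k * H w)" .
    have "m ^ Suc k * n * deriv \<Lambda> w \<noteq> 0" using m d[OF w] by simp
    from mult_left_cancel[OF this] eq show "\<Delta> w * g w ^ Suc k * H (\<gamma> w) = \<Delta> w * g w ^ Suc k * H w" by blast
  qed
qed

text \<open>By freeness the orbit map is injective, so the orbit sum in the logarithmic derivative
  becomes a sum over the group, the form in which unfolding produces it.\<close>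

lemma poisson_orbit_sum:
  assumes unif: "uniformization \<Lambda> D" and \<zeta>: "cmod \<zeta> < 1"
  defines "A \<equiv> group_orbit (deck_group \<Lambda>) \<zeta>"
  assumes summ: "(\<lambda>a. 1 - cmod a) summable_on A" and t: "cmod t = 1"
    and l: "has_nt_limit (blaschke_product A) t l" and l1: "cmod l = 1"
    and c: "has_nt_limit (deriv (blaschke_product A)) t c"
  shows "0 \<le> Re (c * t / l)" "of_real (Re (c * t / l)) = c * t / l"
    "(\<integral>\<^sup>+\<gamma>. ennreal (poisson (\<gamma> \<zeta>) t) \<partial>count_space (deck_group \<Lambda>)) = ennreal (Re (c * t / l))"
proof -
  have A: "A \<subseteq> ball 0 1" using deck_group_ball[OF _ \<zeta>] by (auto simp: A_def group_orbit_def)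
  note ld = blaschke_product_log_derivative[OF A summ t l l1 c]
  have inj: "inj_on (\<lambda>\<gamma>. \<gamma> \<zeta>) (deck_group \<Lambda>)"
    by (rule inj_onI) (rule deck_group_free[OF unif _ _ \<zeta>])
  have Re: "Re (c * t / l) = (\<Sum>\<^sub>\<infinity>a\<in>A. poisson a t)" unfolding ld(2) by simp
  show "0 \<le> Re (c * t / l)" unfolding Re using A by (intro infsum_nonneg poisson_nonneg) auto
  show "of_real (Re (c * t / l)) = c * t / l" unfolding ld(2) by simp
  have "(\<lambda>\<gamma>. poisson (\<gamma> \<zeta>) t) summable_on deck_group \<Lambda>"
    using ld(1) unfolding A_def group_orbit_def summable_on_reindex[OF inj] by (simp add: o_def)
  then have "(\<integral>\<^sup>+\<gamma>. ennreal (poisson (\<gamma> \<zeta>) t) \<partial>count_space (deck_group \<Lambda>)) = ennreal (\<Sum>\<^sub>\<infinity>\<gamma>\<in>deck_group \<Lambda>. poisson (\<gamma> \<zeta>) t)"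
    by (rule nn_integral_count_space_infsum[rotated]) (rule poisson_nonneg[OF deck_group_ball[OF _ \<zeta>]])
  also have "(\<Sum>\<^sub>\<infinity>\<gamma>\<in>deck_group \<Lambda>. poisson (\<gamma> \<zeta>) t) = (\<Sum>\<^sub>\<infinity>a\<in>A. poisson a t)"
    unfolding A_def group_orbit_def infsum_reindex[OF inj] by (simp add: o_def)
  finally show "(\<integral>\<^sup>+\<gamma>. ennreal (poisson (\<gamma> \<zeta>) t) \<partial>count_space (deck_group \<Lambda>)) = ennreal (Re (c * t / l))" unfolding Re .
qed

text \<open>A summable real family has only countably many nonzero terms, and
  \<open>1 - cmod a\<close> is positive on the whole orbit; by freeness the orbit is in bijection
  with the group.\<close>

lemma deck_group_countable:
  assumes unif: "uniformization \<Lambda> D" and \<zeta>: "cmod \<zeta> < 1"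
    and summ: "(\<lambda>a. 1 - cmod a) summable_on group_orbit (deck_group \<Lambda>) \<zeta>"
  shows "countable (deck_group \<Lambda>)"
proof -
  have inj: "inj_on (\<lambda>\<gamma>. \<gamma> \<zeta>) (deck_group \<Lambda>)"
    by (rule inj_onI) (rule deck_group_free[OF unif _ _ \<zeta>])
  have "{a \<in> group_orbit (deck_group \<Lambda>) \<zeta>. 1 - cmod a \<noteq> 0} = (\<lambda>\<gamma>. \<gamma> \<zeta>) ` deck_group \<Lambda>"
    using deck_group_ball[OF _ \<zeta>] by (force simp: group_orbit_def)
  then have "countable ((\<lambda>\<gamma>. \<gamma> \<zeta>) ` deck_group \<Lambda>)" using summable_countable_real[OF summ] by simp
  then show ?thesis by (rule countable_image_inj_on[OF _ inj])
qed

theorem theorem2p2: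
  fixes D E :: "complex set" and \<Lambda> :: "complex \<Rightarrow> complex"
    and \<Gamma> :: "(complex \<Rightarrow> complex) set"
    and \<zeta> :: complex and k :: nat
    and f \<Delta> :: "complex \<Rightarrow> complex"
    and \<mu> \<delta> :: "(complex \<Rightarrow> complex) \<Rightarrow> complex"
  assumes "open D" and "connected D" and "bounded D"
    and "uniformization \<Lambda> D"
    and "\<Gamma> = deck_group \<Lambda>"
    and "fundamental_set \<Gamma> E"
    and "cauchy_integral_formula D \<Lambda> E"
    and "widom_type \<Gamma>"
    and "outer_smirnov (deriv \<Lambda>)"
    and "\<forall>\<xi>\<in>ball 0 1. outer_smirnov (remove_sings (\<lambda>t. (\<Lambda> t - \<Lambda> \<xi>) / green \<Gamma> \<xi> t))"
    and "\<zeta> \<in> ball 0 1"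
    and "inner_part_of (deriv (green \<Gamma> \<zeta>)) \<Delta>"
    and "character_of \<Gamma> (green \<Gamma> \<zeta>) \<mu>"
    and "character_of \<Gamma> \<Delta> \<delta>"
    and "hardy_H1 f"
    and "automorphic \<Gamma> (\<lambda>\<gamma>. \<mu> \<gamma> ^ k * \<delta> \<gamma>) f"
  shows "(LINT t|circle_lebesgue.
            nt_lim f t / (nt_lim \<Delta> t * nt_lim (green \<Gamma> \<zeta>) t ^ k)
              * of_real ((1 - (cmod \<zeta>)\<^sup>2) / (cmod (t - \<zeta>))\<^sup>2))
       = 1 / fact k *
           (((\<lambda>u t. deriv u t / deriv (green \<Gamma> \<zeta>) t) ^^ k) (\<lambda>t. f t / \<Delta> t)) \<zeta>"
proof -
  define g where "g = green \<Gamma> \<zeta>"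
  define A where "A = group_orbit \<Gamma> \<zeta>"
  define c where "c = \<Lambda> \<zeta>"
  define q where "q = remove_sings (\<lambda>t. (\<Lambda> t - c) / g t)"
  note unif = assms(4) and \<Gamma> = assms(5) and cif = assms(7)
  have z: "cmod \<zeta> < 1" using assms(11) by simp
  have gA: "g = blaschke_product A" by (simp add: g_def A_def green_def)
  have summ: "(\<lambda>a. 1 - cmod a) summable_on A" using assms(8,11) unfolding widom_type_def A_def by blast
  have AB: "A \<subseteq> ball 0 1" using deck_group_ball[OF _ z] by (auto simp: A_def group_orbit_def \<Gamma>)
  have countable: "countable \<Gamma>" unfolding \<Gamma>
    by (rule deck_group_countable[OF unif z]) (use summ in \<open>simp add: A_def \<Gamma>\<close>)
  note Lh = unif_hol[OF unif]
  have gh: "g holomorphic_on ball 0 1" unfolding gA by (rule blaschke_product_holomorphic[OF AB summ])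
  have dL: "deriv \<Lambda> w \<noteq> 0" if "cmod w < 1" for w by (rule outer_smirnov_nonzero[OF assms(9) that])
  have inner: "inner_function \<Delta>" and "\<exists>v. outer_smirnov v \<and> (\<forall>z\<in>ball 0 1. deriv g z = \<Delta> z * v z)"
    using assms(12) by (simp_all add: inner_part_of_def g_def)
  then obtain v where v: "outer_smirnov v" and dg: "\<And>w. cmod w < 1 \<Longrightarrow> deriv g w = \<Delta> w * v w" by auto
  have \<Delta>h: "\<Delta> holomorphic_on ball 0 1" and vh: "v holomorphic_on ball 0 1" and fh: "f holomorphic_on ball 0 1"
    using inner v assms(15) by (simp_all add: inner_function_def outer_smirnov_def hardy_H1_def)
  have q: "outer_smirnov q" using bspec[OF assms(10) assms(11)] by (simp add: q_def g_def c_def)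
  have qh: "q holomorphic_on ball 0 1" using q by (simp add: outer_smirnov_def)
  have qg: "q w * g w = \<Lambda> w - c" if "cmod w < 1" for w
    unfolding q_def by (rule remove_sings_quotient_mult[OF _ gh _ that])
      (intro holomorphic_intros Lh, use q in \<open>simp add: q_def\<close>)
  have q0: "q w \<noteq> 0" if "cmod w < 1" for w by (rule outer_smirnov_nonzero[OF q that])

  \<comment> \<open>The local coordinates \<open>\<Lambda> - c\<close> and \<open>g\<close> at
    \<open>\<zeta>\<close>\<close>
  define \<phi> where "\<phi> w = \<Lambda> w - c" for w
  have d\<phi>: "deriv \<phi> w = deriv \<Lambda> w" if "cmod w < 1" for w
  proof -
    have "(\<phi> has_field_derivative deriv \<Lambda> w - 0) (at w)" unfolding \<phi>_def
      by (intro DERIV_diff DERIV_const holomorphic_derivI[OF Lh open_ball]) (use that in simp)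
    then show ?thesis by (simp add: DERIV_imp_deriv)
  qed
  have \<phi>h: "\<phi> holomorphic_on ball 0 1" unfolding \<phi>_def by (intro holomorphic_intros Lh)
  have "restrict (\<lambda>z. z) (cball 0 1) \<zeta> \<in> A"
    unfolding A_def group_orbit_def \<Gamma> by (rule imageI[OF deck_group_id[OF unif]])
  then have g\<zeta>: "g \<zeta> = 0" unfolding gA using z by (intro blaschke_product_zero[OF AB summ]) simp
  \<comment> \<open>Differentiate \<open>q * g = \<Lambda> - c\<close> at \<open>\<zeta>\<close>,
    where \<open>g\<close> vanishes: if \<open>deriv g\<close> vanished as well, so would
    \<open>deriv \<Lambda>\<close>, which is zero-free by outerness.\<close>
  have dg\<zeta>: "deriv g \<zeta> \<noteq> 0"
  proof
    assume 0: "deriv g \<zeta> = 0"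
    have "((\<lambda>w. q w * g w) has_field_derivative deriv q \<zeta> * g \<zeta> + deriv g \<zeta> * q \<zeta>) (at \<zeta>)"
      by (rule DERIV_mult[OF holomorphic_derivI[OF qh open_ball assms(11)] holomorphic_derivI[OF gh open_ball assms(11)]])
    then have "(\<phi> has_field_derivative deriv q \<zeta> * g \<zeta> + deriv g \<zeta> * q \<zeta>) (at \<zeta>)"
      by (rule has_field_derivative_transform_within_open[OF _ open_ball assms(11)]) (simp add: qg \<phi>_def)
    then have "deriv \<phi> \<zeta> = deriv q \<zeta> * g \<zeta> + deriv g \<zeta> * q \<zeta>" by (rule DERIV_imp_deriv)
    then show False using dL[OF z] d\<phi>[OF z] by (simp add: 0 g\<zeta>)
  qed
  have "\<exists>r>0. ball \<zeta> r \<subseteq> ball 0 1 \<and> (\<forall>w\<in>ball \<zeta> r. deriv g w \<noteq> 0) \<and> (\<forall>w\<in>ball \<zeta> r - {\<zeta>}. g w \<noteq> 0)"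
  proof -
    have dgh: "deriv g holomorphic_on ball 0 1" by (rule holomorphic_deriv[OF gh open_ball])
    have "isCont (deriv g) \<zeta>"
      using holomorphic_on_imp_continuous_on[OF dgh] assms(11) by (simp add: continuous_on_eq_continuous_at)
    from continuous_at_avoid[OF this dg\<zeta>] obtain e where e: "e > 0" "\<forall>y. dist \<zeta> y < e \<longrightarrow> deriv g y \<noteq> 0" by blast
    have "\<exists>z0\<in>ball 0 1. g z0 \<noteq> 0"
    proof (rule ccontr)
      assume *: "\<not> ?thesis"
      have "((\<lambda>_. 0) has_field_derivative deriv g \<zeta>) (at \<zeta>)"
        by (rule has_field_derivative_transform_within_open[OF holomorphic_derivI[OF gh open_ball assms(11)] open_ball assms(11)])
          (use * in auto)
      then show False using DERIV_unique[OF _ DERIV_const] dg\<zeta> by blast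
    qed
    then obtain z0 where z0: "z0 \<in> ball 0 1" "g z0 \<noteq> 0" by blast
    obtain r where r: "0 < r" "ball \<zeta> r \<subseteq> ball 0 1" "\<And>w. w \<in> ball \<zeta> r - {\<zeta>} \<Longrightarrow> g w \<noteq> 0"
      using isolated_zeros[OF gh open_ball connected_ball assms(11) g\<zeta> z0] by blast
    show ?thesis using e r by (intro exI[of _ "min e r"]) auto
  qed
  then obtain r where r: "r > 0" and rB: "ball \<zeta> r \<subseteq> ball 0 1"
    and dg0: "\<And>w. w \<in> ball \<zeta> r \<Longrightarrow> deriv g w \<noteq> 0" and g0: "\<And>w. w \<in> ball \<zeta> r - {\<zeta>} \<Longrightarrow> g w \<noteq> 0" by blast
  have r1: "cmod w < 1" if "w \<in> ball \<zeta> r" for w using subsetD[OF rB that] by simp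
  have \<Delta>0: "\<Delta> w \<noteq> 0" if "w \<in> ball \<zeta> r" for w using dg0[OF that] dg[OF r1[OF that]] by auto

  \<comment> \<open>The invariant function and its descent to \<open>D\<close>\<close>
  define H where "H w = f w * v w * q w ^ Suc k / deriv \<Lambda> w" for w
  have Hh: "H holomorphic_on ball 0 1" unfolding H_def
    using dL by (intro holomorphic_intros fh vh qh holomorphic_deriv[OF Lh]) auto
  have char: "\<mu> \<gamma> \<noteq> 0" "\<delta> \<gamma> \<noteq> 0" if "\<gamma> \<in> \<Gamma>" for \<gamma>
    using assms(13,14) that unfolding character_of_def character_def by (force dest: bspec)+
  have aut: "g (\<gamma> w) = \<mu> \<gamma> * g w" "\<Delta> (\<gamma> w) = \<delta> \<gamma> * \<Delta> w" "f (\<gamma> w) = \<mu> \<gamma> ^ k * \<delta> \<gamma> * f w"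
    if "\<gamma> \<in> \<Gamma>" "cmod w < 1" for \<gamma> w
    using assms(13,14,16) that unfolding character_of_def automorphic_def g_def by simp_all
  have Hinv: "H (\<gamma> w) = H w" if \<gamma>: "\<gamma> \<in> deck_group \<Lambda>" and w: "cmod w < 1" for \<gamma> w
  proof -
    \<comment> \<open>A point of the punctured ball, witnessing that the factor to be cancelled is
      not identically zero.\<close>
    define z0 where "z0 = \<zeta> + of_real (r / 2)"
    have z0: "z0 \<in> ball \<zeta> r - {\<zeta>}" using r by (simp add: z0_def dist_norm)
    have z01: "cmod z0 < 1" by (rule r1) (use z0 in simp)
    have nz: "\<Delta> z0 * g z0 ^ Suc k \<noteq> 0" using \<Delta>0[of z0] g0[OF z0] z0 by simp
    have \<gamma>': "\<gamma> \<in> \<Gamma>" using \<gamma> by (simp add: \<Gamma>)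
    show ?thesis unfolding H_def
      by (rule automorphic_density_invariant[where \<Lambda> = \<Lambda> and D = D and c = c and g = g and \<Delta> = \<Delta> and v = v and q = q
            and f = f and k = k and ?z0.0 = z0 and m = "\<mu> \<gamma>" and n = "\<delta> \<gamma>" and \<gamma> = \<gamma> and z = w])
        (assumption | rule unif \<gamma> fh gh \<Delta>h vh qh z01 nz char[OF \<gamma>'] w dL dg qg aut[OF \<gamma>'])+
  qed
  have "\<exists>h. h holomorphic_on D \<and> (\<forall>w. cmod w < 1 \<longrightarrow> h (\<Lambda> w) = H w)"
    by (rule deck_group_descend[OF unif _ Hh]) (fact dL Hinv)+
  then obtain h where h: "h holomorphic_on D" "\<And>w. cmod w < 1 \<Longrightarrow> h (\<Lambda> w) = H w" by blast

  \<comment> \<open>The right-hand side as a derivative of \<open>h\<close>\<close>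
  have rhs: "1 / fact k * (((\<lambda>u t. deriv u t / deriv g t) ^^ k) (\<lambda>t. f t / \<Delta> t)) \<zeta> = (deriv ^^ k) h c / fact k"
  proof -
    note sub = holomorphic_on_subset[OF _ rB]
    have "1 / fact k * (((\<lambda>u t. deriv u t / deriv g t) ^^ k) (\<lambda>t. f t / \<Delta> t)) \<zeta> =
        residue (\<lambda>t. f t / \<Delta> t * deriv g t / g t ^ Suc k) \<zeta>"
    proof (rule residue_local_coordinate[OF r sub[OF gh] g\<zeta>, symmetric])
      show "(\<lambda>t. f t / \<Delta> t) holomorphic_on ball \<zeta> r"
        by (intro holomorphic_on_divide sub[OF fh] sub[OF \<Delta>h] \<Delta>0)
    qed (fact dg0 g0)+
    also have "\<dots> = residue (\<lambda>t. h (\<Lambda> t) * deriv \<phi> t / \<phi> t ^ Suc k) \<zeta>"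
    proof (rule residue_cong)
      have "\<forall>\<^sub>F t in at \<zeta>. t \<in> ball \<zeta> r - {\<zeta>}" using r by (intro eventually_at_in_open) auto
      then show "\<forall>\<^sub>F t in at \<zeta>. f t / \<Delta> t * deriv g t / g t ^ Suc k = h (\<Lambda> t) * deriv \<phi> t / \<phi> t ^ Suc k"
      proof eventually_elim
        case (elim t)
        then have tr: "t \<in> ball \<zeta> r" by simp
        note t1 = r1[OF tr]
        \<comment> \<open>Writing \<open>\<Lambda> - c\<close> as \<open>q * g\<close> exposes in
          the denominator the same power of \<open>q\<close> that was built into \<open>H\<close>,
          and \<open>deriv \<Lambda>\<close> cancels against its inverse in
          \<open>H\<close>.\<close>
        have "h (\<Lambda> t) * deriv \<phi> t / \<phi> t ^ Suc k = f t * v t * q t ^ Suc k / (q t ^ Suc k * g t ^ Suc k)"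
          unfolding h(2)[OF t1] d\<phi>[OF t1] \<phi>_def qg[OF t1, symmetric] power_mult_distrib using dL[OF t1] by (simp add: H_def)
        also have "\<dots> = f t * v t / g t ^ Suc k" using q0[OF t1] by simp
        also have "\<dots> = f t / \<Delta> t * deriv g t / g t ^ Suc k" unfolding dg[OF t1] using \<Delta>0[OF tr] by simp
        finally show ?case ..
      qed
    qed simp
    also have "\<dots> = 1 / fact k * (((\<lambda>u t. deriv u t / deriv \<phi> t) ^^ k) (\<lambda>t. h (\<Lambda> t))) \<zeta>"
    proof (rule residue_local_coordinate[OF r sub[OF \<phi>h]])
      show "\<phi> \<zeta> = 0" by (simp add: \<phi>_def c_def)
      show "deriv \<phi> w \<noteq> 0" if "w \<in> ball \<zeta> r" for w using dL[OF r1[OF that]] d\<phi>[OF r1[OF that]] by simp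
      show "\<phi> w \<noteq> 0" if w: "w \<in> ball \<zeta> r - {\<zeta>}" for w
      proof -
        have "w \<in> ball \<zeta> r" using w by simp
        from qg[OF r1[OF this]] q0[OF r1[OF this]] g0[OF w] show ?thesis by (auto simp: \<phi>_def)
      qed
      show "(\<lambda>t. h (\<Lambda> t)) holomorphic_on ball \<zeta> r"
        by (rule holomorphic_transform[OF sub[OF Hh]]) (simp add: h(2) r1)
    qed
    also have "(((\<lambda>u t. deriv u t / deriv \<phi> t) ^^ k) (\<lambda>t. h (\<Lambda> t))) \<zeta> = (deriv ^^ k) h (\<Lambda> \<zeta>)"
      by (rule funpow_deriv_quotient_comp[OF assms(1) Lh _ dL h(1) d\<phi> z]) (simp add: unif_image[OF unif])
    finally show ?thesis by (simp add: c_def)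
  qed

  \<comment> \<open>Boundary values and their measurability\<close>
  define Hs where "Hs = nt_lim (h \<circ> \<Lambda>)"
  define Ls where "Ls = nt_lim \<Lambda>"
  define Ls' where "Ls' = nt_lim (deriv \<Lambda>)"
  define F where "F t = nt_lim f t / (nt_lim \<Delta> t * nt_lim g t ^ k)" for t
  define S where "S t = Re (nt_lim (deriv g) t * t / nt_lim g t)" for t
  \<comment> \<open>Division by \<open>deriv \<Lambda>\<close> stays in the Smirnov class because
    that derivative is an outer Smirnov function, hence so is the role of its numerator as a
    denominator.\<close>
  have Hsm: "smirnov (h \<circ> \<Lambda>)"
  proof (rule smirnov_cong)
    show "smirnov (\<lambda>w. f w * v w * q w ^ Suc k * (1 / deriv \<Lambda> w))"
      by (intro smirnov_mult smirnov_power outer_smirnov_imp_smirnov outer_smirnov_inverse_smirnov H1_smirnov assms v q)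
    show "f w * v w * q w ^ Suc k * (1 / deriv \<Lambda> w) = (h \<circ> \<Lambda>) w" if "cmod w < 1" for w
      by (simp add: h(2)[OF that] H_def)
  qed
  obtain B where B: "\<And>s. s \<in> D \<Longrightarrow> cmod s \<le> B" using assms(3) by (auto simp: bounded_iff)
  have LD: "\<Lambda> w \<in> D" if "cmod w < 1" for w using unif_image[OF unif] that by auto
  have Lb: "bounded_analytic \<Lambda>" by (rule bounded_analyticI[OF Lh B[OF LD]])
  have cD: "c \<in> D" unfolding c_def by (rule LD[OF z])
  obtain d where d: "d > 0" "ball c d \<subseteq> D" using assms(1) cD open_contains_ball by blast
  have aef: "AE t in circle_borel. \<exists>l. has_nt_limit f t l" by (rule smirnov_nt_limit_AE[OF H1_smirnov[OF assms(15)]])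
  have aev: "AE t in circle_borel. \<exists>l. has_nt_limit v t l" by (rule smirnov_nt_limit_AE[OF outer_smirnov_imp_smirnov[OF v]])
  have aeq: "AE t in circle_borel. \<exists>l. has_nt_limit q t l" by (rule smirnov_nt_limit_AE[OF outer_smirnov_imp_smirnov[OF q]])
  have aeL': "AE t in circle_borel. \<exists>l. has_nt_limit (deriv \<Lambda>) t l" by (rule smirnov_nt_limit_AE[OF outer_smirnov_imp_smirnov[OF assms(9)]])
  have aeH: "AE t in circle_borel. \<exists>l. has_nt_limit (h \<circ> \<Lambda>) t l" by (rule smirnov_nt_limit_AE[OF Hsm])
  have aeL: "AE t in circle_borel. \<exists>l. has_nt_limit \<Lambda> t l" by (rule bounded_analytic_nt_limit_AE[OF Lb])
  have aeg: "AE t in circle_borel. \<exists>l. has_nt_limit g t l" unfolding gA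
    by (rule bounded_analytic_nt_limit_AE[OF blaschke_product_bounded_analytic[OF AB summ]])
  have g1: "AE t in circle_borel. cmod (nt_lim g t) = 1" unfolding gA by (rule blaschke_product_unimodular[OF AB summ])
  have \<Delta>1: "AE t in circle_borel. \<exists>l. has_nt_limit \<Delta> t l \<and> cmod l = 1"
    using inner by (simp add: inner_function_def AE_circle_lebesgue_iff)
  \<comment> \<open>The boundary values of \<open>deriv g\<close> are assembled from those of the
    inner factor and of the outer Smirnov factor.\<close>
  have aedg: "AE t in circle_borel. (\<exists>l. has_nt_limit (deriv g) t l) \<and> nt_lim (deriv g) t = nt_lim \<Delta> t * nt_lim v t"
    using \<Delta>1 aev AE_circle_norm
  proof eventually_elim
    case (elim t)
    have "\<exists>l. has_nt_limit \<Delta> t l" using elim(1) by blast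
    from has_nt_limit_mult[OF has_nt_limit_nt_lim[OF this elim(3)] has_nt_limit_nt_lim[OF elim(2,3)]]
    have "has_nt_limit (deriv g) t (nt_lim \<Delta> t * nt_lim v t)"
      by (rule iffD1[OF has_nt_limit_cong, rotated]) (simp add: dg)
    then show ?case using nt_lim_eq[OF _ elim(3)] by blast
  qed
  have ae\<Delta>: "AE t in circle_borel. \<exists>l. has_nt_limit \<Delta> t l" using \<Delta>1 by eventually_elim blast
  have \<Delta>u: "AE t in circle_borel. cmod (nt_lim \<Delta> t) = 1"
    using \<Delta>1 AE_circle_norm by eventually_elim (use nt_lim_eq in blast)
  have aedg1: "AE t in circle_borel. \<exists>l. has_nt_limit (deriv g) t l" using aedg by eventually_elim blast
  note [measurable] = measurable_nt_lim[OF fh aef] measurable_nt_lim[OF \<Delta>h ae\<Delta>] measurable_nt_lim[OF gh aeg]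
    measurable_nt_lim[OF holomorphic_deriv[OF gh open_ball] aedg1]
  have [measurable]: "(\<lambda>t. t) \<in> borel_measurable circle_lebesgue" "poisson \<zeta> \<in> borel_measurable circle_lebesgue"
    by (intro measurable_circle_lebesgue, measurable)+
  have HLh: "(h \<circ> \<Lambda>) holomorphic_on ball 0 1"
    by (rule holomorphic_on_compose_gen[OF Lh h(1)]) (use LD in auto)
  have Hsm' [measurable]: "Hs \<in> borel_measurable circle_lebesgue" unfolding Hs_def by (rule measurable_nt_lim[OF HLh aeH])
  have Lsm [measurable]: "Ls \<in> borel_measurable circle_lebesgue" unfolding Ls_def by (rule measurable_nt_lim[OF Lh aeL])
  have Ls'm [measurable]: "Ls' \<in> borel_measurable circle_lebesgue" unfolding Ls'_def
    by (rule measurable_nt_lim[OF holomorphic_deriv[OF Lh open_ball] aeL'])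
  have Fm: "F \<in> borel_measurable circle_lebesgue" unfolding F_def by measurable
  have Sm: "S \<in> borel_measurable circle_lebesgue" unfolding S_def by measurable
  have E: "E \<in> sets circle_lebesgue" using assms(6) by (simp add: fundamental_set_def)

  \<comment> \<open>The boundary density and the hypotheses of unfolding\<close>
  have LsB: "AE t in circle_borel. cmod (Ls t) \<le> B \<and> d \<le> cmod (Ls t - c)"
    using aeL AE_circle_norm
  proof eventually_elim
    case (elim t)
    have l: "has_nt_limit \<Lambda> t (Ls t)" unfolding Ls_def by (rule has_nt_limit_nt_lim[OF elim])
    have "Ls t \<notin> D" by (rule unif_boundary_value[OF unif elim(2) l])
    then have "Ls t \<notin> ball c d" using d(2) by blast
    then have "d \<le> cmod (Ls t - c)" by (simp add: dist_norm norm_minus_commute)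
    moreover have "cmod (Ls t) \<le> B" by (rule nt_lim_norm_le[OF l elim(2) B[OF LD]])
    ultimately show ?case by blast
  qed
  \<comment> \<open>The factor \<open>t\<close> is the one in
    \<open>dt = 2 * pi * \<i> * t * L(dt)\<close>. On the right, \<open>k\<close> of the
    \<open>k + 1\<close> factors \<open>g\<close> in the denominator come from \<open>F\<close> and
    one from the logarithmic derivative \<open>S\<close>; they cancel against the power of
    \<open>Ls t - c\<close>, which is the boundary value of \<open>q * g\<close>.\<close>
  have density: "AE t in circle_borel. t * Hs t * Ls' t = F t * of_real (S t) * (Ls t - c) ^ Suc k"
    using aef aev aeq aeL' aeH aeL aeg g1 aedg \<Delta>u AE_circle_norm
  proof eventually_elim
    case (elim t)
    note lim = has_nt_limit_nt_lim[OF _ elim(11)]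
    have "has_nt_limit (\<lambda>w. (h \<circ> \<Lambda>) w * deriv \<Lambda> w) t (Hs t * Ls' t)"
      unfolding Hs_def Ls'_def by (intro has_nt_limit_mult lim elim)
    moreover have "has_nt_limit (\<lambda>w. f w * v w * q w ^ Suc k) t (nt_lim f t * nt_lim v t * nt_lim q t ^ Suc k)"
      by (intro has_nt_limit_mult has_nt_limit_power lim elim)
    then have "has_nt_limit (\<lambda>w. (h \<circ> \<Lambda>) w * deriv \<Lambda> w) t (nt_lim f t * nt_lim v t * nt_lim q t ^ Suc k)"
      by (rule iffD1[OF has_nt_limit_cong, rotated]) (simp add: h(2) H_def dL)
    ultimately have HL: "Hs t * Ls' t = nt_lim f t * nt_lim v t * nt_lim q t ^ Suc k"
      using nt_lim_eq[OF _ elim(11)] by metis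
    have "has_nt_limit (\<lambda>w. \<Lambda> w - c) t (Ls t - c)"
      unfolding Ls_def by (intro has_nt_limit_diff_const lim elim)
    moreover have "has_nt_limit (\<lambda>w. q w * g w) t (nt_lim q t * nt_lim g t)"
      by (intro has_nt_limit_mult lim elim)
    then have "has_nt_limit (\<lambda>w. \<Lambda> w - c) t (nt_lim q t * nt_lim g t)"
      by (rule iffD1[OF has_nt_limit_cong, rotated]) (simp add: qg)
    ultimately have Lc: "Ls t - c = nt_lim q t * nt_lim g t"
      using nt_lim_eq[OF _ elim(11)] by metis
    have nz: "nt_lim g t \<noteq> 0" "nt_lim \<Delta> t \<noteq> 0" using elim(8,10) by auto
    have "of_real (S t) = nt_lim (deriv g) t * t / nt_lim g t"
      unfolding S_def gA
    proof (rule poisson_orbit_sum(2)[OF unif z])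
      show "(\<lambda>a. 1 - cmod a) summable_on group_orbit (deck_group \<Lambda>) \<zeta>" using summ by (simp add: A_def \<Gamma>)
      show "cmod t = 1" by (rule elim)
      show "has_nt_limit (blaschke_product (group_orbit (deck_group \<Lambda>) \<zeta>)) t (nt_lim (blaschke_product A) t)"
        using lim[OF elim(7)] by (simp add: gA A_def \<Gamma>)
      show "cmod (nt_lim (blaschke_product A) t) = 1" using elim(8) by (simp add: gA)
      show "has_nt_limit (deriv (blaschke_product (group_orbit (deck_group \<Lambda>) \<zeta>))) t (nt_lim (deriv (blaschke_product A)) t)"
        using lim[OF conjunct1[OF elim(9)]] by (simp add: gA A_def \<Gamma>)
    qed
    then have S: "of_real (S t) = nt_lim \<Delta> t * nt_lim v t * t / nt_lim g t" using elim(9) by simp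
    have "F t * of_real (S t) = nt_lim f t * nt_lim v t * t / nt_lim g t ^ Suc k"
      unfolding F_def S using nz by (simp add: mult_ac)
    then have "F t * of_real (S t) * (Ls t - c) ^ Suc k = nt_lim f t * nt_lim v t * t * nt_lim q t ^ Suc k"
      unfolding Lc power_mult_distrib using nz by simp
    also have "\<dots> = t * (Hs t * Ls' t)" unfolding HL by (simp only: mult_ac)
    finally show ?case by (simp only: mult.assoc)
  qed
  have SG: "AE t in circle_borel. 0 \<le> S t \<and> (\<integral>\<^sup>+\<gamma>. ennreal (poisson (\<gamma> \<zeta>) t) \<partial>count_space \<Gamma>) = ennreal (S t)"
    using aeg g1 aedg1 AE_circle_norm
  proof eventually_elim
    case (elim t)
    note lim = has_nt_limit_nt_lim[OF _ elim(4)]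
    note ps = poisson_orbit_sum[OF unif z, of t "nt_lim g t" "nt_lim (deriv g) t", folded \<Gamma>, folded A_def, folded gA]
    show ?case using ps(1,3)[OF summ elim(4) lim[OF elim(1)] elim(2) lim[OF elim(3)]] unfolding S_def by blast
  qed
  have Finv: "AE t in circle_borel. \<forall>\<gamma>\<in>\<Gamma>. F (\<gamma> t) = F t"
  proof -
    have sub: "\<Gamma> \<subseteq> deck_group \<Lambda>" by (simp add: \<Gamma>)
    show ?thesis
      using aef ae\<Delta> aeg AE_deck_group[OF countable sub aef] AE_deck_group[OF countable sub ae\<Delta>]
        AE_deck_group[OF countable sub aeg] AE_circle_norm
    proof eventually_elim
      case (elim t)
      show ?case
      proof
        fix \<gamma> assume \<gamma>: "\<gamma> \<in> \<Gamma>"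
        have \<gamma>': "\<gamma> \<in> deck_group \<Lambda>" using \<gamma> by (simp add: \<Gamma>)
        note nl = nt_lim_automorphic[OF \<gamma>' elim(7)]
        have 1: "nt_lim g (\<gamma> t) = \<mu> \<gamma> * nt_lim g t" by (rule nl[OF elim(3) bspec[OF elim(6) \<gamma>] aut(1)[OF \<gamma>]])
        have 2: "nt_lim \<Delta> (\<gamma> t) = \<delta> \<gamma> * nt_lim \<Delta> t" by (rule nl[OF elim(2) bspec[OF elim(5) \<gamma>] aut(2)[OF \<gamma>]])
        have 3: "nt_lim f (\<gamma> t) = \<mu> \<gamma> ^ k * \<delta> \<gamma> * nt_lim f t" by (rule nl[OF elim(1) bspec[OF elim(4) \<gamma>] aut(3)[OF \<gamma>]])
        show "F (\<gamma> t) = F t" unfolding F_def 1 2 3 power_mult_distrib using char[OF \<gamma>] by simp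
      qed
    qed
  qed
  \<comment> \<open>Since \<open>g\<close> and \<open>\<Delta>\<close> are unimodular almost
    everywhere on the circle, \<open>F\<close> has the modulus of the boundary values of
    \<open>f\<close>, and the kernel at the fixed point \<open>\<zeta>\<close> is bounded.\<close>
  have Fint: "integrable circle_lebesgue (\<lambda>t. F t * of_real (poisson \<zeta> t))"
  proof (rule Bochner_Integration.integrable_bound)
    show "integrable circle_lebesgue (\<lambda>t. cmod (nt_lim f t) * (2 / (1 - cmod \<zeta>)))"
      by (intro integrable_mult_left integrable_norm H1_nt_lim_integrable assms)
    show "(\<lambda>t. F t * of_real (poisson \<zeta> t)) \<in> borel_measurable circle_lebesgue" using Fm by measurable
    show "AE t in circle_lebesgue. norm (F t * of_real (poisson \<zeta> t)) \<le> norm (cmod (nt_lim f t) * (2 / (1 - cmod \<zeta>)))"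
      unfolding AE_circle_lebesgue_iff using g1 \<Delta>u AE_circle_norm
    proof eventually_elim
      case (elim t)
      have "cmod (F t) = cmod (nt_lim f t)" by (simp add: F_def norm_divide norm_mult norm_power elim)
      then have "norm (F t * of_real (poisson \<zeta> t)) = cmod (nt_lim f t) * poisson \<zeta> t"
        using poisson_nonneg[OF z, of t] by (simp add: norm_mult)
      also have "\<dots> \<le> cmod (nt_lim f t) * (2 / (1 - cmod \<zeta>))"
        by (intro mult_left_mono poisson_le z elim norm_ge_zero)
      also have "\<dots> \<le> norm (cmod (nt_lim f t) * (2 / (1 - cmod \<zeta>)))" unfolding real_norm_def by (rule abs_ge_self)
      finally show ?case .
    qed
  qed
  have "AE t in circle_borel. \<exists>!\<gamma>. \<gamma> \<in> \<Gamma> \<and> \<gamma> t \<in> E"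
    using fundamental_set_AE_ex1[of \<Lambda> E] assms(6) by (simp add: \<Gamma>)
  note unfold = unfold_integral[OF countable _ E this Fm Finv z Fint Sm SG, of \<Lambda>]
  have sub: "\<Gamma> \<subseteq> deck_group \<Lambda>" by (simp add: \<Gamma>)

  \<comment> \<open>Membership of \<open>h\<close> in the Hardy space of \<open>D\<close>\<close>
  have setint: "set_integrable circle_lebesgue E (\<lambda>t. cmod (Hs t) * cmod (Ls' t))"
    unfolding set_integrable_def
  proof (rule Bochner_Integration.integrable_bound)
    \<comment> \<open>Unfolding supplies the integrability of \<open>F * S\<close> on
      \<open>E\<close>; \<open>B + cmod c\<close> bounds \<open>cmod (Ls t - c)\<close>, because
      boundary values of \<open>\<Lambda>\<close> obey the bound \<open>B\<close> for
      \<open>D\<close>.\<close>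
    show "integrable circle_lebesgue (\<lambda>t. cmod (indicator E t *\<^sub>R (F t * of_real (S t))) * (B + cmod c) ^ Suc k)"
      by (intro integrable_mult_left integrable_norm unfold(1)[OF sub])
    show "(\<lambda>t. indicator E t *\<^sub>R (cmod (Hs t) * cmod (Ls' t))) \<in> borel_measurable circle_lebesgue"
      using E by measurable
    show "AE t in circle_lebesgue. norm (indicator E t *\<^sub>R (cmod (Hs t) * cmod (Ls' t)))
        \<le> norm (cmod (indicator E t *\<^sub>R (F t * of_real (S t))) * (B + cmod c) ^ Suc k)"
      unfolding AE_circle_lebesgue_iff using density LsB AE_circle_norm
    proof eventually_elim
      case (elim t)
      have "cmod (Hs t) * cmod (Ls' t) = cmod (t * Hs t * Ls' t)" by (simp add: norm_mult elim(3))
      also have "\<dots> = cmod (F t * of_real (S t)) * cmod (Ls t - c) ^ Suc k"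
        unfolding elim(1) by (simp only: norm_mult norm_power)
      also have "\<dots> \<le> cmod (F t * of_real (S t)) * (B + cmod c) ^ Suc k"
        using elim(2) norm_triangle_ineq4[of "Ls t" c] by (intro mult_left_mono power_mono) auto
      finally have le: "cmod (Hs t) * cmod (Ls' t) \<le> cmod (F t * of_real (S t)) * (B + cmod c) ^ Suc k" .
      have "0 \<le> B" using elim(2) norm_ge_zero[of "Ls t"] by linarith
      then have "0 \<le> (B + cmod c) ^ Suc k" by simp
      with le show ?case by (cases "t \<in> E") (simp_all add: abs_mult del: power_Suc of_real_mult norm_of_real)
    qed
  qed
  have H1: "H1_domain D \<Lambda> E h"
    unfolding H1_domain_def using h(1) Hsm setint by (simp add: Hs_def Ls'_def)

  \<comment> \<open>The Cauchy formula and its derivative of order \<open>k\<close>\<close>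
  define X where "X t = indicator E t *\<^sub>R (t * Hs t * Ls' t)" for t
  have Xi: "integrable circle_lebesgue X"
  proof (rule Bochner_Integration.integrable_bound[OF setint[unfolded set_integrable_def]])
    show "X \<in> borel_measurable circle_lebesgue" unfolding X_def using E by measurable
    show "AE t in circle_lebesgue. norm (X t) \<le> norm (indicator E t *\<^sub>R (cmod (Hs t) * cmod (Ls' t)))"
      unfolding AE_circle_lebesgue_iff using AE_circle_norm
      by eventually_elim (simp add: X_def norm_mult)
  qed
  have cauchy: "(LINT t|circle_lebesgue. X t / (Ls t - w)) = h w" if w: "w \<in> ball c d" for w
  proof -
    have wD: "w \<in> D" using w d(2) by blast
    have "h w = 1 / (2 * complex_of_real pi * \<i>) * circle_line_integral E (\<lambda>t. Hs t / (Ls t - w) * Ls' t)"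
      using cif H1 wD unfolding cauchy_integral_formula_def Hs_def Ls_def Ls'_def by simp
    also have "\<dots> = (LINT t|circle_lebesgue. 1 / (2 * complex_of_real pi * \<i>) *
        (indicator E t *\<^sub>R (Hs t / (Ls t - w) * Ls' t * (2 * complex_of_real pi * \<i> * t))))"
      unfolding circle_line_integral_def set_lebesgue_integral_def by (rule integral_mult_right_zero[symmetric])
    also have "\<dots> = (LINT t|circle_lebesgue. X t / (Ls t - w))"
    proof (rule Bochner_Integration.integral_cong[OF refl])
      fix t :: complex
      \<comment> \<open>\<open>u\<close> stands for \<open>2 * complex_of_real pi * \<i>\<close>:
        the normalization of the Cauchy formula cancels against the constant in \<open>dt\<close>,
        and the remaining factor \<open>t\<close> is the one in \<open>X\<close>.\<close>
      have "1 / u * (i *\<^sub>R (a / y * b * (u * t))) = i *\<^sub>R (t * a * b) / y" if "u \<noteq> 0" for u a b y :: complex and i :: real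
        using that by (simp add: scaleR_conv_of_real)
      moreover have "2 * complex_of_real pi * \<i> \<noteq> 0" by simp
      ultimately show "1 / (2 * complex_of_real pi * \<i>) *
          (indicator E t *\<^sub>R (Hs t / (Ls t - w) * Ls' t * (2 * complex_of_real pi * \<i> * t))) = X t / (Ls t - w)"
        unfolding X_def by blast
    qed
    finally show ?thesis ..
  qed
  have "(LINT t|circle_lebesgue. X t / (Ls t - c) ^ Suc k) = (deriv ^^ k) h c / fact k"
  proof (rule cauchy_kernel_higher_deriv[OF Xi Lsm d(1)])
    show "AE t in circle_borel. d \<le> cmod (Ls t - c)" using LsB by eventually_elim blast
    show "h holomorphic_on ball c d" by (rule holomorphic_on_subset[OF h(1) d(2)])
  qed (rule cauchy)
  moreover have "(LINT t|circle_lebesgue. X t / (Ls t - c) ^ Suc k) =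
      (LINT t|circle_lebesgue. indicator E t *\<^sub>R (F t * of_real (S t)))"
  proof (rule integral_circle_cong_AE(1))
    show "AE t in circle_borel. X t / (Ls t - c) ^ Suc k = indicator E t *\<^sub>R (F t * of_real (S t))"
      using density LsB
    proof eventually_elim
      case (elim t)
      have "(Ls t - c) ^ Suc k \<noteq> 0" using elim(2) d(1) by auto
      then have "t * Hs t * Ls' t / (Ls t - c) ^ Suc k = F t * of_real (S t)"
        unfolding elim(1) by (rule nonzero_mult_div_cancel_right)
      then show ?case unfolding X_def by (simp only: scaleR_conv_of_real times_divide_eq_right[symmetric])
    qed
  qed
  ultimately have lhs: "(LINT t|circle_lebesgue. F t * of_real (poisson \<zeta> t)) = (deriv ^^ k) h c / fact k"
    using unfold(2)[OF sub] by simp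
  show ?thesis using lhs rhs by (simp only: F_def poisson_def g_def)
qed

end
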